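(* The following decision problem is strongly $\mathcal{NP}$-complete: given a finite simplicial complex $\Delta$ and a nonnegative integer $c$, decide whether there exists a Morse matching of $\Delta$ with at most $c$ critical faces. This remains strongly $\mathcal{NP}$-complete even when restricted to inputs $\Delta$ that are connected, pure, $2$-dimensional, and embeddable in $\mathbb{R}^3$.
   Context: A finite abstract simplicial complex $\Delta$ on a finite vertex set $V$ is a family of nonempty subsets of $V$ (faces) closed under taking nonempty subsets; $\dim F=|F|-1$. $\Delta$ is pure if all inclusion-maximal faces have the same dimension, and connected if its graph (vertices, adjacent iff forming a $1$-face) is connected. For faces write $F \prec G$ if $F\subset G$ and $\dim F=\dim G-1$. The Hasse diagram $H$ is the directed graph on the faces with an arc $(G,F)$ whenever $F\prec G$. A matching $M$ in $H$ is a set of arcs with each face incident to at most one arc of $M$; $H(M)$ is $H$ with the arcs of $M$ reversed; $M$ is a Morse matching if $H(M)$ is acyclic. A face is critical if it is incident to no arc of $M$. Input size of $\Delta$ is the coding length of its face lattice. *)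

theory Defs
  imports "HOL-Analysis.Analysis" "HOL-Computational_Algebra.Polynomial"
begin

section \<open>Multi-tape Turing machines and polynomial time\<close>

datatype direction = Go_Left | Stay | Go_Right

fun offset :: "direction \<Rightarrow> int" where
  "offset Go_Left = -1"
| "offset Stay = 0"
| "offset Go_Right = 1"

text \<open>
  The states are the numbers below \<open>tm_states\<close>, with start state \<open>0\<close>; the number
  \<open>tm_states\<close> itself is the halting state. The tape alphabet consists of the numbers below
  \<open>tm_symbols\<close>, where \<open>0\<close> is the blank and \<open>1\<close>, \<open>2\<close> are the input symbols.
\<close>

record tm =
  tm_tapes :: nat
  tm_symbols :: nat
  tm_states :: nat
  tm_delta :: "nat \<Rightarrow> nat list \<Rightarrow> nat \<times> (nat \<times> direction) list"

definition wf_tm :: "tm \<Rightarrow> bool" where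
  "wf_tm M \<longleftrightarrow> tm_tapes M \<ge> 1 \<and> tm_symbols M \<ge> 3 \<and>
     (\<forall>q ss. q < tm_states M \<and> length ss = tm_tapes M \<and> (\<forall>s\<in>set ss. s < tm_symbols M) \<longrightarrow>
        (case tm_delta M q ss of (q', as) \<Rightarrow>
           q' \<le> tm_states M \<and> length as = tm_tapes M \<and> (\<forall>(s, d)\<in>set as. s < tm_symbols M)))"

text \<open>A tape is two-way infinite and is paired with the position of its head.\<close>

type_synonym tape = "(int \<Rightarrow> nat) \<times> int"
type_synonym config = "nat \<times> tape list"
type_synonym word = "bool list"

definition word_tape :: "word \<Rightarrow> int \<Rightarrow> nat" where
  "word_tape w i =
     (if 0 \<le> i \<and> nat i < length w then (if w ! nat i then 2 else 1) else 0)"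

definition tm_init :: "tm \<Rightarrow> word \<Rightarrow> config" where
  "tm_init M w = (0, (word_tape w, 0) # replicate (tm_tapes M - 1) (word_tape [], 0))"

fun tape_act :: "nat \<times> direction \<Rightarrow> tape \<Rightarrow> tape" where
  "tape_act (s, d) (t, h) = (t(h := s), h + offset d)"

fun tm_step :: "tm \<Rightarrow> config \<Rightarrow> config" where
  "tm_step M (q, ts) =
     (if q \<ge> tm_states M then (q, ts)
      else case tm_delta M q (map (\<lambda>(t, h). t h) ts) of
             (q', as) \<Rightarrow> (q', map2 tape_act as ts))"

text \<open>Input on the first tape, output on the last tape.\<close>

definition tm_computes_within :: "tm \<Rightarrow> word \<Rightarrow> word \<Rightarrow> nat \<Rightarrow> bool" where
  "tm_computes_within M w v T \<longleftrightarrow>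
     (\<exists>t\<le>T. case (tm_step M ^^ t) (tm_init M w) of
        (q, ts) \<Rightarrow> q = tm_states M \<and> fst (last ts) = word_tape v)"

definition poly_time :: "(word \<Rightarrow> word) \<Rightarrow> bool" where
  "poly_time f \<longleftrightarrow>
     (\<exists>M (p :: nat poly). wf_tm M \<and> (\<forall>w. tm_computes_within M w (f w) (poly p (length w))))"


section \<open>NP and strong NP-completeness\<close>

definition class_P :: "word set set" where
  "class_P = {L. poly_time (\<lambda>w. [w \<in> L])}"

definition pair_word :: "word \<Rightarrow> word \<Rightarrow> word" where
  "pair_word x u = concat (map (\<lambda>b. [b, b]) x) @ [False, True] @ u"

definition class_NP :: "word set set" where
  "class_NP = {L. \<exists>R\<in>class_P. \<exists>p :: nat poly. \<forall>x.
     x \<in> L \<longleftrightarrow> (\<exists>u. length u \<le> poly p (length x) \<and> pair_word x u \<in> R)}"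

text \<open>
  A decision problem together with a coding of its instances as words; \<open>max_number\<close> is the
  largest number occurring in an instance.
\<close>

record 'i problem =
  instances :: "'i set"
  yes_instance :: "'i \<Rightarrow> bool"
  code_word :: "'i \<Rightarrow> word"
  max_number :: "'i \<Rightarrow> nat"

definition yes_words :: "'i problem \<Rightarrow> word set" where
  "yes_words P = {code_word P i |i. i \<in> instances P \<and> yes_instance P i}"

text \<open>
  In the following, \<open>C\<close> is the class of instances to which the problem is restricted. The
  restriction is a promise: an algorithm may answer arbitrarily on instances of \<open>P\<close> outside
  \<open>C\<close>, so deciding \<open>C\<close> itself is not part of the problem. Words that do not encode any
  instance of \<open>P\<close> have to be rejected. If \<open>C\<close> contains all instances, the first definition
  says \<open>yes_words P \<in> class_NP\<close>.
\<close>

definition in_NP_on :: "'i set \<Rightarrow> 'i problem \<Rightarrow> bool" where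
  "in_NP_on C P \<longleftrightarrow>
     (\<exists>L\<in>class_NP. \<forall>w. w \<notin> code_word P ` (instances P - C) \<longrightarrow> (w \<in> L \<longleftrightarrow> w \<in> yes_words P))"

definition NP_hard_on :: "'i set \<Rightarrow> 'i problem \<Rightarrow> bool" where
  "NP_hard_on C P \<longleftrightarrow>
     (\<forall>A\<in>class_NP. \<exists>f. poly_time f \<and>
        (\<forall>x. \<exists>i \<in> instances P \<inter> C. f x = code_word P i \<and> (x \<in> A \<longleftrightarrow> yes_instance P i)))"

definition NP_complete_on :: "'i set \<Rightarrow> 'i problem \<Rightarrow> bool" where
  "NP_complete_on C P \<longleftrightarrow> in_NP_on C P \<and> NP_hard_on C P"

text \<open>
  NP-completeness in the strong sense (Garey and Johnson): the problem is in NP, and it stays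
  NP-complete when the numbers in the instance are polynomially bounded in its coding length.
\<close>

definition strongly_NP_complete_on :: "'i set \<Rightarrow> 'i problem \<Rightarrow> bool" where
  "strongly_NP_complete_on C P \<longleftrightarrow>
     in_NP_on C P \<and>
     (\<exists>p :: nat poly.
        NP_complete_on (C \<inter> {i. max_number P i \<le> poly p (length (code_word P i))}) P)"

definition strongly_NP_complete :: "'i problem \<Rightarrow> bool" where
  "strongly_NP_complete P \<longleftrightarrow> strongly_NP_complete_on UNIV P"


section \<open>Simplicial complexes\<close>

text \<open>Finiteness of \<open>\<Union>\<Delta>\<close> says that the faces are subsets of some finite vertex set.\<close>

definition simplicial_complex :: "'a set set \<Rightarrow> bool" where
  "simplicial_complex \<Delta> \<longleftrightarrow>
     finite (\<Union>\<Delta>) \<and> {} \<notin> \<Delta> \<and> (\<forall>F\<in>\<Delta>. \<forall>G\<subseteq>F. G \<noteq> {} \<longrightarrow> G \<in> \<Delta>)"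

definition face_dim :: "'a set \<Rightarrow> int" where
  "face_dim F = int (card F) - 1"

definition maximal_face :: "'a set set \<Rightarrow> 'a set \<Rightarrow> bool" where
  "maximal_face \<Delta> F \<longleftrightarrow> F \<in> \<Delta> \<and> (\<forall>G\<in>\<Delta>. F \<subseteq> G \<longrightarrow> G = F)"

definition pure_complex :: "'a set set \<Rightarrow> bool" where
  "pure_complex \<Delta> \<longleftrightarrow>
     (\<forall>F G. maximal_face \<Delta> F \<and> maximal_face \<Delta> G \<longrightarrow> face_dim F = face_dim G)"

definition complex_has_dim :: "'a set set \<Rightarrow> int \<Rightarrow> bool" where
  "complex_has_dim \<Delta> d \<longleftrightarrow> (\<exists>F\<in>\<Delta>. face_dim F = d) \<and> (\<forall>F\<in>\<Delta>. face_dim F \<le> d)"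

definition complex_graph :: "'a set set \<Rightarrow> ('a \<times> 'a) set" where
  "complex_graph \<Delta> = {(u, v). u \<noteq> v \<and> {u, v} \<in> \<Delta>}"

definition connected_complex :: "'a set set \<Rightarrow> bool" where
  "connected_complex \<Delta> \<longleftrightarrow> (\<forall>u\<in>\<Union>\<Delta>. \<forall>v\<in>\<Union>\<Delta>. (u, v) \<in> (complex_graph \<Delta>)\<^sup>*)"

text \<open>
  Points are given by barycentric coordinates. As there are only finitely many vertices, the
  product topology on functions induces the usual topology of the realization.
\<close>

definition geometric_realization :: "'a set set \<Rightarrow> ('a \<Rightarrow> real) set" where
  "geometric_realization \<Delta> =
     {x. (\<forall>v. 0 \<le> x v) \<and> {v. x v \<noteq> 0} \<in> \<Delta> \<and> (\<Sum>v\<in>\<Union>\<Delta>. x v) = 1}"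

definition embeddable_in_R3 :: "'a set set \<Rightarrow> bool" where
  "embeddable_in_R3 \<Delta> \<longleftrightarrow> (\<exists>S :: (real ^ 3) set. geometric_realization \<Delta> homeomorphic S)"


section \<open>Morse matchings\<close>

definition face_covered :: "'a set \<Rightarrow> 'a set \<Rightarrow> bool" where
  "face_covered F G \<longleftrightarrow> F \<subset> G \<and> face_dim F = face_dim G - 1"

definition hasse :: "'a set set \<Rightarrow> ('a set \<times> 'a set) set" where
  "hasse \<Delta> = {(G, F). G \<in> \<Delta> \<and> F \<in> \<Delta> \<and> face_covered F G}"

definition incident :: "'a set \<Rightarrow> 'a set \<times> 'a set \<Rightarrow> bool" where
  "incident F a \<longleftrightarrow> F = fst a \<or> F = snd a"

definition hasse_matching :: "'a set set \<Rightarrow> ('a set \<times> 'a set) set \<Rightarrow> bool" where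
  "hasse_matching \<Delta> M \<longleftrightarrow> M \<subseteq> hasse \<Delta> \<and>
     (\<forall>F\<in>\<Delta>. \<forall>a\<in>M. \<forall>b\<in>M. incident F a \<and> incident F b \<longrightarrow> a = b)"

definition hasse_reversed :: "'a set set \<Rightarrow> ('a set \<times> 'a set) set \<Rightarrow> ('a set \<times> 'a set) set" where
  "hasse_reversed \<Delta> M = (hasse \<Delta> - M) \<union> M\<inverse>"

definition morse_matching :: "'a set set \<Rightarrow> ('a set \<times> 'a set) set \<Rightarrow> bool" where
  "morse_matching \<Delta> M \<longleftrightarrow> hasse_matching \<Delta> M \<and> acyclic (hasse_reversed \<Delta> M)"

definition critical_faces :: "'a set set \<Rightarrow> ('a set \<times> 'a set) set \<Rightarrow> 'a set set" where
  "critical_faces \<Delta> M = {F\<in>\<Delta>. \<forall>a\<in>M. \<not> incident F a}"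


section \<open>The Morse matching problem\<close>

text \<open>Binary representation, least significant bit first.\<close>

fun binary_word :: "nat \<Rightarrow> word" where
  "binary_word n = (if n = 0 then [] else odd n # binary_word (n div 2))"

declare binary_word.simps [simp del]

text \<open>
  An instance is a complex, given by an enumeration of its faces, and a number. Its code word
  consists of the number of faces in unary, the incidence matrix of the inclusion order on the
  faces (that is, the face lattice, without its bottom and top), and the number in binary. Hence
  the complex is encoded up to isomorphism, vertex labels do not occur in the code, and there is
  no loss in taking natural numbers as vertices.
\<close>

definition morse_code :: "nat set list \<times> nat \<Rightarrow> word" where
  "morse_code = (\<lambda>(Fs, c). replicate (length Fs) True @ [False] @
     concat (map (\<lambda>F. map (\<lambda>G. F \<subseteq> G) Fs) Fs) @ binary_word c)"

definition morse_matching_problem :: "(nat set list \<times> nat) problem" where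
  "morse_matching_problem =
     \<lparr> instances = {(Fs, c). distinct Fs \<and> simplicial_complex (set Fs)},
       yes_instance =
         (\<lambda>(Fs, c). \<exists>M. morse_matching (set Fs) M \<and> card (critical_faces (set Fs) M) \<le> c),
       code_word = morse_code,
       max_number = snd \<rparr>"

end

theory Submission
  imports Defs "HOL-Library.Nat_Bijection"
begin

text \<open>
  A connected pure 2-complex has a Morse matching with \<open>c\<close> critical faces if and only if all its
  triangles can be erased through free edges after removing \<open>m\<close> of them, where \<open>c\<close> and \<open>m\<close> determine
  each other through the Euler characteristic. Erasing triangles realizes Horn inference: a derived
  fact is a closed surface piece, shaped like a box with two rooms, that has been opened, and a tube
  that two of these surfaces share with a third one realizes a rule \<open>x \<and> y \<longrightarrow> z\<close>. The run of a
  nondeterministic polynomial-time machine is such an inference, in which every guessed bit costs one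
  removed triangle; feeding acceptance back into all facts makes everything erasable exactly for
  accepting guesses. All pieces lie in a grid in three-space, and the triangles of the grid squares
  are part of its Kuhn triangulation. The reduction is computable in polynomial time because its output is
  described by arithmetical expressions with bounded sums, which are compiled to Turing machines.
\<close>

text \<open>A rule must act in one direction only, although erasing across an edge between two
  squares is symmetric. The remedy is a tube that ends inside a face: of the three squares at such
  an edge two belong to the plate, so erasing the plate frees the tube, while erasing the tube
  leaves the plate stuck. Where three different pieces meet, any two free the third; this gives the
  conjunction, but also the backward steps \<open>backA\<close> and \<open>backB\<close>, which the
  counting argument has to survive. The tube of a rule meets the plate of its conclusion between its
  two ends, so that plate must lie between those of the premises. Therefore every fact
  \<open>a\<close> has three plates, \<open>a\<close>, \<open>N + a\<close> and
  \<open>2 * N + a\<close>; conclusions arrive at the middle one and are copied to the outer ones.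
  Removed triangles may lie anywhere, also on tubes, so their number is bounded from below with
  disjoint groups of pieces, none of which can be entered from outside.\<close>

section \<open>Counter programs on Turing machines\<close>

text \<open>\<open>Rd s n\<close> asks whether the scanned input symbol is at least
  \<open>s\<close>: with \<open>s = 1\<close> it recognizes a nonblank cell, with
  \<open>s = 2\<close> the bit \<open>True\<close>. The position of the input head is not stored, so
  programs that move it must count their moves in order to return.\<close>

datatype instr = Inc nat | Dec nat | Jz nat nat | Jmp nat | MvR | MvL | Rd nat nat | Out nat

type_synonym mstate = "int \<times> (nat \<Rightarrow> nat) \<times> word"

fun instr_step :: "word \<Rightarrow> instr \<Rightarrow> nat \<times> mstate \<Rightarrow> nat \<times> mstate" where
  "instr_step w (Inc n) (p, h, c, out) = (Suc p, h, c(n := Suc (c n)), out)"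
| "instr_step w (Dec n) (p, h, c, out) = (Suc p, h, c(n := c n - 1), out)"
| "instr_step w (Jz n p') (p, h, c, out) = (if c n = 0 then p' else Suc p, h, c, out)"
| "instr_step w (Jmp p') (p, h, c, out) = (p', h, c, out)"
| "instr_step w MvR (p, h, c, out) = (Suc p, h + 1, c, out)"
| "instr_step w MvL (p, h, c, out) = (Suc p, h - 1, c, out)"
| "instr_step w (Rd s n) (p, h, c, out) =
     (Suc p, h, if s \<le> word_tape w h then c(n := Suc (c n)) else c, out)"
| "instr_step w (Out n) (p, h, c, out) = (Suc p, h, c, out @ [c n \<noteq> 0])"

definition prog_step :: "word \<Rightarrow> instr list \<Rightarrow> nat \<times> mstate \<Rightarrow> nat \<times> mstate" where
  "prog_step w P s = (if fst s < length P then instr_step w (P ! fst s) s else s)"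

fun instr_counters :: "instr \<Rightarrow> nat set" where
  "instr_counters (Inc n) = {n}"
| "instr_counters (Dec n) = {n}"
| "instr_counters (Jz n _) = {n}"
| "instr_counters (Rd _ n) = {n}"
| "instr_counters (Out n) = {n}"
| "instr_counters _ = {}"

fun instr_targets :: "instr \<Rightarrow> nat set" where
  "instr_targets (Jz _ p) = {p}"
| "instr_targets (Jmp p) = {p}"
| "instr_targets _ = {}"

text \<open>
  Counter \<open>n\<close> is the head position on tape \<open>n + 1\<close>, whose cell \<open>0\<close> carries a mark; hence
  counters are incremented, decremented and tested for zero in one step. State \<open>0\<close> writes
  the marks, state \<open>Suc p\<close> executes instruction \<open>p\<close>.
\<close>

fun input_dir :: "instr \<Rightarrow> direction" where
  "input_dir MvR = Go_Right"
| "input_dir MvL = Go_Left"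
| "input_dir _ = Stay"

fun counter_dir :: "instr \<Rightarrow> nat list \<Rightarrow> nat \<Rightarrow> direction" where
  "counter_dir (Inc n) ss m = (if m = n then Go_Right else Stay)"
| "counter_dir (Dec n) ss m = (if m = n \<and> ss ! Suc n \<noteq> 1 then Go_Left else Stay)"
| "counter_dir (Rd s n) ss m = (if m = n \<and> s \<le> ss ! 0 then Go_Right else Stay)"
| "counter_dir _ _ _ = Stay"

fun output_act :: "instr \<Rightarrow> nat list \<Rightarrow> nat \<times> direction" where
  "output_act (Out n) ss = (if ss ! Suc n = 1 then 1 else 2, Go_Right)"
| "output_act _ ss = (0, Stay)"

fun next_state :: "nat \<Rightarrow> instr \<Rightarrow> nat list \<Rightarrow> nat" where
  "next_state p (Jz n p') ss = (if ss ! Suc n = 1 then Suc p' else Suc (Suc p))"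
| "next_state p (Jmp p') ss = Suc p'"
| "next_state p _ ss = Suc (Suc p)"

definition prog_tm :: "nat \<Rightarrow> instr list \<Rightarrow> tm" where
  "prog_tm K P = \<lparr> tm_tapes = K + 2, tm_symbols = 3, tm_states = Suc (length P),
     tm_delta = (\<lambda>q ss. case q of
         0 \<Rightarrow> (1, (ss ! 0, Stay) # map (\<lambda>n. (1, Stay)) [0..<K] @ [(0, Stay)])
       | Suc p \<Rightarrow> (next_state p (P ! p) ss,
           (ss ! 0, input_dir (P ! p)) #
           map (\<lambda>n. (ss ! Suc n, counter_dir (P ! p) ss n)) [0..<K] @
           [output_act (P ! p) ss])) \<rparr>"

lemma wf_prog_tm:
  assumes "\<And>i. i \<in> set P \<Longrightarrow> instr_targets i \<subseteq> {..length P}"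
  shows "wf_tm (prog_tm K P)"
proof -
  have ns: "next_state p i ss \<le> Suc (length P)" if "p < length P" "i \<in> set P" for p i ss
    using assms[OF that(2)] that(1) by (cases i) auto
  have oa: "fst (output_act i ss) < 3" for i ss by (cases i) auto
  show ?thesis
    unfolding wf_tm_def prog_tm_def
    by (auto split: nat.split intro!: ns simp: nth_mem) (metis oa fst_conv)+
qed

text \<open>The word \<open>[False]\<close> puts symbol 1 on cell 0 and blanks elsewhere: this is
  the mark of a counter tape.\<close>

definition prog_conf :: "nat \<Rightarrow> word \<Rightarrow> nat \<times> mstate \<Rightarrow> config" where
  "prog_conf K w = (\<lambda>(p, h, c, out). (Suc p, (word_tape w, h) #
     map (\<lambda>n. (word_tape [False], int (c n))) [0..<K] @ [(word_tape out, int (length out))]))"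

lemma word_tape_mark: "word_tape [False] (int n) = (if n = 0 then 1 else 0)"
  by (auto simp: word_tape_def)

lemma word_tape_snoc:
  "(word_tape out)(int (length out) := if b then 2 else 1) = word_tape (out @ [b])"
proof
  fix i :: int
  show "((word_tape out)(int (length out) := if b then 2 else 1)) i = word_tape (out @ [b]) i"
  proof (cases "i = int (length out)")
    case False
    then have "nat i \<noteq> length out" if "0 \<le> i" using that by auto
    then show ?thesis using False by (auto simp: word_tape_def nth_append)
  qed (auto simp: word_tape_def)
qed

lemma map2_map: "map2 f (map g xs) (map h xs) = map (\<lambda>x. f (g x) (h x)) xs"
  by (induction xs) auto

lemma word_tape_end: "word_tape out (int (length out)) = 0"
  by (auto simp: word_tape_def)

lemma prog_tm_step:
  assumes "fst s < length P" "instr_counters (P ! fst s) \<subseteq> {..<K}"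
  shows "tm_step (prog_tm K P) (prog_conf K w s) = prog_conf K w (prog_step w P s)"
proof -
  obtain p h c out where s: "s = (p, h, c, out)" by (cases s)
  define ss where "ss = word_tape w h # map (\<lambda>n. word_tape [False] (int (c n))) [0..<K] @
    [word_tape out (int (length out))]"
  have ss0: "ss ! 0 = word_tape w h" by (simp add: ss_def)
  have ssn: "ss ! Suc n = (if c n = 0 then 1 else 0)" if "n < K" for n
    using that by (simp add: ss_def nth_append word_tape_mark)
  have reads: "map (\<lambda>(t, h). t h) (snd (prog_conf K w s)) = ss"
    by (simp add: prog_conf_def s ss_def comp_def)
  have upd: "tape_act (t h, d) (t, h) = (t, h + offset d)" for t h d by simp
  have cnt: "tape_act (ss ! Suc n, d) (word_tape [False], int (c n)) =
    (word_tape [False], int (c n) + offset d)" if "n < K" for n d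
    using ssn[OF that] word_tape_mark[of "c n"] by (auto intro!: ext)
  define i where "i = P ! p"
  have "tm_step (prog_tm K P) (prog_conf K w s) =
    (next_state p i ss, (word_tape w, h + offset (input_dir i)) #
      map (\<lambda>n. tape_act (ss ! Suc n, counter_dir i ss n) (word_tape [False], int (c n))) [0..<K] @
      [tape_act (output_act i ss) (word_tape out, int (length out))])"
    using assms(1) reads
    by (simp add: s prog_conf_def prog_tm_def i_def ss0 map2_map)
  also have "map (\<lambda>n. tape_act (ss ! Suc n, counter_dir i ss n) (word_tape [False], int (c n))) [0..<K] =
    map (\<lambda>n. (word_tape [False], int (c n) + offset (counter_dir i ss n))) [0..<K]"
    by (rule map_cong) (use cnt in auto)
  also have "(next_state p i ss, (word_tape w, h + offset (input_dir i)) #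
      map (\<lambda>n. (word_tape [False], int (c n) + offset (counter_dir i ss n))) [0..<K] @
      [tape_act (output_act i ss) (word_tape out, int (length out))]) =
     prog_conf K w (instr_step w i s)"
  proof -
    have blank: "(word_tape out)(int (length out) := 0) = word_tape out"
      using word_tape_end[of out] by (auto intro!: ext)
    have snoc1: "(word_tape out)(int (length out) := Suc 0) = word_tape (out @ [False])"
      using word_tape_snoc[of out False] by simp
    have snoc2: "(word_tape out)(int (length out) := 2) = word_tape (out @ [True])"
      using word_tape_snoc[of out True] by simp
    show ?thesis
      using assms(2)
      by (cases i) (auto simp: s prog_conf_def i_def ssn ss0 blank snoc1 snoc2)
  qed
  finally show ?thesis using assms(1) by (simp add: prog_step_def s i_def)
qed

lemma prog_tm_init:
  "tm_step (prog_tm K P) (tm_init (prog_tm K P) w) = prog_conf K w (0, 0, (\<lambda>_. 0), [])"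
proof -
  have mk: "(word_tape [])(0 := Suc 0) = word_tape [False]"
    using word_tape_snoc[of "[]" False] by simp
  have bl: "(word_tape [])(0 := 0) = word_tape []" by (auto simp: word_tape_def intro!: ext)
  have rep: "replicate (Suc K) (word_tape [], 0::int) =
     map (\<lambda>_. (word_tape [], 0)) [0..<K] @ [(word_tape [], 0)]"
    by (simp add: map_replicate_const replicate_append_same)
  show ?thesis
    unfolding tm_init_def
    by (simp add: prog_tm_def prog_conf_def rep map2_map mk bl del: replicate_Suc)
qed

lemma prog_tm_steps:
  assumes "\<And>i. i \<in> set P \<Longrightarrow> instr_counters i \<subseteq> {..<K}"
  shows "\<exists>t'\<le>t. (tm_step (prog_tm K P) ^^ t') (prog_conf K w s) = prog_conf K w ((prog_step w P ^^ t) s)"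
proof (induction t)
  case (Suc t)
  then obtain t' where t': "t' \<le> t"
    "(tm_step (prog_tm K P) ^^ t') (prog_conf K w s) = prog_conf K w ((prog_step w P ^^ t) s)" by blast
  let ?s = "(prog_step w P ^^ t) s"
  show ?case
  proof (cases "fst ?s < length P")
    case True
    have "(tm_step (prog_tm K P) ^^ Suc t') (prog_conf K w s) = prog_conf K w ((prog_step w P ^^ Suc t) s)"
      using prog_tm_step[OF True] assms[OF nth_mem[OF True]] t'(2) by simp
    then show ?thesis using t'(1) by (intro exI[of _ "Suc t'"]) auto
  next
    case False
    then have "prog_step w P ?s = ?s" by (simp add: prog_step_def)
    then show ?thesis using t' by (intro exI[of _ t']) auto
  qed
qed auto

section \<open>Structured programs\<close>

datatype com = Skip | Atom instr | Seq com com | Loop nat com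

fun code_len :: "com \<Rightarrow> nat" where
  "code_len Skip = 0"
| "code_len (Atom _) = 1"
| "code_len (Seq c d) = code_len c + code_len d"
| "code_len (Loop _ c) = code_len c + 3"

fun code :: "com \<Rightarrow> nat \<Rightarrow> instr list" where
  "code Skip p = []"
| "code (Atom i) p = [i]"
| "code (Seq c d) p = code c p @ code d (p + code_len c)"
| "code (Loop n c) p = [Jz n (p + code_len c + 3), Dec n] @ code c (p + 2) @ [Jmp p]"

lemma length_code [simp]: "length (code c p) = code_len c"
  by (induction c arbitrary: p) auto

fun no_jump :: "instr \<Rightarrow> bool" where
  "no_jump (Jz _ _) = False"
| "no_jump (Jmp _) = False"
| "no_jump _ = True"

fun wf_com :: "com \<Rightarrow> bool" where
  "wf_com Skip = True"
| "wf_com (Atom i) = no_jump i"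
| "wf_com (Seq c d) = (wf_com c \<and> wf_com d)"
| "wf_com (Loop _ c) = wf_com c"

lemma code_targets:
  "wf_com c \<Longrightarrow> i \<in> set (code c p) \<Longrightarrow> instr_targets i \<subseteq> {..p + code_len c}"
proof (induction c arbitrary: p)
  case (Atom j)
  then show ?case by (cases j) auto
next
  case (Seq c d)
  then show ?case by (fastforce simp: subset_iff)
next
  case (Loop n c)
  then show ?case by (fastforce simp: subset_iff)
qed auto

text \<open>Jump targets are absolute, so code is correct only relative to its place in a program.
  Quantifying over the surrounding code \<open>A\<close> and \<open>B\<close> makes the relation
  compositional.\<close>

definition exec :: "word \<Rightarrow> com \<Rightarrow> mstate \<Rightarrow> nat \<Rightarrow> mstate \<Rightarrow> bool" where
  "exec w c s T s' \<longleftrightarrow> (\<forall>A B. \<exists>t\<le>T.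
     (prog_step w (A @ code c (length A) @ B) ^^ t) (length A, s) = (length A + code_len c, s'))"

lemma exec_mono: "exec w c s T s' \<Longrightarrow> T \<le> T' \<Longrightarrow> exec w c s T' s'"
  unfolding exec_def by (meson le_trans)

lemma exec_Skip: "exec w Skip s 0 s"
  by (simp add: exec_def)

lemma exec_Atom:
  assumes "no_jump i"
  shows "exec w (Atom i) s 1 (snd (instr_step w i (0, s)))"
proof -
  have "prog_step w (A @ [i] @ B) (length A, s) = (Suc (length A), snd (instr_step w i (0, s)))" for A B
    using assms by (cases s; cases i) (auto simp: prog_step_def)
  then show ?thesis unfolding exec_def by (intro allI exI[of _ 1]) auto
qed

lemma exec_Seq:
  assumes "exec w c s T s'" "exec w d s' T' s''"
  shows "exec w (Seq c d) s (T + T') s''"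
  unfolding exec_def
proof (intro allI)
  fix A B
  obtain t where t: "t \<le> T" "(prog_step w (A @ code c (length A) @ code d (length A + code_len c) @ B) ^^ t)
      (length A, s) = (length A + code_len c, s')"
    using assms(1) unfolding exec_def by blast
  obtain t' where t': "t' \<le> T'" "(prog_step w ((A @ code c (length A)) @ code d (length (A @ code c (length A))) @ B) ^^ t')
      (length (A @ code c (length A)), s') = (length (A @ code c (length A)) + code_len d, s'')"
    using assms(2) unfolding exec_def by blast
  show "\<exists>t\<le>T + T'. (prog_step w (A @ code (Seq c d) (length A) @ B) ^^ t) (length A, s) =
      (length A + code_len (Seq c d), s'')"
    using t t' by (intro exI[of _ "t' + t"]) (auto simp: funpow_add add.assoc)
qed

lemma exec_Loop_0:
  assumes "c n = 0"
  shows "exec w (Loop n b) (h, c, out) 1 (h, c, out)"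
  unfolding exec_def
  by (intro allI exI[of _ 1]) (use assms in \<open>auto simp: prog_step_def\<close>)

lemma exec_Loop_Suc:
  assumes "c n = Suc k" "exec w b (h, c(n := k), out) T s" "exec w (Loop n b) s T' s'"
  shows "exec w (Loop n b) (h, c, out) (T + T' + 3) s'"
  unfolding exec_def
proof (intro allI)
  fix A B
  let ?P = "A @ code (Loop n b) (length A) @ B"
  let ?A = "A @ [Jz n (length A + code_len b + 3), Dec n]"
  have P: "?P = ?A @ code b (length ?A) @ ([Jmp (length A)] @ B)" by simp
  obtain t where t: "t \<le> T" "(prog_step w ?P ^^ t) (length ?A, h, c(n := k), out) = (length ?A + code_len b, s)"
    using assms(2) unfolding exec_def P by blast
  obtain t' where t': "t' \<le> T'" "(prog_step w ?P ^^ t') (length A, s) = (length A + code_len (Loop n b), s')"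
    using assms(3) unfolding exec_def by blast
  have 1: "(prog_step w ?P ^^ 2) (length A, h, c, out) = (length ?A, h, c(n := k), out)"
    using assms(1) by (simp add: prog_step_def numeral_2_eq_2 nth_append)
  have 2: "(prog_step w ?P ^^ 1) (length ?A + code_len b, s) = (length A, s)"
    by (cases s) (simp add: prog_step_def nth_append)
  have "(prog_step w ?P ^^ (t' + (1 + (t + 2)))) (length A, h, c, out) =
     (prog_step w ?P ^^ t') ((prog_step w ?P ^^ 1) ((prog_step w ?P ^^ t) ((prog_step w ?P ^^ 2) (length A, h, c, out))))"
    unfolding funpow_add comp_def ..
  also have "\<dots> = (length A + code_len (Loop n b), s')"
    unfolding 1 t(2) 2 t'(2) ..
  finally show "\<exists>t\<le>T + T' + 3. (prog_step w ?P ^^ t) (length A, h, c, out) = (length A + code_len (Loop n b), s')"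
    using t(1) t'(1) by (intro exI[of _ "t' + (1 + (t + 2))"]) auto
qed

text \<open>Invariant rule for counting loops: \<open>C j\<close> describes the counters after
  \<open>j\<close> rounds up to counter \<open>n\<close>, which the header has already decremented
  when the body starts. The 3 steps per round are the test, the decrement and the jump back.\<close>

lemma exec_Loop:
  assumes "c n = v"
    and "\<And>j. j < v \<Longrightarrow> exec w b (H j, (C j)(n := v - Suc j), W j) T (H (Suc j), (C (Suc j))(n := v - Suc j), W (Suc j))"
    and "C 0 = c(n := v)" "(C v)(n := 0) = c'"
  shows "exec w (Loop n b) (H 0, c, W 0) (v * (T + 3) + 1) (H v, c', W v)"
proof -
  have "exec w (Loop n b) (H (v - k), (C (v - k))(n := k), W (v - k)) (k * (T + 3) + 1) (H v, c', W v)"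
    if "k \<le> v" for k
    using that
  proof (induction k)
    case 0
    then show ?case using exec_Loop_0[of "(C v)(n := 0)" n w b "H v" "W v"] assms(4) by auto
  next
    case (Suc k)
    then have j: "v - Suc k < v" "Suc (v - Suc k) = v - k" "v - Suc (v - Suc k) = k" by auto
    have "exec w (Loop n b) (H (v - Suc k), (C (v - Suc k))(n := Suc k), W (v - Suc k))
       (T + (k * (T + 3) + 1) + 3) (H v, c', W v)"
    proof (rule exec_Loop_Suc)
      show "((C (v - Suc k))(n := Suc k)) n = Suc k" by simp
      show "exec w b (H (v - Suc k), ((C (v - Suc k))(n := Suc k))(n := k), W (v - Suc k)) T
          (H (v - k), (C (v - k))(n := k), W (v - k))"
        using assms(2)[OF j(1)] j by simp
      show "exec w (Loop n b) (H (v - k), (C (v - k))(n := k), W (v - k)) (k * (T + 3) + 1) (H v, c', W v)"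
        using Suc.prems by (intro Suc.IH) simp
    qed
    then show ?case by (rule exec_mono) simp
  qed
  from this[of v] show ?thesis using assms(1,3) by (simp add: fun_upd_idem)
qed

fun com_bound :: "com \<Rightarrow> nat" where
  "com_bound Skip = 0"
| "com_bound (Atom i) = Suc (Max (insert 0 (instr_counters i)))"
| "com_bound (Seq c d) = max (com_bound c) (com_bound d)"
| "com_bound (Loop n c) = max (Suc n) (com_bound c)"

lemma code_counters: "i \<in> set (code c p) \<Longrightarrow> instr_counters i \<subseteq> {..<com_bound c}"
proof (induction c arbitrary: p)
  case (Atom j)
  have "finite (instr_counters j)" by (cases j) auto
  then show ?case using Atom by (auto simp: less_Suc_eq_le)
next
  case (Seq c d)
  then show ?case by (fastforce simp: subset_iff)
next
  case (Loop n c)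
  then show ?case by (fastforce simp: subset_iff)
qed auto

lemma exec_poly_time:
  assumes "wf_com c" and ex: "\<And>w. exec w c (0, (\<lambda>_. 0), []) (poly p (length w)) (h w, c' w, f w)"
  shows "poly_time f"
proof -
  define P where "P = code c 0"
  define M where "M = prog_tm (com_bound c) P"
  have "wf_tm M" unfolding M_def P_def
    by (rule wf_prog_tm) (use code_targets[OF assms(1), of _ 0] in auto)
  \<comment> \<open>The additional 1 pays for the first machine step, which writes the
    marks.\<close>
  moreover have "tm_computes_within M w (f w) (poly (p + 1) (length w))" for w
  proof -
    have "\<exists>t\<le>poly p (length w). (prog_step w ([] @ code c (length ([]::instr list)) @ []) ^^ t) (length ([]::instr list), 0, (\<lambda>_. 0), []) =
        (length ([]::instr list) + code_len c, h w, c' w, f w)"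
      using ex[of w] unfolding exec_def by blast
    then obtain t where t: "t \<le> poly p (length w)"
      "(prog_step w P ^^ t) (0, 0, (\<lambda>_. 0), []) = (code_len c, h w, c' w, f w)"
      by (auto simp: P_def)
    obtain t' where t': "t' \<le> t" "(tm_step M ^^ t') (prog_conf (com_bound c) w (0, 0, (\<lambda>_. 0), [])) =
        prog_conf (com_bound c) w (code_len c, h w, c' w, f w)"
      using prog_tm_steps[of P "com_bound c" t w "(0, 0, (\<lambda>_. 0), [])"] code_counters t(2)
      unfolding M_def P_def by (metis (no_types, lifting))
    have "(tm_step M ^^ Suc t') (tm_init M w) = prog_conf (com_bound c) w (code_len c, h w, c' w, f w)"
      unfolding funpow_Suc_right comp_def M_def prog_tm_init
      using t'(2) unfolding M_def by simp
    moreover have "Suc t' \<le> poly (p + 1) (length w)" using t t' by simp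
    ultimately show ?thesis unfolding tm_computes_within_def
      by (intro exI[of _ "Suc t'"]) (auto simp: prog_conf_def M_def prog_tm_def P_def)
  qed
  ultimately show ?thesis unfolding poly_time_def by blast
qed

section \<open>Arithmetical expressions\<close>

text \<open>There is neither product nor power: bounded sums suffice for products, and every value
  stays polynomial in the input length and the variables, which keeps the loops of the compiled
  programs polynomial.\<close>

datatype expr = Var nat | One | Len | Bit expr | Add expr expr | Sub expr expr | Sum expr expr

primrec eval :: "word \<Rightarrow> expr \<Rightarrow> (nat \<Rightarrow> nat) \<Rightarrow> nat" where
  "eval w (Var i) = (\<lambda>\<sigma>. \<sigma> i)"
| "eval w One = (\<lambda>\<sigma>. 1)"
| "eval w Len = (\<lambda>\<sigma>. length w)"
| "eval w (Bit a) = (\<lambda>\<sigma>. if eval w a \<sigma> < length w \<and> w ! eval w a \<sigma> then 1 else 0)"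
| "eval w (Add a b) = (\<lambda>\<sigma>. eval w a \<sigma> + eval w b \<sigma>)"
| "eval w (Sub a b) = (\<lambda>\<sigma>. eval w a \<sigma> - eval w b \<sigma>)"
| "eval w (Sum a b) = (\<lambda>\<sigma>. \<Sum>k<eval w a \<sigma>. eval w b (case_nat k \<sigma>))"

text \<open>
  The command \<open>comp a \<rho> d b\<close> adds the value of \<open>a\<close> to counter \<open>d\<close>, where variable \<open>i\<close> is held in
  counter \<open>\<rho> i\<close> and the counters from \<open>b\<close> on are zero and free for use.
\<close>

primrec comp :: "expr \<Rightarrow> (nat \<Rightarrow> nat) \<Rightarrow> nat \<Rightarrow> nat \<Rightarrow> com" where
  "comp (Var i) \<rho> d b = Seq (Loop (\<rho> i) (Atom (Inc b))) (Loop b (Seq (Atom (Inc (\<rho> i))) (Atom (Inc d))))"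
| "comp One \<rho> d b = Atom (Inc d)"
| "comp Len \<rho> d b = Seq (Atom (Rd 1 b)) (Seq
     (Loop b (Seq (Atom (Inc d)) (Seq (Atom (Inc (Suc b))) (Seq (Atom MvR) (Atom (Rd 1 b))))))
     (Loop (Suc b) (Atom MvL)))"
| "comp (Bit a) \<rho> d b = Seq (comp a \<rho> b (b + 2)) (Seq
     (Loop b (Seq (Atom MvR) (Atom (Inc (Suc b)))))
     (Seq (Atom (Rd 2 d)) (Loop (Suc b) (Atom MvL))))"
| "comp (Add a a') \<rho> d b = Seq (comp a \<rho> d b) (comp a' \<rho> d b)"
| "comp (Sub a a') \<rho> d b = Seq (comp a \<rho> b (b + 2)) (Seq (comp a' \<rho> (Suc b) (b + 2))
     (Seq (Loop (Suc b) (Atom (Dec b))) (Loop b (Atom (Inc d)))))"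
| "comp (Sum a a') \<rho> d b = Seq (comp a \<rho> b (b + 2)) (Seq
     (Loop b (Seq (comp a' (case_nat (Suc b) \<rho>) d (b + 2)) (Atom (Inc (Suc b)))))
     (Loop (Suc b) Skip))"

lemma wf_comp: "wf_com (comp a \<rho> d b)"
  by (induction a arbitrary: \<rho> d b) auto

lemma poly_nat_mono: "x \<le> y \<Longrightarrow> poly p x \<le> poly p (y :: nat)"
  by (induction p) (auto intro!: add_mono mult_mono)

primrec val_poly :: "expr \<Rightarrow> nat poly" where
  "val_poly (Var i) = [:0, 1:]"
| "val_poly One = 1"
| "val_poly Len = [:0, 1:]"
| "val_poly (Bit a) = 1"
| "val_poly (Add a b) = val_poly a + val_poly b"
| "val_poly (Sub a b) = val_poly a"
| "val_poly (Sum a b) = val_poly a * pcompose (val_poly b) ([:0, 1:] + val_poly a)"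

lemma eval_le_poly:
  "length w \<le> N \<Longrightarrow> (\<And>i. \<sigma> i \<le> N) \<Longrightarrow> eval w a \<sigma> \<le> poly (val_poly a) N"
proof (induction a arbitrary: \<sigma> N)
  case (Add a b)
  then show ?case by (auto intro!: add_mono)
next
  case (Sub a b)
  have "eval w a \<sigma> \<le> poly (val_poly a) N" by (rule Sub.IH) (use Sub in auto)
  then show ?case by simp
next
  case (Sum a b)
  have a: "eval w a \<sigma> \<le> poly (val_poly a) N" by (rule Sum.IH) (use Sum in auto)
  have "eval w b (case_nat k \<sigma>) \<le> poly (val_poly b) (N + poly (val_poly a) N)" if "k < eval w a \<sigma>" for k
    by (rule Sum.IH)
      (use Sum.prems that a in \<open>auto split: nat.split intro: trans_le_add1\<close>)
  then have "(\<Sum>k<eval w a \<sigma>. eval w b (case_nat k \<sigma>)) \<le>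
      eval w a \<sigma> * poly (val_poly b) (N + poly (val_poly a) N)"
    using sum_bounded_above[of "{..<eval w a \<sigma>}" "\<lambda>k. eval w b (case_nat k \<sigma>)"] by simp
  also have "\<dots> \<le> poly (val_poly a) N * poly (val_poly b) (N + poly (val_poly a) N)"
    using a by simp
  finally show ?case by (simp add: poly_pcompose)
qed auto

section \<open>Running times of the basic program fragments\<close>

lemma exec_eqI: "exec w c s T s' \<Longrightarrow> s' = s'' \<Longrightarrow> T \<le> T' \<Longrightarrow> exec w c s T' s''"
  using exec_mono by blast

lemma exec_Inc: "exec w (Atom (Inc n)) (h, c, out) 1 (h, c(n := Suc (c n)), out)"
  using exec_Atom[of "Inc n" w "(h, c, out)"] by simp

lemma exec_Dec: "exec w (Atom (Dec n)) (h, c, out) 1 (h, c(n := c n - 1), out)"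
  using exec_Atom[of "Dec n" w "(h, c, out)"] by simp

lemma exec_MvR: "exec w (Atom MvR) (h, c, out) 1 (h + 1, c, out)"
  using exec_Atom[of MvR w "(h, c, out)"] by simp

lemma exec_MvL: "exec w (Atom MvL) (h, c, out) 1 (h - 1, c, out)"
  using exec_Atom[of MvL w "(h, c, out)"] by simp

lemma exec_Rd: "exec w (Atom (Rd s n)) (h, c, out) 1
   (h, if s \<le> word_tape w h then c(n := Suc (c n)) else c, out)"
  using exec_Atom[of "Rd s n" w "(h, c, out)"] by simp

lemma exec_Out: "exec w (Atom (Out n)) (h, c, out) 1 (h, c, out @ [c n \<noteq> 0])"
  using exec_Atom[of "Out n" w "(h, c, out)"] by simp

lemma exec_move:
  assumes "n \<noteq> m"
  shows "exec w (Loop n (Atom (Inc m))) (h, c, out) (c n * 4 + 1) (h, c(n := 0, m := c m + c n), out)"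
proof -
  have "exec w (Loop n (Atom (Inc m))) (h, c, out) (c n * (1 + 3) + 1) (h, c(n := 0, m := c m + c n), out)"
  proof (rule exec_Loop[where C = "\<lambda>j. c(m := c m + j)" and H = "\<lambda>_. h" and W = "\<lambda>_. out"])
    fix j
    show "exec w (Atom (Inc m)) (h, (c(m := c m + j))(n := c n - Suc j), out) 1
         (h, (c(m := c m + Suc j))(n := c n - Suc j), out)"
      using exec_Inc[of w m h "(c(m := c m + j))(n := c n - Suc j)" out] assms
      by (simp add: fun_upd_twist)
  qed (use assms in \<open>auto simp: fun_upd_twist\<close>)
  then show ?thesis by simp
qed

lemma exec_clear: "exec w (Loop n Skip) (h, c, out) (c n * 3 + 1) (h, c(n := 0), out)"
proof -
  have "exec w (Loop n Skip) (h, c, out) (c n * (0 + 3) + 1) (h, c(n := 0), out)"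
    by (rule exec_Loop[where C = "\<lambda>j. c" and H = "\<lambda>_. h" and W = "\<lambda>_. out"]) (auto intro: exec_Skip)
  then show ?thesis by simp
qed

lemma exec_rewind:
  "exec w (Loop n (Atom MvL)) (int (c n), c, out) (c n * 4 + 1) (0, c(n := 0), out)"
proof -
  have "exec w (Loop n (Atom MvL)) (int (c n - 0), c, out) (c n * (1 + 3) + 1) (int (c n - c n), c(n := 0), out)"
  proof (rule exec_Loop[where C = "\<lambda>j. c" and H = "\<lambda>j. int (c n - j)" and W = "\<lambda>_. out"])
    fix j assume "j < c n"
    then have "int (c n - j) - 1 = int (c n - Suc j)" by auto
    then show "exec w (Atom MvL) (int (c n - j), c(n := c n - Suc j), out) 1
        (int (c n - Suc j), c(n := c n - Suc j), out)"
      by (intro exec_eqI[OF exec_MvL]) auto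
  qed auto
  then show ?thesis by simp
qed

lemma exec_Var:
  assumes "c b = 0" "b \<noteq> d" "b \<noteq> r" "r \<noteq> d"
  shows "exec w (Seq (Loop r (Atom (Inc b))) (Loop b (Seq (Atom (Inc r)) (Atom (Inc d)))))
     (h, c, out) (c r * 9 + 2) (h, c(d := c d + c r), out)"
proof -
  let ?c = "c(r := 0, b := c r)"
  have 1: "exec w (Loop r (Atom (Inc b))) (h, c, out) (c r * 4 + 1) (h, ?c, out)"
    using exec_move[of r b w h c out] assms by simp
  have "exec w (Loop b (Seq (Atom (Inc r)) (Atom (Inc d)))) (h, ?c, out) (c r * (2 + 3) + 1) (h, c(d := c d + c r), out)"
  proof (rule exec_Loop[where C = "\<lambda>j. ?c(r := j, d := c d + j)" and H = "\<lambda>_. h" and W = "\<lambda>_. out"])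
    fix j
    let ?s = "(?c(r := j, d := c d + j))(b := c r - Suc j)"
    have "exec w (Seq (Atom (Inc r)) (Atom (Inc d))) (h, ?s, out) (1 + 1)
       (h, (?s(r := Suc (?s r)))(d := Suc ((?s(r := Suc (?s r))) d)), out)"
      by (intro exec_Seq[OF exec_Inc exec_Inc])
    then show "exec w (Seq (Atom (Inc r)) (Atom (Inc d))) (h, ?s, out) 2
       (h, (?c(r := Suc j, d := c d + Suc j))(b := c r - Suc j), out)"
      by (rule exec_eqI) (use assms in \<open>auto simp: fun_eq_iff\<close>)
  qed (use assms in \<open>auto simp: fun_eq_iff\<close>)
  from exec_Seq[OF 1 this] show ?thesis by (rule exec_eqI) auto
qed

lemma exec_monus:
  assumes "n \<noteq> m"
  shows "exec w (Loop n (Atom (Dec m))) (h, c, out) (c n * 4 + 1) (h, c(n := 0, m := c m - c n), out)"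
proof -
  have "exec w (Loop n (Atom (Dec m))) (h, c, out) (c n * (1 + 3) + 1) (h, c(n := 0, m := c m - c n), out)"
  proof (rule exec_Loop[where C = "\<lambda>j. c(m := c m - j)" and H = "\<lambda>_. h" and W = "\<lambda>_. out"])
    fix j
    show "exec w (Atom (Dec m)) (h, (c(m := c m - j))(n := c n - Suc j), out) 1
         (h, (c(m := c m - Suc j))(n := c n - Suc j), out)"
      using exec_Dec[of w m h "(c(m := c m - j))(n := c n - Suc j)" out] assms
      by (simp add: fun_upd_twist)
  qed (use assms in \<open>auto simp: fun_upd_twist\<close>)
  then show ?thesis by simp
qed

lemma exec_advance:
  assumes "n \<noteq> m" "c m = 0"
  shows "exec w (Loop n (Seq (Atom MvR) (Atom (Inc m)))) (0, c, out) (c n * 5 + 1)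
     (int (c n), c(n := 0, m := c n), out)"
proof -
  have "exec w (Loop n (Seq (Atom MvR) (Atom (Inc m)))) (int 0, c, out) (c n * (2 + 3) + 1)
     (int (c n), c(n := 0, m := c n), out)"
  proof (rule exec_Loop[where C = "\<lambda>j. c(m := j)" and H = "\<lambda>j. int j" and W = "\<lambda>_. out"])
    fix j
    let ?s = "(c(m := j))(n := c n - Suc j)"
    have "exec w (Seq (Atom MvR) (Atom (Inc m))) (int j, ?s, out) (1 + 1) (int j + 1, ?s(m := Suc (?s m)), out)"
      by (intro exec_Seq[OF exec_MvR exec_Inc])
    then show "exec w (Seq (Atom MvR) (Atom (Inc m))) (int j, ?s, out) 2
         (int (Suc j), (c(m := Suc j))(n := c n - Suc j), out)"
      by (rule exec_eqI) (use assms in \<open>auto simp: fun_eq_iff\<close>)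
  qed (use assms in \<open>auto simp: fun_upd_twist fun_eq_iff\<close>)
  then show ?thesis by simp
qed

lemma word_tape_ge_1: "1 \<le> word_tape w (int j) \<longleftrightarrow> j < length w"
  by (auto simp: word_tape_def)

lemma word_tape_ge_2: "2 \<le> word_tape w (int j) \<longleftrightarrow> j < length w \<and> w ! j"
  by (auto simp: word_tape_def)

text \<open>Here \<open>Loop\<close> serves as a while loop: counter \<open>b\<close> is 1 as long
  as the head scans a nonblank cell and is refilled by the body. Counter \<open>Suc b\<close>
  records the moves for the way back.\<close>

lemma exec_Len:
  assumes "c b = 0" "c (Suc b) = 0" "d < b"
  shows "exec w (comp Len \<rho> d b) (0, c, out) (length w * 11 + 3) (0, c(d := c d + length w), out)"
proof -
  let ?f = "\<lambda>j. c(b := if j < length w then 1 else 0, d := c d + j, Suc b := j)"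
  let ?body = "Seq (Atom (Inc d)) (Seq (Atom (Inc (Suc b))) (Seq (Atom MvR) (Atom (Rd 1 b))))"
  have 1: "exec w (Atom (Rd 1 b)) (0, c, out) 1 (int 0, ?f 0, out)"
    by (rule exec_eqI[OF exec_Rd])
      (use assms word_tape_ge_1[of w 0] in \<open>auto simp: fun_eq_iff\<close>)
  have "exec w (Loop b ?body) (int j, ?f j, out) ((length w - j) * 7 + 1) (int (length w), ?f (length w), out)"
    if "j \<le> length w" for j
    using that
  proof (induction j rule: inc_induct)
    case base
    show ?case by (rule exec_eqI[OF exec_Loop_0]) (use assms in auto)
  next
    case (step j)
    let ?s = "(?f j)(b := 0)"
    let ?s1 = "?s(d := Suc (?s d))"
    let ?s2 = "?s1(Suc b := Suc (?s1 (Suc b)))"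
    have "exec w ?body (int j, ?s, out) (1 + (1 + (1 + 1)))
       (int j + 1, if 1 \<le> word_tape w (int j + 1) then ?s2(b := Suc (?s2 b)) else ?s2, out)"
      by (intro exec_Seq[OF exec_Inc] exec_Seq[OF exec_MvR] exec_Rd)
    then have "exec w ?body (int j, ?s, out) 4 (int (Suc j), ?f (Suc j), out)"
      by (rule exec_eqI)
        (use assms word_tape_ge_1[of w "Suc j"] in \<open>auto simp: fun_eq_iff add.commute\<close>)
    have "exec w (Loop b ?body) (int j, ?f j, out) (4 + ((length w - Suc j) * 7 + 1) + 3)
        (int (length w), ?f (length w), out)"
      by (rule exec_Loop_Suc[OF _ \<open>exec w ?body _ 4 _\<close> step.IH]) (use step.hyps assms in simp)
    then show ?case by (rule exec_mono) (use step.hyps in auto)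
  qed
  from this[of 0] have 2: "exec w (Loop b ?body) (int 0, ?f 0, out) (length w * 7 + 1) (int (length w), ?f (length w), out)"
    by simp
  have 3: "exec w (Loop (Suc b) (Atom MvL)) (int (length w), ?f (length w), out) (length w * 4 + 1)
     (0, (?f (length w))(Suc b := 0), out)"
    using exec_rewind[of w "Suc b" "?f (length w)" out] by simp
  show ?thesis unfolding comp.simps
    by (rule exec_eqI[OF exec_Seq[OF 1 exec_Seq[OF 2 3]]]) (use assms in \<open>auto simp: fun_eq_iff\<close>)
qed

text \<open>The constants collect the loop costs of \<open>comp\<close>. For \<open>Bit\<close>, for
  instance, each unit of the value costs 5 steps to advance the input head and 4 to rewind
  it.\<close>

primrec time_poly :: "expr \<Rightarrow> nat poly" where
  "time_poly (Var i) = [:2, 9:]"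
| "time_poly One = 1"
| "time_poly Len = [:3, 11:]"
| "time_poly (Bit a) = time_poly a + smult 9 (val_poly a) + [:3:]"
| "time_poly (Add a b) = time_poly a + time_poly b"
| "time_poly (Sub a b) = time_poly a + time_poly b + smult 4 (val_poly a) + smult 4 (val_poly b) + [:2:]"
| "time_poly (Sum a b) = time_poly a + val_poly a * (pcompose (time_poly b) ([:0, 1:] + val_poly a) + [:7:]) + [:2:]"

lemma exec_comp:
  assumes "length w \<le> N" "\<And>i. \<sigma> i \<le> N" "\<And>i. c (\<rho> i) = \<sigma> i" "\<And>i. \<rho> i < b" "\<And>i. \<rho> i \<noteq> d"
    "d < b" "\<And>n. n \<ge> b \<Longrightarrow> c n = 0"
  shows "exec w (comp a \<rho> d b) (0, c, out) (poly (time_poly a) N) (0, c(d := c d + eval w a \<sigma>), out)"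
  using assms
proof (induction a arbitrary: \<rho> \<sigma> d b c N)
  case (Var i)
  have "exec w (comp (Var i) \<rho> d b) (0, c, out) (c (\<rho> i) * 9 + 2) (0, c(d := c d + c (\<rho> i)), out)"
    unfolding comp.simps
    by (rule exec_Var) (use Var.prems(4)[of i] Var.prems(5)[of i] Var.prems(6,7) in auto)
  then show ?case
    by (rule exec_eqI) (use Var.prems(2,3)[of i] in auto)
next
  case One
  show ?case unfolding comp.simps by (rule exec_eqI[OF exec_Inc]) auto
next
  case Len
  show ?case
    by (rule exec_eqI[OF exec_Len]) (use Len in auto)
next
  case (Bit a)
  let ?v = "eval w a \<sigma>"
  have v: "?v \<le> poly (val_poly a) N" by (rule eval_le_poly) (use Bit.prems in auto)
  have 1: "exec w (comp a \<rho> b (b + 2)) (0, c, out) (poly (time_poly a) N) (0, c(b := c b + ?v), out)"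
    by (rule Bit.IH) (use Bit.prems in \<open>auto simp: less_imp_neq less_SucI\<close>)
  let ?c1 = "c(b := c b + ?v)"
  have 2: "exec w (Loop b (Seq (Atom MvR) (Atom (Inc (Suc b))))) (0, ?c1, out) (?v * 5 + 1)
     (int ?v, c(Suc b := ?v), out)"
    by (rule exec_eqI[OF exec_advance]) (use Bit.prems in \<open>auto simp: fun_eq_iff\<close>)
  let ?c2 = "c(Suc b := ?v)"
  have 3: "exec w (Atom (Rd 2 d)) (int ?v, ?c2, out) 1 (int (?c2 (Suc b)), ?c2(d := c d + eval w (Bit a) \<sigma>), out)"
    by (rule exec_eqI[OF exec_Rd])
      (use Bit.prems word_tape_ge_2[of w ?v] in \<open>auto simp: fun_eq_iff\<close>)
  let ?c3 = "?c2(d := c d + eval w (Bit a) \<sigma>)"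
  have c3: "?c2 (Suc b) = ?c3 (Suc b)" using Bit.prems by auto
  have 4: "exec w (Loop (Suc b) (Atom MvL)) (int (?c2 (Suc b)), ?c3, out) (?v * 4 + 1) (0, ?c3(Suc b := 0), out)"
    unfolding c3 by (rule exec_eqI[OF exec_rewind]) (use Bit.prems in auto)
  show ?case unfolding comp.simps
    by (rule exec_eqI[OF exec_Seq[OF 1 exec_Seq[OF 2 exec_Seq[OF 3 4]]]])
      (use Bit.prems v in \<open>auto simp: fun_eq_iff\<close>)
next
  case (Add a a')
  have 1: "exec w (comp a \<rho> d b) (0, c, out) (poly (time_poly a) N) (0, c(d := c d + eval w a \<sigma>), out)"
    by (rule Add.IH) (use Add.prems in auto)
  have 2: "exec w (comp a' \<rho> d b) (0, c(d := c d + eval w a \<sigma>), out) (poly (time_poly a') N)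
     (0, (c(d := c d + eval w a \<sigma>))(d := (c(d := c d + eval w a \<sigma>)) d + eval w a' \<sigma>), out)"
    by (rule Add.IH) (use Add.prems in auto)
  show ?case unfolding comp.simps
    by (rule exec_eqI[OF exec_Seq[OF 1 2]]) (auto simp: fun_eq_iff)
next
  case (Sub a a')
  let ?v = "eval w a \<sigma>" and ?u = "eval w a' \<sigma>"
  have v: "?v \<le> poly (val_poly a) N" by (rule eval_le_poly) (use Sub.prems in auto)
  have u: "?u \<le> poly (val_poly a') N" by (rule eval_le_poly) (use Sub.prems in auto)
  have 1: "exec w (comp a \<rho> b (b + 2)) (0, c, out) (poly (time_poly a) N) (0, c(b := c b + ?v), out)"
    by (rule Sub.IH) (use Sub.prems in \<open>auto simp: less_imp_neq less_SucI\<close>)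
  let ?c1 = "c(b := c b + ?v)"
  have 2: "exec w (comp a' \<rho> (Suc b) (b + 2)) (0, ?c1, out) (poly (time_poly a') N)
     (0, ?c1(Suc b := ?c1 (Suc b) + ?u), out)"
    by (rule Sub.IH) (use Sub.prems in \<open>auto simp: less_imp_neq less_SucI\<close>)
  let ?c2 = "?c1(Suc b := ?c1 (Suc b) + ?u)"
  have 3: "exec w (Loop (Suc b) (Atom (Dec b))) (0, ?c2, out) (?u * 4 + 1) (0, c(b := ?v - ?u), out)"
    by (rule exec_eqI[OF exec_monus]) (use Sub.prems in \<open>auto simp: fun_eq_iff\<close>)
  have 4: "exec w (Loop b (Atom (Inc d))) (0, c(b := ?v - ?u), out) (?v * 4 + 1) (0, c(d := c d + (?v - ?u)), out)"
    by (rule exec_eqI[OF exec_move]) (use Sub.prems in \<open>auto simp: fun_eq_iff\<close>)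
  show ?case unfolding comp.simps
    by (rule exec_eqI[OF exec_Seq[OF 1 exec_Seq[OF 2 exec_Seq[OF 3 4]]]])
      (use v u in \<open>auto simp: fun_eq_iff\<close>)
next
  case (Sum a a')
  let ?v = "eval w a \<sigma>"
  let ?g = "\<lambda>k. eval w a' (case_nat k \<sigma>)"
  \<comment> \<open>The summation index is a variable bounded only by the value of \<open>a\<close>,
    so the body needs the larger bound.\<close>
  let ?N = "N + poly (val_poly a) N"
  have v: "?v \<le> poly (val_poly a) N" by (rule eval_le_poly) (use Sum.prems in auto)
  have 1: "exec w (comp a \<rho> b (b + 2)) (0, c, out) (poly (time_poly a) N) (0, c(b := c b + ?v), out)"
    by (rule Sum.IH) (use Sum.prems in \<open>auto simp: less_imp_neq less_SucI\<close>)
  let ?C = "\<lambda>j. c(b := ?v, d := c d + (\<Sum>k<j. ?g k), Suc b := j)"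
  let ?body = "Seq (comp a' (case_nat (Suc b) \<rho>) d (b + 2)) (Atom (Inc (Suc b)))"
  have 2: "exec w (Loop b ?body) (0, c(b := c b + ?v), out) (?v * ((poly (time_poly a') ?N + 1) + 3) + 1) (0, (?C ?v)(b := 0), out)"
  proof (rule exec_Loop[where C = ?C and H = "\<lambda>_. 0" and W = "\<lambda>_. out"])
    fix j assume j: "j < ?v"
    let ?s = "(?C j)(b := ?v - Suc j)"
    have ne: "\<rho> i \<noteq> b" "\<rho> i \<noteq> Suc b" "\<rho> i \<noteq> d" "\<rho> i < b + 2" for i
      using Sum.prems(4)[of i] Sum.prems(5)[of i] by auto
    have "exec w (comp a' (case_nat (Suc b) \<rho>) d (b + 2)) (0, ?s, out) (poly (time_poly a') ?N)
        (0, ?s(d := ?s d + ?g j), out)"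
    proof (rule Sum.IH(2))
      show "length w \<le> ?N" using Sum.prems by auto
      show "case_nat j \<sigma> i \<le> ?N" for i
        using Sum.prems(2)[of "i - 1"] j v by (cases i) auto
      show "?s (case_nat (Suc b) \<rho> i) = case_nat j \<sigma> i" for i
        using Sum.prems(3,6) ne by (cases i) auto
      show "case_nat (Suc b) \<rho> i < b + 2" for i using ne by (cases i) auto
      show "case_nat (Suc b) \<rho> i \<noteq> d" for i using ne Sum.prems by (cases i) auto
      show "d < b + 2" using Sum.prems by auto
      show "?s n = 0" if "n \<ge> b + 2" for n using Sum.prems that by auto
    qed
    from exec_Seq[OF this exec_Inc]
    show "exec w ?body (0, ?s, out) (poly (time_poly a') ?N + 1) (0, (?C (Suc j))(b := ?v - Suc j), out)"
      by (rule exec_eqI) (use Sum.prems in \<open>auto simp: fun_eq_iff\<close>)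
  qed (use Sum.prems in \<open>auto simp: fun_eq_iff\<close>)
  have 3: "exec w (Loop (Suc b) Skip) (0, (?C ?v)(b := 0), out) (?v * 3 + 1) (0, (?C ?v)(b := 0, Suc b := 0), out)"
    by (rule exec_eqI[OF exec_clear]) (use Sum.prems in auto)
  have time: "poly (time_poly a) N + ((?v * ((poly (time_poly a') ?N + 1) + 3) + 1) + (?v * 3 + 1)) \<le> poly (time_poly (Sum a a')) N"
  proof -
    have "?v * (poly (time_poly a') ?N + 7) \<le> poly (val_poly a) N * (poly (time_poly a') ?N + 7)" using v by simp
    then show ?thesis by (simp add: poly_pcompose algebra_simps)
  qed
  show ?case unfolding comp.simps
    by (rule exec_eqI[OF exec_Seq[OF 1 exec_Seq[OF 2 3]] _ time])
      (use Sum.prems in \<open>auto simp: fun_eq_iff\<close>)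
qed

text \<open>Both expressions are evaluated in constant environments, so the single counter 0,
  holding the output position, can stand for all variables. Counter 1 drives the loop and counter 2
  holds the current bit.\<close>

theorem poly_time_expr:
  "poly_time (\<lambda>w. map (\<lambda>i. eval w b (\<lambda>_. i) \<noteq> 0) [0..<eval w l (\<lambda>_. 0)])"
proof -
  define body where "body = Seq (comp b (\<lambda>_. 0) 2 3) (Seq (Atom (Out 2)) (Seq (Loop 2 Skip) (Atom (Inc 0))))"
  define pr where "pr = Seq (comp l (\<lambda>_. 0) 1 3) (Loop 1 body)"
  define Q where "Q = [:0, 1:] + val_poly l"
  define T where "T = pcompose (time_poly b) Q + smult 3 (pcompose (val_poly b) Q) + [:3:]"
  define p where "p = time_poly l + val_poly l * (T + [:3:]) + 1"
  have "wf_com pr" by (simp add: pr_def body_def wf_comp)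
  moreover have "exec w pr (0, (\<lambda>_. 0), []) (poly p (length w))
     (0, (\<lambda>_. 0)(0 := eval w l (\<lambda>_. 0)), map (\<lambda>i. eval w b (\<lambda>_. i) \<noteq> 0) [0..<eval w l (\<lambda>_. 0)])" for w
  proof -
    let ?v = "eval w l (\<lambda>_. 0)"
    let ?N = "length w + poly (val_poly l) (length w)"
    have v: "?v \<le> poly (val_poly l) (length w)" by (rule eval_le_poly) auto
    have 1: "exec w (comp l (\<lambda>_. 0) 1 3) (0, (\<lambda>_. 0), []) (poly (time_poly l) (length w)) (0, (\<lambda>_. 0)(1 := ?v), [])"
      by (rule exec_eqI[OF exec_comp[where \<sigma> = "\<lambda>_. 0" and N = "length w"]]) auto
    let ?C = "\<lambda>j. (\<lambda>_. 0 :: nat)(1 := ?v, 0 := j)"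
    let ?W = "\<lambda>j. map (\<lambda>i. eval w b (\<lambda>_. i) \<noteq> 0) [0..<j]"
    have 2: "exec w (Loop 1 body) (0, (\<lambda>_. 0)(1 := ?v), ?W 0) (?v * (poly T (length w) + 3) + 1)
       (0, (\<lambda>_. 0)(0 := ?v), ?W ?v)"
    proof (rule exec_Loop[where C = ?C and H = "\<lambda>_. 0" and W = ?W])
      fix j assume j: "j < ?v"
      let ?s = "(?C j)(1 := ?v - Suc j)"
      let ?x = "eval w b (\<lambda>_. j)"
      have x: "?x \<le> poly (val_poly b) ?N" by (rule eval_le_poly) (use j v in auto)
      have b1: "exec w (comp b (\<lambda>_. 0) 2 3) (0, ?s, ?W j) (poly (time_poly b) ?N) (0, ?s(2 := ?x), ?W j)"
        by (rule exec_eqI[OF exec_comp[where \<sigma> = "\<lambda>_. j" and N = ?N]]) (use j v in auto)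
      have b2: "exec w (Atom (Out 2)) (0, ?s(2 := ?x), ?W j) 1 (0, ?s(2 := ?x), ?W (Suc j))"
        by (rule exec_eqI[OF exec_Out]) auto
      have b3: "exec w (Loop 2 Skip) (0, ?s(2 := ?x), ?W (Suc j)) (?x * 3 + 1) (0, ?s, ?W (Suc j))"
        by (rule exec_eqI[OF exec_clear]) (auto simp: fun_eq_iff)
      show "exec w body (0, ?s, ?W j) (poly T (length w)) (0, (?C (Suc j))(1 := ?v - Suc j), ?W (Suc j))"
        unfolding body_def
        by (rule exec_eqI[OF exec_Seq[OF b1 exec_Seq[OF b2 exec_Seq[OF b3 exec_Inc]]]])
          (use x in \<open>auto simp: fun_eq_iff T_def Q_def poly_pcompose\<close>)
    qed (auto simp: fun_eq_iff)
    have "poly (time_poly l) (length w) + (?v * (poly T (length w) + 3) + 1) \<le> poly p (length w)"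
      using v by (simp add: p_def)
    from exec_eqI[OF exec_Seq[OF 1 2[unfolded upt_0 list.map(1)]] refl this]
    show ?thesis unfolding pr_def by simp
  qed
  ultimately show ?thesis by (rule exec_poly_time)
qed

section \<open>Definable functions\<close>

text \<open>
  The second argument \<open>\<sigma>\<close> assigns values to de Bruijn variables; the rules for bounded sums and
  quantifiers below open a binder by shifting it.
\<close>

definition definable :: "(word \<Rightarrow> (nat \<Rightarrow> nat) \<Rightarrow> nat) \<Rightarrow> bool" where
  "definable f \<longleftrightarrow> (\<exists>a. \<forall>w \<sigma>. eval w a \<sigma> = f w \<sigma>)"

definition definable_pred :: "(word \<Rightarrow> (nat \<Rightarrow> nat) \<Rightarrow> bool) \<Rightarrow> bool" where
  "definable_pred P \<longleftrightarrow> definable (\<lambda>w \<sigma>. of_bool (P w \<sigma>))"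

named_theorems dintros

lemma definableI: "(\<And>w \<sigma>. eval w a \<sigma> = f w \<sigma>) \<Longrightarrow> definable f"
  unfolding definable_def by blast

lemma definable_cong: "definable f \<Longrightarrow> (\<And>w \<sigma>. f w \<sigma> = g w \<sigma>) \<Longrightarrow> definable g"
  unfolding definable_def by simp

lemma definable_pred_cong: "definable_pred P \<Longrightarrow> (\<And>w \<sigma>. P w \<sigma> \<longleftrightarrow> Q w \<sigma>) \<Longrightarrow> definable_pred Q"
  unfolding definable_pred_def definable_def by simp

lemma definable_predI: "definable f \<Longrightarrow> (\<And>w \<sigma>. f w \<sigma> = of_bool (P w \<sigma>)) \<Longrightarrow> definable_pred P"
  unfolding definable_pred_def by (erule definable_cong)

lemma definable_var [dintros]: "definable (\<lambda>w \<sigma>. \<sigma> i)"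
  by (rule definableI[where a = "Var i"]) simp

lemma definable_length [dintros]: "definable (\<lambda>w \<sigma>. length w)"
  by (rule definableI[where a = Len]) simp

lemma definable_add [dintros]:
  assumes "definable f" "definable g" shows "definable (\<lambda>w \<sigma>. f w \<sigma> + g w \<sigma>)"
  using assms unfolding definable_def by (metis eval.simps(5))

lemma definable_diff [dintros]:
  assumes "definable f" "definable g" shows "definable (\<lambda>w \<sigma>. f w \<sigma> - g w \<sigma>)"
  using assms unfolding definable_def by (metis eval.simps(6))

lemma definable_const [dintros]: "definable (\<lambda>w \<sigma>. n)"
proof (induction n)
  case 0
  show ?case by (rule definableI[where a = "Sub One One"]) simp
next
  case (Suc n)
  from definable_add[OF Suc definableI[where a = One and f = "\<lambda>w \<sigma>. 1"]] show ?case by simp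
qed

lemma definable_Suc [dintros]: "definable f \<Longrightarrow> definable (\<lambda>w \<sigma>. Suc (f w \<sigma>))"
  using definable_add[OF _ definable_const[of 1], of f] by simp

lemma definable_sum [dintros]:
  assumes "definable a" "definable (\<lambda>w \<sigma>. b w (\<lambda>i. \<sigma> (Suc i)) (\<sigma> 0))"
  shows "definable (\<lambda>w \<sigma>. \<Sum>k<a w \<sigma>. b w \<sigma> k)"
proof -
  obtain x y where "\<And>w \<sigma>. eval w x \<sigma> = a w \<sigma>" "\<And>w \<sigma>. eval w y \<sigma> = b w (\<lambda>i. \<sigma> (Suc i)) (\<sigma> 0)"
    using assms unfolding definable_def by blast
  then show ?thesis by (intro definableI[where a = "Sum x y"]) simp
qed

lemma definable_rename: "definable f \<Longrightarrow> definable (\<lambda>w \<sigma>. f w (\<lambda>i. \<sigma> (\<rho> i)))"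
proof -
  have *: "definable (\<lambda>w \<sigma>. eval w a (\<lambda>i. \<sigma> (\<rho> i)))" for a \<rho>
  proof (induction a arbitrary: \<rho>)
    case (Bit a)
    then obtain b where "\<And>w \<sigma>. eval w b \<sigma> = eval w a (\<lambda>i. \<sigma> (\<rho> i))" unfolding definable_def by blast
    then show ?case by (intro definableI[where a = "Bit b"]) simp
  next
    case (Sum a b)
    have eq: "(\<lambda>i. \<sigma> (case_nat 0 (\<lambda>i. Suc (\<rho> i)) i)) = case_nat (\<sigma> 0) (\<lambda>i. \<sigma> (Suc (\<rho> i)))" for \<sigma> :: "nat \<Rightarrow> nat"
      by (auto split: nat.split)
    show ?case unfolding eval.simps
      using Sum(2)[of "case_nat 0 (\<lambda>i. Suc (\<rho> i))"]
      by (intro definable_sum Sum(1)) (simp add: eq)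
  qed (simp_all add: definable_const definable_length definable_var definable_add definable_diff)
  assume "definable f"
  then obtain a where "\<And>w \<sigma>. eval w a \<sigma> = f w \<sigma>" unfolding definable_def by blast
  then show ?thesis using *[of a \<rho>] by simp
qed

text \<open>The rules for binders work on de Bruijn variables. This lemma allows a notion to be
  shown definable for variables only and then to be applied to arbitrary definable
  arguments.\<close>

lemma definable_subst:
  assumes "definable f" "\<And>i. definable (\<theta> i)"
  shows "definable (\<lambda>w \<sigma>. f w (\<lambda>i. \<theta> i w \<sigma>))"
proof -
  have *: "definable (\<lambda>w \<sigma>. eval w a (\<lambda>i. \<theta> i w \<sigma>))" if "\<And>i. definable (\<theta> i)" for a \<theta>
    using that
  proof (induction a arbitrary: \<theta>)
    case (Bit a)
    have "definable (\<lambda>w \<sigma>. eval w a (\<lambda>i. \<theta> i w \<sigma>))" by (rule Bit.IH) (rule Bit.prems)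
    then obtain b where "\<And>w \<sigma>. eval w b \<sigma> = eval w a (\<lambda>i. \<theta> i w \<sigma>)"
      unfolding definable_def by blast
    then show ?case by (intro definableI[where a = "Bit b"]) simp
  next
    case (Sum a b)
    \<comment> \<open>The substitution lifted under the binder: variable 0 stays, the other
      variables are replaced and shifted. This is where renaming must already be available.\<close>
    define \<theta>' where "\<theta>' = case_nat (\<lambda>w \<sigma>. \<sigma> 0) (\<lambda>i w \<sigma>. \<theta> i w (\<lambda>i. \<sigma> (Suc i)))"
    have "definable (\<theta>' i)" for i
    proof (cases i)
      case 0
      then show ?thesis using definable_var[of 0] by (simp add: \<theta>'_def)
    next
      case (Suc j)
      have "definable (\<theta> j)" by (rule Sum.prems)
      from definable_rename[OF this, where \<rho> = Suc] show ?thesis using Suc by (simp add: \<theta>'_def)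
    qed
    then have "definable (\<lambda>w \<sigma>. eval w b (\<lambda>i. \<theta>' i w \<sigma>))" by (rule Sum(2))
    moreover have "(\<lambda>i. \<theta>' i w \<sigma>) = case_nat (\<sigma> 0) (\<lambda>i. \<theta> i w (\<lambda>i. \<sigma> (Suc i)))" for w \<sigma>
      by (auto simp: \<theta>'_def split: nat.split)
    ultimately have "definable (\<lambda>w \<sigma>. eval w b (case_nat (\<sigma> 0) (\<lambda>i. \<theta> i w (\<lambda>i. \<sigma> (Suc i)))))" by simp
    moreover have "definable (\<lambda>w \<sigma>. eval w a (\<lambda>i. \<theta> i w \<sigma>))" by (rule Sum.IH) (rule Sum.prems)
    ultimately show ?case unfolding eval.simps by (intro definable_sum)
  qed (simp_all add: definable_const definable_length definable_add definable_diff)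
  obtain a where "\<And>w \<sigma>. eval w a \<sigma> = f w \<sigma>" using assms(1) unfolding definable_def by blast
  then show ?thesis using *[of \<theta> a] assms(2) by simp
qed

lemma definable_subst1:
  assumes "definable (\<lambda>w \<sigma>. g w (\<sigma> 0))" "definable a"
  shows "definable (\<lambda>w \<sigma>. g w (a w \<sigma>))"
  using definable_subst[OF assms(1), of "\<lambda>_. a"] assms(2) by simp

lemma definable_subst2:
  assumes "definable (\<lambda>w \<sigma>. g w (\<sigma> 0) (\<sigma> 1))" "definable a" "definable b"
  shows "definable (\<lambda>w \<sigma>. g w (a w \<sigma>) (b w \<sigma>))"
  using definable_subst[OF assms(1), of "\<lambda>i. if i = 0 then a else b"] assms(2,3) by simp

lemma definable_subst3:
  assumes "definable (\<lambda>w \<sigma>. g w (\<sigma> 0) (\<sigma> 1) (\<sigma> 2))" "definable a" "definable b" "definable c"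
  shows "definable (\<lambda>w \<sigma>. g w (a w \<sigma>) (b w \<sigma>) (c w \<sigma>))"
  using definable_subst[OF assms(1), of "\<lambda>i. if i = 0 then a else if i = 1 then b else c"] assms(2-4) by simp

lemmas definable_pred_subst1 = definable_subst1[where g = "\<lambda>w x. of_bool (P w x)" for P, folded definable_pred_def]
lemmas definable_pred_subst2 = definable_subst2[where g = "\<lambda>w x y. of_bool (P w x y)" for P, folded definable_pred_def]
lemmas definable_pred_subst3 = definable_subst3[where g = "\<lambda>w x y z. of_bool (P w x y z)" for P, folded definable_pred_def]

lemma definable_mult [dintros]:
  assumes "definable f" "definable g" shows "definable (\<lambda>w \<sigma>. f w \<sigma> * g w \<sigma>)"
proof -
  have "definable (\<lambda>w \<sigma>. \<Sum>k<f w \<sigma>. g w \<sigma>)"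
    by (rule definable_sum[OF assms(1)]) (rule definable_rename[OF assms(2)])
  then show ?thesis by (rule definable_cong) simp
qed

lemma definable_of_bool [dintros]: "definable_pred P \<Longrightarrow> definable (\<lambda>w \<sigma>. of_bool (P w \<sigma>))"
  unfolding definable_pred_def .

lemma definable_pred_bit [dintros]:
  assumes "definable f" shows "definable_pred (\<lambda>w \<sigma>. f w \<sigma> < length w \<and> w ! f w \<sigma>)"
proof -
  obtain a where "\<And>w \<sigma>. eval w a \<sigma> = f w \<sigma>" using assms unfolding definable_def by blast
  then show ?thesis unfolding definable_pred_def by (intro definableI[where a = "Bit a"]) simp
qed

lemma definable_pred_const [dintros]: "definable_pred (\<lambda>w \<sigma>. b)"
  unfolding definable_pred_def by (rule definable_const)

lemma definable_pred_not [dintros]: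
  assumes "definable_pred P" shows "definable_pred (\<lambda>w \<sigma>. \<not> P w \<sigma>)"
  by (rule definable_predI[OF definable_diff[OF definable_const[of 1] assms[unfolded definable_pred_def]]]) auto

lemma definable_pred_conj [dintros]:
  assumes "definable_pred P" "definable_pred Q" shows "definable_pred (\<lambda>w \<sigma>. P w \<sigma> \<and> Q w \<sigma>)"
  by (rule definable_predI[OF definable_mult[OF assms[unfolded definable_pred_def]]]) auto

lemma definable_pred_disj [dintros]:
  assumes "definable_pred P" "definable_pred Q" shows "definable_pred (\<lambda>w \<sigma>. P w \<sigma> \<or> Q w \<sigma>)"
  using definable_pred_not[OF definable_pred_conj[OF assms[THEN definable_pred_not]]] by simp

lemma definable_pred_imp [dintros]:
  assumes "definable_pred P" "definable_pred Q" shows "definable_pred (\<lambda>w \<sigma>. P w \<sigma> \<longrightarrow> Q w \<sigma>)"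
  by (rule definable_pred_cong[OF definable_pred_disj[OF definable_pred_not[OF assms(1)] assms(2)]]) blast

lemma definable_pred_le [dintros]:
  assumes "definable f" "definable g" shows "definable_pred (\<lambda>w \<sigma>. f w \<sigma> \<le> g w \<sigma>)"
  by (rule definable_predI[OF definable_diff[OF definable_const[of 1] definable_diff[OF assms]]]) auto

lemma definable_pred_less [dintros]:
  assumes "definable f" "definable g" shows "definable_pred (\<lambda>w \<sigma>. f w \<sigma> < g w \<sigma>)"
  using definable_pred_le[OF definable_Suc[OF assms(1)] assms(2)] by (simp add: Suc_le_eq)

lemma definable_pred_eq [dintros]:
  assumes "definable f" "definable g" shows "definable_pred (\<lambda>w \<sigma>. f w \<sigma> = g w \<sigma>)"
  using definable_pred_conj[OF definable_pred_le[OF assms] definable_pred_le[OF assms(2,1)]]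
  by (simp add: eq_iff)

lemma definable_pred_iff [dintros]:
  assumes "definable_pred P" "definable_pred Q" shows "definable_pred (\<lambda>w \<sigma>. P w \<sigma> = Q w \<sigma>)"
  by (rule definable_pred_cong[OF definable_pred_eq[OF assms[unfolded definable_pred_def]]]) auto

lemma definable_if [dintros]:
  assumes "definable_pred P" "definable f" "definable g"
  shows "definable (\<lambda>w \<sigma>. if P w \<sigma> then f w \<sigma> else g w \<sigma>)"
  by (rule definable_cong[OF definable_add[OF definable_mult[OF assms(1)[unfolded definable_pred_def] assms(2)]
        definable_mult[OF definable_pred_not[OF assms(1), unfolded definable_pred_def] assms(3)]]]) auto

lemma definable_pred_if [dintros]:
  assumes "definable_pred P" "definable_pred Q" "definable_pred R"
  shows "definable_pred (\<lambda>w \<sigma>. if P w \<sigma> then Q w \<sigma> else R w \<sigma>)"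
  by (rule definable_pred_cong[OF definable_pred_disj[OF definable_pred_conj[OF assms(1,2)]
        definable_pred_conj[OF definable_pred_not[OF assms(1)] assms(3)]]]) auto

lemma sum_of_bool_pos: "(0::nat) < (\<Sum>k<n. of_bool (P k)) \<longleftrightarrow> (\<exists>k<n. P k)" for n :: nat
  by (induction n) (auto simp: less_Suc_eq)

lemma definable_pred_bex [dintros]:
  assumes "definable a" "definable_pred (\<lambda>w \<sigma>. P w (\<lambda>i. \<sigma> (Suc i)) (\<sigma> 0))"
  shows "definable_pred (\<lambda>w \<sigma>. \<exists>k<a w \<sigma>. P w \<sigma> k)"
proof -
  have "definable (\<lambda>w \<sigma>. \<Sum>k<a w \<sigma>. of_bool (P w \<sigma> k))"
    using assms(2) unfolding definable_pred_def by (rule definable_sum[OF assms(1)])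
  from definable_pred_less[OF definable_const[of 0] this] show ?thesis
    by (rule definable_pred_cong) (rule sum_of_bool_pos)
qed

lemma definable_pred_ball [dintros]:
  assumes "definable a" "definable_pred (\<lambda>w \<sigma>. P w (\<lambda>i. \<sigma> (Suc i)) (\<sigma> 0))"
  shows "definable_pred (\<lambda>w \<sigma>. \<forall>k<a w \<sigma>. P w \<sigma> k)"
  using definable_pred_not[OF definable_pred_bex[OF assms(1) definable_pred_not[OF assms(2)]]] by simp

text \<open>The quotient counts the positive multiples of the divisor up to the dividend; division
  by 0 needs the extra conjunct.\<close>

lemma definable_div [dintros]:
  assumes "definable f" "definable g" shows "definable (\<lambda>w \<sigma>. f w \<sigma> div g w \<sigma>)"
proof (rule definable_subst2[OF _ assms, where g = "\<lambda>w x y. x div y"])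
  have "definable (\<lambda>w \<sigma>. \<Sum>k<\<sigma> 0. of_bool (Suc k * \<sigma> 1 \<le> \<sigma> 0 \<and> \<sigma> 1 \<noteq> 0))"
    by (intro dintros)
  moreover have "(\<Sum>k<x. of_bool (Suc k * y \<le> x \<and> y \<noteq> 0)) = x div y" for x y :: nat
  proof (cases "y = 0")
    case False
    then have "{..<x} \<inter> {k. Suc k * y \<le> x \<and> y \<noteq> 0} = {..<x div y}"
    proof (intro set_eqI)
      fix k
      have "Suc k * y \<le> x \<longleftrightarrow> k < x div y"
        using less_eq_div_iff_mult_less_eq[of y "Suc k" x] False by (simp only: Suc_le_eq neq0_conv)
      then show "k \<in> {..<x} \<inter> {k. Suc k * y \<le> x \<and> y \<noteq> 0} \<longleftrightarrow> k \<in> {..<x div y}"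
        using False div_le_dividend[of x y] less_le_trans[of k "x div y" x] by auto
    qed
    then show ?thesis by (simp add: sum.If_cases of_bool_def)
  qed auto
  ultimately show "definable (\<lambda>w \<sigma>. \<sigma> 0 div \<sigma> 1)" by simp
qed

lemma definable_mod [dintros]:
  assumes "definable f" "definable g" shows "definable (\<lambda>w \<sigma>. f w \<sigma> mod g w \<sigma>)"
  using definable_diff[OF assms(1) definable_mult[OF definable_div[OF assms] assms(2)]]
  by (simp add: minus_div_mult_eq_mod)

lemma definable_pred_dvd [dintros]:
  assumes "definable f" "definable g" shows "definable_pred (\<lambda>w \<sigma>. f w \<sigma> dvd g w \<sigma>)"
  using definable_pred_eq[OF definable_mod[OF assms(2,1)] definable_const[of 0]]
  by (simp add: dvd_eq_mod_eq_0)

lemma definable_poly [dintros]: "definable f \<Longrightarrow> definable (\<lambda>w \<sigma>. poly p (f w \<sigma>))"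
  by (induction p) (auto intro!: dintros)

lemma definable_power [dintros]: "definable f \<Longrightarrow> definable (\<lambda>w \<sigma>. f w \<sigma> ^ n)"
  by (induction n) (auto intro!: dintros)

lemma triangle_sum: "triangle n = (\<Sum>k<Suc n. k)"
  by (induction n) auto

lemma definable_prod_encode [dintros]:
  assumes "definable f" "definable g" shows "definable (\<lambda>w \<sigma>. prod_encode (f w \<sigma>, g w \<sigma>))"
  unfolding prod_encode_def prod.case triangle_sum
  by (rule definable_subst2[OF _ assms, where g = "\<lambda>w x y. (\<Sum>k<Suc (x + y). k) + x"]) (intro dintros)

text \<open>The transition function of a machine is an arbitrary function on finitely many relevant
  arguments; as a finite table it becomes an expression.\<close>

lemma definable_finite_support:
  assumes "finite {(x, y). f x y \<noteq> 0}"
  shows "definable (\<lambda>w \<sigma>. f (\<sigma> 0) (\<sigma> 1))"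
proof -
  have "definable (\<lambda>w \<sigma>. g (\<sigma> 0) (\<sigma> 1))" if "finite A" "{(x, y). g x y \<noteq> 0} \<subseteq> A" for A g
    using that
  proof (induction A arbitrary: g rule: finite_induct)
    case empty
    then have "g = (\<lambda>x y. 0)" by (auto simp: fun_eq_iff)
    then show ?case by (simp add: dintros)
  next
    case (insert a A)
    obtain u v where a: "a = (u, v)" by (cases a)
    let ?g = "\<lambda>x y. if (x, y) = a then 0 else g x y"
    have d: "definable (\<lambda>w \<sigma>. ?g (\<sigma> 0) (\<sigma> 1))"
      by (rule insert.IH) (use insert.prems in auto)
    have "definable (\<lambda>w \<sigma>. if \<sigma> 0 = u \<and> \<sigma> 1 = v then g u v else ?g (\<sigma> 0) (\<sigma> 1))"
      by (rule definable_if[OF _ definable_const d]) (intro dintros)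
    then show ?case by (rule definable_cong) (auto simp: a)
  qed
  from this[OF assms order_refl] show ?thesis .
qed

theorem definable_poly_time:
  assumes "definable (\<lambda>w \<sigma>. l w)" "definable_pred (\<lambda>w \<sigma>. b w (\<sigma> 0))"
  shows "poly_time (\<lambda>w. map (b w) [0..<l w])"
proof -
  obtain x y where "\<And>w \<sigma>. eval w x \<sigma> = l w" "\<And>w \<sigma>. eval w y \<sigma> = of_bool (b w (\<sigma> 0))"
    using assms unfolding definable_def definable_pred_def by blast
  then show ?thesis using poly_time_expr[of y x] by simp
qed

lemma definable_class_P:
  assumes "definable_pred (\<lambda>w \<sigma>. w \<in> L)"
  shows "L \<in> class_P"
proof -
  have "poly_time (\<lambda>w. map (\<lambda>_. w \<in> L) [0..<1])"
    by (rule definable_poly_time) (use assms in \<open>auto intro: dintros\<close>)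
  then show ?thesis by (simp add: class_P_def)
qed

section \<open>Binary representation\<close>

text \<open>An exponent cannot be computed by an expression, whereas divisors are bounded. The odd
  part of \<open>p\<close> is a divisor, and it must be 1.\<close>

lemma pow2_iff_dvd: "(\<exists>k. p = 2 ^ k) \<longleftrightarrow> p \<noteq> 0 \<and> (\<forall>d<Suc p. d dvd p \<longrightarrow> d = 1 \<or> 2 dvd d)" for p :: nat
proof
  assume "\<exists>k. p = 2 ^ k"
  then show "p \<noteq> 0 \<and> (\<forall>d<Suc p. d dvd p \<longrightarrow> d = 1 \<or> 2 dvd d)"
    by (auto simp: divides_primepow_nat)
next
  assume R: "p \<noteq> 0 \<and> (\<forall>d<Suc p. d dvd p \<longrightarrow> d = 1 \<or> 2 dvd d)"
  obtain m where m: "p = 2 ^ multiplicity 2 p * m" "\<not> 2 dvd m"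
    by (rule multiplicity_decompose'[of p 2]) (use R in auto)
  then have "m dvd p" by (metis dvd_triv_right)
  then have "m < Suc p" using R by (auto simp: less_Suc_eq_le dvd_imp_le)
  then have "m = 1" using R m \<open>m dvd p\<close> by blast
  then show "\<exists>k. p = 2 ^ k" using m(1) by (metis mult.right_neutral)
qed

lemma definable_pred_pow2 [dintros]:
  assumes "definable f" shows "definable_pred (\<lambda>w \<sigma>. \<exists>k. f w \<sigma> = 2 ^ k)"
  by (rule definable_pred_subst1[OF _ assms, where P = "\<lambda>w x. \<exists>k. x = 2 ^ k"])
    (unfold pow2_iff_dvd, intro dintros)

lemma sum_pow2: "(\<Sum>q<n. of_bool (\<exists>k. q = 2 ^ k)) = card {k. 2 ^ k < (n::nat)}"
proof -
  have "{..<n} \<inter> {q. \<exists>k. q = 2 ^ k} = (\<lambda>k. 2 ^ k) ` {k. 2 ^ k < n}" by auto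
  moreover have "inj_on (\<lambda>k. 2 ^ k :: nat) A" for A by (auto simp: inj_on_def)
  ultimately show ?thesis by (simp add: sum.If_cases of_bool_def card_image)
qed

lemma finite_pow2_less: "finite {k. 2 ^ k < (n::nat)}"
  by (rule finite_subset[of _ "{..n}"]) (auto intro: less_imp_le[OF less_trans[OF less_exp]])

lemma binary_word_0 [simp]: "binary_word 0 = []"
  by (subst binary_word.simps) simp

lemma binary_word_pos: "n \<noteq> 0 \<Longrightarrow> binary_word n = odd n # binary_word (n div 2)"
  by (subst binary_word.simps) simp

lemma binary_word_eq_Nil [simp]: "binary_word n = [] \<longleftrightarrow> n = 0"
  by (cases "n = 0") (auto simp: binary_word_pos)

lemma length_binary_word: "length (binary_word n) = card {k. 2 ^ k < Suc n}"
proof (induction n rule: binary_word.induct)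
  case (1 n)
  show ?case
  proof (cases "n = 0")
    case False
    have "{k. 2 ^ k < Suc n} = insert 0 (Suc ` {k. 2 ^ k < Suc (n div 2)})"
    proof (rule set_eqI)
      fix k show "k \<in> {k. 2 ^ k < Suc n} \<longleftrightarrow> k \<in> insert 0 (Suc ` {k. 2 ^ k < Suc (n div 2)})"
        using False by (cases k) (auto simp: less_Suc_eq_le)
    qed
    then show ?thesis using False 1 finite_pow2_less[of "Suc (n div 2)"]
      by (subst binary_word_pos) (simp_all add: card_image)
  qed auto
qed

lemma binary_word_nth: "i < length (binary_word n) \<Longrightarrow> binary_word n ! i = odd (n div 2 ^ i)"
proof (induction n arbitrary: i rule: binary_word.induct)
  case (1 n)
  show ?case
  proof (cases "n = 0")
    case True
    then show ?thesis using 1 by simp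
  next
    case False
    then have eq: "binary_word n = odd n # binary_word (n div 2)" by (rule binary_word_pos)
    show ?thesis using 1(1)[OF False] 1(2) unfolding eq by (cases i) (auto simp: div_mult2_eq)
  qed
qed

definition binary_length :: "nat \<Rightarrow> nat" where
  "binary_length n = (\<Sum>q<Suc n. of_bool (\<exists>k. q = 2 ^ k))"

text \<open>The power of two with exactly \<open>i\<close> smaller powers of two is the one with
  exponent \<open>i\<close>; counting replaces exponentiation.\<close>

definition binary_bit :: "nat \<Rightarrow> nat \<Rightarrow> bool" where
  "binary_bit n i \<longleftrightarrow> (\<exists>p<Suc n. (\<exists>k. p = 2 ^ k) \<and> (\<Sum>q<p. of_bool (\<exists>k. q = 2 ^ k)) = i \<and> \<not> 2 dvd n div p)"

lemma definable_binary_length [dintros]: "definable f \<Longrightarrow> definable (\<lambda>w \<sigma>. binary_length (f w \<sigma>))"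
  by (rule definable_subst1[where g = "\<lambda>w. binary_length"]) (unfold binary_length_def, intro dintros)

lemma definable_binary_bit [dintros]:
  "definable f \<Longrightarrow> definable g \<Longrightarrow> definable_pred (\<lambda>w \<sigma>. binary_bit (f w \<sigma>) (g w \<sigma>))"
  by (rule definable_pred_subst2[where P = "\<lambda>w. binary_bit"]) (unfold binary_bit_def, intro dintros)

lemma binary_word_conv: "binary_word n = map (binary_bit n) [0..<binary_length n]"
proof (rule nth_equalityI)
  show "length (binary_word n) = length (map (binary_bit n) [0..<binary_length n])"
    by (simp add: length_binary_word binary_length_def sum_pow2 del: sum.lessThan_Suc)
  fix i assume i: "i < length (binary_word n)"
  have cnt: "(\<Sum>q<(2::nat) ^ k. of_bool (\<exists>k. q = 2 ^ k)) = k" for k by (simp add: sum_pow2)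
  have "2 ^ i < Suc n"
  proof (rule ccontr)
    assume "\<not> 2 ^ i < Suc n"
    then have "{k. 2 ^ k < Suc n} \<subseteq> {..<i}"
      by (auto simp: less_Suc_eq_le not_le) (metis le_less_trans one_less_numeral_iff power_less_imp_less_exp semiring_norm(76))
    then have "card {k. 2 ^ k < Suc n} \<le> i" using card_mono[of "{..<i}"] by fastforce
    then show False using i by (simp add: length_binary_word)
  qed
  then have "binary_bit n i \<longleftrightarrow> odd (n div 2 ^ i)"
    unfolding binary_bit_def using cnt by auto
  then show "binary_word n ! i = map (binary_bit n) [0..<binary_length n] ! i"
    using i by (simp add: binary_word_nth length_binary_word binary_length_def sum_pow2 del: sum.lessThan_Suc)
qed

lemma binary_word_inj: "binary_word m = binary_word n \<Longrightarrow> m = n"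
proof (induction m arbitrary: n rule: binary_word.induct)
  case (1 m)
  show ?case
  proof (cases "m = 0 \<or> n = 0")
    case True
    then show ?thesis using 1(2) by (metis binary_word_0 binary_word_eq_Nil)
  next
    case False
    then have "odd m = odd n" "binary_word (m div 2) = binary_word (n div 2)"
      using 1(2) binary_word_pos[of m] binary_word_pos[of n] by auto
    then have "m div 2 = n div 2" using 1(1) False by blast
    then show ?thesis using \<open>odd m = odd n\<close> by presburger
  qed
qed

lemma binary_word_last: "n \<noteq> 0 \<Longrightarrow> last (binary_word n)"
proof (induction n rule: binary_word.induct)
  case (1 n)
  then show ?case by (cases "n div 2 = 0") (auto simp: binary_word_pos)
qed

lemma ex_binary_word: "(bs = [] \<or> last bs) \<Longrightarrow> \<exists>n. binary_word n = bs"
proof (induction bs)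
  case Nil
  show ?case by (intro exI[of _ 0]) simp
next
  case (Cons b bs)
  then obtain n where n: "binary_word n = bs" by (auto split: if_splits)
  have "binary_word (2 * n + of_bool b) = b # bs"
  proof (cases "2 * n + of_bool b = 0")
    case True
    then have "\<not> b" "bs = []" using n by auto
    then show ?thesis using Cons.prems by simp
  next
    case False
    then show ?thesis using n by (subst binary_word_pos) auto
  qed
  then show ?case by blast
qed

section \<open>Membership in NP\<close>

text \<open>The format of \<open>morse_code\<close> for an arbitrary relation: a word has to be
  decoded before it is known whether its matrix belongs to a complex.\<close>

definition code_of :: "nat \<Rightarrow> (nat \<Rightarrow> nat \<Rightarrow> bool) \<Rightarrow> word \<Rightarrow> word" where
  "code_of n le bs = replicate n True @ [False] @ concat (map (\<lambda>i. map (le i) [0..<n]) [0..<n]) @ bs"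

lemma map_conv_nth: "map f xs = map (\<lambda>i. f (xs ! i)) [0..<length xs]"
proof -
  have "map f xs = map f (map ((!) xs) [0..<length xs])" by (simp only: map_nth)
  then show ?thesis by (simp add: comp_def)
qed

lemma morse_code_code_of:
  "morse_code (Fs, c) = code_of (length Fs) (\<lambda>i j. Fs ! i \<subseteq> Fs ! j) (binary_word c)"
proof -
  have "map (\<lambda>F. map (\<lambda>G. F \<subseteq> G) Fs) Fs =
      map (\<lambda>i. map (\<lambda>G. Fs ! i \<subseteq> G) Fs) [0..<length Fs]" by (rule map_conv_nth)
  also have "\<dots> = map (\<lambda>i. map (\<lambda>j. Fs ! i \<subseteq> Fs ! j) [0..<length Fs]) [0..<length Fs]"
    by (intro map_cong refl map_conv_nth)
  finally show ?thesis unfolding morse_code_def code_of_def by simp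
qed

lemma concat_map_upt:
  "concat (map (\<lambda>i. map (f i) [0..<n]) [0..<m]) = map (\<lambda>k. f (k div n) (k mod n)) [0..<m * n]"
proof (induction m)
  case (Suc m)
  have "[0..<Suc m * n] = [0..<m * n] @ map (\<lambda>k. k + m * n) [0..<n]"
    using upt_add_eq_append[of 0 "m * n" n] by (simp add: map_add_upt add.commute)
  moreover have "map (\<lambda>k. f ((k + m * n) div n) ((k + m * n) mod n)) [0..<n] = map (f m) [0..<n]"
    by (rule map_cong) auto
  ultimately show ?case using Suc by (simp add: comp_def)
qed auto

definition code_bit :: "nat \<Rightarrow> (nat \<Rightarrow> nat \<Rightarrow> bool) \<Rightarrow> (nat \<Rightarrow> bool) \<Rightarrow> nat \<Rightarrow> bool" where
  "code_bit n le b k \<longleftrightarrow> (if k < n then True else if k = n then False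
     else if k < n + 1 + n * n then le ((k - (n + 1)) div n) ((k - (n + 1)) mod n) else b (k - (n + 1 + n * n)))"

lemma code_of_conv:
  "code_of n le (map b [0..<l]) = map (code_bit n le b) [0..<n + 1 + n * n + l]"
proof -
  have "[0..<n + 1 + n * n + l] = [0..<n] @ [n] @ map (\<lambda>k. k + (n + 1)) [0..<n * n] @
      map (\<lambda>k. k + (n + 1 + n * n)) [0..<l]"
  proof -
    have "[0..<n + (1 + (n * n + l))] = [0..<n] @ [n..<n + (1 + (n * n + l))]"
      by (rule upt_add_eq_append) simp
    moreover have "[n..<n + 1 + (n * n + l)] = [n..<n + 1] @ [n + 1..<n + 1 + (n * n + l)]"
      by (rule upt_add_eq_append) simp
    moreover have "[n + 1..<n + 1 + n * n + l] = [n + 1..<n + 1 + n * n] @ [n + 1 + n * n..<n + 1 + n * n + l]"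
      by (rule upt_add_eq_append) simp
    moreover have "map (\<lambda>k. k + (n + 1)) [0..<n * n] = [n + 1..<n + 1 + n * n]"
      "map (\<lambda>k. k + (n + 1 + n * n)) [0..<l] = [n + 1 + n * n..<n + 1 + n * n + l]" "[n..<n + 1] = [n]"
      by (simp_all only: map_add_upt add.commute) simp
    ultimately show ?thesis by (simp only: add.assoc append_assoc)
  qed
  moreover have "replicate n True = map (\<lambda>_. True) [0..<n]" by (simp add: map_replicate_const)
  ultimately show ?thesis unfolding code_of_def concat_map_upt
    by (auto simp: code_bit_def)
qed

section \<open>Decoding a word into a number, a matrix and a rest\<close>

definition leading_ones :: "(nat \<Rightarrow> bool) \<Rightarrow> nat \<Rightarrow> nat" where
  "leading_ones X l = (\<Sum>k<l. of_bool (\<forall>j<Suc k. X j))"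

lemma leading_ones_eq:
  assumes "n \<le> l" "\<And>j. j < n \<Longrightarrow> X j" "n < l \<Longrightarrow> \<not> X n"
  shows "leading_ones X l = n"
proof -
  have "{..<l} \<inter> {k. \<forall>j<Suc k. X j} = {..<n}"
  proof (intro set_eqI iffI)
    fix k assume "k \<in> {..<l} \<inter> {k. \<forall>j<Suc k. X j}"
    then show "k \<in> {..<n}" using assms(3) by (cases "n \<le> k") auto
  qed (use assms in \<open>auto simp: less_Suc_eq_le\<close>)
  then show ?thesis by (simp add: leading_ones_def sum.If_cases of_bool_def)
qed

lemma leading_ones_props:
  "leading_ones X l \<le> l" "j < leading_ones X l \<Longrightarrow> X j" "leading_ones X l < l \<Longrightarrow> \<not> X (leading_ones X l)"
proof -
  have "\<exists>n\<le>l. (\<forall>j<n. X j) \<and> (n < l \<longrightarrow> \<not> X n)"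
  proof (induction l)
    case (Suc l)
    then obtain n where n: "n \<le> l" "\<forall>j<n. X j" "n < l \<longrightarrow> \<not> X n" by blast
    show ?case
    proof (cases "n = l \<and> X l")
      case True
      then show ?thesis using n by (intro exI[of _ "Suc l"]) (auto simp: less_Suc_eq)
    next
      case False
      then show ?thesis using n by (intro exI[of _ n]) (auto simp: less_Suc_eq)
    qed
  qed auto
  then obtain n where "n \<le> l" "\<And>j. j < n \<Longrightarrow> X j" "n < l \<Longrightarrow> \<not> X n" by blast
  then show "leading_ones X l \<le> l" "j < leading_ones X l \<Longrightarrow> X j" "leading_ones X l < l \<Longrightarrow> \<not> X (leading_ones X l)"
    using leading_ones_eq[of n l X] by auto
qed

definition word_bit :: "word \<Rightarrow> nat \<Rightarrow> bool" where
  "word_bit w i \<longleftrightarrow> i < length w \<and> w ! i"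

definition code_le :: "(nat \<Rightarrow> bool) \<Rightarrow> nat \<Rightarrow> nat \<Rightarrow> nat \<Rightarrow> bool" where
  "code_le X n i j \<longleftrightarrow> X (n + 1 + n * i + j)"

lemma code_of_eqD:
  assumes "x = code_of n le bs"
  shows "leading_ones (word_bit x) (length x) = n" "n + 1 + n * n \<le> length x"
    "drop (n + 1 + n * n) x = bs"
    "i < n \<Longrightarrow> j < n \<Longrightarrow> code_le (word_bit x) n i j = le i j"
proof -
  have x: "x = map (code_bit n le ((!) bs)) [0..<n + 1 + n * n + length bs]"
    using code_of_conv[of n le "(!) bs" "length bs"] assms by (simp add: map_nth)
  then have len: "length x = n + 1 + n * n + length bs" by simp
  have nth: "x ! k = code_bit n le ((!) bs) k" if "k < length x" for k
    using that len x by (metis add_0 length_upt map_nth nth_map nth_upt diff_zero)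
  show "leading_ones (word_bit x) (length x) = n"
    by (rule leading_ones_eq) (auto simp: word_bit_def len nth code_bit_def)
  show "n + 1 + n * n \<le> length x" using len by simp
  show "drop (n + 1 + n * n) x = bs"
    using assms unfolding code_of_def concat_map_upt by (simp add: drop_Cons')
  assume ij: "i < n" "j < n"
  have lt: "n * i + j < n * n"
  proof -
    have "n * i + j < n * Suc i" using ij by simp
    also have "\<dots> \<le> n * n" using ij by (intro mult_le_mono) auto
    finally show ?thesis .
  qed
  then have "n + 1 + n * i + j < length x" using len by simp
  then show "code_le (word_bit x) n i j = le i j"
    using lt ij unfolding code_le_def word_bit_def by (simp add: nth code_bit_def)
qed

lemma code_of_reconstruct:
  assumes "n = leading_ones (word_bit x) (length x)" "n + 1 + n * n \<le> length x"
  shows "x = code_of n (code_le (word_bit x) n) (drop (n + 1 + n * n) x)"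
proof -
  let ?bs = "drop (n + 1 + n * n) x"
  have "code_of n (code_le (word_bit x) n) ?bs =
     map (code_bit n (code_le (word_bit x) n) ((!) ?bs)) [0..<n + 1 + n * n + length ?bs]"
    using code_of_conv[of n "code_le (word_bit x) n" "(!) ?bs" "length ?bs"] unfolding map_nth .
  also have "n + 1 + n * n + length ?bs = length x" using assms(2) by simp
  also have "map (code_bit n (code_le (word_bit x) n) ((!) ?bs)) [0..<length x] = map ((!) x) [0..<length x]"
  proof (rule map_cong[OF refl])
    fix k assume "k \<in> set [0..<length x]"
    then have k: "k < length x" by simp
    have X: "word_bit x k = x ! k" using k by (simp add: word_bit_def)
    show "code_bit n (code_le (word_bit x) n) ((!) ?bs) k = x ! k"
    proof -
      consider "k < n" | "k = n" | "n < k" "k < n + 1 + n * n" | "n + 1 + n * n \<le> k" by linarith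
      then show ?thesis
      proof cases
        case 1
        then show ?thesis using leading_ones_props(2)[of k "word_bit x" "length x"] assms(1) X by (simp add: code_bit_def)
      next
        case 2
        then show ?thesis using leading_ones_props(3)[of "word_bit x" "length x"] assms(1) X k by (simp add: code_bit_def)
      next
        case 3
        then have "n + 1 + n * ((k - (n + 1)) div n) + (k - (n + 1)) mod n = k" by simp
        then show ?thesis using 3 X by (simp add: code_bit_def code_le_def)
      next
        case 4
        then have "?bs ! (k - (n + 1 + n * n)) = x ! k" using k by (subst nth_drop) auto
        then show ?thesis using 4 by (simp add: code_bit_def)
      qed
    qed
  qed
  finally show ?thesis by (simp add: map_nth)
qed

subsection \<open>Recognizing face posets\<close>

definition minimal_elt :: "(nat \<Rightarrow> nat \<Rightarrow> bool) \<Rightarrow> nat \<Rightarrow> nat \<Rightarrow> bool" where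
  "minimal_elt le n v \<longleftrightarrow> (\<forall>j<n. le j v \<longrightarrow> j = v)"

definition vertex_of :: "(nat \<Rightarrow> nat \<Rightarrow> bool) \<Rightarrow> nat \<Rightarrow> nat \<Rightarrow> nat \<Rightarrow> bool" where
  "vertex_of le n v i \<longleftrightarrow> minimal_elt le n v \<and> le v i"

text \<open>Minimal elements play the role of vertices, and an element is represented by the
  vertices below it. All quantifiers are bounded, so the condition is definable; closure under
  removal of a single vertex is enough, as the rest follows by induction.\<close>

definition face_poset :: "(nat \<Rightarrow> nat \<Rightarrow> bool) \<Rightarrow> nat \<Rightarrow> bool" where
  "face_poset le n \<longleftrightarrow>
     (\<forall>i<n. \<forall>j<n. le i j = (\<forall>v<n. vertex_of le n v i \<longrightarrow> vertex_of le n v j)) \<and>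
     (\<forall>i<n. \<forall>j<n. (\<forall>v<n. vertex_of le n v i = vertex_of le n v j) \<longrightarrow> i = j) \<and>
     (\<forall>i<n. \<exists>v<n. vertex_of le n v i) \<and>
     (\<forall>i<n. \<forall>v<n. vertex_of le n v i \<and> (\<exists>u<n. vertex_of le n u i \<and> u \<noteq> v) \<longrightarrow>
        (\<exists>j<n. \<forall>u<n. vertex_of le n u j = (vertex_of le n u i \<and> u \<noteq> v)))"

lemma simplicial_complexI:
  assumes "finite \<Delta>" "\<And>F. F \<in> \<Delta> \<Longrightarrow> finite F" "{} \<notin> \<Delta>"
    "\<And>F v. F \<in> \<Delta> \<Longrightarrow> v \<in> F \<Longrightarrow> F \<noteq> {v} \<Longrightarrow> F - {v} \<in> \<Delta>"
  shows "simplicial_complex \<Delta>"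
  unfolding simplicial_complex_def
proof (intro conjI ballI allI impI)
  show "finite (\<Union>\<Delta>)" using assms by auto
  fix F G assume F: "F \<in> \<Delta>" and "G \<subseteq> F" "G \<noteq> {}"
  have "\<forall>H. H \<in> \<Delta> \<longrightarrow> G \<subseteq> H \<longrightarrow> card (H - G) = k \<longrightarrow> G \<in> \<Delta>" for k
  proof (induction k)
    case 0
    then show ?case using assms(2) by (metis card_eq_0_iff Diff_eq_empty_iff finite_Diff subset_antisym)
  next
    case (Suc k)
    show ?case
    proof (intro allI impI)
      fix H assume H: "H \<in> \<Delta>" "G \<subseteq> H" "card (H - G) = Suc k"
      then obtain v where v: "v \<in> H - G" by (metis card.empty ex_in_conv nat.distinct(1))
      have "H - {v} \<in> \<Delta>" using assms(4)[OF H(1), of v] v \<open>G \<noteq> {}\<close> H(2) by auto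
      moreover have "card (H - {v} - G) = k" "G \<subseteq> H - {v}"
      proof -
        have "H - {v} - G = (H - G) - {v}" by auto
        then show "card (H - {v} - G) = k" using v H(3) by (simp add: card_Diff_singleton)
      qed (use v H in auto)
      ultimately show "G \<in> \<Delta>" using Suc by blast
    qed
  qed
  then show "G \<in> \<Delta>" using F \<open>G \<subseteq> F\<close> by blast
qed (use assms in auto)

lemma face_poset_iff:
  "face_poset le n \<longleftrightarrow> (\<exists>Fs :: nat set list. length Fs = n \<and> distinct Fs \<and> simplicial_complex (set Fs) \<and>
     (\<forall>i<n. \<forall>j<n. le i j \<longleftrightarrow> Fs ! i \<subseteq> Fs ! j))" (is "_ \<longleftrightarrow> ?R")
proof
  assume fp: "face_poset le n"
  define V where "V i = {v. v < n \<and> vertex_of le n v i}" for i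
  define Fs where "Fs = map V [0..<n]"
  note fp1 = fp[unfolded face_poset_def, THEN conjunct1, rule_format]
  note fp2 = fp[unfolded face_poset_def, THEN conjunct2, THEN conjunct1, rule_format]
  note fp3 = fp[unfolded face_poset_def, THEN conjunct2, THEN conjunct2, THEN conjunct1, rule_format]
  note fp4 = fp[unfolded face_poset_def, THEN conjunct2, THEN conjunct2, THEN conjunct2, rule_format]
  have nth: "Fs ! i = V i" if "i < n" for i using that by (simp add: Fs_def)
  have "V i = V j \<longrightarrow> i = j" if "i < n" "j < n" for i j
  proof
    assume "V i = V j"
    then have "\<forall>v<n. vertex_of le n v i = vertex_of le n v j" unfolding V_def by blast
    then show "i = j" using fp2[OF that] by blast
  qed
  then have "distinct Fs" unfolding Fs_def distinct_map by (auto simp: inj_on_def)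
  moreover have "simplicial_complex (set Fs)"
  proof (rule simplicial_complexI)
    show "finite F" if "F \<in> set Fs" for F using that by (auto simp: Fs_def V_def)
    have "V i \<noteq> {}" if "i < n" for i using fp3[OF that] unfolding V_def by blast
    then show "{} \<notin> set Fs" unfolding Fs_def by (auto simp: eq_commute[of "{}"])
    fix F v assume "F \<in> set Fs" "v \<in> F" "F \<noteq> {v}"
    have "\<exists>i<n. F = V i" using \<open>F \<in> set Fs\<close> by (auto simp: Fs_def)
    then obtain i where i: "i < n" "F = V i" by blast
    with \<open>v \<in> F\<close> \<open>F \<noteq> {v}\<close> have "v < n" "vertex_of le n v i" "\<exists>u<n. vertex_of le n u i \<and> u \<noteq> v"
      by (auto simp: V_def)
    then obtain j where "j < n" "\<forall>u<n. vertex_of le n u j = (vertex_of le n u i \<and> u \<noteq> v)"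
      using fp4[OF i(1)] by blast
    then have "F - {v} = V j" "j < n" using i by (auto simp: V_def)
    then show "F - {v} \<in> set Fs" by (auto simp: Fs_def)
  qed simp
  moreover have "le i j \<longleftrightarrow> Fs ! i \<subseteq> Fs ! j" if "i < n" "j < n" for i j
  proof -
    have "le i j \<longleftrightarrow> (\<forall>v<n. vertex_of le n v i \<longrightarrow> vertex_of le n v j)"
      by (rule fp1[OF that])
    also have "\<dots> \<longleftrightarrow> V i \<subseteq> V j" unfolding V_def by blast
    finally show ?thesis using that by (simp add: nth)
  qed
  ultimately show ?R by (intro exI[of _ Fs]) (auto simp: Fs_def)
next
  assume ?R
  then obtain Fs :: "nat set list" where Fs: "length Fs = n" "distinct Fs" "simplicial_complex (set Fs)"
    "\<And>i j. i < n \<Longrightarrow> j < n \<Longrightarrow> le i j \<longleftrightarrow> Fs ! i \<subseteq> Fs ! j" by blast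
  have sub: "G \<in> set Fs" if "F \<in> set Fs" "G \<subseteq> F" "G \<noteq> {}" for F G
    using Fs(3) that unfolding simplicial_complex_def by blast
  have idx: "\<exists>i<n. Fs ! i = F" if "F \<in> set Fs" for F using that Fs(1) by (metis in_set_conv_nth)
  have mem: "Fs ! i \<in> set Fs" if "i < n" for i using that Fs(1) by simp
  have ne: "Fs ! i \<noteq> {}" if "i < n" for i using mem[OF that] Fs(3) unfolding simplicial_complex_def by metis
  have eqi: "i = j" if "Fs ! i = Fs ! j" "i < n" "j < n" for i j
    using that Fs(1,2) by (simp add: nth_eq_iff_index_eq)
  have min: "minimal_elt le n v \<longleftrightarrow> (\<exists>a. Fs ! v = {a})" if v: "v < n" for v
  proof
    assume m: "minimal_elt le n v"
    obtain a where a: "a \<in> Fs ! v" using ne[OF v] by blast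
    then have "{a} \<in> set Fs" using sub[OF mem[OF v], of "{a}"] by simp
    then obtain i where "i < n" "Fs ! i = {a}" using idx by blast
    then show "\<exists>a. Fs ! v = {a}" using m a Fs(4)[of i v] v unfolding minimal_elt_def by auto
  next
    assume "\<exists>a. Fs ! v = {a}"
    then show "minimal_elt le n v" unfolding minimal_elt_def
      using Fs(4) ne eqi v by (metis subset_singletonD)
  qed
  have vert: "\<exists>v<n. Fs ! v = {a} \<and> vertex_of le n v i" if "i < n" "a \<in> Fs ! i" for a i
  proof -
    have "{a} \<in> set Fs" using sub[OF mem[OF that(1)], of "{a}"] that by simp
    then obtain v where "v < n" "Fs ! v = {a}" using idx by blast
    then show ?thesis using min Fs(4) that unfolding vertex_of_def by auto
  qed
  have vo: "vertex_of le n v i \<longleftrightarrow> (\<exists>a\<in>Fs ! i. Fs ! v = {a})" if "v < n" "i < n" for v i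
    unfolding vertex_of_def using min[OF that(1)] Fs(4)[OF that] by auto
  have key: "(\<forall>v<n. vertex_of le n v i \<longrightarrow> vertex_of le n v j) \<longleftrightarrow> Fs ! i \<subseteq> Fs ! j" if "i < n" "j < n" for i j
  proof
    assume a: "\<forall>v<n. vertex_of le n v i \<longrightarrow> vertex_of le n v j"
    show "Fs ! i \<subseteq> Fs ! j"
    proof
      fix x assume "x \<in> Fs ! i"
      then obtain v where v: "v < n" "Fs ! v = {x}" "vertex_of le n v i"
        using vert[OF \<open>i < n\<close>] by blast
      then have "vertex_of le n v j" using a by blast
      then show "x \<in> Fs ! j" using vo[OF v(1) that(2)] v(2) by auto
    qed
  qed (use vo that in auto)
  show "face_poset le n" unfolding face_poset_def
  proof (intro conjI allI impI)
    show "le i j = (\<forall>v<n. vertex_of le n v i \<longrightarrow> vertex_of le n v j)" if "i < n" "j < n" for i j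
      using key Fs(4) that by simp
    show "i = j" if "i < n" "j < n" "\<forall>v<n. vertex_of le n v i = vertex_of le n v j" for i j
      using key[OF that(1,2)] key[OF that(2,1)] that eqi by auto
    show "\<exists>v<n. vertex_of le n v i" if "i < n" for i using ne vert that by blast
    fix i v assume i: "i < n" and v: "v < n" and "vertex_of le n v i \<and> (\<exists>u<n. vertex_of le n u i \<and> u \<noteq> v)"
    then obtain u a b where ab: "a \<in> Fs ! i" "Fs ! v = {a}" "u < n" "u \<noteq> v" "b \<in> Fs ! i" "Fs ! u = {b}"
      using vo by auto
    then have "b \<noteq> a" using eqi v by metis
    then have "Fs ! i - {a} \<in> set Fs" using sub[OF mem[OF i], of "Fs ! i - {a}"] ab by auto
    then obtain j where j: "j < n" "Fs ! j = Fs ! i - {a}" using idx by blast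
    have "vertex_of le n w j = (vertex_of le n w i \<and> w \<noteq> v)" if "w < n" for w
      using vo[OF that j(1)] vo[OF that i] j(2) ab(2) eqi[of w v] that v by auto
    then show "\<exists>j<n. \<forall>u<n. vertex_of le n u j = (vertex_of le n u i \<and> u \<noteq> v)" using j(1) by blast
  qed
qed

subsection \<open>Certificates\<close>

definition covers :: "(nat \<Rightarrow> nat \<Rightarrow> bool) \<Rightarrow> nat \<Rightarrow> nat \<Rightarrow> nat \<Rightarrow> bool" where
  "covers le n i j \<longleftrightarrow> le j i \<and> i \<noteq> j \<and> \<not> (\<exists>k<n. le j k \<and> le k i \<and> k \<noteq> i \<and> k \<noteq> j)"

text \<open>The certificate for acyclicity is a strict order \<open>rr\<close> containing the reversed Hasse diagram.\<close>

definition good_matching ::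
  "(nat \<Rightarrow> nat \<Rightarrow> bool) \<Rightarrow> (nat \<Rightarrow> nat \<Rightarrow> bool) \<Rightarrow> (nat \<Rightarrow> nat \<Rightarrow> bool) \<Rightarrow> nat \<Rightarrow> bool" where
  "good_matching le mt rr n \<longleftrightarrow>
     (\<forall>i<n. \<forall>j<n. mt i j \<longrightarrow> covers le n i j) \<and>
     (\<forall>i<n. \<forall>j<n. \<forall>i'<n. \<forall>j'<n. mt i j \<longrightarrow> mt i' j' \<longrightarrow> i = i' \<or> i = j' \<or> j = i' \<or> j = j' \<longrightarrow> i = i' \<and> j = j') \<and>
     (\<forall>i<n. \<forall>j<n. covers le n i j \<longrightarrow> \<not> mt i j \<longrightarrow> rr i j) \<and>
     (\<forall>i<n. \<forall>j<n. mt i j \<longrightarrow> rr j i) \<and>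
     (\<forall>i<n. \<not> rr i i) \<and>
     (\<forall>i<n. \<forall>j<n. \<forall>k<n. rr i j \<longrightarrow> rr j k \<longrightarrow> rr i k)"

definition critical_count :: "(nat \<Rightarrow> nat \<Rightarrow> bool) \<Rightarrow> nat \<Rightarrow> nat" where
  "critical_count mt n = (\<Sum>i<n. of_bool (\<forall>j<n. \<not> mt i j \<and> \<not> mt j i))"

lemma critical_count_card: "critical_count mt n = card {i. i < n \<and> (\<forall>j<n. \<not> mt i j \<and> \<not> mt j i)}"
proof -
  have "{..<n} \<inter> {i. \<forall>j<n. \<not> mt i j \<and> \<not> mt j i} = {i. i < n \<and> (\<forall>j<n. \<not> mt i j \<and> \<not> mt j i)}" by auto
  then show ?thesis by (simp add: critical_count_def sum.If_cases of_bool_def)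
qed

lemma good_matching_cong:
  assumes "\<And>i j. i < n \<Longrightarrow> j < n \<Longrightarrow> mt i j = mt' i j" "\<And>i j. i < n \<Longrightarrow> j < n \<Longrightarrow> rr i j = rr' i j"
  shows "good_matching le mt rr n = good_matching le mt' rr' n" "critical_count mt n = critical_count mt' n"
  unfolding good_matching_def critical_count_def by (simp_all add: assms)

locale face_list =
  fixes Fs :: "nat set list" and n :: nat and le :: "nat \<Rightarrow> nat \<Rightarrow> bool"
  assumes len: "length Fs = n" and dist: "distinct Fs" and scx: "simplicial_complex (set Fs)"
    and le: "\<And>i j. i < n \<Longrightarrow> j < n \<Longrightarrow> le i j \<longleftrightarrow> Fs ! i \<subseteq> Fs ! j"
begin

lemma idx: "F \<in> set Fs \<Longrightarrow> \<exists>i<n. Fs ! i = F" using len by (metis in_set_conv_nth)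

lemma mem: "i < n \<Longrightarrow> Fs ! i \<in> set Fs" using len by simp

lemma nth_eq: "i < n \<Longrightarrow> j < n \<Longrightarrow> Fs ! i = Fs ! j \<longleftrightarrow> i = j"
  using len dist by (simp add: nth_eq_iff_index_eq)

lemma fin: "i < n \<Longrightarrow> finite (Fs ! i)"
  using mem[of i] scx finite_subset[OF Union_upper[of "Fs ! i" "set Fs"]] unfolding simplicial_complex_def by blast

text \<open>The code contains no dimensions. They can be read off the order, because a complex has,
  between any two nested faces, a face with just one more vertex than the smaller one.\<close>

lemma covers_iff:
  assumes "i < n" "j < n"
  shows "covers le n i j \<longleftrightarrow> face_covered (Fs ! j) (Fs ! i)"
proof
  assume c: "covers le n i j"
  then have sub: "Fs ! j \<subset> Fs ! i" using assms nth_eq le by (auto simp: covers_def)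
  have lt: "card (Fs ! j) < card (Fs ! i)" using psubset_card_mono[OF fin[OF assms(1)] sub] .
  have "card (Fs ! i) = Suc (card (Fs ! j))"
  proof (rule ccontr)
    assume ne: "card (Fs ! i) \<noteq> Suc (card (Fs ! j))"
    obtain v where v: "v \<in> Fs ! i" "v \<notin> Fs ! j" using sub by blast
    let ?H = "insert v (Fs ! j)"
    have "?H \<in> set Fs" using scx mem[OF assms(1)] v sub unfolding simplicial_complex_def
      by (metis insert_not_empty insert_subset psubset_imp_subset)
    then obtain k where k: "k < n" "Fs ! k = ?H" using idx by blast
    have "card ?H = Suc (card (Fs ! j))" using v fin[OF assms(2)] by simp
    then have "k \<noteq> i" "k \<noteq> j" using ne k v by auto
    moreover have "le j k" "le k i" using k le assms v sub by auto
    ultimately show False using c k(1) unfolding covers_def by blast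
  qed
  then show "face_covered (Fs ! j) (Fs ! i)" using sub by (simp add: face_covered_def face_dim_def)
next
  assume "face_covered (Fs ! j) (Fs ! i)"
  then have sub: "Fs ! j \<subset> Fs ! i" and cd: "card (Fs ! i) = Suc (card (Fs ! j))"
    by (auto simp: face_covered_def face_dim_def)
  have False if "k < n" "le j k" "le k i" "k \<noteq> i" "k \<noteq> j" for k
  proof -
    have "Fs ! j \<subset> Fs ! k" "Fs ! k \<subset> Fs ! i" using that le nth_eq assms by auto
    then have "card (Fs ! j) < card (Fs ! k)" "card (Fs ! k) < card (Fs ! i)"
      using psubset_card_mono fin that assms by auto
    then show False using cd by simp
  qed
  then show "covers le n i j" using sub assms le unfolding covers_def by auto
qed

lemma morse_matching_imp_certificate:
  assumes M: "morse_matching (set Fs) M"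
  shows "\<exists>mt rr. good_matching le mt rr n \<and> critical_count mt n = card (critical_faces (set Fs) M)"
proof -
  define mt where "mt i j \<longleftrightarrow> (Fs ! i, Fs ! j) \<in> M" for i j
  \<comment> \<open>For an acyclic relation the transitive closure is irreflexive, hence the strict
    order that is required.\<close>
  define rr where "rr i j \<longleftrightarrow> (Fs ! i, Fs ! j) \<in> (hasse_reversed (set Fs) M)\<^sup>+" for i j
  have hm: "hasse_matching (set Fs) M" and M3: "acyclic (hasse_reversed (set Fs) M)"
    using M unfolding morse_matching_def by auto
  have M1: "M \<subseteq> hasse (set Fs)" using hm unfolding hasse_matching_def by (rule conjunct1)
  have M2: "a = b" if "F \<in> set Fs" "a \<in> M" "b \<in> M" "incident F a" "incident F b" for F a b
    using hm[unfolded hasse_matching_def, THEN conjunct2, rule_format, OF that(1-3)] that(4,5) by simp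
  have "good_matching le mt rr n"
    unfolding good_matching_def
  proof (intro conjI allI impI)
    show "covers le n i j" if "i < n" "j < n" "mt i j" for i j
    proof -
      have "(Fs ! i, Fs ! j) \<in> hasse (set Fs)" using that(3) M1 unfolding mt_def by blast
      then show ?thesis using covers_iff[OF that(1,2)] unfolding hasse_def by simp
    qed
  next
    fix i j i' j' assume a: "i < n" "j < n" "i' < n" "j' < n" "mt i j" "mt i' j'" "i = i' \<or> i = j' \<or> j = i' \<or> j = j'"
    have "(Fs ! i, Fs ! j) = (Fs ! i', Fs ! j')"
    proof (cases "i = i' \<or> i = j'")
      case True
      then show ?thesis using a mem[OF a(1)] unfolding mt_def
        by (intro M2[of "Fs ! i"]) (auto simp: incident_def)
    next
      case False
      then show ?thesis using a mem[OF a(2)] unfolding mt_def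
        by (intro M2[of "Fs ! j"]) (auto simp: incident_def)
    qed
    then show "i = i'" "j = j'" using a nth_eq by auto
  next
    show "rr i j" if "i < n" "j < n" "covers le n i j" "\<not> mt i j" for i j
    proof -
      have "(Fs ! i, Fs ! j) \<in> hasse_reversed (set Fs) M"
        using that(4) covers_iff[OF that(1,2)] that(3) mem[OF that(1)] mem[OF that(2)]
        unfolding mt_def hasse_reversed_def hasse_def by simp
      then show ?thesis unfolding rr_def by (rule r_into_trancl)
    qed
    show "rr j i" if "i < n" "j < n" "mt i j" for i j
      using that(3) unfolding rr_def mt_def hasse_reversed_def by (intro r_into_trancl) simp
    show "\<not> rr i i" for i using M3 unfolding rr_def acyclic_def by blast
    show "rr i k" if "rr i j" "rr j k" for i j k using that unfolding rr_def by (rule trancl_trans)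
  qed
  moreover have "critical_count mt n = card (critical_faces (set Fs) M)"
  proof -
    have "critical_faces (set Fs) M = (!) Fs ` {i. i < n \<and> (\<forall>j<n. \<not> mt i j \<and> \<not> mt j i)}"
    proof (intro set_eqI iffI)
      fix F assume F: "F \<in> critical_faces (set Fs) M"
      then obtain i where i: "i < n" "Fs ! i = F" using idx unfolding critical_faces_def by blast
      then show "F \<in> (!) Fs ` {i. i < n \<and> (\<forall>j<n. \<not> mt i j \<and> \<not> mt j i)}"
        using F unfolding critical_faces_def mt_def incident_def by force
    next
      fix F assume "F \<in> (!) Fs ` {i. i < n \<and> (\<forall>j<n. \<not> mt i j \<and> \<not> mt j i)}"
      then obtain i where i: "i < n" "F = Fs ! i" "\<forall>j<n. \<not> mt i j \<and> \<not> mt j i" by blast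
      have "\<not> incident F a" if a: "a \<in> M" for a
      proof -
        obtain G H where GH: "a = (G, H)" "G \<in> set Fs" "H \<in> set Fs" using M1 a unfolding hasse_def by auto
        obtain k l where "k < n" "G = Fs ! k" "l < n" "H = Fs ! l" using idx GH by metis
        then show ?thesis using i a GH nth_eq unfolding mt_def incident_def by auto
      qed
      then show "F \<in> critical_faces (set Fs) M" using i mem unfolding critical_faces_def by auto
    qed
    moreover have "inj_on ((!) Fs) {i. i < n \<and> (\<forall>j<n. \<not> mt i j \<and> \<not> mt j i)}"
      using nth_eq by (auto simp: inj_on_def)
    ultimately show ?thesis by (simp add: critical_count_card card_image)
  qed
  ultimately show ?thesis by blast
qed

lemma certificate_imp_morse_matching:
  assumes g: "good_matching le mt rr n"
  shows "\<exists>M. morse_matching (set Fs) M \<and> card (critical_faces (set Fs) M) = critical_count mt n"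
proof -
  note gg = g[unfolded good_matching_def]
  note g1 = gg[THEN conjunct1, rule_format]
  note g2 = gg[THEN conjunct2, THEN conjunct1, rule_format]
  note g31 = gg[THEN conjunct2, THEN conjunct2, THEN conjunct1, rule_format]
  note g32 = gg[THEN conjunct2, THEN conjunct2, THEN conjunct2, THEN conjunct1, rule_format]
  note g33 = gg[THEN conjunct2, THEN conjunct2, THEN conjunct2, THEN conjunct2, THEN conjunct1, rule_format]
  note g4 = gg[THEN conjunct2, THEN conjunct2, THEN conjunct2, THEN conjunct2, THEN conjunct2, rule_format]
  define M where "M = {(Fs ! i, Fs ! j) |i j. i < n \<and> j < n \<and> mt i j}"
  define R where "R = {(Fs ! i, Fs ! j) |i j. i < n \<and> j < n \<and> rr i j}"
  have "M \<subseteq> hasse (set Fs)"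
    unfolding M_def hasse_def by (clarify, intro CollectI case_prodI conjI mem) (auto simp: covers_iff[symmetric] g1)
  moreover have "a = b" if "a \<in> M" "b \<in> M" "incident F a" "incident F b" for F a b
  proof -
    obtain i j where a: "a = (Fs ! i, Fs ! j)" "i < n" "j < n" "mt i j" using \<open>a \<in> M\<close> unfolding M_def by blast
    obtain i' j' where b: "b = (Fs ! i', Fs ! j')" "i' < n" "j' < n" "mt i' j'" using \<open>b \<in> M\<close> unfolding M_def by blast
    have "F = Fs ! i \<or> F = Fs ! j" "F = Fs ! i' \<or> F = Fs ! j'"
      using that(3,4) unfolding incident_def a(1) b(1) by simp_all
    then have "Fs ! i = Fs ! i' \<or> Fs ! i = Fs ! j' \<or> Fs ! j = Fs ! i' \<or> Fs ! j = Fs ! j'" by metis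
    then have "i = i' \<or> i = j' \<or> j = i' \<or> j = j'"
      by (simp only: nth_eq[OF a(2) b(2)] nth_eq[OF a(2) b(3)] nth_eq[OF a(3) b(2)] nth_eq[OF a(3) b(3)])
    then have "i = i' \<and> j = j'" by (rule g2[OF a(2,3) b(2,3) a(4) b(4)])
    then show ?thesis using a(1) b(1) by simp
  qed
  moreover have "acyclic (hasse_reversed (set Fs) M)"
  proof (rule acyclic_subset)
    have "trans R"
    proof (rule transI)
      fix x y z assume "(x, y) \<in> R" "(y, z) \<in> R"
      then obtain i j j' k where "x = Fs ! i" "y = Fs ! j" "i < n" "j < n" "rr i j"
        "y = Fs ! j'" "z = Fs ! k" "j' < n" "k < n" "rr j' k" unfolding R_def by blast
      moreover then have "j = j'" using nth_eq by blast
      ultimately show "(x, z) \<in> R" unfolding R_def using g4[of i j k] by blast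
    qed
    moreover have "irrefl R" unfolding R_def irrefl_def using nth_eq g33 by auto
    ultimately show "acyclic R" by (simp add: acyclic_irrefl trancl_id)
    show "hasse_reversed (set Fs) M \<subseteq> R"
    proof
      fix p assume p: "p \<in> hasse_reversed (set Fs) M"
      show "p \<in> R"
      proof (cases "p \<in> M\<inverse>")
        case True
        then show ?thesis unfolding M_def R_def by (auto intro: g32)
      next
        case False
        then have p2: "p \<in> hasse (set Fs)" "p \<notin> M" using p unfolding hasse_reversed_def by auto
        then obtain G F where GF: "p = (G, F)" "G \<in> set Fs" "F \<in> set Fs" "face_covered F G"
          unfolding hasse_def by blast
        obtain i j where ij: "i < n" "Fs ! i = G" "j < n" "Fs ! j = F" using idx GF by metis
        then have "covers le n i j" using covers_iff GF by simp
        moreover have "\<not> mt i j" using p2 ij GF unfolding M_def by blast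
        ultimately show ?thesis using g31[of i j] ij GF unfolding R_def by blast
      qed
    qed
  qed
  ultimately have mm: "morse_matching (set Fs) M" unfolding morse_matching_def hasse_matching_def by blast
  have "critical_faces (set Fs) M = (!) Fs ` {i. i < n \<and> (\<forall>j<n. \<not> mt i j \<and> \<not> mt j i)}"
  proof (intro set_eqI iffI)
    fix F assume F: "F \<in> critical_faces (set Fs) M"
    then obtain i where i: "i < n" "Fs ! i = F" using idx unfolding critical_faces_def by blast
    have inM: "(Fs ! k, Fs ! l) \<in> M" if "k < n" "l < n" "mt k l" for k l using that unfolding M_def by blast
    have nin: "\<not> incident F a" if "a \<in> M" for a using F that unfolding critical_faces_def by blast
    have "\<not> mt i j \<and> \<not> mt j i" if "j < n" for j
      using nin[OF inM[OF i(1) that]] nin[OF inM[OF that i(1)]] i(2) by (auto simp: incident_def)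
    then show "F \<in> (!) Fs ` {i. i < n \<and> (\<forall>j<n. \<not> mt i j \<and> \<not> mt j i)}" using i by auto
  next
    fix F assume "F \<in> (!) Fs ` {i. i < n \<and> (\<forall>j<n. \<not> mt i j \<and> \<not> mt j i)}"
    then obtain i where i: "i < n" "F = Fs ! i" "\<forall>j<n. \<not> mt i j \<and> \<not> mt j i" by blast
    have "\<not> incident F a" if "a \<in> M" for a
    proof
      assume inc: "incident F a"
      obtain k l where kl: "k < n" "l < n" "a = (Fs ! k, Fs ! l)" "mt k l"
        using \<open>a \<in> M\<close> unfolding M_def by blast
      then have "i = k \<or> i = l"
        using inc nth_eq[OF i(1) kl(1)] nth_eq[OF i(1) kl(2)] by (simp add: incident_def i(2))
      then show False using i(3) kl by blast
    qed
    then show "F \<in> critical_faces (set Fs) M" using mem[OF i(1)] i(2) unfolding critical_faces_def by simp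
  qed
  moreover have "inj_on ((!) Fs) {i. i < n \<and> (\<forall>j<n. \<not> mt i j \<and> \<not> mt j i)}"
    using nth_eq by (auto simp: inj_on_def)
  ultimately show ?thesis using mm by (intro exI[of _ M]) (simp add: critical_count_card card_image)
qed

end

subsection \<open>The verifier\<close>

definition np_check :: "(nat \<Rightarrow> bool) \<Rightarrow> nat \<Rightarrow> (nat \<Rightarrow> bool) \<Rightarrow> nat \<Rightarrow> bool" where
  "np_check X l U n \<longleftrightarrow> n + 1 + n * n \<le> l \<and> (n + 1 + n * n < l \<longrightarrow> X (l - 1)) \<and>
     face_poset (code_le X n) n \<and>
     good_matching (code_le X n) (\<lambda>i j. U (n * i + j)) (\<lambda>i j. U (n * n + n * i + j)) n \<and>
     \<not> (\<exists>c<critical_count (\<lambda>i j. U (n * i + j)) n.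
          binary_length c = l - (n + 1 + n * n) \<and> (\<forall>k<binary_length c. binary_bit c k = X (n + 1 + n * n + k)))"

lemma definable_np_check:
  assumes X: "definable_pred (\<lambda>w \<sigma>. X w (\<sigma> 0))" and U: "definable_pred (\<lambda>w \<sigma>. U w (\<sigma> 0))"
    and l: "definable (\<lambda>w \<sigma>. l w)" and n: "definable (\<lambda>w \<sigma>. n w)"
  shows "definable_pred (\<lambda>w \<sigma>. np_check (X w) (l w) (U w) (n w))"
proof -
  note X' = definable_pred_subst1[OF X] and U' = definable_pred_subst1[OF U]
  have le: "definable_pred (\<lambda>w \<sigma>. code_le (X w) (n w) (f w \<sigma>) (g w \<sigma>))" if "definable f" "definable g" for f g
    unfolding code_le_def by (intro dintros X' n that)
  have min: "definable_pred (\<lambda>w \<sigma>. minimal_elt (code_le (X w) (n w)) (n w) (f w \<sigma>))" if "definable f" for f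
    by (rule definable_pred_subst1[OF _ that]) (unfold minimal_elt_def, intro dintros le n)
  have vert: "definable_pred (\<lambda>w \<sigma>. vertex_of (code_le (X w) (n w)) (n w) (f w \<sigma>) (g w \<sigma>))" if "definable f" "definable g" for f g
    unfolding vertex_of_def by (intro dintros min le n that)
  have cov: "definable_pred (\<lambda>w \<sigma>. covers (code_le (X w) (n w)) (n w) (f w \<sigma>) (g w \<sigma>))" if "definable f" "definable g" for f g
    by (rule definable_pred_subst2[OF _ that]) (unfold covers_def, intro dintros le n)
  show ?thesis
    unfolding np_check_def face_poset_def good_matching_def critical_count_def
    by (intro dintros X' U' le vert cov n l)
qed

lemma word_bit_map: "word_bit (map f [0..<l]) i \<longleftrightarrow> i < l \<and> f i"
  by (auto simp: word_bit_def)

lemma code_of_cong: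
  assumes "\<And>i j. i < n \<Longrightarrow> j < n \<Longrightarrow> le i j = le' i j"
  shows "code_of n le bs = code_of n le' bs"
proof -
  have "map (\<lambda>i. map (le i) [0..<n]) [0..<n] = map (\<lambda>i. map (le' i) [0..<n]) [0..<n]"
    using assms by (intro map_cong refl) auto
  then show ?thesis unfolding code_of_def by (simp only:)
qed

text \<open>The certificate consists of two matrices, the matching and the strict order. Since the
  code already contains one matrix of that size, twice the code length is enough.\<close>

lemma yes_word_iff_certificate:
  fixes x :: word
  defines "n \<equiv> leading_ones (word_bit x) (length x)"
  shows "x \<in> yes_words morse_matching_problem \<longleftrightarrow>
    (\<exists>u. length u \<le> 2 * length x \<and> np_check (word_bit x) (length x) (word_bit u) n)"
proof
  assume "x \<in> yes_words morse_matching_problem"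
  then obtain Fs c M where Fs: "distinct Fs" "simplicial_complex (set Fs)"
    and M: "morse_matching (set Fs) M" "card (critical_faces (set Fs) M) \<le> c" and x: "x = morse_code (Fs, c)"
    unfolding yes_words_def morse_matching_problem_def by auto
  have xc: "x = code_of (length Fs) (\<lambda>i j. Fs ! i \<subseteq> Fs ! j) (binary_word c)"
    unfolding x by (rule morse_code_code_of)
  note D = code_of_eqD[OF xc]
  have nF: "length Fs = n" using D(1) n_def by simp
  let ?le = "code_le (word_bit x) n"
  have le: "?le i j \<longleftrightarrow> Fs ! i \<subseteq> Fs ! j" if "i < n" "j < n" for i j using D(4)[of i j] nF that by simp
  interpret face_list Fs n ?le using Fs nF le by unfold_locales auto
  obtain mt rr where g: "good_matching ?le mt rr n" "critical_count mt n = card (critical_faces (set Fs) M)"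
    using morse_matching_imp_certificate[OF M(1)] by blast
  define u where "u = map (\<lambda>k. if k < n * n then mt (k div n) (k mod n) else rr ((k - n * n) div n) ((k - n * n) mod n)) [0..<2 * (n * n)]"
  have lt: "n * i + j < n * n" if "i < n" "j < n" for i j
  proof -
    have "n * i + j < n * Suc i" using that by simp
    also have "\<dots> \<le> n * n" using that by (intro mult_le_mono) auto
    finally show ?thesis .
  qed
  have u1: "word_bit u (n * i + j) = mt i j" if "i < n" "j < n" for i j
    unfolding u_def word_bit_map using lt[OF that] that by simp
  have u2: "word_bit u (n * n + n * i + j) = rr i j" if "i < n" "j < n" for i j
    unfolding u_def word_bit_map using lt[OF that] that by (simp add: add.assoc)
  have len: "n + 1 + n * n \<le> length x" using D(2) nF by simp
  have dr: "drop (n + 1 + n * n) x = binary_word c" using D(3) nF by simp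
  have "np_check (word_bit x) (length x) (word_bit u) n"
    unfolding np_check_def
  proof (intro conjI impI notI)
    show "n + 1 + n * n \<le> length x" by (rule len)
    assume a: "n + 1 + n * n < length x"
    have "c \<noteq> 0"
    proof
      assume "c = 0"
      then have "drop (n + 1 + n * n) x = []" using dr by simp
      then show False using a by simp
    qed
    then have "last x" using binary_word_last[of c] dr a by (simp add: last_drop flip: dr)
    then show "word_bit x (length x - 1)" using a last_conv_nth[of x] by (cases "x = []") (auto simp: word_bit_def)
  next
    show "face_poset ?le n" unfolding face_poset_iff using Fs nF le by blast
    show "good_matching ?le (\<lambda>i j. word_bit u (n * i + j)) (\<lambda>i j. word_bit u (n * n + n * i + j)) n"
      using g(1) good_matching_cong(1)[of n "\<lambda>i j. word_bit u (n * i + j)" mt "\<lambda>i j. word_bit u (n * n + n * i + j)" rr] u1 u2 by simp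
  next
    assume "\<exists>c<critical_count (\<lambda>i j. word_bit u (n * i + j)) n. binary_length c = length x - (n + 1 + n * n) \<and>
       (\<forall>k<binary_length c. binary_bit c k = word_bit x (n + 1 + n * n + k))"
    moreover have "critical_count (\<lambda>i j. word_bit u (n * i + j)) n = critical_count mt n"
      using good_matching_cong(2)[of n "\<lambda>i j. word_bit u (n * i + j)" mt "\<lambda>i j. True" "\<lambda>i j. True"] u1 by simp
    ultimately obtain c' where c': "c' < critical_count mt n" "binary_length c' = length x - (n + 1 + n * n)"
      "\<forall>k<binary_length c'. binary_bit c' k = word_bit x (n + 1 + n * n + k)" by auto
    have "binary_word c' = drop (n + 1 + n * n) x"
      by (rule nth_equalityI) (use c' len in \<open>auto simp: binary_word_conv word_bit_def\<close>)
    then have "c' = c" using dr binary_word_inj by simp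
    then show False using c'(1) g(2) M(2) by simp
  qed
  moreover have "length u \<le> 2 * length x" using len by (simp add: u_def)
  ultimately show "\<exists>u. length u \<le> 2 * length x \<and> np_check (word_bit x) (length x) (word_bit u) n" by blast
next
  assume "\<exists>u. length u \<le> 2 * length x \<and> np_check (word_bit x) (length x) (word_bit u) n"
  then obtain u where u: "np_check (word_bit x) (length x) (word_bit u) n" by blast
  let ?le = "code_le (word_bit x) n" and ?mt = "\<lambda>i j. word_bit u (n * i + j)"
  let ?bs = "drop (n + 1 + n * n) x"
  have xlen: "n + 1 + n * n \<le> length x" and can: "n + 1 + n * n < length x \<longrightarrow> word_bit x (length x - 1)"
    and fp: "face_poset ?le n" and gm: "good_matching ?le ?mt (\<lambda>i j. word_bit u (n * n + n * i + j)) n"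
    and nc: "\<not> (\<exists>c<critical_count ?mt n. binary_length c = length x - (n + 1 + n * n) \<and>
       (\<forall>k<binary_length c. binary_bit c k = word_bit x (n + 1 + n * n + k)))"
    using u unfolding np_check_def by blast+
  obtain Fs :: "nat set list" where Fs: "length Fs = n" "distinct Fs" "simplicial_complex (set Fs)"
    "\<And>i j. i < n \<Longrightarrow> j < n \<Longrightarrow> ?le i j \<longleftrightarrow> Fs ! i \<subseteq> Fs ! j"
    using fp unfolding face_poset_iff by blast
  interpret face_list Fs n ?le using Fs by unfold_locales auto
  obtain M where M: "morse_matching (set Fs) M" "card (critical_faces (set Fs) M) = critical_count ?mt n"
    using certificate_imp_morse_matching[OF gm] by blast
  have "?bs = [] \<or> last ?bs"
  proof (cases "n + 1 + n * n < length x")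
    case True
    then have "x \<noteq> []" by auto
    then show ?thesis using can True last_conv_nth[of x] by (simp add: last_drop word_bit_def)
  qed simp
  then obtain c where c: "binary_word c = ?bs" using ex_binary_word by blast
  have "critical_count ?mt n \<le> c"
  proof (rule ccontr)
    assume "\<not> critical_count ?mt n \<le> c"
    moreover have "binary_length c = length x - (n + 1 + n * n)"
      using arg_cong[OF c, of length] by (simp add: binary_word_conv)
    moreover have "binary_bit c k = word_bit x (n + 1 + n * n + k)" if "k < binary_length c" for k
    proof -
      have "binary_bit c k = ?bs ! k" using c that by (metis add_0 binary_word_conv diff_zero length_upt nth_map nth_upt)
      moreover have "n + 1 + n * n + k < length x" using that \<open>binary_length c = _\<close> xlen by linarith
      ultimately show ?thesis by (simp add: word_bit_def)
    qed
    ultimately show False using nc by auto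
  qed
  moreover have "x = morse_code (Fs, c)"
    using code_of_reconstruct[OF n_def[THEN meta_eq_to_obj_eq] xlen] code_of_cong[of n ?le "\<lambda>i j. Fs ! i \<subseteq> Fs ! j" ?bs] Fs
    by (simp add: morse_code_code_of c)
  ultimately have c1: "card (critical_faces (set Fs) M) \<le> c" "x = morse_code (Fs, c)" using M(2) by simp_all
  show "x \<in> yes_words morse_matching_problem"
    unfolding yes_words_def mem_Collect_eq
    by (intro exI[of _ "(Fs, c)"]) (use Fs(2,3) M(1) c1 in \<open>auto simp: morse_matching_problem_def\<close>)
qed

text \<open>The separator is the first pair \<open>False\<close>, \<open>True\<close> at an even
  position; a doubled bit never looks like it. So this is the length of the first component of a
  pair.\<close>

definition pair_sep :: "word \<Rightarrow> nat" where
  "pair_sep w = leading_ones (\<lambda>j. word_bit w (2 * j) \<or> \<not> word_bit w (2 * j + 1)) (length w)"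

lemma doubled_nth:
  "i < length x \<Longrightarrow> concat (map (\<lambda>b. [b, b]) x) ! (2 * i) = x ! i"
  "i < length x \<Longrightarrow> concat (map (\<lambda>b. [b, b]) x) ! Suc (2 * i) = x ! i"
  by (induction x arbitrary: i) (auto simp: nth_Cons split: nat.split)

lemma length_doubled: "length (concat (map (\<lambda>b. [b, b]) x)) = 2 * length x"
  by (induction x) auto

lemma pair_word_bits:
  "i < length x \<Longrightarrow> word_bit (pair_word x u) (2 * i) = x ! i"
  "i < length x \<Longrightarrow> word_bit (pair_word x u) (2 * i + 1) = x ! i"
  "\<not> word_bit (pair_word x u) (2 * length x)" "word_bit (pair_word x u) (2 * length x + 1)"
  "word_bit (pair_word x u) (2 * length x + 2 + j) = word_bit u j"
  "length (pair_word x u) = 2 * length x + 2 + length u"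
  unfolding word_bit_def pair_word_def
  by (auto simp: nth_append length_doubled doubled_nth)

lemma pair_sep_pair_word: "pair_sep (pair_word x u) = length x"
  unfolding pair_sep_def
  by (rule leading_ones_eq) (use pair_word_bits in auto)

theorem yes_words_in_NP: "yes_words morse_matching_problem \<in> class_NP"
proof -
  define X where "X w i \<longleftrightarrow> i < pair_sep w \<and> word_bit w (2 * i)" for w i
  define U where "U w j = word_bit w (2 * pair_sep w + 2 + j)" for w j
  define n where "n w = leading_ones (X w) (pair_sep w)" for w
  define R where "R = {w. np_check (X w) (pair_sep w) (U w) (n w)}"
  have wb: "definable_pred (\<lambda>w \<sigma>. word_bit w (f w \<sigma>))" if "definable f" for f
    unfolding word_bit_def by (rule definable_pred_bit[OF that])
  have sep: "definable (\<lambda>w \<sigma>. pair_sep w)"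
    unfolding pair_sep_def leading_ones_def by (intro dintros wb)
  have X: "definable_pred (\<lambda>w \<sigma>. X w (f w \<sigma>))" if "definable f" for f
    unfolding X_def by (intro dintros wb sep that)
  have U: "definable_pred (\<lambda>w \<sigma>. U w (f w \<sigma>))" if "definable f" for f
    unfolding U_def by (intro dintros wb sep that)
  have n: "definable (\<lambda>w \<sigma>. n w)"
    unfolding n_def leading_ones_def by (intro dintros X sep)
  have "definable_pred (\<lambda>w \<sigma>. w \<in> R)"
    unfolding R_def mem_Collect_eq by (intro definable_np_check X U sep n definable_var)
  then have "R \<in> class_P" by (rule definable_class_P)
  moreover have "x \<in> yes_words morse_matching_problem \<longleftrightarrow>
      (\<exists>u. length u \<le> poly [:0, 2:] (length x) \<and> pair_word x u \<in> R)" for x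
  proof -
    have "X (pair_word x u) = word_bit x" "U (pair_word x u) = word_bit u" for u
      using pair_word_bits unfolding X_def U_def pair_sep_pair_word by (auto simp: word_bit_def fun_eq_iff)
    then have "pair_word x u \<in> R \<longleftrightarrow> np_check (word_bit x) (length x) (word_bit u) (leading_ones (word_bit x) (length x))" for u
      unfolding R_def n_def mem_Collect_eq pair_sep_pair_word by simp
    then show ?thesis using yes_word_iff_certificate[of x] by (simp add: mult.commute)
  qed
  ultimately show ?thesis unfolding class_NP_def by blast
qed

section \<open>Morse matchings and erasability of 2-complexes\<close>

definition complex_of :: "'a set set \<Rightarrow> 'a set set" where
  "complex_of Tr = {F. F \<noteq> {} \<and> (\<exists>t\<in>Tr. F \<subseteq> t)}"

definition skel :: "nat \<Rightarrow> 'a set set \<Rightarrow> 'a set set" where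
  "skel k Tr = {F \<in> complex_of Tr. card F = k}"

text \<open>
  The triangles outside \<open>C\<close> can be removed one after another through free edges: equivalently, there
  is no nonempty set of them such that each edge lies in none or in at least two of its members.
\<close>

definition erasable :: "'a set set \<Rightarrow> 'a set set \<Rightarrow> bool" where
  "erasable Tr C \<longleftrightarrow> (\<forall>S\<subseteq>Tr. S \<noteq> {} \<longrightarrow> S \<inter> C = {} \<longrightarrow>
     (\<exists>t\<in>S. \<exists>e\<subseteq>t. card e = 2 \<and> (\<forall>t'\<in>S. e \<subseteq> t' \<longrightarrow> t' = t)))"

section \<open>Erasing orders and spanning trees\<close>

definition edge_graph :: "'a set set \<Rightarrow> ('a \<times> 'a) set" where
  "edge_graph X = {(u, v). u \<noteq> v \<and> {u, v} \<in> X}"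

text \<open>A triangle with a free edge is erased first and gets the largest rank, since other free
  edges may lie in it. The last clause says that deleting the chosen edges never disconnects the
  graph: at the moment of its deletion an edge can be bypassed along the two other sides of its
  triangle.\<close>

lemma erasing_order:
  assumes "finite S" "\<And>t. t \<in> S \<Longrightarrow> card t = 3"
    "\<And>S'. S' \<subseteq> S \<Longrightarrow> S' \<noteq> {} \<Longrightarrow> \<exists>t\<in>S'. \<exists>e\<subseteq>t. card e = 2 \<and> (\<forall>t'\<in>S'. e \<subseteq> t' \<longrightarrow> t' = t)"
  shows "\<exists>(rk :: 'a set \<Rightarrow> nat) ed. (\<forall>t\<in>S. ed t \<subseteq> t \<and> card (ed t) = 2) \<and>
     (\<forall>t\<in>S. \<forall>t'\<in>S. t' \<noteq> t \<longrightarrow> ed t \<subseteq> t' \<longrightarrow> rk t < rk t') \<and>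
     (\<forall>X. (\<forall>t\<in>S. \<forall>e\<subseteq>t. card e = 2 \<longrightarrow> e \<in> X) \<longrightarrow> (edge_graph X)\<^sup>* \<subseteq> (edge_graph (X - ed ` S))\<^sup>*)"
  using assms
proof (induction "card S" arbitrary: S)
  case 0
  then show ?case by auto
next
  case (Suc n)
  then have "S \<noteq> {}" by auto
  from Suc.prems(3)[OF order_refl this] obtain t0 e0
    where t0': "t0 \<in> S" "e0 \<subseteq> t0" "card e0 = 2" "\<forall>t'\<in>S. e0 \<subseteq> t' \<longrightarrow> t' = t0"
    by (elim bexE exE conjE) (rule that)
  note t0 = t0'(1-3) t0'(4)[rule_format]
  let ?S = "S - {t0}"
  have "\<exists>(rk :: 'a set \<Rightarrow> nat) ed. (\<forall>t\<in>?S. ed t \<subseteq> t \<and> card (ed t) = 2) \<and>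
     (\<forall>t\<in>?S. \<forall>t'\<in>?S. t' \<noteq> t \<longrightarrow> ed t \<subseteq> t' \<longrightarrow> rk t < rk t') \<and>
     (\<forall>X. (\<forall>t\<in>?S. \<forall>e\<subseteq>t. card e = 2 \<longrightarrow> e \<in> X) \<longrightarrow> (edge_graph X)\<^sup>* \<subseteq> (edge_graph (X - ed ` ?S))\<^sup>*)"
  proof (rule Suc.hyps(1))
    show "n = card ?S" using Suc.hyps(2) Suc.prems(1) t0(1) by simp
    show "finite ?S" using Suc.prems(1) by simp
    show "card t = 3" if "t \<in> ?S" for t using Suc.prems(2) that by blast
    show "\<exists>t\<in>S'. \<exists>e\<subseteq>t. card e = 2 \<and> (\<forall>t'\<in>S'. e \<subseteq> t' \<longrightarrow> t' = t)" if "S' \<subseteq> ?S" "S' \<noteq> {}" for S'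
      by (rule Suc.prems(3)) (use that in auto)
  qed
  then obtain rk :: "'a set \<Rightarrow> nat" and ed where
    ed0: "\<forall>t\<in>?S. ed t \<subseteq> t \<and> card (ed t) = 2"
    and rk0: "\<forall>t\<in>?S. \<forall>t'\<in>?S. t' \<noteq> t \<longrightarrow> ed t \<subseteq> t' \<longrightarrow> rk t < rk t'"
    and con0: "\<forall>X. (\<forall>t\<in>?S. \<forall>e\<subseteq>t. card e = 2 \<longrightarrow> e \<in> X) \<longrightarrow> (edge_graph X)\<^sup>* \<subseteq> (edge_graph (X - ed ` ?S))\<^sup>*"
    by (elim exE conjE) (rule that)
  note ed = ed0[rule_format] and rk = rk0[rule_format] and con = con0[THEN spec, THEN mp]
  define rk' where "rk' = rk(t0 := Suc (\<Sum>t\<in>?S. rk t))"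
  define ed' where "ed' = ed(t0 := e0)"
  have le: "rk t \<le> (\<Sum>t\<in>?S. rk t)" if "t \<in> ?S" for t
    using that Suc.prems(1) by (intro member_le_sum) auto
  have "ed' t \<subseteq> t \<and> card (ed' t) = 2" if "t \<in> S" for t
    using that t0(1-3) ed[of t] by (cases "t = t0") (auto simp: ed'_def)
  moreover have "rk' t < rk' t'" if t: "t \<in> S" "t' \<in> S" "t' \<noteq> t" "ed' t \<subseteq> t'" for t t'
  proof -
    have "t \<noteq> t0" using t t0(4)[of t'] unfolding ed'_def by auto
    then have tS: "t \<in> ?S" "ed t \<subseteq> t'" using t by (auto simp: ed'_def)
    show ?thesis
    proof (cases "t' = t0")
      case True
      then show ?thesis using le[OF tS(1)] \<open>t \<noteq> t0\<close> by (simp add: rk'_def)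
    next
      case False
      then show ?thesis using rk[OF tS(1) _ t(3) tS(2)] t(2) \<open>t \<noteq> t0\<close> by (simp add: rk'_def)
    qed
  qed
  moreover have "(edge_graph X)\<^sup>* \<subseteq> (edge_graph (X - ed' ` S))\<^sup>*"
    if X: "\<forall>t\<in>S. \<forall>e\<subseteq>t. card e = 2 \<longrightarrow> e \<in> X" for X
  proof -
    let ?X = "X - {e0}"
    have "(edge_graph X)\<^sup>* \<subseteq> (edge_graph ?X)\<^sup>*"
    proof (rule rtrancl_subset_rtrancl, rule subrelI)
      fix u v assume uv: "(u, v) \<in> edge_graph X"
      show "(u, v) \<in> (edge_graph ?X)\<^sup>*"
      proof (cases "{u, v} = e0")
        case False
        then show ?thesis using uv by (intro r_into_rtrancl) (auto simp: edge_graph_def)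
      next
        case True
        have "card t0 = 3" using Suc.prems(2) t0(1) by blast
        moreover have "finite e0" using t0(3) by (metis card.infinite zero_neq_numeral)
        ultimately have "card (t0 - e0) = 1" using t0(2,3) by (simp add: card_Diff_subset)
        then obtain z where z: "t0 - e0 = {z}" by (metis card_1_singletonE)
        then have "z \<noteq> u" "z \<noteq> v" "{u, z} \<subseteq> t0" "{z, v} \<subseteq> t0" using True t0(2) by auto
        moreover then have "{u, z} \<in> X" "{z, v} \<in> X" using X t0(1) by (auto simp: card_insert_if)
        moreover have "{u, z} \<noteq> e0" "{z, v} \<noteq> e0" using z by auto
        ultimately have "(u, z) \<in> edge_graph ?X" "(z, v) \<in> edge_graph ?X" by (auto simp: edge_graph_def)
        then show ?thesis by (meson converse_rtrancl_into_rtrancl r_into_rtrancl)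
      qed
    qed
    also have "\<dots> \<subseteq> (edge_graph (?X - ed ` ?S))\<^sup>*"
    proof (rule con, intro ballI allI impI)
      fix t e assume a: "t \<in> ?S" "e \<subseteq> t" "card e = 2"
      then have "e \<noteq> e0" using t0(4)[of t] by auto
      then show "e \<in> ?X" using X a by auto
    qed
    also have "?X - ed ` ?S = X - ed' ` S"
    proof -
      have "ed' ` S = insert e0 (ed ` ?S)" using t0(1) unfolding ed'_def by (auto simp: image_iff)
      then show ?thesis by auto
    qed
    finally show ?thesis .
  qed
  ultimately have "(\<forall>t\<in>S. ed' t \<subseteq> t \<and> card (ed' t) = 2)"
    "(\<forall>t\<in>S. \<forall>t'\<in>S. t' \<noteq> t \<longrightarrow> ed' t \<subseteq> t' \<longrightarrow> rk' t < rk' t')"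
    "(\<forall>X. (\<forall>t\<in>S. \<forall>e\<subseteq>t. card e = 2 \<longrightarrow> e \<in> X) \<longrightarrow> (edge_graph X)\<^sup>* \<subseteq> (edge_graph (X - ed' ` S))\<^sup>*)"
    by simp_all
  then show ?case by (intro exI[of _ rk'] exI[of _ ed'] conjI)
qed

text \<open>A breadth-first tree: \<open>d\<close> is the distance from the root and
  \<open>p\<close> the parent.\<close>

lemma spanning_tree:
  assumes con: "\<And>v. v \<in> V \<Longrightarrow> (r, v) \<in> (edge_graph X)\<^sup>*"
  shows "\<exists>(d :: 'a \<Rightarrow> nat) p. d r = 0 \<and> (\<forall>v\<in>V. v \<noteq> r \<longrightarrow> {v, p v} \<in> X \<and> p v \<noteq> v \<and> d v = Suc (d (p v)))"
proof -
  define d where "d v = (LEAST k. (r, v) \<in> edge_graph X ^^ k)" for v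
  have ex: "\<exists>p. {v, p} \<in> X \<and> p \<noteq> v \<and> d v = Suc (d p)" if v: "v \<in> V" "v \<noteq> r" for v
  proof -
    have "\<exists>k. (r, v) \<in> edge_graph X ^^ k" using con[OF v(1)] rtrancl_imp_relpow by blast
    then have dv: "(r, v) \<in> edge_graph X ^^ d v" unfolding d_def by (meson LeastI_ex)
    then have "d v \<noteq> 0" using v(2) by (intro notI) simp
    then obtain k where k: "d v = Suc k" using not0_implies_Suc by blast
    then obtain p where p: "(r, p) \<in> edge_graph X ^^ k" "(p, v) \<in> edge_graph X" using dv by auto
    have "d p \<le> k" unfolding d_def by (rule Least_le) (rule p(1))
    moreover have "(r, v) \<in> edge_graph X ^^ Suc (d p)"
      using LeastI[of "\<lambda>k. (r, p) \<in> edge_graph X ^^ k", OF p(1)] p(2) unfolding d_def by auto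
    then have "d v \<le> Suc (d p)" unfolding d_def by (rule Least_le)
    ultimately have "d v = Suc (d p)" using k by simp
    then show ?thesis using p(2) by (intro exI[of _ p]) (auto simp: edge_graph_def insert_commute)
  qed
  have "d r = 0" unfolding d_def by (rule Least_equality) auto
  moreover have "\<exists>p. \<forall>v\<in>V. v \<noteq> r \<longrightarrow> {v, p v} \<in> X \<and> p v \<noteq> v \<and> d v = Suc (d (p v))"
    using ex by (intro bchoice) blast
  ultimately show ?thesis by blast
qed

lemma acyclic_minimal:
  assumes "finite R" "acyclic R" "S \<noteq> {}"
  shows "\<exists>x\<in>S. \<forall>y\<in>S. (y, x) \<notin> R\<^sup>+" "\<exists>x\<in>S. \<forall>y\<in>S. (x, y) \<notin> R\<^sup>+"
proof -
  have "wf (R\<^sup>+)" by (rule wf_trancl[OF finite_acyclic_wf[OF assms(1,2)]])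
  then show "\<exists>x\<in>S. \<forall>y\<in>S. (y, x) \<notin> R\<^sup>+" using assms(3) by (metis ex_in_conv wfE_min)
  have "wf ((R\<inverse>)\<^sup>+)" by (rule wf_trancl[OF finite_acyclic_wf_converse[OF assms(1,2)]])
  then obtain x where x: "x \<in> S" "\<And>y. (y, x) \<in> (R\<inverse>)\<^sup>+ \<Longrightarrow> y \<notin> S" using assms(3) by (metis ex_in_conv wfE_min)
  then show "\<exists>x\<in>S. \<forall>y\<in>S. (x, y) \<notin> R\<^sup>+" by (metis converse_iff trancl_converse)
qed

section \<open>Critical faces and erased triangles of a pure 2-complex\<close>

locale pure_2_complex =
  fixes Tr :: "'a set set"
  assumes finite_Tr: "finite Tr" and card_Tr: "\<And>t. t \<in> Tr \<Longrightarrow> card t = 3" and Tr_ne: "Tr \<noteq> {}"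
begin

abbreviation "\<Delta> \<equiv> complex_of Tr"

lemma finite_triangle: "t \<in> Tr \<Longrightarrow> finite t"
  using card_Tr[of t] by (metis card.infinite zero_neq_numeral)

lemma finite_complex: "finite \<Delta>"
proof -
  have "\<Delta> \<subseteq> (\<Union>t\<in>Tr. Pow t)" by (auto simp: complex_of_def)
  then show ?thesis by (rule finite_subset) (use finite_Tr finite_triangle in auto)
qed

lemma complex_subset: "F \<in> \<Delta> \<Longrightarrow> G \<subseteq> F \<Longrightarrow> G \<noteq> {} \<Longrightarrow> G \<in> \<Delta>"
  unfolding complex_of_def by (blast intro: order_trans)

lemma finite_face: "F \<in> \<Delta> \<Longrightarrow> finite F"
  by (auto simp: complex_of_def intro: finite_subset finite_triangle)

lemma card_face: "F \<in> \<Delta> \<Longrightarrow> card F = 1 \<or> card F = 2 \<or> card F = 3"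
proof -
  assume F: "F \<in> \<Delta>"
  then obtain t where "t \<in> Tr" "F \<subseteq> t" by (auto simp: complex_of_def)
  then have "card F \<le> 3" using card_mono[OF finite_triangle] card_Tr by metis
  moreover have "card F \<noteq> 0" using F finite_face[OF F] by (auto simp: complex_of_def)
  ultimately show ?thesis by linarith
qed

lemma card_face_3: "F \<in> \<Delta> \<Longrightarrow> card F = 3 \<longleftrightarrow> F \<in> Tr"
proof
  assume F: "F \<in> \<Delta>" "card F = 3"
  then obtain t where t: "t \<in> Tr" "F \<subseteq> t" by (auto simp: complex_of_def)
  then show "F \<in> Tr" using card_subset_eq[OF finite_triangle[OF t(1)] t(2)] F(2) card_Tr[OF t(1)] by simp
qed (rule card_Tr)

lemma Tr_subset: "Tr \<subseteq> \<Delta>"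
  using card_Tr by (fastforce simp: complex_of_def)

lemma simplicial: "simplicial_complex \<Delta>"
proof -
  have "finite (\<Union>\<Delta>)" using finite_complex finite_face by (rule finite_Union)
  moreover have "{} \<notin> \<Delta>" by (simp add: complex_of_def)
  ultimately show ?thesis unfolding simplicial_complex_def using complex_subset by blast
qed

lemma skel_3: "skel 3 Tr = Tr"
  using card_face_3 Tr_subset unfolding skel_def by blast

lemma pure: "pure_complex \<Delta>"
proof -
  have "face_dim F = 2" if m: "maximal_face \<Delta> F" for F
  proof -
    obtain t where "t \<in> Tr" "F \<subseteq> t" using m by (auto simp: maximal_face_def complex_of_def)
    then have "t = F" using m Tr_subset unfolding maximal_face_def by blast
    then show ?thesis using card_Tr \<open>t \<in> Tr\<close> by (simp add: face_dim_def)
  qed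
  then show ?thesis by (simp add: pure_complex_def)
qed

lemma has_dim_2: "complex_has_dim \<Delta> 2"
proof -
  obtain t where "t \<in> Tr" using Tr_ne by blast
  then show ?thesis unfolding complex_has_dim_def face_dim_def
    using Tr_subset card_Tr[of t] card_face by (auto intro!: bexI[of _ t]) force
qed

lemma card_complex: "card \<Delta> = card (skel 1 Tr) + card (skel 2 Tr) + card Tr"
proof -
  have "\<Delta> = skel 1 Tr \<union> skel 2 Tr \<union> skel 3 Tr" using card_face unfolding skel_def by blast
  moreover have "card (skel 1 Tr \<union> skel 2 Tr \<union> skel 3 Tr) = card (skel 1 Tr) + card (skel 2 Tr) + card (skel 3 Tr)"
    using finite_complex by (subst card_Un_disjoint; (subst card_Un_disjoint)?) (auto simp: skel_def)
  ultimately show ?thesis by (simp add: skel_3)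
qed

lemma hasse_card: "(G, F) \<in> hasse \<Delta> \<Longrightarrow> G \<in> \<Delta> \<and> F \<in> \<Delta> \<and> F \<subset> G \<and> card G = Suc (card F)"
  by (auto simp: hasse_def face_covered_def face_dim_def)

lemma hasseI: "G \<in> \<Delta> \<Longrightarrow> F \<in> \<Delta> \<Longrightarrow> F \<subseteq> G \<Longrightarrow> card G = Suc (card F) \<Longrightarrow> (G, F) \<in> hasse \<Delta>"
  by (auto simp: hasse_def face_covered_def face_dim_def)

lemma finite_hasse: "finite (hasse \<Delta>)"
  by (rule finite_subset[of _ "\<Delta> \<times> \<Delta>"]) (auto simp: hasse_def finite_complex)

lemma matchingD:
  assumes "hasse_matching \<Delta> M"
  shows "M \<subseteq> hasse \<Delta>"
    "F \<in> \<Delta> \<Longrightarrow> a \<in> M \<Longrightarrow> b \<in> M \<Longrightarrow> incident F a \<Longrightarrow> incident F b \<Longrightarrow> a = b"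
  using assms[unfolded hasse_matching_def, THEN conjunct1]
    assms[unfolded hasse_matching_def, THEN conjunct2, rule_format, of F a b] by simp_all

lemma card_critical:
  assumes "hasse_matching \<Delta> M"
  shows "card (critical_faces \<Delta> M) + 2 * card M = card \<Delta>"
proof -
  note M1 = matchingD(1)[OF assms] and M2 = matchingD(2)[OF assms]
  have in\<Delta>: "fst a \<in> \<Delta>" "snd a \<in> \<Delta>" "fst a \<noteq> snd a" if "a \<in> M" for a
    using M1 that hasse_card[of "fst a" "snd a"] by auto
  have i1: "inj_on fst M"
  proof (rule inj_onI)
    fix a b assume "a \<in> M" "b \<in> M" "fst a = fst b"
    then show "a = b" using M2[of "fst a" a b] in\<Delta>(1) by (simp add: incident_def)
  qed
  have i2: "inj_on snd M"
  proof (rule inj_onI)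
    fix a b assume "a \<in> M" "b \<in> M" "snd a = snd b"
    then show "a = b" using M2[of "snd a" a b] in\<Delta>(2) by (simp add: incident_def)
  qed
  have "fst a \<noteq> snd b" if "a \<in> M" "b \<in> M" for a b
  proof
    assume "fst a = snd b"
    then have "a = b" using M2[of "fst a" a b] in\<Delta>(1)[OF that(1)] that by (simp add: incident_def)
    then show False using in\<Delta>(3) that \<open>fst a = snd b\<close> by auto
  qed
  then have disj: "fst ` M \<inter> snd ` M = {}" by blast
  have finM: "finite M" using M1 finite_hasse by (rule finite_subset)
  have "critical_faces \<Delta> M = \<Delta> - (fst ` M \<union> snd ` M)"
    unfolding critical_faces_def incident_def by force
  moreover have sub: "fst ` M \<union> snd ` M \<subseteq> \<Delta>" using in\<Delta> by auto
  moreover have "card (fst ` M \<union> snd ` M) = 2 * card M"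
    using disj finM card_image[OF i1] card_image[OF i2] by (simp add: card_Un_disjoint)
  ultimately show ?thesis
    using card_Diff_subset[OF finite_subset[OF sub finite_complex] sub] card_mono[OF finite_complex sub] by simp
qed

text \<open>The triangles in no arc of the matching form \<open>C\<close>, and the arcs between
  triangles and edges yield free edges for the others. As at least one vertex is not matched with an
  edge, counting the arcs bounds the size of \<open>C\<close>.\<close>

lemma morse_imp_erasable:
  assumes M: "morse_matching \<Delta> M"
    and cr: "card (critical_faces \<Delta> M) \<le> (card (skel 2 Tr) + 2 * m + 2) - (card (skel 1 Tr) + card Tr)"
  shows "\<exists>C\<subseteq>Tr. card C \<le> m \<and> erasable Tr C"
proof -
  have hm: "hasse_matching \<Delta> M" and ac: "acyclic (hasse_reversed \<Delta> M)"
    using M unfolding morse_matching_def by auto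
  note M1 = matchingD(1)[OF hm] and M2 = matchingD(2)[OF hm]
  let ?R = "hasse_reversed \<Delta> M"
  have finR: "finite ?R" unfolding hasse_reversed_def
    using finite_hasse finite_subset[OF M1] by simp
  define A where "A = {a \<in> M. card (fst a) = 3}"
  define B where "B = {a \<in> M. card (fst a) = 2}"
  have finM: "finite M" using M1 finite_hasse by (rule finite_subset)
  have mem: "fst a \<in> \<Delta>" "snd a \<in> \<Delta>" "snd a \<subset> fst a" "card (fst a) = Suc (card (snd a))" if "a \<in> M" for a
  proof -
    have "(fst a, snd a) \<in> hasse \<Delta>" using subsetD[OF M1 that] by simp
    from hasse_card[OF this] show "fst a \<in> \<Delta>" "snd a \<in> \<Delta>" "snd a \<subset> fst a" "card (fst a) = Suc (card (snd a))"
      by simp_all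
  qed
  have cM: "card M = card A + card B"
  proof -
    have "card (fst a) = 2 \<or> card (fst a) = 3" if "a \<in> M" for a
      using card_face[OF mem(1)[OF that]] card_face[OF mem(2)[OF that]] mem(4)[OF that] by linarith
    then have "M = A \<union> B" unfolding A_def B_def by blast
    moreover have "card (A \<union> B) = card A + card B"
      by (rule card_Un_disjoint) (use finM in \<open>auto simp: A_def B_def\<close>)
    ultimately show ?thesis by metis
  qed
  define C where "C = Tr - fst ` A"
  have iA: "inj_on fst A"
  proof (rule inj_onI)
    fix a b assume "a \<in> A" "b \<in> A" "fst a = fst b"
    then show "a = b" using M2[of "fst a" a b] mem(1) by (simp add: incident_def A_def)
  qed
  have A_sub: "fst ` A \<subseteq> Tr"
  proof
    fix x assume "x \<in> fst ` A"
    then obtain a where "a \<in> M" "card (fst a) = 3" "x = fst a" unfolding A_def by blast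
    then show "x \<in> Tr" using card_face_3[OF mem(1)] by simp
  qed
  have cC: "card C + card A = card Tr"
    unfolding C_def using card_Diff_subset[OF finite_subset[OF A_sub finite_Tr] A_sub] card_image[OF iA]
      card_mono[OF finite_Tr A_sub] by simp
  have iB: "inj_on snd B"
  proof (rule inj_onI)
    fix a b assume "a \<in> B" "b \<in> B" "snd a = snd b"
    then show "a = b" using M2[of "snd a" a b] mem(2) by (simp add: incident_def B_def)
  qed
  have B_sub: "snd ` B \<subseteq> skel 1 Tr" using mem unfolding B_def skel_def by auto
  have ne1: "skel 1 Tr \<noteq> {}"
  proof -
    obtain t v where "t \<in> Tr" "v \<in> t" using Tr_ne card_Tr by (metis card.empty ex_in_conv zero_neq_numeral)
    then have "{v} \<in> skel 1 Tr" by (auto simp: skel_def complex_of_def)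
    then show ?thesis by blast
  qed
  have Bne: "snd ` B \<noteq> skel 1 Tr"
  proof
    assume eq: "snd ` B = skel 1 Tr"
    \<comment> \<open>A vertex from which no vertex is reachable in the reversed diagram. If it were
      matched with an edge, it would reach the other end of that edge.\<close>
    obtain x where x: "x \<in> skel 1 Tr" "\<And>y. y \<in> skel 1 Tr \<Longrightarrow> (x, y) \<notin> ?R\<^sup>+"
      using acyclic_minimal(2)[OF finR ac ne1] by blast
    then obtain e where e: "(e, x) \<in> M" "card e = 2" using eq unfolding B_def by force
    then have "x \<subset> e" "e \<in> \<Delta>" "card x = 1" using mem[OF e(1)] by auto
    then obtain v where v: "x = {v}" by (auto simp: card_1_singleton_iff)
    obtain a b where ab: "e = {a, b}" "a \<noteq> b" using e(2) by (auto simp: card_2_iff)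
    then have "v = a \<or> v = b" using v \<open>x \<subset> e\<close> by auto
    then have "\<exists>u. e = {v, u} \<and> u \<noteq> v" using ab by auto
    then obtain u where vu: "x = {v}" "e = {v, u}" "u \<noteq> v" using v by blast
    have u: "{u} \<in> \<Delta>" using complex_subset[OF \<open>e \<in> \<Delta>\<close>, of "{u}"] vu by auto
    have "(e, {u}) \<notin> M" using M2[OF \<open>e \<in> \<Delta>\<close> e(1), of "(e, {u})"] vu by (auto simp: incident_def)
    then have "(e, {u}) \<in> ?R" using hasseI[OF \<open>e \<in> \<Delta>\<close> u] vu by (auto simp: hasse_reversed_def)
    moreover have "(x, e) \<in> ?R" using e(1) by (auto simp: hasse_reversed_def)
    ultimately have "(x, {u}) \<in> ?R\<^sup>+" by (meson r_into_trancl trancl_into_trancl)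
    moreover have "{u} \<in> skel 1 Tr" using u by (auto simp: skel_def)
    ultimately show False using x(2) by blast
  qed
  have fin1: "finite (skel 1 Tr)" using finite_complex by (auto simp: skel_def)
  have cB: "card B < card (skel 1 Tr)"
    using psubset_card_mono[OF fin1, of "snd ` B"] B_sub Bne card_image[OF iB] by auto
  \<comment> \<open>The assumed bound is a truncated difference and might be 0 for the wrong reason;
    an unmatched vertex excludes this.\<close>
  have "critical_faces \<Delta> M \<noteq> {}"
  proof -
    obtain x where x: "x \<in> skel 1 Tr" "x \<notin> snd ` B" using B_sub Bne by blast
    have "\<not> incident x a" if "a \<in> M" for a
    proof
      assume "incident x a"
      then consider "x = fst a" | "x = snd a" unfolding incident_def by blast
      then show False
      proof cases
        case 1
        then have "card (snd a) = 0" using mem(4)[OF that] x(1) by (simp add: skel_def)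
        then show False using mem(2)[OF that] finite_face by (auto simp: complex_of_def)
      next
        case 2
        then have "card (fst a) = 2" using mem(4)[OF that] x(1) by (simp add: skel_def)
        then show False using 2 that x(2) by (auto simp: B_def)
      qed
    qed
    then have "x \<in> critical_faces \<Delta> M" using x(1) by (auto simp: critical_faces_def skel_def)
    then show ?thesis by blast
  qed
  moreover have "finite (critical_faces \<Delta> M)" using finite_complex by (auto simp: critical_faces_def)
  ultimately have "card (critical_faces \<Delta> M) \<ge> 1" by (simp add: Suc_leI card_gt_0_iff)
  then have "card C \<le> m"
    using cr card_critical[OF hm] card_complex cM cC cB by linarith
  moreover have "erasable Tr C"
    unfolding erasable_def
  proof (intro allI impI)
    \<comment> \<open>The triangle of \<open>S\<close> that is chosen next is not reachable from any
      triangle of \<open>S\<close>. Its matched edge is free in \<open>S\<close>, because another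
      triangle containing that edge would reach it through the edge.\<close>
    fix S assume S: "S \<subseteq> Tr" "S \<noteq> {}" "S \<inter> C = {}"
    obtain t where t: "t \<in> S" "\<And>t'. t' \<in> S \<Longrightarrow> (t', t) \<notin> ?R\<^sup>+"
      using acyclic_minimal(1)[OF finR ac S(2)] by blast
    then have "t \<in> fst ` A" using S unfolding C_def by blast
    then obtain e where e: "(t, e) \<in> M" unfolding A_def by force
    then have e2: "e \<subseteq> t" "card e = 2" "e \<in> \<Delta>" using mem[OF e] card_Tr S(1) t(1) by auto
    have "t' = t" if t': "t' \<in> S" "e \<subseteq> t'" for t'
    proof (rule ccontr)
      assume ne: "t' \<noteq> t"
      have "t' \<in> \<Delta>" using t' S(1) Tr_subset by blast
      then have "(t', e) \<in> hasse \<Delta>" using hasseI e2 t' S(1) card_Tr by auto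
      moreover have "(t', e) \<notin> M" using M2[OF e2(3) e, of "(t', e)"] ne by (auto simp: incident_def)
      ultimately have "(t', e) \<in> ?R" by (auto simp: hasse_reversed_def)
      moreover have "(e, t) \<in> ?R" using e by (auto simp: hasse_reversed_def)
      ultimately have "(t', t) \<in> ?R\<^sup>+" by (meson r_into_trancl trancl_into_trancl)
      then show False using t(2) t'(1) by blast
    qed
    then show "\<exists>t\<in>S. \<exists>e\<subseteq>t. card e = 2 \<and> (\<forall>t'\<in>S. e \<subseteq> t' \<longrightarrow> t' = t)" using t(1) e2 by blast
  qed
  ultimately show ?thesis unfolding C_def by blast
qed

text \<open>Each erased triangle is matched with its free edge. The remaining edges still connect
  all vertices, so they contain a spanning tree, and each vertex except the root is matched with the
  edge to its parent. Two faces are saved per arc, with \<open>card Tr - card C\<close> arcs of the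
  first kind and one arc of the second kind for every vertex but one; this gives the count.\<close>

lemma erasable_imp_morse:
  assumes con: "connected_complex \<Delta>" and C: "C \<subseteq> Tr" "erasable Tr C"
  shows "\<exists>M. morse_matching \<Delta> M \<and>
    card (critical_faces \<Delta> M) + card (skel 1 Tr) + card Tr = card (skel 2 Tr) + 2 * card C + 2"
proof -
  let ?S = "Tr - C"
  have finS: "finite ?S" using finite_Tr by simp
  obtain rk :: "'a set \<Rightarrow> nat" and ed where
    ed0: "\<forall>t\<in>?S. ed t \<subseteq> t \<and> card (ed t) = 2"
    and rk0: "\<forall>t\<in>?S. \<forall>t'\<in>?S. t' \<noteq> t \<longrightarrow> ed t \<subseteq> t' \<longrightarrow> rk t < rk t'"
    and con0: "\<forall>X. (\<forall>t\<in>?S. \<forall>e\<subseteq>t. card e = 2 \<longrightarrow> e \<in> X) \<longrightarrow> (edge_graph X)\<^sup>* \<subseteq> (edge_graph (X - ed ` ?S))\<^sup>*"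
  proof -
    have "\<exists>t\<in>S'. \<exists>e\<subseteq>t. card e = 2 \<and> (\<forall>t'\<in>S'. e \<subseteq> t' \<longrightarrow> t' = t)" if S': "S' \<subseteq> ?S" "S' \<noteq> {}" for S'
    proof -
      have "S' \<subseteq> Tr" "S' \<inter> C = {}" using S' by auto
      then show ?thesis using C(2)[unfolded erasable_def, rule_format, OF _ S'(2)] by simp
    qed
    moreover have "card t = 3" if "t \<in> ?S" for t using card_Tr that by blast
    ultimately have "\<exists>(rk :: 'a set \<Rightarrow> nat) ed. (\<forall>t\<in>?S. ed t \<subseteq> t \<and> card (ed t) = 2) \<and>
     (\<forall>t\<in>?S. \<forall>t'\<in>?S. t' \<noteq> t \<longrightarrow> ed t \<subseteq> t' \<longrightarrow> rk t < rk t') \<and>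
     (\<forall>X. (\<forall>t\<in>?S. \<forall>e\<subseteq>t. card e = 2 \<longrightarrow> e \<in> X) \<longrightarrow> (edge_graph X)\<^sup>* \<subseteq> (edge_graph (X - ed ` ?S))\<^sup>*)"
      by (intro erasing_order[OF finS])
    then show ?thesis by (elim exE conjE) (rule that)
  qed
  note ed = ed0[rule_format] and rk = rk0[rule_format] and con' = con0[THEN spec, THEN mp]
  have edE: "ed t \<in> skel 2 Tr" if "t \<in> ?S" for t
    using ed[OF that] that by (auto simp: skel_def complex_of_def)
  have inj: "inj_on ed ?S"
  proof (rule inj_onI, rule ccontr)
    fix t t' assume tt: "t \<in> ?S" "t' \<in> ?S" "ed t = ed t'" "t \<noteq> t'"
    then have "rk t < rk t'" "rk t' < rk t" using rk[of t t'] rk[of t' t] ed[of t] ed[of t'] by auto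
    then show False by simp
  qed
  define X where "X = skel 2 Tr - ed ` ?S"
  let ?V = "\<Union>\<Delta>"
  obtain r where r: "r \<in> ?V" using Tr_ne Tr_subset card_Tr by (metis Union_iff card.empty ex_in_conv subsetD zero_neq_numeral)
  have cg: "complex_graph \<Delta> = edge_graph (skel 2 Tr)"
    by (auto simp: complex_graph_def edge_graph_def skel_def)
  have "(r, v) \<in> (edge_graph X)\<^sup>*" if "v \<in> ?V" for v
  proof -
    have "(r, v) \<in> (edge_graph (skel 2 Tr))\<^sup>*" using con r that unfolding connected_complex_def cg by blast
    moreover have "\<forall>t\<in>?S. \<forall>e\<subseteq>t. card e = 2 \<longrightarrow> e \<in> skel 2 Tr"
      by (auto simp: skel_def complex_of_def)
    ultimately show ?thesis using con'[of "skel 2 Tr"] unfolding X_def by blast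
  qed
  then obtain d :: "'a \<Rightarrow> nat" and p where d0: "d r = 0"
    and dp: "\<And>v. v \<in> ?V \<Longrightarrow> v \<noteq> r \<Longrightarrow> {v, p v} \<in> X \<and> p v \<noteq> v \<and> d v = Suc (d (p v))"
    using spanning_tree[of ?V r X] by blast
  let ?W = "?V - {r}"
  define te where "te v = {v, p v}" for v
  have teX: "te v \<in> X" "te v \<in> \<Delta>" "card (te v) = 2" if "v \<in> ?W" for v
    using dp[of v] that unfolding te_def X_def skel_def by auto
  have te_inj: "v = u" if "v \<in> ?W" "u \<in> ?W" "te v = te u" for u v
  proof (rule ccontr)
    assume "v \<noteq> u"
    then have "v = p u \<and> p v = u" using that(3) unfolding te_def doubleton_eq_iff by blast
    moreover have "d v = Suc (d (p v))" "d u = Suc (d (p u))" using dp[of v] dp[of u] that(1,2) by blast+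
    ultimately have "d v = Suc (d u)" "d u = Suc (d v)" by metis+
    then show False by linarith
  qed
  have sing: "{v} \<in> \<Delta>" if "v \<in> ?V" for v using that by (auto simp: complex_of_def)
  define MA where "MA = (\<lambda>t. (t, ed t)) ` ?S"
  define MB where "MB = (\<lambda>v. (te v, {v})) ` ?W"
  define M where "M = MA \<union> MB"
  have "M \<subseteq> hasse \<Delta>"
  proof
    fix a assume "a \<in> M"
    then consider t where "t \<in> ?S" "a = (t, ed t)" | v where "v \<in> ?W" "a = (te v, {v})"
      unfolding M_def MA_def MB_def by blast
    then show "a \<in> hasse \<Delta>"
    proof cases
      case 1
      then show ?thesis using edE[OF 1(1)] ed[OF 1(1)] card_Tr[of t] Tr_subset by (auto simp: skel_def intro!: hasseI)
    next
      case 2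
      then show ?thesis using teX[OF 2(1)] sing[of v] by (auto intro!: hasseI simp: te_def)
    qed
  qed
  have c3: "card t = 3" "card (ed t) = 2" if "t \<in> ?S" for t using card_Tr ed that by auto
  have disjX: "te v \<noteq> ed t" if "v \<in> ?W" "t \<in> ?S" for v t using teX[OF that(1)] that(2) unfolding X_def by auto
  have match: "a = b" if "a \<in> M" "b \<in> M" "incident F a" "incident F b" for F a b
  proof -
    have cases: "(\<exists>t\<in>?S. a = (t, ed t)) \<or> (\<exists>v\<in>?W. a = (te v, {v}))" if "a \<in> M" for a
      using that unfolding M_def MA_def MB_def by blast
    consider t t' where "t \<in> ?S" "a = (t, ed t)" "t' \<in> ?S" "b = (t', ed t')"
      | t v where "t \<in> ?S" "a = (t, ed t)" "v \<in> ?W" "b = (te v, {v})"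
      | t v where "t \<in> ?S" "b = (t, ed t)" "v \<in> ?W" "a = (te v, {v})"
      | v u where "v \<in> ?W" "a = (te v, {v})" "u \<in> ?W" "b = (te u, {u})"
      using cases[OF \<open>a \<in> M\<close>] cases[OF \<open>b \<in> M\<close>] by blast
    then show ?thesis
    proof cases
      case 1
      have "F = t \<or> F = ed t" "F = t' \<or> F = ed t'" using that(3,4) unfolding incident_def 1(2) 1(4) by simp_all
      then have "t = t' \<or> ed t = ed t' \<or> t = ed t' \<or> t' = ed t" by metis
      moreover have "t \<noteq> ed t'" "t' \<noteq> ed t" using c3[OF 1(1)] c3[OF 1(3)] by auto
      ultimately have "t = t'" using inj 1 by (auto dest: inj_onD)
      then show ?thesis using 1 by simp
    next
      case 2
      have F: "F = t \<or> F = ed t" "F = te v \<or> F = {v}"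
        using that(3) that(4) unfolding incident_def 2(2) 2(4) by simp_all
      have "card F = 3 \<or> card F = 2 \<and> F = ed t" using F(1) c3[OF 2(1)] by (elim disjE) simp_all
      moreover have "card F = 2 \<and> F = te v \<or> card F = 1" using F(2) teX(3)[OF 2(3)] by (elim disjE) simp_all
      ultimately have False using disjX[OF 2(3,1)] by auto
      then show ?thesis ..
    next
      case 3
      have F: "F = t \<or> F = ed t" "F = te v \<or> F = {v}"
        using that(4) that(3) unfolding incident_def 3(2) 3(4) by simp_all
      have "card F = 3 \<or> card F = 2 \<and> F = ed t" using F(1) c3[OF 3(1)] by (elim disjE) simp_all
      moreover have "card F = 2 \<and> F = te v \<or> card F = 1" using F(2) teX(3)[OF 3(3)] by (elim disjE) simp_all
      ultimately have False using disjX[OF 3(3,1)] by auto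
      then show ?thesis ..
    next
      case 4
      have F: "F = te v \<or> F = {v}" "F = te u \<or> F = {u}"
        using that(3,4) unfolding incident_def 4(2) 4(4) by simp_all
      have h1: "card F = 2 \<and> F = te v \<or> card F = 1 \<and> F = {v}" using F(1) teX(3)[OF 4(1)] by (elim disjE) simp_all
      have h2: "card F = 2 \<and> F = te u \<or> card F = 1 \<and> F = {u}" using F(2) teX(3)[OF 4(3)] by (elim disjE) simp_all
      have "te v = te u \<or> v = u"
      proof (cases "card F = 2")
        case True
        then have "card F \<noteq> 1" by simp
        then have "F = te v" "F = te u" using h1 h2 by blast+
        then show ?thesis by metis
      next
        case False
        then have "F = {v}" "F = {u}" using h1 h2 by blast+
        then show ?thesis by (metis singleton_inject)
      qed
      then have "v = u" using te_inj 4 by blast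
      then show ?thesis using 4 by simp
    qed
  qed
  have hm: "hasse_matching \<Delta> M" unfolding hasse_matching_def
  proof (intro conjI ballI impI)
    fix F a b assume "a \<in> M" "b \<in> M" "incident F a \<and> incident F b"
    then show "a = b" using match[of a b F] by simp
  qed fact
  have finV: "finite ?V" using finite_complex finite_face by (rule finite_Union)
  define K where "K = 2 * (\<Sum>v\<in>?V. d v) + 2"
  have dK: "2 * d v + 1 < K" if "v \<in> ?V" for v
    using member_le_sum[OF that _ finV, of d] unfolding K_def by simp
  define Rm where "Rm = (\<Sum>t\<in>?S. rk t)"
  have rkR: "rk t \<le> Rm" if "t \<in> ?S" for t
    unfolding Rm_def by (rule member_le_sum[OF that _ finS]) auto
  \<comment> \<open>A potential that decreases along every arc: vertices and tree edges are ordered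
    by depth, the other unmatched edges come just below \<open>K\<close>, erased triangles with
    their edges are ordered by rank above it, and \<open>C\<close> comes on top. A matched edge sits
    one above its triangle, a tree edge one below its lower end.\<close>
  define \<phi> where "\<phi> F = (if card F = 3 then (if F \<in> C then K + 2 * Rm + 2 else K + 2 * rk F)
     else if card F = 2 then (if F \<in> ed ` ?S then K + 2 * rk (inv_into ?S ed F) + 1
       else if F \<in> te ` ?W then 2 * d (inv_into ?W te F) - 1 else K - 1)
     else 2 * d (the_elem F))" for F
  have \<phi>t: "\<phi> t = K + 2 * rk t" if "t \<in> ?S" for t using c3[OF that] that by (simp add: \<phi>_def)
  have \<phi>e: "\<phi> (ed t) = K + 2 * rk t + 1" if "t \<in> ?S" for t
    using c3[OF that] that inv_into_f_f[OF inj that] by (simp add: \<phi>_def)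
  have \<phi>te: "\<phi> (te v) = 2 * d v - 1" if "v \<in> ?W" for v
  proof -
    have "inj_on te ?W" using te_inj by (auto intro!: inj_onI)
    then have "inv_into ?W te (te v) = v" using that by (rule inv_into_f_f)
    moreover have "te v \<notin> ed ` ?S" using disjX that by auto
    ultimately show ?thesis using teX(3)[OF that] that by (simp add: \<phi>_def)
  qed
  have \<phi>v: "\<phi> {v} = 2 * d v" for v by (simp add: \<phi>_def)
  have \<phi>X: "\<phi> e < K" if "e \<in> X" for e
  proof -
    have c2: "card e = 2" "e \<notin> ed ` ?S" using that unfolding X_def skel_def by auto
    show ?thesis
    proof (cases "e \<in> te ` ?W")
      case True
      then obtain v where "v \<in> ?W" "e = te v" by blast
      then show ?thesis using \<phi>te dK[of v] by auto
    next
      case False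
      then show ?thesis using c2 by (simp add: \<phi>_def K_def)
    qed
  qed
  have "\<phi> b < \<phi> a" if ab: "(a, b) \<in> hasse_reversed \<Delta> M" for a b
  proof (cases "(b, a) \<in> M")
    case True
    then consider t where "t \<in> ?S" "b = t" "a = ed t" | v where "v \<in> ?W" "b = te v" "a = {v}"
      unfolding M_def MA_def MB_def by blast
    then show ?thesis
    proof cases
      case 1
      then show ?thesis using \<phi>t \<phi>e by simp
    next
      case 2
      then show ?thesis using \<phi>te \<phi>v dp[of v] by simp
    qed
  next
    case False
    then have ab': "(a, b) \<in> hasse \<Delta>" "(a, b) \<notin> M" using ab by (auto simp: hasse_reversed_def)
    note h = hasse_card[OF ab'(1)]
    then have "card b = 1 \<or> card b = 2" using card_face[of a] card_face[of b] by auto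
    then show ?thesis
    proof
      assume b1: "card b = 1"
      then obtain v where v: "b = {v}" by (metis card_1_singletonE)
      have vV: "v \<in> ?V" using h v by blast
      have aE: "a \<in> skel 2 Tr" using h b1 by (auto simp: skel_def)
      show ?thesis
      proof (cases "a \<in> te ` ?W")
        case True
        then obtain u where u: "u \<in> ?W" "a = te u" by blast
        then have "u \<noteq> v" using ab'(2) v unfolding M_def MB_def by auto
        then have "v = p u" using h v u by (auto simp: te_def)
        then show ?thesis using dp[of u] u \<phi>te[OF u(1)] \<phi>v v by auto
      next
        case False
        show ?thesis
        proof (cases "a \<in> ed ` ?S")
          case True
          then show ?thesis using \<phi>e \<phi>v v dK[OF vV] by auto
        next
          case False
          have "\<phi> a = K - 1" using False \<open>a \<notin> te ` ?W\<close> aE by (simp add: \<phi>_def skel_def)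
          then show ?thesis using \<phi>v v dK[OF vV] by auto
        qed
      qed
    next
      assume b2: "card b = 2"
      then have aT: "a \<in> Tr" using h card_face_3[of a] by auto
      have bE: "b \<in> skel 2 Tr" using h b2 by (simp add: skel_def)
      have aK: "K \<le> \<phi> a" using card_Tr[OF aT] by (simp add: \<phi>_def)
      show ?thesis
      proof (cases "b \<in> ed ` ?S")
        case False
        then have "b \<in> X" using bE by (simp add: X_def)
        then show ?thesis using \<phi>X aK by fastforce
      next
        case True
        then obtain t where t: "t \<in> ?S" "b = ed t" by blast
        show ?thesis
        proof (cases "a \<in> C")
          case True
          then show ?thesis using \<phi>e[OF t(1)] t rkR[OF t(1)] card_Tr[OF aT] by (simp add: \<phi>_def)
        next
          case False
          have "a \<noteq> t" using ab'(2) t unfolding M_def MA_def by auto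
          then have "rk t < rk a" using rk[OF t(1), of a] False aT h t by auto
          then show ?thesis using \<phi>e[OF t(1)] \<phi>t[of a] False aT t by auto
        qed
      qed
    qed
  qed
  then have "acyclic (hasse_reversed \<Delta> M)" by (rule acyclicI_order)
  then have mm: "morse_matching \<Delta> M" using hm by (simp add: morse_matching_def)
  have "card M = card MA + card MB"
    unfolding M_def
  proof (rule card_Un_disjoint)
    show "finite MA" "finite MB" using finS finV by (auto simp: MA_def MB_def)
    show "MA \<inter> MB = {}" unfolding MA_def MB_def using c3 teX by force
  qed
  moreover have "card MA = card Tr - card C"
    unfolding MA_def using C(1) finite_Tr by (subst card_image) (auto simp: inj_on_def card_Diff_subset finite_subset)
  moreover have "card MB = card ?V - 1"
    unfolding MB_def using r finV by (subst card_image) (auto simp: inj_on_def)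
  moreover have "card ?V = card (skel 1 Tr)"
  proof -
    have "skel 1 Tr = (\<lambda>v. {v}) ` ?V"
      using sing by (auto simp: skel_def card_1_singleton_iff)
    then show ?thesis by (simp add: card_image)
  qed
  moreover have "card ?V \<ge> 1" using r finV by (metis One_nat_def Suc_leI card_gt_0_iff empty_iff)
  moreover have "card C \<le> card Tr" using card_mono[OF finite_Tr C(1)] .
  ultimately show ?thesis using card_critical[OF hm] card_complex mm by (intro exI[of _ M]) linarith
qed

theorem morse_bound_iff:
  assumes "connected_complex \<Delta>"
  shows "(\<exists>M. morse_matching \<Delta> M \<and> card (critical_faces \<Delta> M) \<le>
      (card (skel 2 Tr) + 2 * m + 2) - (card (skel 1 Tr) + card Tr)) \<longleftrightarrow>
    (\<exists>C\<subseteq>Tr. card C \<le> m \<and> erasable Tr C)"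
proof
  assume "\<exists>C\<subseteq>Tr. card C \<le> m \<and> erasable Tr C"
  then obtain C where C: "C \<subseteq> Tr" "card C \<le> m" "erasable Tr C" by blast
  from erasable_imp_morse[OF assms C(1,3)] C(2)
  show "\<exists>M. morse_matching \<Delta> M \<and> card (critical_faces \<Delta> M) \<le>
      (card (skel 2 Tr) + 2 * m + 2) - (card (skel 1 Tr) + card Tr)" by fastforce
qed (use morse_imp_erasable in blast)

end

section \<open>Embedding into three-space\<close>

definition hat :: "real \<Rightarrow> real \<Rightarrow> real \<Rightarrow> real" where
  "hat a b c = max 0 (1 + min 0 (min a (min b c)) - max 0 (max a (max b c)))"

lemma hat_perm: "hat a b c = hat a c b" "hat a b c = hat b a c" "hat a b c = hat b c a" "hat a b c = hat c a b" "hat a b c = hat c b a"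
  by (auto simp: hat_def min.commute min.left_commute max.commute max.left_commute)

lemma hat_eq_0:
  assumes "a \<ge> 1 \<or> a \<le> -1 \<or> b \<ge> 1 \<or> b \<le> -1 \<or> c \<ge> 1 \<or> c \<le> -1"
  shows "hat a b c = 0"
  using assms unfolding hat_def by linarith

text \<open>
  The triangle has the vertices \<open>p\<close>, \<open>p + e\<^sub>1\<close>, \<open>p + e\<^sub>1 + e\<^sub>2\<close>; the differences \<open>p - v\<close> to a lattice point
  \<open>v\<close> are \<open>i\<close>, \<open>j\<close>, \<open>k\<close>. So \<open>hat\<close> is the piecewise linear hat function of the Kuhn triangulation.
\<close>

lemma hat_barycentric:
  fixes i j k :: int and \<alpha> \<beta> \<gamma> :: real
  assumes "\<alpha> \<ge> 0" "\<beta> \<ge> 0" "\<gamma> \<ge> 0" "\<alpha> + \<beta> + \<gamma> = 1"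
  shows "hat (i + \<beta> + \<gamma>) (j + \<gamma>) k =
    (if i = 0 \<and> j = 0 \<and> k = 0 then \<alpha> else if i = -1 \<and> j = 0 \<and> k = 0 then \<beta>
     else if i = -1 \<and> j = -1 \<and> k = 0 then \<gamma> else 0)"
proof -
  have big: "real_of_int n \<ge> 1" if "n \<ge> 1" for n using that by simp
  have small: "real_of_int n \<le> -2" if "n \<le> -2" for n
    using that by (metis of_int_le_iff of_int_minus of_int_numeral)
  have small1: "real_of_int n \<le> -1" if "n \<le> -1" for n
    using that by (metis of_int_le_iff of_int_minus of_int_1)
  consider "k \<ge> 1 \<or> k \<le> -1" | "i \<ge> 1" | "i \<le> -2" | "j \<ge> 1" | "j \<le> -2"
    | "k = 0" "i = 0" "j = 0" | "k = 0" "i = -1" "j = 0" | "k = 0" "i = -1" "j = -1" | "k = 0" "i = 0" "j = -1"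
    by linarith
  then show ?thesis
  proof cases
    case 1
    then have "hat (i + \<beta> + \<gamma>) (j + \<gamma>) k = 0" by (intro hat_eq_0) (use big[of k] small1[of k] in auto)
    then show ?thesis using 1 by auto
  next
    case 2
    then have "hat (i + \<beta> + \<gamma>) (j + \<gamma>) k = 0" by (intro hat_eq_0) (use big[of i] assms in auto)
    then show ?thesis using 2 by auto
  next
    case 3
    then have "hat (i + \<beta> + \<gamma>) (j + \<gamma>) k = 0" by (intro hat_eq_0) (use small[of i] assms in auto)
    then show ?thesis using 3 by auto
  next
    case 4
    then have "hat (i + \<beta> + \<gamma>) (j + \<gamma>) k = 0" by (intro hat_eq_0) (use big[of j] assms in auto)
    then show ?thesis using 4 by auto
  next
    case 5
    then have "hat (i + \<beta> + \<gamma>) (j + \<gamma>) k = 0" by (intro hat_eq_0) (use small[of j] assms in auto)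
    then show ?thesis using 5 by auto
  qed (use assms in \<open>simp_all add: hat_def min_def max_def\<close>)
qed

text \<open>The hat functions of the vertices recover the barycentric coordinates from the image
  point. This continuous inverse replaces any comparison of pairs of triangles in space.\<close>

lemma (in pure_2_complex) embeddable_if_kuhn:
  fixes X :: "nat \<Rightarrow> 'a \<Rightarrow> int"
  assumes inj: "\<And>u v. X 0 u = X 0 v \<Longrightarrow> X 1 u = X 1 v \<Longrightarrow> X 2 u = X 2 v \<Longrightarrow> u = v"
    and kuhn: "\<And>t. t \<in> Tr \<Longrightarrow> \<exists>A B C i j k. t = {A, B, C} \<and>
      (i, j, k) \<in> {(0, 1, 2), (0, 2, 1), (1, 0, 2), (1, 2, 0), (2, 0, 1), (2, 1, 0)} \<and>
      X i B = X i A + 1 \<and> X j B = X j A \<and> X k B = X k A \<and>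
      X i C = X i A + 1 \<and> X j C = X j A + 1 \<and> X k C = X k A"
  shows "embeddable_in_R3 \<Delta>"
proof -
  let ?V = "\<Union>\<Delta>" and ?S = "geometric_realization \<Delta>"
  have finV: "finite ?V" using finite_complex finite_face by (rule finite_Union)
  define s where "s n x = (\<Sum>v\<in>?V. x v * of_int (X n v))" for n and x :: "'a \<Rightarrow> real"
  define f :: "('a \<Rightarrow> real) \<Rightarrow> real ^ 3" where "f x = (\<chi> n. if n = 1 then s 0 x else if n = 2 then s 1 x else s 2 x)" for x
  define g where "g p v = (if v \<in> ?V then hat (p $ 1 - of_int (X 0 v)) (p $ 2 - of_int (X 1 v)) (p $ 3 - of_int (X 2 v)) else 0)"
    for p :: "real ^ 3" and v
  have f_nth: "f x $ 1 = s 0 x" "f x $ 2 = s 1 x" "f x $ 3 = s 2 x" for x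
    by (simp_all add: f_def)
  have gf: "g (f x) = x" if x: "x \<in> ?S" for x
  proof
    fix v
    have pos: "\<And>v. 0 \<le> x v" and supp: "{v. x v \<noteq> 0} \<in> \<Delta>" and sum1: "(\<Sum>v\<in>?V. x v) = 1"
      using x by (auto simp: geometric_realization_def)
    then obtain t where t: "t \<in> Tr" "{v. x v \<noteq> 0} \<subseteq> t" by (auto simp: complex_of_def)
    have tV: "t \<subseteq> ?V" using t(1) Tr_subset by blast
    have zero: "x u = 0" if "u \<notin> t" for u using t(2) that by blast
    show "g (f x) v = x v"
    proof (cases "v \<in> ?V")
      case False
      then show ?thesis using zero[of v] tV by (auto simp: g_def)
    next
      case True
      obtain A B C i j k where tri: "t = {A, B, C}"
        and ijk: "(i, j, k) \<in> {(0, 1, 2), (0, 2, 1), (1, 0, 2), (1, 2, 0), (2, 0, 1), (2, 1, 0)}"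
        and co: "X i B = X i A + 1" "X j B = X j A" "X k B = X k A"
          "X i C = X i A + 1" "X j C = X j A + 1" "X k C = X k A"
        using kuhn[OF t(1)] by blast
      have ne: "A \<noteq> B" "A \<noteq> C" "B \<noteq> C" using co by auto
      have restr: "(\<Sum>u\<in>?V. x u * h u) = x A * h A + x B * h B + x C * h C" for h
      proof -
        have "(\<Sum>u\<in>?V. x u * h u) = (\<Sum>u\<in>t. x u * h u)"
          by (rule sum.mono_neutral_right[OF finV tV]) (use zero in auto)
        then show ?thesis using ne by (simp add: tri algebra_simps)
      qed
      have abc: "x A + x B + x C = 1" using sum1 restr[of "\<lambda>_. 1"] by simp
      have si: "s i x - of_int (X i v) = of_int (X i A - X i v) + x B + x C"
      proof -
        have "s i x = (x A + x B + x C) * of_int (X i A) + x B + x C"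
          unfolding s_def restr co by (simp add: algebra_simps)
        then show ?thesis by (simp add: abc)
      qed
      have sj: "s j x - of_int (X j v) = of_int (X j A - X j v) + x C"
      proof -
        have "s j x = (x A + x B + x C) * of_int (X j A) + x C"
          unfolding s_def restr co by (simp add: algebra_simps)
        then show ?thesis by (simp add: abc)
      qed
      have sk: "s k x - of_int (X k v) = of_int (X k A - X k v)"
      proof -
        have "s k x = (x A + x B + x C) * of_int (X k A)"
          unfolding s_def restr co by (simp add: algebra_simps)
        then show ?thesis by (simp add: abc)
      qed
      have "g (f x) v = hat (s 0 x - of_int (X 0 v)) (s 1 x - of_int (X 1 v)) (s 2 x - of_int (X 2 v))"
        using True by (simp add: g_def f_nth)
      \<comment> \<open>The hat function is symmetric, so the order in which the triangle uses the
        axes does not matter.\<close>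
      also have "\<dots> = hat (s i x - of_int (X i v)) (s j x - of_int (X j v)) (s k x - of_int (X k v))"
        using ijk hat_perm by auto
      also have "\<dots> = (if X i A - X i v = 0 \<and> X j A - X j v = 0 \<and> X k A - X k v = 0 then x A
         else if X i A - X i v = -1 \<and> X j A - X j v = 0 \<and> X k A - X k v = 0 then x B
         else if X i A - X i v = -1 \<and> X j A - X j v = -1 \<and> X k A - X k v = 0 then x C else 0)"
        unfolding si sj sk by (rule hat_barycentric) (use pos abc in auto)
      also have "\<dots> = x v"
      proof -
        have inj': "u = v" if "X i u = X i v" "X j u = X j v" "X k u = X k v" for u
          using that ijk by (intro inj) auto
        have "X i A - X i v = 0 \<and> X j A - X j v = 0 \<and> X k A - X k v = 0 \<longleftrightarrow> v = A"
          using inj'[of A] by auto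
        moreover have "X i A - X i v = -1 \<and> X j A - X j v = 0 \<and> X k A - X k v = 0 \<longleftrightarrow> v = B"
          using inj'[of B] co by auto
        moreover have "X i A - X i v = -1 \<and> X j A - X j v = -1 \<and> X k A - X k v = 0 \<longleftrightarrow> v = C"
          using inj'[of C] co by auto
        moreover have "x v = 0" if "v \<noteq> A" "v \<noteq> B" "v \<noteq> C" using zero[of v] that tri by simp
        ultimately show ?thesis by auto
      qed
      finally show ?thesis .
    qed
  qed
  have "continuous_on ?S (\<lambda>x. x v)" for v :: 'a
    by (rule continuous_on_subset[OF continuous_on_product_coordinates]) simp
  then have sc: "continuous_on ?S (s n)" for n
    unfolding s_def by (intro continuous_intros)
  have "continuous_on ?S f"
    unfolding f_def
  proof (rule continuous_on_vec_lambda)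
    fix n :: 3
    show "continuous_on ?S (\<lambda>x. if n = 1 then s 0 x else if n = 2 then s 1 x else s 2 x)"
      by (cases "n = 1"; cases "n = 2") (simp_all add: sc)
  qed
  moreover have "continuous_on (f ` ?S) g"
  proof (rule continuous_on_coordinatewise_then_product)
    fix v show "continuous_on (f ` ?S) (\<lambda>p. g p v)"
      unfolding g_def hat_def by (cases "v \<in> ?V") (auto intro!: continuous_intros)
  qed
  ultimately have "homeomorphism ?S (f ` ?S) f g"
    unfolding homeomorphism_def using gf by force
  then show ?thesis unfolding embeddable_in_R3_def homeomorphic_def by blast
qed

section \<open>Horn systems on pieces\<close>

datatype piece = Plate nat | TubeA nat nat nat | TubeB nat nat nat

text \<open>One clause for each way in which an edge with three squares of different pieces can set
  a piece free. The two backward clauses are unwanted, but an edge where three pieces meet cannot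
  tell which of them is the conclusion.\<close>

inductive_set derived :: "nat \<Rightarrow> (nat \<Rightarrow> nat \<Rightarrow> nat \<Rightarrow> bool) \<Rightarrow> piece set \<Rightarrow> piece set"
  for N rl P where
  seed: "p \<in> P \<Longrightarrow> p \<in> derived N rl P"
| copyL: "Plate (N + a) \<in> derived N rl P \<Longrightarrow> a < N \<Longrightarrow> Plate a \<in> derived N rl P"
| copyR: "Plate (N + a) \<in> derived N rl P \<Longrightarrow> a < N \<Longrightarrow> Plate (2 * N + a) \<in> derived N rl P"
| tubeA: "rl x y z \<Longrightarrow> Plate x \<in> derived N rl P \<Longrightarrow> TubeA x y z \<in> derived N rl P"
| tubeB: "rl x y z \<Longrightarrow> Plate (2 * N + y) \<in> derived N rl P \<Longrightarrow> TubeB x y z \<in> derived N rl P"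
| head: "rl x y z \<Longrightarrow> TubeA x y z \<in> derived N rl P \<Longrightarrow> TubeB x y z \<in> derived N rl P \<Longrightarrow>
    Plate (N + z) \<in> derived N rl P"
| backB: "rl x y z \<Longrightarrow> TubeA x y z \<in> derived N rl P \<Longrightarrow> Plate (N + z) \<in> derived N rl P \<Longrightarrow>
    TubeB x y z \<in> derived N rl P"
| backA: "rl x y z \<Longrightarrow> TubeB x y z \<in> derived N rl P \<Longrightarrow> Plate (N + z) \<in> derived N rl P \<Longrightarrow>
    TubeA x y z \<in> derived N rl P"

definition pieces :: "nat \<Rightarrow> (nat \<Rightarrow> nat \<Rightarrow> nat \<Rightarrow> bool) \<Rightarrow> piece set" where
  "pieces N rl = {Plate v |v. v < 3 * N} \<union> {TubeA x y z |x y z. rl x y z} \<union> {TubeB x y z |x y z. rl x y z}"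

text \<open>There are no axioms, since an erasure without removed triangles never starts; every
  derivation begins with a given fact.\<close>

inductive_set der :: "(nat \<Rightarrow> nat \<Rightarrow> nat \<Rightarrow> bool) \<Rightarrow> nat set \<Rightarrow> nat set" for base G where
  given: "a \<in> G \<Longrightarrow> a \<in> der base G"
| step: "base x y z \<Longrightarrow> x \<in> der base G \<Longrightarrow> y \<in> der base G \<Longrightarrow> z \<in> der base G"

locale guess_system =
  fixes N :: nat and base :: "nat \<Rightarrow> nat \<Rightarrow> nat \<Rightarrow> bool" and U :: "nat \<Rightarrow> bool \<Rightarrow> nat" and acc m :: nat
  assumes base: "base x y z \<Longrightarrow> x < N \<and> y < N \<and> z < N \<and> x \<noteq> acc \<and> y \<noteq> acc"
    and base_U: "base x y (U i b) \<Longrightarrow> i < m \<Longrightarrow> False"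
    and U_inj: "U i b = U j c \<Longrightarrow> i < m \<Longrightarrow> j < m \<Longrightarrow> i = j \<and> b = c"
    and U_less: "i < m \<Longrightarrow> U i b < N" and acc_less: "acc < N" and acc_U: "i < m \<Longrightarrow> acc \<noteq> U i b"
begin

text \<open>
  Once \<open>acc\<close> holds, everything follows, except that one variable of each pair \<open>U i\<close> has to be
  chosen: this is where the number of seeds comes from.
\<close>

definition rl :: "nat \<Rightarrow> nat \<Rightarrow> nat \<Rightarrow> bool" where
  "rl x y z \<longleftrightarrow> base x y z \<or> (x = acc \<and> y = acc \<and> z < N \<and> (\<forall>i<m. z \<noteq> U i True \<and> z \<noteq> U i False)) \<or>
     (\<exists>i<m. (x = U i True \<and> y = acc \<and> z = U i False) \<or> (x = U i False \<and> y = acc \<and> z = U i True))"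

lemma rl_less: "rl x y z \<Longrightarrow> x < N \<and> y < N \<and> z < N"
  using base U_less acc_less unfolding rl_def by blast

lemma rl_group: "i < m \<Longrightarrow> rl (U i b) acc (U i (\<not> b))"
  unfolding rl_def by (cases b) auto

lemma rl_cases:
  assumes "rl x y z"
  obtains "base x y z" | "x = acc" "y = acc" "\<And>i b. i < m \<Longrightarrow> z \<noteq> U i b"
    | i b where "i < m" "x = U i b" "y = acc" "z = U i (\<not> b)"
proof -
  consider "base x y z" | "x = acc \<and> y = acc \<and> (\<forall>i<m. z \<noteq> U i True \<and> z \<noteq> U i False)"
    | i where "i < m" "x = U i True" "y = acc" "z = U i False"
    | i where "i < m" "x = U i False" "y = acc" "z = U i True"
    using assms unfolding rl_def by blast
  then show ?thesis
  proof cases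
    case 2
    then have "z \<noteq> U i b" if "i < m" for i b using that by (cases b) auto
    then show ?thesis using 2 that(2) by blast
  next
    case 3
    then show ?thesis using that(3)[of i True] by simp
  next
    case 4
    then show ?thesis using that(3)[of i False] by simp
  qed (rule that(1))
qed

abbreviation "plates a \<equiv> {Plate a, Plate (N + a), Plate (2 * N + a)}"

lemma seeds_if_accepting:
  assumes acc: "acc \<in> der base ((\<lambda>i. U i (c i)) ` {..<m})"
  shows "pieces N rl \<subseteq> derived N rl ((\<lambda>i. Plate (N + U i (c i))) ` {..<m})" (is "_ \<subseteq> ?D")
proof -
  have der: "Plate (N + a) \<in> ?D" if "a \<in> der base ((\<lambda>i. U i (c i)) ` {..<m})" for a
    using that
  proof induction
    case (given a)
    then show ?case by (auto intro: derived.seed)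
  next
    case (step x y z)
    note b = base[OF step(1)]
    have r: "rl x y z" using step(1) by (simp add: rl_def)
    have "Plate x \<in> ?D" "Plate (2 * N + y) \<in> ?D" using step.IH b by (auto intro: derived.copyL derived.copyR)
    then show ?case using r by (blast intro: derived.head derived.tubeA derived.tubeB)
  qed
  have ru: "Plate (N + z) \<in> ?D" if "rl x y z" "Plate (N + x) \<in> ?D" "Plate (N + y) \<in> ?D" for x y z
    using that rl_less[OF that(1)] by (blast intro: derived.head derived.tubeA derived.tubeB derived.copyL derived.copyR)
  have M: "Plate (N + z) \<in> ?D" if "z < N" for z
  proof (cases "\<exists>i<m. \<exists>b. z = U i b")
    case True
    then obtain i b where i: "i < m" "z = U i b" by blast
    have s: "Plate (N + U i (c i)) \<in> ?D" using i(1) by (auto intro: derived.seed)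
    show ?thesis
    proof (cases "b = c i")
      case False
      then have "b = (\<not> c i)" by blast
      then show ?thesis using ru[OF rl_group[OF i(1), of "c i"] s der[OF acc]] i by simp
    qed (use s i in simp)
  next
    case False
    then have "rl acc acc z" using that unfolding rl_def by blast
    then show ?thesis using ru der[OF acc] by blast
  qed
  have P: "Plate v \<in> ?D" if "v < 3 * N" for v
  proof -
    consider "v < N" | "N \<le> v" "v < 2 * N" | "2 * N \<le> v" by linarith
    then show ?thesis
    proof cases
      case 1
      then show ?thesis using M by (blast intro: derived.copyL)
    next
      case 2
      then show ?thesis using M[of "v - N"] by simp
    next
      case 3
      then show ?thesis using derived.copyR[OF M, of "v - 2 * N"] that by simp
    qed
  qed
  have "TubeA x y z \<in> ?D" "TubeB x y z \<in> ?D" if "rl x y z" for x y z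
    using rl_less[OF that] by (auto intro!: derived.tubeA[OF that P] derived.tubeB[OF that P])
  then show ?thesis unfolding pieces_def using P by auto
qed

text \<open>The pieces that become derivable only through one another: neither value of bit
  \<open>i\<close> can be reached without a seed among them. The tubes \<open>TubeA\<close> between
  the two values are included because a seed there would do as well; the tubes \<open>TubeB\<close>
  are not, as they follow from \<open>acc\<close>.\<close>

definition group :: "nat \<Rightarrow> piece set" where
  "group i = (\<Union>b. insert (TubeA (U i b) acc (U i (\<not> b))) (plates (U i b)))"

lemma group_ne:
  assumes i: "i < m" and all: "pieces N rl \<subseteq> derived N rl P"
  shows "P \<inter> group i \<noteq> {}"
proof
  assume emp: "P \<inter> group i = {}"
  have Plate_in: "Plate v \<in> group i \<longleftrightarrow> (\<exists>b. v = U i b \<or> v = N + U i b \<or> v = 2 * N + U i b)" for v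
    by (auto simp: group_def)
  have Tube_in: "TubeA x y z \<in> group i \<longleftrightarrow> (\<exists>b. x = U i b \<and> y = acc \<and> z = U i (\<not> b))" for x y z
    by (auto simp: group_def)
  have Tube_nin: "TubeB x y z \<notin> group i" for x y z by (auto simp: group_def)
  have "p \<notin> group i" if "p \<in> derived N rl P" for p
    using that
  proof induction
    case (seed p)
    then show ?case using emp by blast
  next
    case (copyL a)
    then show ?case using U_less[OF i] unfolding Plate_in by (metis add_less_same_cancel1 add_lessD1 mult_2 not_add_less1)
  next
    case (copyR a)
    have False if "2 * N + a = U i b \<or> 2 * N + a = N + U i b" for b using that U_less[OF i, of b] by auto
    then show ?case using copyR unfolding Plate_in by (metis add_left_cancel)
  next
    case (tubeA x y z)
    then show ?case unfolding Plate_in Tube_in by blast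
  next
    case (tubeB x y z)
    show ?case by (rule Tube_nin)
  next
    case (head x y z)
    show ?case
    proof
      assume "Plate (N + z) \<in> group i"
      then obtain b where b: "N + z = U i b \<or> N + z = N + U i b \<or> N + z = 2 * N + U i b" unfolding Plate_in by blast
      then have z: "z = U i b" using U_less[OF i, of b] rl_less[OF head(1)] by auto
      from head(1) show False
      proof (cases rule: rl_cases)
        case 1
        then show ?thesis using base_U i z by blast
      next
        case 2
        then show ?thesis using i z by blast
      next
        case (3 j b')
        then have "j = i" using U_inj[of i b j "\<not> b'"] i z by auto
        then have "TubeA x y z \<in> group i" using 3 unfolding Tube_in by blast
        then show ?thesis using head by blast
      qed
    qed
  next
    case (backB x y z)
    show ?case by (rule Tube_nin)
  next
    case (backA x y z)
    then show ?case unfolding Plate_in Tube_in by blast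
  qed
  moreover have "Plate (U i True) \<in> derived N rl P"
    using all U_less[OF i, of True] unfolding pieces_def by auto
  moreover have "Plate (U i True) \<in> group i" by (auto simp: group_def)
  ultimately show False by blast
qed

lemma group_disjoint:
  assumes "i < m" "j < m" "p \<in> group i" "p \<in> group j"
  shows "i = j"
proof -
  have U: "U i b < N" "U j b < N" for b using U_less assms by auto
  have "\<exists>b c. U i b = U j c"
  proof -
    obtain b where b: "p = TubeA (U i b) acc (U i (\<not> b)) \<or> p \<in> plates (U i b)" using assms(3) unfolding group_def by blast
    obtain c where c: "p = TubeA (U j c) acc (U j (\<not> c)) \<or> p \<in> plates (U j c)" using assms(4) unfolding group_def by blast
    have "U i b = U j c" using b c U(1)[of b] U(2)[of c] by auto
    then show ?thesis by blast
  qed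
  then show ?thesis using U_inj assms(1,2) by blast
qed

text \<open>Every group needs a seed and the groups are disjoint. With at most \<open>m\<close>
  seeds, each group therefore has exactly one and there is no seed elsewhere; the seeds determine
  the guessed values.\<close>

lemma accepting_if_seeds:
  assumes fin: "finite P" "card P \<le> m" and all: "pieces N rl \<subseteq> derived N rl P"
  shows "\<exists>c. acc \<in> der base ((\<lambda>i. U i (c i)) ` {..<m})"
proof -
  have "\<forall>i\<in>{..<m}. \<exists>p. p \<in> P \<inter> group i" using group_ne[OF _ all] by blast
  then obtain h where h: "\<And>i. i < m \<Longrightarrow> h i \<in> P \<inter> group i" using bchoice[of "{..<m}"] by (metis lessThan_iff)
  have "inj_on h {..<m}"
  proof (rule inj_onI)
    fix i j assume "i \<in> {..<m}" "j \<in> {..<m}" "h i = h j"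
    then show "i = j" using group_disjoint[of i j "h i"] h[of i] h[of j] by simp
  qed
  then have "card (h ` {..<m}) = m" by (simp add: card_image)
  moreover have sub: "h ` {..<m} \<subseteq> P" using h by blast
  ultimately have Ph: "h ` {..<m} = P" using fin by (metis card_seteq)
  \<comment> \<open>If the seed of a group is a tube, the value \<open>False\<close> is chosen
    arbitrarily: such a seed is of no use before \<open>acc\<close> is derived.\<close>
  define c where "c i \<longleftrightarrow> h i \<in> plates (U i True)" for i
  let ?G = "(\<lambda>i. U i (c i)) ` {..<m}"
  have der_less: "a < N" if "a \<in> der base ?G" for a
    using that by induction (use U_less base in auto)
  have "acc \<in> der base ?G"
  proof (rule ccontr)
    assume nacc: "acc \<notin> der base ?G"
    \<comment> \<open>Invariant as long as \<open>acc\<close> cannot be derived. A tube may have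
      been opened from its premise or, backwards, from its conclusion; the last alternative for
      \<open>TubeA\<close> admits the seeds that lie on tubes.\<close>
    let ?I = "\<lambda>p. case p of
        Plate v \<Rightarrow> \<exists>a\<in>der base ?G. v = a \<or> v = N + a \<or> v = 2 * N + a
      | TubeA x y z \<Rightarrow> x \<in> der base ?G \<or> z \<in> der base ?G \<or> y = acc \<and> (\<exists>i<m. \<exists>b. x = U i b)
      | TubeB x y z \<Rightarrow> y \<in> der base ?G \<or> z \<in> der base ?G"
    have plate: "a \<in> der base ?G" if "?I (Plate (N + a))" "a < N" for a
      using that der_less by auto
    have plateR: "a \<in> der base ?G" if "?I (Plate (2 * N + a))" "a < N" for a
      using that der_less by fastforce
    have plateL: "a \<in> der base ?G" if "?I (Plate a)" "a < N" for a
      using that by auto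
    have "?I p" if "p \<in> derived N rl P" for p
      using that
    proof induction
      case (seed p)
      then obtain i where i: "i < m" "p = h i" using Ph by blast
      then obtain b where b: "p = TubeA (U i b) acc (U i (\<not> b)) \<or> p \<in> plates (U i b)"
        using h[OF i(1)] unfolding group_def by blast
      then show ?case
      proof
        assume "p = TubeA (U i b) acc (U i (\<not> b))"
        then show ?thesis using i(1) by auto
      next
        assume p: "p \<in> plates (U i b)"
        have "b = c i"
        proof (cases b)
          case True
          then show ?thesis using p i unfolding c_def by simp
        next
          case False
          have "p \<notin> plates (U i True)"
          proof
            assume "p \<in> plates (U i True)"
            then have "U i True = U i b" using p U_less[OF i(1), of b] U_less[OF i(1), of True] by auto
            then show False using U_inj[OF _ i(1) i(1)] False by blast
          qed
          then show ?thesis using False i unfolding c_def by simp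
        qed
        then have "U i b \<in> der base ?G" using i(1) by (auto intro: der.given)
        then show ?thesis using p by auto
      qed
    next
      case (copyL a)
      then show ?case using plate[of a] by auto
    next
      case (copyR a)
      then show ?case using plate[of a] by auto
    next
      case (tubeA x y z)
      then show ?case using plateL[of x] rl_less[OF tubeA(1)] by simp
    next
      case (tubeB x y z)
      then show ?case using plateR[of y] rl_less[OF tubeB(1)] by simp
    next
      case (head x y z)
      have "z \<in> der base ?G"
      proof (rule ccontr)
        \<comment> \<open>Without \<open>z\<close>, the second tube can only come from
          \<open>y\<close>, so \<open>y\<close> differs from \<open>acc\<close>. This excludes
          seeded tubes, hence \<open>x\<close> is derivable too.\<close>
        assume nz: "z \<notin> der base ?G"
        then have y: "y \<in> der base ?G" using head.IH(2) by simp
        then have "y \<noteq> acc" using nacc by blast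
        then have x: "x \<in> der base ?G" using head.IH(1) nz by simp
        from head(1) show False
          by (cases rule: rl_cases) (use x y nz nacc in \<open>auto intro: der.step\<close>)
      qed
      then show ?case by auto
    next
      case (backB x y z)
      then show ?case using plate[of z] rl_less[OF backB(1)] by simp
    next
      case (backA x y z)
      then show ?case using plate[of z] rl_less[OF backA(1)] by simp
    qed
    moreover have "Plate (N + acc) \<in> derived N rl P" using all acc_less unfolding pieces_def by auto
    ultimately show False using plate[of acc] acc_less nacc by blast
  qed
  then show ?thesis by blast
qed

end

section \<open>Cubical complexes\<close>

datatype square = Face nat nat nat | Xw nat nat nat | Zw nat nat nat
datatype gedge = Ex nat nat nat | Ey nat nat nat | Ez nat nat nat

definition vx :: "nat \<Rightarrow> nat \<Rightarrow> nat \<Rightarrow> nat" where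
  "vx i y j = prod_encode (i, prod_encode (y, j))"

lemma vx_eq [simp]: "vx i y j = vx i' y' j' \<longleftrightarrow> i = i' \<and> y = y' \<and> j = j'"
  by (simp add: vx_def)

text \<open>Every diagonal runs from the lowest to the highest corner of its square, as in the Kuhn
  triangulation; the two halves differ in the order of the two axes.\<close>

fun tri :: "square \<Rightarrow> bool \<Rightarrow> nat set" where
  "tri (Face i y j) b = {vx i y j, if b then vx (Suc i) y j else vx i y (Suc j), vx (Suc i) y (Suc j)}"
| "tri (Xw i y j) b = {vx i y j, if b then vx i (Suc y) j else vx i y (Suc j), vx i (Suc y) (Suc j)}"
| "tri (Zw i y j) b = {vx i y j, if b then vx (Suc i) y j else vx i (Suc y) j, vx (Suc i) (Suc y) j}"

fun diag :: "square \<Rightarrow> nat set" where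
  "diag (Face i y j) = {vx i y j, vx (Suc i) y (Suc j)}"
| "diag (Xw i y j) = {vx i y j, vx i (Suc y) (Suc j)}"
| "diag (Zw i y j) = {vx i y j, vx (Suc i) (Suc y) j}"

fun eset :: "gedge \<Rightarrow> nat set" where
  "eset (Ex i y j) = {vx i y j, vx (Suc i) y j}"
| "eset (Ey i y j) = {vx i y j, vx i (Suc y) j}"
| "eset (Ez i y j) = {vx i y j, vx i y (Suc j)}"

fun half_sides :: "square \<Rightarrow> bool \<Rightarrow> gedge set" where
  "half_sides (Face i y j) b = (if b then {Ex i y j, Ez (Suc i) y j} else {Ez i y j, Ex i y (Suc j)})"
| "half_sides (Xw i y j) b = (if b then {Ey i y j, Ez i (Suc y) j} else {Ez i y j, Ey i y (Suc j)})"
| "half_sides (Zw i y j) b = (if b then {Ex i y j, Ey (Suc i) y j} else {Ey i y j, Ex i (Suc y) j})"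

definition sides :: "square \<Rightarrow> gedge set" where
  "sides q = half_sides q True \<union> half_sides q False"

lemma card_tri: "card (tri q b) = 3"
  by (cases q; cases b) simp_all

lemma card_diag: "card (diag q) = 2"
  by (cases q) simp_all

lemma card_eset: "card (eset e) = 2"
  by (cases e) simp_all

lemma diag_subset: "diag q \<subseteq> tri q' b \<longleftrightarrow> q' = q"
  by (cases q; cases q'; cases b) auto

lemma eset_subset: "eset e \<subseteq> tri q b \<longleftrightarrow> e \<in> half_sides q b"
  by (cases q; cases e; cases b) auto

lemma half_sides_disjoint: "half_sides q True \<inter> half_sides q False = {}"
  by (cases q) auto

lemma tri_eq: "tri q b = tri q' b' \<longleftrightarrow> q = q' \<and> b = b'"
proof
  assume eq: "tri q b = tri q' b'"
  then have q: "q' = q" using diag_subset[of q q' b'] diag_subset[of q q b] by simp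
  moreover have "b = b'"
  proof (rule ccontr)
    assume "b \<noteq> b'"
    obtain e where "e \<in> half_sides q b" by (cases q; cases b) auto
    then have "e \<in> half_sides q b \<inter> half_sides q b'" using eq q eset_subset by blast
    then show False using half_sides_disjoint[of q] \<open>b \<noteq> b'\<close> by (cases b; cases b') auto
  qed
  ultimately show "q = q' \<and> b = b'" by simp
qed simp

lemma edge_cases:
  assumes "e \<subseteq> tri q b" "card e = 2"
  shows "e = diag q \<or> (\<exists>g\<in>half_sides q b. e = eset g)"
proof -
  obtain x y where e: "e = {x, y}" "x \<noteq> y" using assms(2) by (auto simp: card_2_iff)
  have "x \<in> tri q b" "y \<in> tri q b" using assms(1) e by auto
  then show ?thesis using e(2) unfolding e(1)
    by (cases q; cases b) (auto simp: insert_commute)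
qed

lemma sides_simps:
  "Ex i y j \<in> sides q \<longleftrightarrow> q = Face i y j \<or> (\<exists>j'. j = Suc j' \<and> q = Face i y j') \<or> q = Zw i y j \<or> (\<exists>y'. y = Suc y' \<and> q = Zw i y' j)"
  "Ey i y j \<in> sides q \<longleftrightarrow> q = Xw i y j \<or> (\<exists>j'. j = Suc j' \<and> q = Xw i y j') \<or> q = Zw i y j \<or> (\<exists>i'. i = Suc i' \<and> q = Zw i' y j)"
  "Ez i y j \<in> sides q \<longleftrightarrow> q = Face i y j \<or> (\<exists>i'. i = Suc i' \<and> q = Face i' y j) \<or> q = Xw i y j \<or> (\<exists>y'. y = Suc y' \<and> q = Xw i y' j)"
  by (cases q; auto simp: sides_def)+

definition tris :: "square set \<Rightarrow> nat set set" where
  "tris Q = {tri q b |q b. q \<in> Q}"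

lemma tri_in_tris: "tri q b \<in> tris Q \<longleftrightarrow> q \<in> Q"
  by (auto simp: tris_def tri_eq)

definition stuck :: "square set \<Rightarrow> bool" where
  "stuck A \<longleftrightarrow> (\<forall>g. \<forall>q\<in>A. g \<in> sides q \<longrightarrow> (\<exists>q'\<in>A. g \<in> sides q' \<and> q' \<noteq> q))"

text \<open>A diagonal lies in the two halves of its square and nowhere else. So an obstruction to
  erasing contains both halves of a square or none, and it can be regarded as a set of squares
  without a free side.\<close>

lemma erasable_iff_stuck:
  "erasable (tris Q) C \<longleftrightarrow> (\<forall>A\<subseteq>Q. stuck A \<longrightarrow> (\<forall>q\<in>A. \<forall>b. tri q b \<notin> C) \<longrightarrow> A = {})"
proof
  assume er: "erasable (tris Q) C"
  show "\<forall>A\<subseteq>Q. stuck A \<longrightarrow> (\<forall>q\<in>A. \<forall>b. tri q b \<notin> C) \<longrightarrow> A = {}"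
  proof (intro allI impI, rule ccontr)
    fix A assume A: "A \<subseteq> Q" "stuck A" "\<forall>q\<in>A. \<forall>b. tri q b \<notin> C" "A \<noteq> {}"
    have "tris A \<noteq> {}" using A(4) tri_in_tris[of _ True A] by blast
    moreover have "tris A \<subseteq> tris Q" "tris A \<inter> C = {}" using A(1,3) by (auto simp: tris_def)
    ultimately obtain t e where te: "t \<in> tris A" "e \<subseteq> t" "card e = 2"
      "\<forall>t'\<in>tris A. e \<subseteq> t' \<longrightarrow> t' = t"
      using er[unfolded erasable_def, rule_format, of "tris A"] by meson
    obtain q b where q: "t = tri q b" "q \<in> A" using te(1) by (auto simp: tris_def)
    from edge_cases[OF te(2)[unfolded q(1)] te(3)] show False
    proof
      assume "e = diag q"
      then have "e \<subseteq> tri q (\<not> b)" by (simp add: diag_subset)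
      then have "tri q (\<not> b) = t" using te(4) q(2) tri_in_tris by blast
      then show False using q(1) tri_eq by metis
    next
      assume "\<exists>g\<in>half_sides q b. e = eset g"
      then obtain g where g: "g \<in> half_sides q b" "e = eset g" by blast
      then have "g \<in> sides q" unfolding sides_def by (cases b) auto
      then obtain q' where q': "q' \<in> A" "g \<in> sides q'" "q' \<noteq> q" using A(2) q(2) unfolding stuck_def by blast
      then obtain b' where "g \<in> half_sides q' b'" unfolding sides_def by blast
      then have "e \<subseteq> tri q' b'" using g(2) eset_subset by blast
      then have "tri q' b' = t" using te(4) q'(1) tri_in_tris by blast
      then show False using q(1) q'(3) tri_eq by blast
    qed
  qed
next
  assume st: "\<forall>A\<subseteq>Q. stuck A \<longrightarrow> (\<forall>q\<in>A. \<forall>b. tri q b \<notin> C) \<longrightarrow> A = {}"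
  show "erasable (tris Q) C"
    unfolding erasable_def
  proof (intro allI impI, rule ccontr)
    fix S assume S: "S \<subseteq> tris Q" "S \<noteq> {}" "S \<inter> C = {}"
      and neg: "\<not> (\<exists>t\<in>S. \<exists>e\<subseteq>t. card e = 2 \<and> (\<forall>t'\<in>S. e \<subseteq> t' \<longrightarrow> t' = t))"
    have neg': "\<exists>t'\<in>S. e \<subseteq> t' \<and> t' \<noteq> t" if "t \<in> S" "e \<subseteq> t" "card e = 2" for t e
    proof (rule ccontr)
      assume "\<not> ?thesis"
      then have "\<forall>t'\<in>S. e \<subseteq> t' \<longrightarrow> t' = t" by blast
      then have "\<exists>t\<in>S. \<exists>e\<subseteq>t. card e = 2 \<and> (\<forall>t'\<in>S. e \<subseteq> t' \<longrightarrow> t' = t)"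
        using that by (intro bexI[of _ t] exI[of _ e] conjI)
      then show False using neg by (rule notE[rotated])
    qed
    define A where "A = {q. \<exists>b. tri q b \<in> S}"
    have AQ: "A \<subseteq> Q" using S(1) tri_in_tris unfolding A_def by blast
    have both: "tri q b' \<in> S" if tb: "tri q b \<in> S" for q b b'
    proof (cases "b' = b")
      case False
      obtain t' where t': "t' \<in> S" "diag q \<subseteq> t'" "t' \<noteq> tri q b"
        using neg'[OF tb _ card_diag[of q]] diag_subset[of q q b] by blast
      obtain q2 b2 where t2: "t' = tri q2 b2" using t'(1) S(1) by (auto simp: tris_def)
      have "q2 = q" using t'(2) t2 diag_subset by blast
      then have "b2 \<noteq> b" using t'(3) t2 by blast
      then have "b2 = b'" using False by (cases b; cases b2; cases b') auto
      then show ?thesis using t'(1) t2 \<open>q2 = q\<close> by simp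
    qed (use tb in simp)
    have "stuck A" unfolding stuck_def
    proof (intro allI ballI impI)
      fix g q assume q: "q \<in> A" "g \<in> sides q"
      then obtain b where b: "g \<in> half_sides q b" unfolding sides_def by blast
      have tS: "tri q b \<in> S" using both q(1) unfolding A_def by blast
      have "eset g \<subseteq> tri q b" using b eset_subset by blast
      from neg'[OF tS this card_eset] obtain t' where t': "t' \<in> S" "eset g \<subseteq> t'" "t' \<noteq> tri q b"
        by blast
      obtain q' b' where qb: "t' = tri q' b'" using t'(1) S(1) by (auto simp: tris_def)
      have g': "g \<in> half_sides q' b'" using t'(2) eset_subset qb by blast
      have "q' \<noteq> q"
      proof
        assume "q' = q"
        then have "b' = b" using g' b half_sides_disjoint[of q] by (cases b; cases b') auto
        then show False using t'(3) qb \<open>q' = q\<close> by simp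
      qed
      moreover have "g \<in> sides q'" using g' unfolding sides_def by (cases b') auto
      moreover have "q' \<in> A" using t'(1) qb unfolding A_def by blast
      ultimately show "\<exists>q'\<in>A. g \<in> sides q' \<and> q' \<noteq> q" by blast
    qed
    moreover have "tri q b \<notin> C" if "q \<in> A" for q b
      using both that S(3) unfolding A_def by blast
    ultimately have "A = {}" using st AQ by blast
    then show False using S(1,2) unfolding A_def tris_def by blast
  qed
qed

section \<open>The layout of a Horn system\<close>

locale layout =
  fixes N :: nat and rl :: "nat \<Rightarrow> nat \<Rightarrow> nat \<Rightarrow> bool"
  assumes N_pos: "N > 0" and rl_less: "rl x y z \<Longrightarrow> x < N \<and> y < N \<and> z < N"
begin

text \<open>
  Plate \<open>v\<close> is a flat box with front, middle and back face at the heights \<open>3 v\<close>, \<open>3 v + 1\<close>, \<open>3 v + 2\<close>;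
  the middle face splits it into two rooms. Columns of width \<open>7\<close> are numbered from \<open>1\<close> to
  \<open>ncols\<close>. The residue of the column number modulo \<open>5\<close> is its kind: in columns of kind 0
  (kind 1) all plates have a tunnel from behind to the front room (from the front to the back room);
  column kind 2 realizes a rule by a tube from plate \<open>lo\<close> through plate \<open>mid\<close>, where the front face
  of \<open>mid\<close> ends on the tube, to plate \<open>hi\<close>; columns of kind 3 and 4 copy plate \<open>N + a\<close> to \<open>a\<close> and
  to \<open>2 N + a\<close>, by a tube which is part of the copy. Where a tube ends on a plate, a tunnel in that
  plate keeps its surface connected.
\<close>

definition ncols :: nat where "ncols = 5 * (N * N * N)"
definition cx :: "nat \<Rightarrow> nat" where "cx r = (r div 5) mod N"
definition cy :: "nat \<Rightarrow> nat" where "cy r = (r div 5) div N mod N"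
definition cz :: "nat \<Rightarrow> nat" where "cz r = (r div 5) div N div N mod N"
definition is_and :: "nat \<Rightarrow> bool" where "is_and r \<longleftrightarrow> r mod 5 = 2 \<and> rl (cx r) (cy r) (cz r)"
definition has_tube :: "nat \<Rightarrow> bool" where "has_tube r \<longleftrightarrow> is_and r \<or> r mod 5 = 3 \<or> r mod 5 = 4"
definition lo :: "nat \<Rightarrow> nat" where "lo r = (if r mod 5 = 4 then N + cx r else cx r)"
definition hi :: "nat \<Rightarrow> nat" where
  "hi r = (if r mod 5 = 2 then 2 * N + cy r else if r mod 5 = 3 then N + cx r else 2 * N + cx r)"
definition mid :: "nat \<Rightarrow> nat" where "mid r = N + cz r"

definition xt :: "nat \<Rightarrow> nat \<Rightarrow> bool" where "xt r v \<longleftrightarrow> has_tube r \<and> v = lo r \<and> r mod 5 \<noteq> 3 \<or> r mod 5 = 0"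
definition yt :: "nat \<Rightarrow> nat \<Rightarrow> bool" where "yt r v \<longleftrightarrow> has_tube r \<and> v = hi r \<and> r mod 5 \<noteq> 4 \<or> r mod 5 = 1"
definition thru :: "nat \<Rightarrow> nat \<Rightarrow> bool" where "thru r v \<longleftrightarrow> has_tube r \<and> lo r < v \<and> v < hi r"
definition md :: "nat \<Rightarrow> nat \<Rightarrow> bool" where "md r v \<longleftrightarrow> is_and r \<and> v = mid r"
definition hl :: "nat \<Rightarrow> nat \<Rightarrow> bool" where "hl r v \<longleftrightarrow> r mod 5 = 3 \<and> v = lo r"
definition hr :: "nat \<Rightarrow> nat \<Rightarrow> bool" where "hr r v \<longleftrightarrow> r mod 5 = 4 \<and> v = hi r"

definition yk :: "nat \<Rightarrow> nat \<Rightarrow> nat \<Rightarrow> nat" where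
  "yk r v l = (if thru r v then (if md r v \<and> l = 0 then 2 else 3)
     else if xt r v then (if l = 0 then 0 else 1)
     else if yt r v then (if l = 2 then 0 else 1)
     else if hl r v then (if l = 2 then 2 else 0)
     else if hr r v then (if l = 0 then 2 else 0) else 0)"

definition tube_at :: "nat \<Rightarrow> nat \<Rightarrow> nat \<Rightarrow> bool" where
  "tube_at r v l \<longleftrightarrow> has_tube r \<and> (v = lo r \<and> l = 2 \<or> lo r < v \<and> v < hi r)"

definition tube_label :: "nat \<Rightarrow> nat \<Rightarrow> piece" where
  "tube_label r v = (if r mod 5 = 3 then Plate (lo r) else if r mod 5 = 4 then Plate (hi r)
     else if v < mid r then TubeA (cx r) (cy r) (cz r) else TubeB (cx r) (cy r) (cz r))"

text \<open>Threshold \<open>k\<close> is the boundary between the rings \<open>k - 1\<close> and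
  \<open>k\<close>: 1 carries the tunnels, 2 the tubes, 3 the rims around passing tubes, and 4 the
  outer walls. Outer walls and rims fill only the levels 0 and 1, since level 2 is the gap up to the
  next plate.\<close>

definition wall :: "nat \<Rightarrow> nat \<Rightarrow> nat \<Rightarrow> nat \<Rightarrow> piece option" where
  "wall r v l k = (if 3 * N \<le> v then None
     else if k = 1 then (if xt r v \<and> l = 1 \<or> yt r v \<and> l = 0 then Some (Plate v) else None)
     else if k = 2 then (if tube_at r v l then Some (tube_label r v) else None)
     else if k = 3 then (if thru r v \<and> (l = 1 \<or> l = 0 \<and> \<not> md r v) then Some (Plate v) else None)
     else (if l \<noteq> 2 then Some (Plate v) else None))"

definition face :: "nat \<Rightarrow> nat \<Rightarrow> nat \<Rightarrow> nat \<Rightarrow> piece option" where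
  "face r v l a = (if v < 3 * N \<and> a < 4 \<and> yk r v l \<le> a then Some (Plate v) else None)"

definition ad :: "nat \<Rightarrow> nat" where "ad u = (if u \<le> 3 then 3 - u else u - 3)"

definition inside :: "nat \<Rightarrow> nat \<Rightarrow> bool" where
  "inside i j \<longleftrightarrow> 1 \<le> i div 7 \<and> i div 7 \<le> ncols \<and> j div 7 = 1"

text \<open>The number of the square ring around the central cell of a block of width 7. The
  boundary between two neighbouring blocks has ring 3 on both sides and hence no wall, so that the
  plates extend through all columns.\<close>

definition rho :: "nat \<Rightarrow> nat \<Rightarrow> nat" where
  "rho i j = (if inside i j then max (ad (i mod 7)) (ad (j mod 7)) else 4)"

text \<open>At coordinate 0 the truncated predecessor compares a cell with itself, so no wall arises
  there.\<close>

fun label :: "square \<Rightarrow> piece option" where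
  "label (Face i y j) = face (i div 7) (y div 3) (y mod 3) (rho i j)"
| "label (Xw i y j) = (if rho (i - 1) j = rho i j then None
     else wall (i div 7) (y div 3) (y mod 3) (max (rho (i - 1) j) (rho i j)))"
| "label (Zw i y j) = (if rho i (j - 1) = rho i j then None
     else wall (i div 7) (y div 3) (y mod 3) (max (rho i (j - 1)) (rho i j)))"

definition squares :: "square set" where "squares = {q. label q \<noteq> None}"

lemma cx_less: "cx r < N" and cy_less: "cy r < N" and cz_less: "cz r < N"
  using N_pos by (simp_all add: cx_def cy_def cz_def)

lemma lo_less_hi: "lo r < hi r"
  using cx_less[of r] cy_less[of r] by (auto simp: lo_def hi_def)

lemma hi_less: "hi r < 3 * N"
  using cx_less[of r] cy_less[of r] by (auto simp: hi_def)

lemma lo_less_mid: "is_and r \<Longrightarrow> lo r < mid r" and mid_less_hi: "is_and r \<Longrightarrow> mid r < hi r"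
  using cx_less[of r] cz_less[of r] by (auto simp: lo_def mid_def hi_def is_and_def)

lemma yk_le: "yk r v l \<le> 3"
  by (simp add: yk_def)

lemma face_outer: "v < 3 * N \<Longrightarrow> face r v l 3 = Some (Plate v)"
  using yk_le[of r v l] by (simp add: face_def)

lemma face_4: "face r v l 4 = None"
  by (simp add: face_def)

lemma ad_le: "u < 7 \<Longrightarrow> ad u \<le> 3"
  by (auto simp: ad_def)

lemma rho_le: "rho i j \<le> 4"
  unfolding rho_def using ad_le[of "i mod 7"] ad_le[of "j mod 7"] by simp

section \<open>The squares at an edge between two neighbouring rings\<close>

definition below :: "nat \<Rightarrow> nat \<Rightarrow> nat \<Rightarrow> nat \<Rightarrow> piece option" where
  "below r v l k = (if l = 0 then (if v = 0 then None else wall r (v - 1) 2 k) else wall r v (l - 1) k)"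

lemma has_tube_kind: "has_tube r \<Longrightarrow> r mod 5 \<noteq> 0 \<and> r mod 5 \<noteq> 1"
  by (auto simp: has_tube_def is_and_def)

lemma thruD: "thru r v \<Longrightarrow> \<not> xt r v \<and> \<not> yt r v"
  using has_tube_kind[of r] by (auto simp: thru_def xt_def yt_def)

lemma xtD: "xt r v \<Longrightarrow> \<not> yt r v"
  using has_tube_kind[of r] lo_less_hi[of r] by (auto simp: xt_def yt_def)

lemma thru_pos: "thru r v \<Longrightarrow> 0 < v"
  by (auto simp: thru_def)

lemma wall_1: "wall r v l 1 = (if v < 3 * N \<and> (xt r v \<and> l = 1 \<or> yt r v \<and> l = 0) then Some (Plate v) else None)"
  by (simp add: wall_def)

lemma below_1: "l < 3 \<Longrightarrow> below r v l 1 = (if v < 3 * N \<and> (xt r v \<and> l = 2 \<or> yt r v \<and> l = 1) then Some (Plate v) else None)"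
  by (auto simp: below_def wall_def)

lemma wall_2: "wall r v l 2 = (if tube_at r v l then Some (tube_label r v) else None)"
  using hi_less[of r] lo_less_hi[of r] by (auto simp: wall_def tube_at_def)

lemma below_2: "l < 3 \<Longrightarrow> below r v l 2 = (if has_tube r \<and> lo r < v \<and> (v < hi r \<or> v = hi r \<and> l = 0)
    then Some (tube_label r (if l = 0 then v - 1 else v)) else None)"
  using lo_less_hi[of r] by (cases v) (auto simp: below_def wall_2 tube_at_def)

text \<open>For \<open>k \<noteq> 2\<close> only plate \<open>v\<close> itself meets the edges at threshold \<open>k\<close>, and never just once.\<close>

lemma edge_table_1:
  assumes "l < 3"
  shows "face r v l 0 = None \<or> face r v l 1 \<noteq> None"
    "wall r v l 1 \<noteq> None \<Longrightarrow> below r v l 1 = None \<and> face r v l 0 = None \<and> face r v l 1 = Some (Plate v) \<and> wall r v l 1 = Some (Plate v)"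
    "below r v l 1 \<noteq> None \<Longrightarrow> wall r v l 1 = None \<and> face r v l 0 = None \<and> face r v l 1 = Some (Plate v) \<and> below r v l 1 = Some (Plate v)"
    "face r v l 0 = None \<Longrightarrow> face r v l 1 \<noteq> None \<Longrightarrow> wall r v l 1 \<noteq> None \<or> below r v l 1 \<noteq> None"
proof -
  have l: "l = 0 \<or> l = 1 \<or> l = 2" using assms by auto
  note d = thruD[of r v] xtD[of r v]
  show "face r v l 0 = None \<or> face r v l 1 \<noteq> None" by (simp add: face_def)
  show "wall r v l 1 \<noteq> None \<Longrightarrow> below r v l 1 = None \<and> face r v l 0 = None \<and> face r v l 1 = Some (Plate v) \<and> wall r v l 1 = Some (Plate v)"
    unfolding wall_1 below_1[OF assms] using d by (auto simp: face_def yk_def split: if_splits)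
  show "below r v l 1 \<noteq> None \<Longrightarrow> wall r v l 1 = None \<and> face r v l 0 = None \<and> face r v l 1 = Some (Plate v) \<and> below r v l 1 = Some (Plate v)"
    unfolding wall_1 below_1[OF assms] using d by (auto simp: face_def yk_def split: if_splits)
  show "face r v l 0 = None \<Longrightarrow> face r v l 1 \<noteq> None \<Longrightarrow> wall r v l 1 \<noteq> None \<or> below r v l 1 \<noteq> None"
    unfolding wall_1 below_1[OF assms] using d l by (auto simp: face_def yk_def split: if_splits)
qed

lemma edge_table_3:
  assumes "l < 3"
  shows "face r v l 2 = None \<or> face r v l 3 \<noteq> None"
    "wall r v l 3 \<noteq> None \<Longrightarrow> face r v l 3 = Some (Plate v) \<and> wall r v l 3 = Some (Plate v)"
    "below r v l 3 \<noteq> None \<Longrightarrow> face r v l 3 = Some (Plate v) \<and> below r v l 3 = Some (Plate v)"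
    "face r v l 2 = None \<Longrightarrow> face r v l 3 \<noteq> None \<Longrightarrow> wall r v l 3 \<noteq> None \<or> below r v l 3 \<noteq> None"
proof -
  have l: "l = 0 \<or> l = 1 \<or> l = 2" using assms by auto
  show "face r v l 2 = None \<or> face r v l 3 \<noteq> None" by (simp add: face_def)
  show "wall r v l 3 \<noteq> None \<Longrightarrow> face r v l 3 = Some (Plate v) \<and> wall r v l 3 = Some (Plate v)"
    using face_outer[of v r l] by (auto simp: wall_def split: if_splits)
  show "below r v l 3 \<noteq> None \<Longrightarrow> face r v l 3 = Some (Plate v) \<and> below r v l 3 = Some (Plate v)"
    using l face_outer[of v r l] by (auto simp: wall_def below_def split: if_splits)
  show "face r v l 2 = None \<Longrightarrow> face r v l 3 \<noteq> None \<Longrightarrow> wall r v l 3 \<noteq> None \<or> below r v l 3 \<noteq> None"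
    using l thru_pos[of r v] by (elim disjE) (auto simp: wall_def below_def face_def yk_def split: if_splits)
qed

lemma edge_table_4:
  assumes "l < 3"
  shows "wall r v l 4 \<noteq> None \<Longrightarrow> face r v l 3 = Some (Plate v) \<and> wall r v l 4 = Some (Plate v)"
    "below r v l 4 \<noteq> None \<Longrightarrow> face r v l 3 = Some (Plate v) \<and> below r v l 4 = Some (Plate v)"
    "face r v l 3 \<noteq> None \<Longrightarrow> wall r v l 4 \<noteq> None \<or> below r v l 4 \<noteq> None"
proof -
  have l: "l = 0 \<or> l = 1 \<or> l = 2" using assms by auto
  show "wall r v l 4 \<noteq> None \<Longrightarrow> face r v l 3 = Some (Plate v) \<and> wall r v l 4 = Some (Plate v)"
    using face_outer[of v r l] by (simp add: wall_def split: if_splits)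
  show "below r v l 4 \<noteq> None \<Longrightarrow> face r v l 3 = Some (Plate v) \<and> below r v l 4 = Some (Plate v)"
    using l face_outer[of v r l] by (elim disjE) (simp_all add: wall_def below_def split: if_splits)
  show "face r v l 3 \<noteq> None \<Longrightarrow> wall r v l 4 \<noteq> None \<or> below r v l 4 \<noteq> None"
    using l by (elim disjE) (simp_all add: wall_def below_def face_def split: if_splits)
qed

text \<open>Threshold 2 is where different pieces meet. The cases follow a tube from its lower end
  upwards. At \<open>start\<close> and \<open>stop\<close> the plate is present on both sides of the
  edge, which makes the edge one-way, except at the end of a copy tube where the tube continues its
  own plate.\<close>

lemma edge_table_2:
  assumes "l < 3"
  obtains (flat) "wall r v l 2 = None" "below r v l 2 = None" "face r v l 1 = face r v l 2"
  | (start) "has_tube r" "v = lo r" "l = 2" "below r v l 2 = None" "wall r v l 2 = Some (tube_label r v)"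
      "face r v l 2 = Some (Plate v)" "face r v l 1 = (if r mod 5 = 3 then None else Some (Plate v))"
  | (mid) "is_and r" "v = mid r" "l = 0" "below r v l 2 = Some (TubeA (cx r) (cy r) (cz r))"
      "wall r v l 2 = Some (TubeB (cx r) (cy r) (cz r))" "face r v l 1 = None" "face r v l 2 = Some (Plate v)"
  | (pass) "thru r v" "below r v l 2 = Some (tube_label r v)" "wall r v l 2 = Some (tube_label r v)"
      "face r v l 1 = None" "face r v l 2 = None" "\<not> (md r v \<and> l = 0)"
  | (stop) "has_tube r" "v = hi r" "l = 0" "wall r v l 2 = None" "below r v l 2 = Some (tube_label r (v - 1))"
      "face r v l 2 = Some (Plate v)" "face r v l 1 = (if r mod 5 = 4 then None else Some (Plate v))"
proof -
  have l: "l = 0 \<or> l = 1 \<or> l = 2" using assms by auto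
  note lh = lo_less_hi[of r] hi_less[of r] lo_less_mid[of r] mid_less_hi[of r]
  have five: "is_and r \<Longrightarrow> r mod 5 = 2" by (simp add: is_and_def)
  note ht = has_tube_kind[of r]
  note W = wall_2[of r v l] below_2[OF assms, of r v]
  consider "has_tube r \<and> v = lo r \<and> l = 2" | "is_and r \<and> v = mid r \<and> l = 0" | "thru r v \<and> \<not> (md r v \<and> l = 0)"
    | "has_tube r \<and> v = hi r \<and> l = 0"
    | "\<not> has_tube r \<or> v < lo r \<or> hi r < v \<or> v = lo r \<and> l \<noteq> 2 \<or> v = hi r \<and> l \<noteq> 0"
  proof -
    have "lo r < v \<and> v < hi r \<or> v < lo r \<or> hi r < v \<or> v = lo r \<or> v = hi r" by linarith
    then show ?thesis using that lh unfolding thru_def md_def has_tube_def by metis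
  qed
  then show ?thesis
  proof cases
    case 1
    then have nt: "\<not> thru r v" "\<not> yt r v" "tube_at r v l" using lh ht by (auto simp: thru_def yt_def tube_at_def)
    have x: "xt r v \<longleftrightarrow> r mod 5 \<noteq> 3" "hl r v \<longleftrightarrow> r mod 5 = 3" using 1 ht by (auto simp: xt_def hl_def)
    show ?thesis
      by (rule start) (use 1 nt x lh W in \<open>auto simp: face_def yk_def\<close>)
  next
    case 2
    then have t: "thru r v" "md r v" "tube_at r v l" "has_tube r" using lh by (auto simp: thru_def md_def tube_at_def has_tube_def)
    show ?thesis
      by (rule mid) (use 2 t lh W five in \<open>auto simp: face_def yk_def tube_label_def\<close>)
  next
    case 3
    then have t: "has_tube r" "lo r < v" "v < hi r" "tube_at r v l" by (auto simp: thru_def tube_at_def)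
    have "tube_label r (if l = 0 then v - 1 else v) = tube_label r v"
      using 3 t by (auto simp: tube_label_def md_def has_tube_def)
    then show ?thesis
      by (intro pass) (use 3 t W in \<open>auto simp: face_def yk_def\<close>)
  next
    case 4
    then have nt: "\<not> thru r v" "\<not> xt r v" "\<not> tube_at r v l" "\<not> hl r v" using lh ht by (auto simp: thru_def xt_def tube_at_def hl_def)
    have x: "yt r v \<longleftrightarrow> r mod 5 \<noteq> 4" "hr r v \<longleftrightarrow> r mod 5 = 4" using 4 ht by (auto simp: yt_def hr_def)
    show ?thesis
      by (rule stop) (use 4 nt x lh W in \<open>auto simp: face_def yk_def\<close>)
  next
    case 5
    then have nt: "\<not> thru r v" "\<not> tube_at r v l" "\<not> (has_tube r \<and> lo r < v \<and> (v < hi r \<or> v = hi r \<and> l = 0))"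
      using lh by (auto simp: thru_def tube_at_def)
    have h: "\<not> (hl r v \<and> l = 2)" "\<not> (hr r v \<and> l = 0)"
      using 5 lh by (auto simp: hl_def hr_def has_tube_def)
    have "face r v l 1 = face r v l 2" using nt(1) h by (auto simp: face_def yk_def)
    then show ?thesis using nt W by (intro flat) simp_all
  qed
qed

end

section \<open>Ring numbers around an edge and soundness\<close>

context layout
begin

lemma rho_in: "1 \<le> r \<Longrightarrow> r \<le> ncols \<Longrightarrow> u < 7 \<Longrightarrow> w < 7 \<Longrightarrow> rho (7 * r + u) (7 + w) = max (ad u) (ad w)"
proof -
  assume a: "1 \<le> r" "r \<le> ncols" "u < 7" "w < 7"
  have "(7 * r + u) div 7 = r" "(7 * r + u) mod 7 = u" using a by auto
  moreover have "(7 + w) div 7 = 1" "(7 + w) mod 7 = w" using a by auto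
  ultimately show ?thesis using a by (simp add: rho_def inside_def)
qed

lemma rho_border:
  assumes "i mod 7 = 0 \<or> i mod 7 = 6 \<or> j mod 7 = 0 \<or> j mod 7 = 6"
  shows "rho i j = 3 \<or> rho i j = 4"
proof -
  have "ad (i mod 7) \<le> 3" "ad (j mod 7) \<le> 3" by (simp_all add: ad_le)
  moreover have "ad (i mod 7) = 3 \<or> ad (j mod 7) = 3" using assms by (auto simp: ad_def)
  ultimately show ?thesis unfolding rho_def by auto
qed

lemma rho_less_4: "rho i j < 4 \<longleftrightarrow> inside i j"
  unfolding rho_def using ad_le[of "i mod 7"] ad_le[of "j mod 7"] by auto

lemma wall_4_col: "wall r v l 4 = wall r' v l 4"
  by (simp add: wall_def)

lemma face_3_col: "a \<ge> 3 \<Longrightarrow> face r v l a = face r' v l a"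
  using yk_le[of r v l] yk_le[of r' v l] by (auto simp: face_def)

lemma Suc_div_7: "Suc i mod 7 \<noteq> 0 \<Longrightarrow> Suc i div 7 = i div 7 \<and> Suc i mod 7 = Suc (i mod 7)"
  by (metis div_Suc mod_Suc)

lemma Suc_mod_7_0: "Suc i mod 7 = 0 \<Longrightarrow> i mod 7 = 6"
  by (metis Suc_inject mod_Suc numeral_eq_Suc pred_numeral_simps(3) zero_less_Suc less_irrefl)

lemma ad_Suc: "ad (Suc u) = Suc (ad u) \<or> ad u = Suc (ad (Suc u))"
  by (auto simp: ad_def)

text \<open>One step changes a ring number by at most 1, so the four cells around a vertical edge
  take at most two consecutive values. At a block boundary only 3 and 4 occur, and there nothing
  depends on the column.\<close>

lemma corner:
  "\<exists>k. {rho i j, rho (Suc i) j, rho i (Suc j), rho (Suc i) (Suc j)} \<subseteq> {k, Suc k} \<and> (k = 3 \<or> Suc i div 7 = i div 7)"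
proof (cases "Suc i mod 7 = 0 \<or> Suc j mod 7 = 0")
  case True
  then have "rho i j = 3 \<or> rho i j = 4" "rho (Suc i) j = 3 \<or> rho (Suc i) j = 4"
    "rho i (Suc j) = 3 \<or> rho i (Suc j) = 4" "rho (Suc i) (Suc j) = 3 \<or> rho (Suc i) (Suc j) = 4"
    using Suc_mod_7_0 by (auto intro!: rho_border)
  then show ?thesis by (intro exI[of _ 3]) auto
next
  case False
  then have d: "Suc i div 7 = i div 7" "Suc i mod 7 = Suc (i mod 7)" "Suc j div 7 = j div 7" "Suc j mod 7 = Suc (j mod 7)"
    using Suc_div_7 by auto
  show ?thesis
  proof (cases "inside i j")
    case True
    then have ins: "inside (Suc i) j" "inside i (Suc j)" "inside (Suc i) (Suc j)" using d by (auto simp: inside_def)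
    define s t where "s = min (ad (i mod 7)) (ad (Suc (i mod 7)))" and "t = min (ad (j mod 7)) (ad (Suc (j mod 7)))"
    have "ad (i mod 7) = s \<or> ad (i mod 7) = Suc s" "ad (Suc (i mod 7)) = s \<or> ad (Suc (i mod 7)) = Suc s"
      "ad (j mod 7) = t \<or> ad (j mod 7) = Suc t" "ad (Suc (j mod 7)) = t \<or> ad (Suc (j mod 7)) = Suc t"
      using ad_Suc[of "i mod 7"] ad_Suc[of "j mod 7"] unfolding s_def t_def by auto
    then have m: "max x z = max s t \<or> max x z = Suc (max s t)"
      if "x \<in> {ad (i mod 7), ad (Suc (i mod 7))}" "z \<in> {ad (j mod 7), ad (Suc (j mod 7))}" for x z
    proof -
      have "x = s \<or> x = Suc s" "z = t \<or> z = Suc t"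
        using that \<open>ad (i mod 7) = s \<or> _\<close> \<open>ad (Suc (i mod 7)) = s \<or> _\<close> \<open>ad (j mod 7) = t \<or> _\<close> \<open>ad (Suc (j mod 7)) = t \<or> _\<close>
        by blast+
      then show ?thesis by (auto simp: max_def)
    qed
    show ?thesis
    proof (intro exI[of _ "max s t"] conjI)
      show "{rho i j, rho (Suc i) j, rho i (Suc j), rho (Suc i) (Suc j)} \<subseteq> {max s t, Suc (max s t)}"
      proof -
        have r: "rho i j = max (ad (i mod 7)) (ad (j mod 7))" "rho (Suc i) j = max (ad (Suc (i mod 7))) (ad (j mod 7))"
          "rho i (Suc j) = max (ad (i mod 7)) (ad (Suc (j mod 7)))"
          "rho (Suc i) (Suc j) = max (ad (Suc (i mod 7))) (ad (Suc (j mod 7)))"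
          unfolding rho_def by (simp_all only: True ins d(2) d(4) if_True)
        show ?thesis unfolding r using m by (intro insert_subsetI empty_subsetI) simp_all
      qed
    qed (use d in simp)
  next
    case False
    then have "\<not> inside (Suc i) j" "\<not> inside i (Suc j)" "\<not> inside (Suc i) (Suc j)" using d by (auto simp: inside_def)
    then show ?thesis using False by (intro exI[of _ 3]) (auto simp: rho_def)
  qed
qed

text \<open>An edge at height \<open>y\<close> between two horizontally adjacent planar squares \<open>A\<close>, \<open>B\<close> of rings \<open>a\<close>, \<open>b\<close>.\<close>

definition adj :: "nat \<Rightarrow> gedge \<Rightarrow> square \<Rightarrow> square \<Rightarrow> (nat \<Rightarrow> square) \<Rightarrow> nat \<Rightarrow> nat \<Rightarrow> nat \<Rightarrow> bool" where
  "adj y g A B W r a b \<longleftrightarrow>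
     (\<forall>q. g \<in> sides q \<longleftrightarrow> q = A \<or> q = B \<or> q = W y \<or> (\<exists>y'. y = Suc y' \<and> q = W y')) \<and>
     A \<noteq> B \<and> (\<forall>y. W y \<noteq> A \<and> W y \<noteq> B) \<and> inj W \<and>
     label A = face r (y div 3) (y mod 3) a \<and> label B = face r (y div 3) (y mod 3) b \<and>
     (\<forall>y. label (W y) = (if a = b then None else wall r (y div 3) (y mod 3) (max a b))) \<and>
     (a = b \<or> b = Suc a \<or> a = Suc b) \<and> a \<le> 4 \<and> b \<le> 4"

lemma adj_sides:
  "adj y g A B W r a b \<Longrightarrow> g \<in> sides q \<longleftrightarrow> q = A \<or> q = B \<or> q = W y \<or> (\<exists>y'. y = Suc y' \<and> q = W y')"
  unfolding adj_def by simp

lemma adj_x: "adj y (Ez (Suc i) y j) (Face i y j) (Face (Suc i) y j) (\<lambda>y. Xw (Suc i) y j) (Suc i div 7) (rho i j) (rho (Suc i) j)"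
proof -
  obtain k where k: "{rho i j, rho (Suc i) j} \<subseteq> {k, Suc k}" "k = 3 \<or> Suc i div 7 = i div 7"
    using corner[of i j] by blast
  have "face (i div 7) v l (rho i j) = face (Suc i div 7) v l (rho i j)" for v l
    using k by (auto intro: face_3_col)
  then show ?thesis using k rho_le[of i j] rho_le[of "Suc i" j] unfolding adj_def by (auto simp: sides_simps inj_def)
qed

lemma adj_z: "adj y (Ex i y (Suc j)) (Face i y j) (Face i y (Suc j)) (\<lambda>y. Zw i y (Suc j)) (i div 7) (rho i j) (rho i (Suc j))"
proof -
  obtain k where k: "{rho i j, rho i (Suc j)} \<subseteq> {k, Suc k}" using corner[of i j] by blast
  then show ?thesis using rho_le[of i j] rho_le[of i "Suc j"] unfolding adj_def by (auto simp: sides_simps inj_def)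
qed

lemma adj_sym: "adj y g A B W r a b \<Longrightarrow> adj y g B A W r b a"
  unfolding adj_def by (auto simp: max.commute)

lemma below_label:
  "wall r (y div 3) (y mod 3) k = below r (Suc y div 3) (Suc y mod 3) k"
proof (cases "Suc y mod 3 = 0")
  case True
  then have "Suc y div 3 = Suc (y div 3)" "y mod 3 = 2" by presburger+
  then show ?thesis using True by (simp add: below_def)
next
  case False
  then have "Suc y div 3 = y div 3" "Suc y mod 3 = Suc (y mod 3)" by presburger+
  then show ?thesis by (simp add: below_def)
qed

subsection \<open>Soundness: no edge frees an underived piece\<close>

text \<open>Except at threshold 2, every square at the edge has a partner with the same label, which
  is derived by assumption. At threshold 2 the possible configurations are exactly the clauses of
  \<open>derived\<close>.\<close>

lemma adj_sound:
  assumes adj: "adj y g A B W r a b" and q: "q \<in> squares" "g \<in> sides q"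
    and oth: "\<And>q' p. q' \<in> squares \<Longrightarrow> g \<in> sides q' \<Longrightarrow> q' \<noteq> q \<Longrightarrow> label q' = Some p \<Longrightarrow> p \<in> derived N rl P"
    and lq: "label q = Some p"
  shows "p \<in> derived N rl P"
  using adj
proof (cases "a = b")
  case True
  then have l0: "label (W y) = None" for y using adj by (simp add: adj_def)
  have "q = A \<or> q = B \<or> q = W y \<or> (\<exists>y'. y = Suc y' \<and> q = W y')" using adj_sides[OF adj] q(2) by simp
  then have "q = A \<or> q = B" using l0 lq by auto
  moreover have "label A = label B" using adj True by (simp add: adj_def)
  moreover have "A \<in> squares \<longleftrightarrow> B \<in> squares" using calculation(2) by (simp add: squares_def)
  moreover have "g \<in> sides A" "g \<in> sides B" "A \<noteq> B" using adj by (auto simp: adj_def)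
  ultimately show ?thesis using oth lq q by metis
next
  case False
  define k where "k = max a b"
  define v l where "v = y div 3" and "l = y mod 3"
  have l3: "l < 3" by (simp add: l_def)
  obtain F G where FG: "adj y g F G W r (k - 1) k" "k \<ge> 1"
  proof -
    have "b = Suc a \<or> a = Suc b" using adj False by (auto simp: adj_def)
    then show ?thesis
    proof
      assume "b = Suc a"
      then show ?thesis using that[of A B] adj by (simp add: k_def)
    next
      assume "a = Suc b"
      then show ?thesis using that[of B A] adj_sym[OF adj] by (simp add: k_def)
    qed
  qed
  have lF: "label F = face r v l (k - 1)" "label G = face r v l k" "label (W y) = wall r v l k"
    using FG unfolding adj_def v_def l_def by auto
  have lW: "label (W y') = below r v l k" if "y = Suc y'" for y'
    using FG below_label[of r y' k] that unfolding adj_def v_def l_def by auto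
  have b0: "below r v l k = None" if "y = 0" using that by (simp add: below_def v_def l_def)
  have sd: "g \<in> sides F" "g \<in> sides G" "g \<in> sides (W y)" "y = Suc y' \<Longrightarrow> g \<in> sides (W y')" for y'
    using FG(1) unfolding adj_def by blast+
  have ne: "F \<noteq> G" "W y \<noteq> F" "W y \<noteq> G" "W y' \<noteq> F" "W y' \<noteq> G" "W y' = W y'' \<longleftrightarrow> y' = y''" for y' y''
    using FG(1) unfolding adj_def by (auto dest: injD)
  have other: "p' \<in> derived N rl P" if "label q' = Some p'" "g \<in> sides q'" "q' \<noteq> q" for q' p'
    using oth[of q' p'] that by (simp add: squares_def)
  have oB: "p' \<in> derived N rl P" if "below r v l k = Some p'" "\<And>y'. y = Suc y' \<Longrightarrow> q \<noteq> W y'" for p'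
  proof (cases y)
    case 0
    then show ?thesis using b0 that by simp
  next
    case (Suc y')
    then show ?thesis using other[of "W y'"] lW[OF Suc] sd(4)[OF Suc] that by auto
  qed
  have cases: "q = F \<and> face r v l (k - 1) = Some p \<or> q = G \<and> face r v l k = Some p \<or> q = W y \<and> wall r v l k = Some p \<or>
      (\<exists>y'. y = Suc y' \<and> q = W y' \<and> below r v l k = Some p)"
  proof -
    have "q = F \<or> q = G \<or> q = W y \<or> (\<exists>y'. y = Suc y' \<and> q = W y')" using FG(1) q(2) unfolding adj_def by blast
    then show ?thesis using lq lF lW by auto
  qed
  have "k \<le> 4" using FG(1) unfolding adj_def by simp
  have oF: "p' \<in> derived N rl P" if "face r v l (k - 1) = Some p'" "q \<noteq> F" for p'
    using other[of F p'] lF(1) sd(1) that by simp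
  have oG: "p' \<in> derived N rl P" if "face r v l k = Some p'" "q \<noteq> G" for p'
    using other[of G p'] lF(2) sd(2) that by simp
  have oW: "p' \<in> derived N rl P" if "wall r v l k = Some p'" "q \<noteq> W y" for p'
    using other[of "W y" p'] lF(3) sd(3) that by simp
  have face_label: "p' = Plate v" if "face r v l a = Some p'" for a p'
    using that by (simp add: face_def split: if_splits)
  have fs: "face r v l a = Some p'" if "face r v l a \<noteq> None" "face r v l b = Some p'" for a b p'
    using that face_label[of a] face_label[OF that(2)] by auto
  consider "k = 1" | "k = 2" | "k = 3" | "k = 4" using FG(2) \<open>k \<le> 4\<close> by linarith
  then show ?thesis
  proof cases
    case 1
    note T = edge_table_1[OF l3, of r v]
    from cases show ?thesis
    proof (elim disjE exE conjE)
      assume a: "q = F" "face r v l (k - 1) = Some p"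
      then have "face r v l k \<noteq> None" using T(1) 1 by auto
      then have "face r v l k = Some p" using fs[OF _ a(2)] by blast
      then show ?thesis using oG a ne by simp
    next
      assume a: "q = G" "face r v l k = Some p"
      show ?thesis
      proof (cases "face r v l (k - 1) = None")
        case True
        then have "wall r v l k \<noteq> None \<or> below r v l k \<noteq> None" using T(4) a 1 by auto
        then have "wall r v l k = Some p \<or> below r v l k = Some p"
          using T(2) T(3) 1 face_label[OF a(2)] by (elim disjE) simp_all
        then show ?thesis using oW oB a ne by metis
      next
        case False
        then have "face r v l (k - 1) = Some p" by (rule fs[OF _ a(2)])
        then show ?thesis using oF a ne by simp
      qed
    next
      assume a: "q = W y" "wall r v l k = Some p"
      then have "face r v l k = Some p" using T(2) 1 by simp
      then show ?thesis using oG a ne by simp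
    next
      fix y' assume a: "y = Suc y'" "q = W y'" "below r v l k = Some p"
      then have "face r v l k = Some p" using T(3) 1 by simp
      then show ?thesis using oG a ne by simp
    qed
  next
    case 3
    note T = edge_table_3[OF l3, of r v]
    from cases show ?thesis
    proof (elim disjE exE conjE)
      assume a: "q = F" "face r v l (k - 1) = Some p"
      then have "face r v l k \<noteq> None" using T(1) 3 by auto
      then have "face r v l k = Some p" using fs[OF _ a(2)] by blast
      then show ?thesis using oG a ne by simp
    next
      assume a: "q = G" "face r v l k = Some p"
      show ?thesis
      proof (cases "face r v l (k - 1) = None")
        case True
        then have "wall r v l k \<noteq> None \<or> below r v l k \<noteq> None" using T(4) a 3 by auto
        then have "wall r v l k = Some p \<or> below r v l k = Some p"
          using T(2) T(3) 3 face_label[OF a(2)] by (elim disjE) simp_all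
        then show ?thesis using oW oB a ne by metis
      next
        case False
        then have "face r v l (k - 1) = Some p" by (rule fs[OF _ a(2)])
        then show ?thesis using oF a ne by simp
      qed
    next
      assume a: "q = W y" "wall r v l k = Some p"
      then have "face r v l k = Some p" using T(2) 3 by simp
      then show ?thesis using oG a ne by simp
    next
      fix y' assume a: "y = Suc y'" "q = W y'" "below r v l k = Some p"
      then have "face r v l k = Some p" using T(3) 3 by simp
      then show ?thesis using oG a ne by simp
    qed
  next
    case 4
    note T = edge_table_4[OF l3, of r v]
    from cases show ?thesis
    proof (elim disjE exE conjE)
      assume a: "q = F" "face r v l (k - 1) = Some p"
      then have "wall r v l k \<noteq> None \<or> below r v l k \<noteq> None" using T(3) 4 by auto
      then have "wall r v l k = Some p \<or> below r v l k = Some p"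
        using T(1) T(2) 4 face_label[OF a(2)] by (elim disjE) simp_all
      then show ?thesis using oW oB a ne by metis
    next
      assume a: "q = G" "face r v l k = Some p"
      then show ?thesis using 4 face_4 by simp
    next
      assume a: "q = W y" "wall r v l k = Some p"
      then have "face r v l (k - 1) = Some p" using T(1) 4 by simp
      then show ?thesis using oF a ne by simp
    next
      fix y' assume a: "y = Suc y'" "q = W y'" "below r v l k = Some p"
      then have "face r v l (k - 1) = Some p" using T(2) 4 by simp
      then show ?thesis using oF a ne by simp
    qed
  next
    case 2
    have k1: "k - 1 = 1" using 2 by simp
    have andD: "r mod 5 = 2" "rl (cx r) (cy r) (cz r)" if "has_tube r" "r mod 5 \<noteq> 3" "r mod 5 \<noteq> 4"
      using that by (auto simp: has_tube_def is_and_def)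
    from l3 show ?thesis
    proof (cases rule: edge_table_2[where r = r and v = v])
      case flat
      then show ?thesis using cases oF oG ne 2 k1 by (metis option.distinct(1))
    next
      case start
      show ?thesis
      proof (cases "r mod 5 = 3")
        case True
        then have "tube_label r v = Plate v" using start by (simp add: tube_label_def)
        then show ?thesis using cases oG oW ne 2 k1 start True by (metis option.distinct(1))
      next
        case False
        \<comment> \<open>Only the tube can be the last square at this edge: the plate has squares
          on both sides of it.\<close>
        have "p \<in> derived N rl P" if q: "q = W y" "wall r v l k = Some p"
        proof -
          have G: "Plate (lo r) \<in> derived N rl P" using oG[of "Plate v"] start q ne 2 by simp
          show ?thesis
          proof (cases "r mod 5 = 4")
            case True
            then have "p = Plate (2 * N + cx r)" using q start 2 by (simp add: tube_label_def hi_def)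
            then show ?thesis using G True derived.copyR[OF _ cx_less] by (simp add: lo_def)
          next
            case F4: False
            note a = andD[OF start(1) False F4]
            then have "is_and r" by (simp add: is_and_def)
            then have "p = TubeA (cx r) (cy r) (cz r)" using q start 2 a lo_less_mid by (simp add: tube_label_def)
            then show ?thesis using G a derived.tubeA[where rl = rl, of "cx r" "cy r" "cz r"] by (simp add: lo_def)
          qed
        qed
        then show ?thesis using cases oF oG ne 2 k1 start False by (metis option.distinct(1))
      qed
    next
      case mid
      have r: "rl (cx r) (cy r) (cz r)" "v = N + cz r" using mid by (simp_all add: is_and_def mid_def)
      from cases show ?thesis
      proof (elim disjE exE conjE)
        assume "q = F" "face r v l (k - 1) = Some p"
        then show ?thesis using mid k1 by simp
      next
        assume a: "q = G" "face r v l k = Some p"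
        then have "TubeA (cx r) (cy r) (cz r) \<in> derived N rl P" "TubeB (cx r) (cy r) (cz r) \<in> derived N rl P"
          using oB oW mid ne 2 by auto
        then have "Plate (N + cz r) \<in> derived N rl P" by (rule derived.head[where rl = rl, OF r(1)])
        moreover have "p = Plate (N + cz r)" using a(2) mid(7) r(2) 2 by simp
        ultimately show ?thesis by simp
      next
        assume a: "q = W y" "wall r v l k = Some p"
        then have "TubeA (cx r) (cy r) (cz r) \<in> derived N rl P" "Plate v \<in> derived N rl P"
          using oB oG mid ne 2 by auto
        then have "TubeB (cx r) (cy r) (cz r) \<in> derived N rl P"
          unfolding r(2) by (rule derived.backB[where rl = rl, OF r(1)])
        moreover have "p = TubeB (cx r) (cy r) (cz r)" using a(2) mid(5) 2 by simp
        ultimately show ?thesis by simp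
      next
        fix y' assume a: "y = Suc y'" "q = W y'" "below r v l k = Some p"
        then have "TubeB (cx r) (cy r) (cz r) \<in> derived N rl P" "Plate v \<in> derived N rl P"
          using oW oG mid ne 2 by auto
        then have "TubeA (cx r) (cy r) (cz r) \<in> derived N rl P"
          unfolding r(2) by (rule derived.backA[where rl = rl, OF r(1)])
        moreover have "p = TubeA (cx r) (cy r) (cz r)" using a(3) mid(4) 2 by simp
        ultimately show ?thesis by simp
      qed
    next
      case pass
      from cases show ?thesis
      proof (elim disjE exE conjE)
        assume "q = W y" "wall r v l k = Some p"
        then show ?thesis using oB[of p] pass ne 2 by auto
      next
        fix y' assume a: "y = Suc y'" "q = W y'" "below r v l k = Some p"
        then show ?thesis using oW[of p] pass ne 2 by auto
      qed (use pass k1 2 in simp_all)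
    next
      case stop
      have hb: "p \<in> derived N rl P" if q: "y = Suc y'" "q = W y'" "below r v l k = Some p" for y'
      proof -
        have G: "Plate (hi r) \<in> derived N rl P" if "r mod 5 \<noteq> 4 \<or> True" using oG[of "Plate v"] stop q ne 2 by simp
        consider "r mod 5 = 3" | "r mod 5 = 4" | "r mod 5 \<noteq> 3" "r mod 5 \<noteq> 4" by blast
        then show ?thesis
        proof cases
          case 1
          then have "p = Plate (cx r)" using q stop 2 by (simp add: tube_label_def lo_def)
          then show ?thesis using G 1 derived.copyL[OF _ cx_less] by (simp add: hi_def)
        next
          case 2
          then show ?thesis using G q stop \<open>k = 2\<close> by (simp add: tube_label_def)
        next
          case 3
          note a = andD[OF stop(1) 3]
          then have "is_and r" by (simp add: is_and_def)
          then have "\<not> hi r - 1 < mid r" using mid_less_hi by fastforce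
          then have "p = TubeB (cx r) (cy r) (cz r)" using q stop 2 a by (simp add: tube_label_def)
          then show ?thesis using G a derived.tubeB[where rl = rl, of "cx r" "cy r" "cz r"] by (simp add: hi_def)
        qed
      qed
      show ?thesis
      proof (cases "r mod 5 = 4")
        case True
        then have "tube_label r (v - 1) = Plate v" using stop by (simp add: tube_label_def)
        then show ?thesis using cases oG oB ne 2 k1 stop True hb by (metis option.distinct(1))
      next
        case False
        then show ?thesis using cases oF oG ne 2 k1 stop hb by (metis option.distinct(1))
      qed
    qed
  qed
qed

text \<open>Around a vertical edge the ring numbers take two values, so they change an even number
  of times on the way around. Each change carries a wall of the same threshold and label; hence a
  wall never ends alone.\<close>

lemma vertical_sound:
  assumes q: "q \<in> squares" "Ey i y j \<in> sides q" and lq: "label q = Some p"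
  shows "\<exists>q'\<in>squares. q' \<noteq> q \<and> Ey i y j \<in> sides q' \<and> label q' = Some p"
proof -
  have out: "rho 0 j = 4" "rho i 0 = 4" for i j by (simp_all add: rho_def inside_def)
  have "i \<noteq> 0"
  proof
    assume "i = 0"
    then have "label q = None" using q(2) out by (auto simp: sides_simps)
    then show False using lq by simp
  qed
  moreover have "j \<noteq> 0"
  proof
    assume "j = 0"
    then have "label q = None" using q(2) out by (auto simp: sides_simps)
    then show False using lq by simp
  qed
  ultimately obtain i' j' where ij: "i = Suc i'" "j = Suc j'" using not0_implies_Suc by blast
  obtain k where k: "{rho i' j', rho i j', rho i' j, rho i j} \<subseteq> {k, Suc k}" "k = 3 \<or> i div 7 = i' div 7"
    using corner[of i' j'] ij by blast
  define X where "X = wall (i div 7) (y div 3) (y mod 3) (Suc k)"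
  have col: "wall (i' div 7) (y div 3) (y mod 3) (Suc k) = X"
    using k(2) wall_4_col[of "i div 7" "y div 3" "y mod 3" "i' div 7"] unfolding X_def by auto
  have L: "label (Xw i y j) = (if rho i' j = rho i j then None else X)"
    "label (Xw i y j') = (if rho i' j' = rho i j' then None else X)"
    "label (Zw i y j) = (if rho i j' = rho i j then None else X)"
    "label (Zw i' y j) = (if rho i' j' = rho i' j then None else X)"
    using k(1) col unfolding X_def ij by (auto simp: max_def)
  have sd: "Ey i y j \<in> sides q' \<longleftrightarrow> q' = Xw i y j \<or> q' = Xw i y j' \<or> q' = Zw i y j \<or> q' = Zw i' y j" for q'
    using ij by (auto simp: sides_simps)
  have Xp: "X = Some p"
    using q(2)[unfolded sd] lq L by (elim disjE) (simp_all split: if_splits)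
  have mem: "Xw i y j \<in> squares \<longleftrightarrow> rho i' j \<noteq> rho i j" "Xw i y j' \<in> squares \<longleftrightarrow> rho i' j' \<noteq> rho i j'"
    "Zw i y j \<in> squares \<longleftrightarrow> rho i j' \<noteq> rho i j" "Zw i' y j \<in> squares \<longleftrightarrow> rho i' j' \<noteq> rho i' j"
    unfolding squares_def mem_Collect_eq L using Xp by auto
  have nej: "j \<noteq> j'" "i \<noteq> i'" using ij by auto
  have ex: "\<exists>q'. q' \<in> squares \<and> q' \<noteq> q \<and> Ey i y j \<in> sides q'"
  proof -
    have two: "x = k \<or> x = Suc k" if "x \<in> {rho i' j', rho i j', rho i' j, rho i j}" for x using k(1) that by blast
    note t = two[of "rho i' j'"] two[of "rho i j'"] two[of "rho i' j"] two[of "rho i j"]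
    from q(2)[unfolded sd] show ?thesis
    proof (elim disjE)
      assume a: "q = Xw i y j"
      then have "rho i' j' \<noteq> rho i j' \<or> rho i j' \<noteq> rho i j \<or> rho i' j' \<noteq> rho i' j" using mem(1) q(1) by auto
      then show ?thesis using mem a nej unfolding sd by (metis square.distinct(5) square.inject(2))
    next
      assume a: "q = Xw i y j'"
      then have "rho i' j \<noteq> rho i j \<or> rho i j' \<noteq> rho i j \<or> rho i' j' \<noteq> rho i' j" using mem(2) q(1) by auto
      then show ?thesis using mem a nej unfolding sd by (metis square.distinct(5) square.inject(2))
    next
      assume a: "q = Zw i y j"
      then have "rho i' j \<noteq> rho i j \<or> rho i' j' \<noteq> rho i j' \<or> rho i' j' \<noteq> rho i' j" using mem(3) q(1) by auto
      then show ?thesis using mem a nej unfolding sd by (metis square.distinct(5) square.inject(3))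
    next
      assume a: "q = Zw i' y j"
      then have "rho i' j \<noteq> rho i j \<or> rho i' j' \<noteq> rho i j' \<or> rho i j' \<noteq> rho i j" using mem(4) q(1) by auto
      then show ?thesis using mem a nej unfolding sd by (metis square.distinct(5) square.inject(3))
    qed
  qed
  then obtain q' where q': "q' \<in> squares" "q' \<noteq> q" "Ey i y j \<in> sides q'" by blast
  have "label q' \<noteq> None" using q'(1) by (simp add: squares_def)
  then have "label q' = Some p" using q'(3)[unfolded sd] L Xp by (elim disjE) (simp_all split: if_splits)
  then show ?thesis using q' by blast
qed

lemma edge_sound:
  assumes q: "q \<in> squares" "g \<in> sides q"
    and oth: "\<And>q' p. q' \<in> squares \<Longrightarrow> g \<in> sides q' \<Longrightarrow> q' \<noteq> q \<Longrightarrow> label q' = Some p \<Longrightarrow> p \<in> derived N rl P"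
    and lq: "label q = Some p"
  shows "p \<in> derived N rl P"
proof (cases g)
  case (Ey i y j)
  then show ?thesis using vertical_sound[of q i y j p] q lq oth by blast
next
  case (Ex i y j)
  have "j \<noteq> 0"
  proof
    assume "j = 0"
    moreover have "rho i 0 = 4" by (simp add: rho_def inside_def)
    ultimately have "label q = None" using q(2) Ex by (auto simp: sides_simps face_4)
    then show False using lq by simp
  qed
  then obtain j' where "j = Suc j'" using not0_implies_Suc by blast
  then show ?thesis using adj_sound[OF adj_z[of y i j'] q(1) _ _ lq, of P] q(2) Ex oth by blast
next
  case (Ez i y j)
  have "i \<noteq> 0"
  proof
    assume "i = 0"
    moreover have "rho 0 j = 4" by (simp add: rho_def inside_def)
    ultimately have "label q = None" using q(2) Ez by (auto simp: sides_simps face_4)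
    then show False using lq by simp
  qed
  then obtain i' where "i = Suc i'" using not0_implies_Suc by blast
  then show ?thesis using adj_sound[OF adj_x[of y i' j] q(1) _ _ lq, of P] q(2) Ez oth by blast
qed

lemma derived_empty: "p \<in> derived N rl {} \<Longrightarrow> False"
  by (induction rule: derived.induct) auto

text \<open>Without seeds nothing is derived, so soundness forbids an edge with a single square: the
  complex has no free edge at all.\<close>

lemma edge_partner:
  assumes "q \<in> squares" "g \<in> sides q"
  shows "\<exists>q'\<in>squares. g \<in> sides q' \<and> q' \<noteq> q"
proof (rule ccontr)
  assume n: "\<not> (\<exists>q'\<in>squares. g \<in> sides q' \<and> q' \<noteq> q)"
  obtain p where "label q = Some p" using assms(1) unfolding squares_def by blast
  then have "p \<in> derived N rl {}" using edge_sound[OF assms, of "{}" p] n by blast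
  then show False by (rule derived_empty)
qed

end

context layout
begin

subsection \<open>Connectivity of the pieces\<close>

text \<open>Stuck sets are the possible remainders of an erasure, so linked squares survive or
  disappear together.\<close>

definition linked :: "square \<Rightarrow> square \<Rightarrow> bool" where
  "linked q q' \<longleftrightarrow> (\<forall>A\<subseteq>squares. stuck A \<longrightarrow> (q \<in> A \<longleftrightarrow> q' \<in> A))"

lemma linked_refl: "linked q q"
  by (simp add: linked_def)

lemma linked_sym: "linked q q' \<Longrightarrow> linked q' q"
  by (simp add: linked_def)

lemma linked_trans [trans]: "linked q q' \<Longrightarrow> linked q' q'' \<Longrightarrow> linked q q''"
  by (simp add: linked_def)

lemma private_linked:
  assumes "g \<in> sides q" "g \<in> sides q'" "\<And>x. g \<in> sides x \<Longrightarrow> label x \<noteq> None \<Longrightarrow> x = q \<or> x = q'"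
  shows "linked q q'"
  unfolding linked_def
proof (intro allI impI)
  have *: "q' \<in> A" if "A \<subseteq> squares" "stuck A" "q \<in> A" "g \<in> sides q" "\<And>x. g \<in> sides x \<Longrightarrow> label x \<noteq> None \<Longrightarrow> x = q \<or> x = q'" for A q q'
  proof -
    note h = that
    obtain x where x: "x \<in> A" "g \<in> sides x" "x \<noteq> q" using h(2-4) unfolding stuck_def by blast
    then have "label x \<noteq> None" using h(1) unfolding squares_def by blast
    then show ?thesis using h(5)[OF x(2)] x by blast
  qed
  fix A assume A: "A \<subseteq> squares" "stuck A"
  show "q \<in> A \<longleftrightarrow> q' \<in> A" using *[OF A, of q q'] *[OF A, of q' q] assms by blast
qed

lemma adj_private:
  assumes adj: "adj y g A B W r a b" and v: "v = y div 3" "l = y mod 3"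
    and ab: "a \<noteq> b \<Longrightarrow> k = max a b"
  shows "a = b \<or> wall r v l k = None \<and> below r v l k = None \<Longrightarrow> linked A B"
    "a \<noteq> b \<Longrightarrow> face r v l a = None \<Longrightarrow> below r v l k = None \<Longrightarrow> linked (W y) B"
    "a \<noteq> b \<Longrightarrow> face r v l a = None \<Longrightarrow> wall r v l k = None \<Longrightarrow> y = Suc y' \<Longrightarrow> linked (W y') B"
    "a \<noteq> b \<Longrightarrow> face r v l a = None \<Longrightarrow> face r v l b = None \<Longrightarrow> y = Suc y' \<Longrightarrow> linked (W y) (W y')"
proof -
  have sd: "g \<in> sides q \<longleftrightarrow> q = A \<or> q = B \<or> q = W y \<or> (\<exists>y'. y = Suc y' \<and> q = W y')" for q by (rule adj_sides[OF adj])
  have lA: "label A = face r v l a" "label B = face r v l b" "label (W y) = (if a = b then None else wall r v l k)"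
    using adj v ab unfolding adj_def by auto
  have lW: "label (W y') = (if a = b then None else below r v l k)" if "y = Suc y'" for y'
  proof -
    have "label (W y') = (if a = b then None else wall r (y' div 3) (y' mod 3) (max a b))" using adj unfolding adj_def by blast
    then show ?thesis using below_label[of r y' k] that v ab by auto
  qed
  show "linked A B" if "a = b \<or> wall r v l k = None \<and> below r v l k = None"
    by (rule private_linked[of g]) (use sd lA lW that in \<open>auto split: if_splits\<close>)
  show "linked (W y) B" if "a \<noteq> b" "face r v l a = None" "below r v l k = None"
    by (rule private_linked[of g]) (use sd lA lW that in \<open>auto split: if_splits\<close>)
  show "linked (W y') B" if "a \<noteq> b" "face r v l a = None" "wall r v l k = None" "y = Suc y'"
    by (rule private_linked[of g]) (use sd lA lW that in \<open>auto split: if_splits\<close>)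
  show "linked (W y) (W y')" if "a \<noteq> b" "face r v l a = None" "face r v l b = None" "y = Suc y'"
    by (rule private_linked[of g]) (use sd lA lW that in \<open>auto split: if_splits\<close>)
qed

abbreviation F :: "nat \<Rightarrow> nat \<Rightarrow> nat \<Rightarrow> nat \<Rightarrow> square" where
  "F r u w y \<equiv> Face (7 * r + u) y (7 + w)"

definition col :: "nat \<Rightarrow> bool" where "col r \<longleftrightarrow> 1 \<le> r \<and> r \<le> ncols"

lemma adj_u: "col r \<Longrightarrow> Suc u < 7 \<Longrightarrow> w < 7 \<Longrightarrow>
  adj y (Ez (7 * r + Suc u) y (7 + w)) (F r u w y) (F r (Suc u) w y) (\<lambda>y. Xw (7 * r + Suc u) y (7 + w)) r
    (max (ad u) (ad w)) (max (ad (Suc u)) (ad w))"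
proof -
  assume a: "col r" "Suc u < 7" "w < 7"
  have "Suc (7 * r + u) div 7 = r" using a by auto
  then show ?thesis using adj_x[of y "7 * r + u" "7 + w"] rho_in[of r u w] rho_in[of r "Suc u" w] a by (simp add: col_def)
qed

lemma adj_w: "col r \<Longrightarrow> u < 7 \<Longrightarrow> Suc w < 7 \<Longrightarrow>
  adj y (Ex (7 * r + u) y (7 + Suc w)) (F r u w y) (F r u (Suc w) y) (\<lambda>y. Zw (7 * r + u) y (7 + Suc w)) r
    (max (ad u) (ad w)) (max (ad u) (ad (Suc w)))"
proof -
  assume a: "col r" "u < 7" "Suc w < 7"
  have "(7 * r + u) div 7 = r" using a by auto
  then show ?thesis using adj_z[of y "7 * r + u" "7 + w"] rho_in[of r u w] rho_in[of r u "Suc w"] a by (simp add: col_def)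
qed

lemma ring_u: "col r \<Longrightarrow> Suc u < 7 \<Longrightarrow> w < 7 \<Longrightarrow> max (ad u) (ad w) = max (ad (Suc u)) (ad w) \<Longrightarrow> linked (F r u w y) (F r (Suc u) w y)"
  by (rule adj_private(1)[OF adj_u refl refl]) auto

lemma ring_w: "col r \<Longrightarrow> u < 7 \<Longrightarrow> Suc w < 7 \<Longrightarrow> max (ad u) (ad w) = max (ad u) (ad (Suc w)) \<Longrightarrow> linked (F r u w y) (F r u (Suc w) y)"
  by (rule adj_private(1)[OF adj_w refl refl]) auto

abbreviation root :: "nat \<Rightarrow> square" where "root y \<equiv> Face 7 y 7"

text \<open>The row \<open>j = 7\<close> is the border of all blocks and stays in ring 3, beyond the
  reach of tubes and tunnels. It joins the columns of one level.\<close>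

lemma row_linked: "7 + n < 7 * Suc ncols \<Longrightarrow> linked (root y) (Face (7 + n) y 7)"
proof (induction n)
  case (Suc n)
  have "rho i 7 = 3" if "7 \<le> i" "i < 7 * Suc ncols" for i
  proof -
    have "1 \<le> i div 7" using div_le_mono[OF that(1), of 7] by simp
    moreover have "i div 7 < Suc ncols" using that(2) by (simp only: div_less_iff_less_mult mult.commute[of 7] zero_less_numeral)
    ultimately have "1 \<le> i div 7" "i div 7 \<le> ncols" by simp_all
    then show ?thesis using ad_le[of "i mod 7"] by (simp add: rho_def inside_def ad_def)
  qed
  then have "rho (7 + n) 7 = rho (Suc (7 + n)) 7" using Suc.prems by simp
  then have "linked (Face (7 + n) y 7) (Face (Suc (7 + n)) y 7)"
    by (intro adj_private(1)[OF adj_x refl refl]) auto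
  then show ?case using Suc by (auto intro: linked_trans)
qed (simp add: linked_refl)

lemma ring3_linked:
  assumes c: "col r" and uw: "u < 7" "w < 7" and r3: "max (ad u) (ad w) = 3"
  shows "linked (F r u w y) (root y)"
proof -
  have base: "linked (F r u 0 y) (root y)" if "u < 7" for u
  proof -
    have "7 * r + u = 7 + (7 * (r - 1) + u)" "7 + (7 * (r - 1) + u) < 7 * Suc ncols"
      using c that unfolding col_def by auto
    then show ?thesis using row_linked[of "7 * (r - 1) + u" y] by (metis add.right_neutral linked_sym)
  qed
  have up: "linked (F r u 0 y) (F r u w y)" if "u = 0 \<or> u = 6" "w < 7" for u w
    using that(2)
  proof (induction w)
    case (Suc w)
    have "max (ad u) (ad w) = max (ad u) (ad (Suc w))" using that(1) ad_le[of w] ad_le[of "Suc w"] Suc.prems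
      by (auto simp: ad_def)
    then have "linked (F r u w y) (F r u (Suc w) y)" by (intro ring_w c) (use that(1) Suc.prems in auto)
    then show ?case using Suc by (auto intro: linked_trans)
  qed (simp add: linked_refl)
  have top: "linked (F r 0 6 y) (F r u 6 y)" if "u < 7" for u
    using that
  proof (induction u)
    case (Suc u)
    have "linked (F r u 6 y) (F r (Suc u) 6 y)" by (intro ring_u c) (use Suc.prems in \<open>auto simp: ad_def\<close>)
    then show ?case using Suc by (auto intro: linked_trans)
  qed (simp add: linked_refl)
  have "u = 0 \<or> u = 6 \<or> w = 0 \<or> w = 6"
    using r3 uw by (auto simp: ad_def max_def split: if_splits)
  then consider "u = 0 \<or> u = 6" | "w = 0" | "w = 6" by blast
  then show ?thesis
  proof cases
    case 1
    then show ?thesis using up[OF 1 uw(2)] base[OF uw(1)] linked_sym linked_trans by blast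
  next
    case 2
    then show ?thesis using base[OF uw(1)] by simp
  next
    case 3
    have "linked (F r u 6 y) (root y)"
      by (rule linked_trans[OF linked_sym[OF top[OF uw(1)]] linked_trans[OF linked_sym[OF up[of 0 6]] base[of 0]]]) simp_all
    then show ?thesis using 3 by simp
  qed
qed

lemma outward:
  assumes c: "col r" and uw: "u < 7" "w < 7" and a: "max (ad u) (ad w) = a" "a < 3"
    and nb: "wall r (y div 3) (y mod 3) (Suc a) = None" "below r (y div 3) (y mod 3) (Suc a) = None"
  shows "\<exists>u' w'. u' < 7 \<and> w' < 7 \<and> max (ad u') (ad w') = Suc a \<and> linked (F r u w y) (F r u' w' y)"
proof (cases "ad w \<le> ad u")
  case True
  then have au: "ad u = a" using a by simp
  show ?thesis
  proof (cases "3 \<le> u")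
    case T: True
    then have s: "Suc u < 7" "ad (Suc u) = Suc a" using au a(2) by (auto simp: ad_def split: if_splits)
    then have m: "max (ad (Suc u)) (ad w) = Suc a" using True au by simp
    have "linked (F r u w y) (F r (Suc u) w y)"
      by (rule adj_private(1)[OF adj_u[OF c s(1) uw(2)] refl refl, of "Suc a"]) (use m a nb in auto)
    then show ?thesis using s m uw by blast
  next
    case False
    then obtain u' where u': "u = Suc u'" using au a(2) by (cases u) (auto simp: ad_def)
    then have s: "ad u' = Suc a" using au False by (auto simp: ad_def split: if_splits)
    then have m: "max (ad u') (ad w) = Suc a" using True au by simp
    have "linked (F r u' w y) (F r (Suc u') w y)"
      by (rule adj_private(1)[OF adj_u[OF c _ uw(2)] refl refl, of _ "Suc a"]) (use m a nb u' uw in auto)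
    then show ?thesis using m u' uw linked_sym by (intro exI[of _ u'] exI[of _ w]) auto
  qed
next
  case False
  then have aw: "ad w = a" using a by simp
  show ?thesis
  proof (cases "3 \<le> w")
    case T: True
    then have s: "Suc w < 7" "ad (Suc w) = Suc a" using aw a(2) by (auto simp: ad_def split: if_splits)
    then have m: "max (ad u) (ad (Suc w)) = Suc a" using False aw by simp
    have "linked (F r u w y) (F r u (Suc w) y)"
      by (rule adj_private(1)[OF adj_w[OF c uw(1) s(1)] refl refl, of "Suc a"]) (use m a nb in auto)
    then show ?thesis using s m uw by blast
  next
    case F3: False
    then obtain w' where w': "w = Suc w'" using aw a(2) by (cases w) (auto simp: ad_def)
    then have s: "ad w' = Suc a" using aw F3 by (auto simp: ad_def split: if_splits)
    then have m: "max (ad u) (ad w') = Suc a" using False aw by simp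
    have "linked (F r u w' y) (F r u (Suc w') y)"
      by (rule adj_private(1)[OF adj_w[OF c uw(1)] refl refl, of _ "Suc a"]) (use m a nb w' uw in auto)
    then show ?thesis using m w' uw linked_sym by (intro exI[of _ u] exI[of _ w']) auto
  qed
qed

text \<open>A cell with no wall in its way is led outward ring by ring until it reaches the border
  ring.\<close>

lemma unblocked_linked:
  assumes c: "col r" and nb: "\<And>k. a < k \<Longrightarrow> k \<le> 3 \<Longrightarrow> wall r (y div 3) (y mod 3) k = None \<and> below r (y div 3) (y mod 3) k = None"
  shows "u < 7 \<Longrightarrow> w < 7 \<Longrightarrow> max (ad u) (ad w) = a' \<Longrightarrow> a \<le> a' \<Longrightarrow> a' \<le> 3 \<Longrightarrow> linked (F r u w y) (root y)"
proof (induction "3 - a'" arbitrary: a' u w)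
  case 0
  then show ?case using ring3_linked[OF c] by simp
next
  case (Suc n)
  then have "a' < 3" by simp
  moreover have "wall r (y div 3) (y mod 3) (Suc a') = None" "below r (y div 3) (y mod 3) (Suc a') = None"
    using nb[of "Suc a'"] Suc.prems \<open>a' < 3\<close> by auto
  ultimately obtain u' w' where u': "u' < 7" "w' < 7" "max (ad u') (ad w') = Suc a'" "linked (F r u w y) (F r u' w' y)"
    using outward[OF c Suc.prems(1,2,3)] by blast
  then have "linked (F r u' w' y) (root y)" by (intro Suc.hyps(1)[of "Suc a'"]) (use Suc \<open>a' < 3\<close> in auto)
  then show ?case using u'(4) linked_trans by blast
qed

text \<open>On the way outward within a face, the only possible obstacle is a tube that ends on it,
  and then the cells of ring 1 are cut off together with ring 0. This is why such a plate has a
  tunnel in the same column.\<close>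

lemma blocked_cases:
  assumes l: "l < 3" and f: "face r v l a \<noteq> None" and k: "a < k" "k \<le> 3"
  shows "wall r v l k = None \<and> below r v l k = None \<or> has_tube r \<and> a = 1 \<and> (xt r v \<and> l = 2 \<or> yt r v \<and> l = 0)"
proof -
  have ya: "yk r v l \<le> a" "v < 3 * N" using f by (auto simp: face_def split: if_splits)
  consider "k = 1" | "k = 2" | "k = 3" using k by linarith
  then show ?thesis
  proof cases
    case 1
    then have "face r v l 0 \<noteq> None" using f k by auto
    then have "wall r v l 1 = None" using edge_table_1(2)[OF l, of r v] by metis
    moreover have "below r v l 1 = None" using edge_table_1(3)[OF l, of r v] \<open>face r v l 0 \<noteq> None\<close> by metis
    ultimately show ?thesis using 1 by simp
  next
    case 3
    have "\<not> (thru r v \<and> (l \<noteq> 0 \<or> \<not> md r v))" using ya k 3 by (auto simp: yk_def split: if_splits)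
    then have "\<not> thru r v \<or> l = 0 \<and> md r v" by blast
    then have "wall r v l 3 = None" by (auto simp: wall_def)
    moreover have "below r v l 3 = None"
    proof -
      consider "l = 0" | "l = 1" | "l = 2" using l by linarith
      then show ?thesis using \<open>\<not> thru r v \<or> l = 0 \<and> md r v\<close> by cases (auto simp: wall_def below_def)
    qed
    ultimately show ?thesis using 3 by simp
  next
    case 2
    have a1: "face r v l 1 \<noteq> None" using ya k 2 by (simp add: face_def)
    from l show ?thesis
    proof (cases rule: edge_table_2[where r = r and v = v])
      case flat
      then show ?thesis using 2 by simp
    next
      case start
      then have "xt r v" using a1 by (auto simp: xt_def)
      moreover have "a = 1"
      proof -
        have "yk r v l = 1" using \<open>xt r v\<close> start thruD[of r v] by (auto simp: yk_def)
        then show ?thesis using ya k 2 by simp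
      qed
      ultimately show ?thesis using start by simp
    next
      case stop
      then have "yt r v" using a1 by (auto simp: yt_def)
      moreover have "a = 1"
      proof -
        have "yk r v l = 1" using \<open>yt r v\<close> stop thruD[of r v] xtD[of r v] by (auto simp: yk_def)
        then show ?thesis using ya k 2 by simp
      qed
      ultimately show ?thesis using stop by simp
    qed (use a1 in auto)
  qed
qed

lemma ring1_linked:
  assumes c: "col r" and uw: "u < 7" "w < 7" "max (ad u) (ad w) = 1"
  shows "linked (F r u w y) (F r 2 3 y)"
proof -
  have R: "linked (F r u w y) (F r (Suc u) w y)" if "Suc u < 7" "w < 7" "max (ad u) (ad w) = max (ad (Suc u)) (ad w)" for u w
    using ring_u[OF c that] .
  have Wr: "linked (F r u w y) (F r u (Suc w) y)" if "u < 7" "Suc w < 7" "max (ad u) (ad w) = max (ad u) (ad (Suc w))" for u w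
    using ring_w[OF c that] .
  have e1: "linked (F r 2 2 y) (F r 2 3 y)" using Wr[of 2 2] by (simp add: ad_def)
  have e2: "linked (F r 2 3 y) (F r 2 4 y)" using Wr[of 2 3] by (simp add: ad_def)
  have e3: "linked (F r 2 2 y) (F r 3 2 y)" using R[of 2 2] by (simp add: ad_def)
  have e4: "linked (F r 3 2 y) (F r 4 2 y)" using R[of 3 2] by (simp add: ad_def)
  have e5: "linked (F r 2 4 y) (F r 3 4 y)" using R[of 2 4] by (simp add: ad_def)
  have e6: "linked (F r 3 4 y) (F r 4 4 y)" using R[of 3 4] by (simp add: ad_def)
  have e7: "linked (F r 4 2 y) (F r 4 3 y)" using Wr[of 4 2] by (simp add: ad_def)
  note d = linked_sym
  note t32 = linked_trans[OF d[OF e3] e1] and t34 = linked_trans[OF d[OF e5] d[OF e2]]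
  note t42 = linked_trans[OF d[OF e4] t32] and t44 = linked_trans[OF d[OF e6] t34]
  note t43 = linked_trans[OF d[OF e7] t42]
  have "(u, w) \<in> {(2,2),(2,3),(2,4),(3,2),(3,4),(4,2),(4,3),(4,4)}"
    using uw by (auto simp: ad_def max_def split: if_splits)
  then consider "u = 2 \<and> w = 2" | "u = 2 \<and> w = 3" | "u = 2 \<and> w = 4" | "u = 3 \<and> w = 2" | "u = 3 \<and> w = 4"
    | "u = 4 \<and> w = 2" | "u = 4 \<and> w = 3" | "u = 4 \<and> w = 4" by auto
  then show ?thesis
    by cases (simp_all only: e1 d[OF e2] t32 t34 t42 t43 t44 linked_refl)
qed

text \<open>The disc inside the tunnel is missing from both faces, so at each end the tunnel wall
  meets a single further square.\<close>

lemma tunnel_linked: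
  assumes c: "col r" and v: "v < 3 * N" and t: "xt r v \<and> l = 1 \<or> yt r v \<and> l = 0"
  shows "linked (F r 2 3 (3 * v + l)) (F r 2 3 (3 * v + Suc l))"
proof -
  have l: "l < 3" "Suc l < 3" using t by auto
  have w1: "wall r v l 1 \<noteq> None" using t v by (auto simp: wall_def)
  have b1: "below r v (Suc l) 1 \<noteq> None" using w1 by (simp add: below_def)
  have A: "adj y' (Ez (7 * r + 3) y' 10) (F r 3 3 y') (F r 2 3 y') (\<lambda>y. Xw (7 * r + 3) y 10) r 0 1" for y'
    using adj_sym[OF adj_u[OF c, of 2 3 y']] by (simp add: ad_def)
  have "linked (Xw (7 * r + 3) (3 * v + l) 10) (F r 2 3 (3 * v + l))"
    by (rule adj_private(2)[where v = v and l = l and k = 1, OF A]) (use l edge_table_1(2)[OF l(1) w1] in auto)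
  moreover have "linked (Xw (7 * r + 3) (3 * v + l) 10) (F r 2 3 (3 * v + Suc l))"
    by (rule adj_private(3)[where v = v and l = "Suc l" and k = 1, OF A]) (use l edge_table_1(3)[OF l(2) b1] in auto)
  ultimately show ?thesis using linked_sym linked_trans by blast
qed

lemma col_special: "col 1" "col 5"
  using N_pos by (auto simp: col_def ncols_def)

text \<open>The outer walls cannot join the three faces, since the edge at the middle face carries
  three squares. Columns 1 and 5, of kinds 1 and 0, contain no tube; their tunnels lead from the
  middle face to the front and to the back face.\<close>

lemma level_linked:
  assumes v: "v < 3 * N" and l: "l < 3"
  shows "linked (root (3 * v + l)) (root (3 * v + 1))"
proof -
  have no: "\<not> has_tube 1" "\<not> has_tube 5" by (auto simp: has_tube_def is_and_def)
  have un: "linked (F r 2 3 (3 * v + l)) (root (3 * v + l))" if "col r" "\<not> has_tube r" "face r v l 1 \<noteq> None" "l < 3" for r l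
    by (rule unblocked_linked[OF that(1), of 1 _ 2 3 1]) (use blocked_cases[OF that(4,3)] that in \<open>auto simp: ad_def\<close>)
  have 0: "linked (root (3 * v + 0)) (root (3 * v + 1))"
  proof -
    have y: "yt 1 v" "\<not> xt 1 v" "\<not> thru 1 v" using no by (auto simp: yt_def xt_def thru_def)
    then have f: "face 1 v 0 1 \<noteq> None" "face 1 v 1 1 \<noteq> None" using v by (auto simp: face_def yk_def)
    have t: "linked (F 1 2 3 (3 * v + 0)) (F 1 2 3 (3 * v + 1))" using tunnel_linked[OF col_special(1) v, of 0] y by simp
    have r0: "linked (F 1 2 3 (3 * v + 0)) (root (3 * v + 0))" by (rule un[OF col_special(1) no(1) f(1)]) simp
    have r1: "linked (F 1 2 3 (3 * v + 1)) (root (3 * v + 1))" by (rule un[OF col_special(1) no(1) f(2)]) simp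
    show ?thesis by (rule linked_trans[OF linked_sym[OF r0] linked_trans[OF t r1]])
  qed
  have 2: "linked (root (3 * v + 2)) (root (3 * v + 1))"
  proof -
    have y: "xt 5 v" "\<not> yt 5 v" "\<not> thru 5 v" using no by (auto simp: yt_def xt_def thru_def)
    then have f: "face 5 v 2 1 \<noteq> None" "face 5 v 1 1 \<noteq> None" using v by (auto simp: face_def yk_def)
    have t: "linked (F 5 2 3 (3 * v + 1)) (F 5 2 3 (3 * v + 2))" using tunnel_linked[OF col_special(2) v, of 1] y by (simp add: numeral_2_eq_2)
    have r2: "linked (F 5 2 3 (3 * v + 2)) (root (3 * v + 2))" by (rule un[OF col_special(2) no(2) f(1)]) simp
    have r1: "linked (F 5 2 3 (3 * v + 1)) (root (3 * v + 1))" by (rule un[OF col_special(2) no(2) f(2)]) simp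
    show ?thesis by (rule linked_trans[OF linked_sym[OF r2] linked_trans[OF linked_sym[OF t] r1]])
  qed
  have "l = 0 \<or> l = 1 \<or> l = 2" using l by auto
  then show ?thesis using 0 2 linked_refl by auto
qed

lemma face_linked:
  assumes "label (Face i y j) = Some (Plate v)"
  shows "linked (Face i y j) (root (3 * v + 1))"
proof -
  define l where "l = y mod 3"
  have f: "face (i div 7) (y div 3) l (rho i j) = Some (Plate v)" using assms by (simp add: l_def)
  then have v: "y div 3 = v" "v < 3 * N" "rho i j < 4" by (auto simp: face_def split: if_splits)
  have y: "y = 3 * v + l" "l < 3" using v(1) by (auto simp: l_def)
  define r u w where "r = i div 7" and "u = i mod 7" and "w = j mod 7"
  have ins: "inside i j" using v(3) by (simp add: rho_less_4)
  then have c: "col r" unfolding inside_def col_def r_def by simp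
  have "j div 7 = 1" using ins unfolding inside_def by simp
  then have ij: "i = 7 * r + u" "j = 7 + w" and uw: "u < 7" "w < 7"
    using div_mult_mod_eq[of j 7] unfolding r_def u_def w_def by simp_all
  have rho: "rho i j = max (ad u) (ad w)" using ins unfolding rho_def u_def w_def by simp
  have eq: "Face i y j = F r u w (3 * v + l)" using ij y by simp
  have fr: "face r v l (max (ad u) (ad w)) \<noteq> None" using f v(1) rho r_def by simp
  have root: "linked (root (3 * v + l)) (root (3 * v + 1))" by (rule level_linked[OF v(2) y(2)])
  show ?thesis
  proof (cases "has_tube r \<and> max (ad u) (ad w) = 1 \<and> (xt r v \<and> l = 2 \<or> yt r v \<and> l = 0)")
    case False
    then have "linked (F r u w (3 * v + l)) (root (3 * v + l))"
      by (intro unblocked_linked[OF c, of "max (ad u) (ad w)" _ _ _ "max (ad u) (ad w)"])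
        (use blocked_cases[OF y(2) fr] y(2) uw ad_le in auto)
    then show ?thesis using root eq linked_trans by metis
  next
    case True
    \<comment> \<open>The part of the face inside the foot of a tube is separated from its level; it
      is joined through the tunnel to the middle face, where no tube is in the way.\<close>
    have r1: "linked (F r u w (3 * v + l)) (F r 2 3 (3 * v + l))" by (rule ring1_linked[OF c uw]) (use True in simp)
    have M: "linked (F r 2 3 (3 * v + l)) (F r 2 3 (3 * v + 1))"
    proof (cases "l = 2")
      case l2: True
      then have "xt r v" using True by auto
      then show ?thesis using tunnel_linked[OF c v(2), of 1] l2 linked_sym by (simp add: numeral_2_eq_2)
    next
      case False
      then show ?thesis using tunnel_linked[OF c v(2), of 0] True by auto
    qed
    have "\<not> thru r v" using True thruD by blast
    then have f1: "face r v 1 1 \<noteq> None" using True v(2) xtD[of r v] by (auto simp: face_def yk_def)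
    have d: "(3 * v + 1) div 3 = v" "(3 * v + 1) mod 3 = 1" by auto
    have "wall r ((3 * v + 1) div 3) ((3 * v + 1) mod 3) k = None \<and> below r ((3 * v + 1) div 3) ((3 * v + 1) mod 3) k = None"
      if "1 < k" "k \<le> 3" for k
      unfolding d using blocked_cases[OF _ f1 that] by auto
    then have "linked (F r 2 3 (3 * v + 1)) (root (3 * v + 1))"
      by (rule unblocked_linked[OF c, where a = 1 and a' = 1]) (auto simp: ad_def)
    then show ?thesis using r1 M eq linked_trans by metis
  qed
qed

end

section \<open>Walls and tubes are linked to their pieces\<close>

context layout
begin

text \<open>A wall square is presented as a member of a family \<open>W\<close> over all heights,
  and the cells beside it are ordered so that \<open>B\<close> lies in the outer ring. The family
  lets a later step pass to the edges above and below.\<close>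

lemma wall_adj:
  assumes lq: "label q = Some p" and q: "q = Xw i y j \<or> q = Zw i y j"
  obtains W r k A B g where "W y = q" "\<And>y'. adj y' (g y') (A y') (B y') W r (k - 1) k" "1 \<le> k" "k \<le> 4"
    "wall r (y div 3) (y mod 3) k = Some p" "\<And>y'. \<exists>i j. A y' = Face i y' j" "\<And>y'. \<exists>i j. B y' = Face i y' j"
proof -
  have out: "rho 0 j = 4" "rho i 0 = 4" for i j by (simp_all add: rho_def inside_def)
  note ret = that
  have gen: thesis if adj: "\<And>y'. adj y' (g y') (A y') (B y') W r a b" and W: "W y = q"
    and A: "\<And>y'. \<exists>i j. A y' = Face i y' j" and B: "\<And>y'. \<exists>i j. B y' = Face i y' j" for g A B W r a b
  proof -
    have ne: "a \<noteq> b" and w: "wall r (y div 3) (y mod 3) (max a b) = Some p"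
      using adj[of y] lq W unfolding adj_def by (auto split: if_splits)
    have le: "a \<le> 4" "b \<le> 4" "b = Suc a \<or> a = Suc b" using adj[of y] ne unfolding adj_def by auto
    from le(3) show thesis
    proof
      assume b: "b = Suc a"
      show thesis by (rule ret[where W = W and g = g and A = A and B = B and r = r and k = b]) (use adj W A B w le b in \<open>auto simp: max_def\<close>)
    next
      assume a: "a = Suc b"
      show thesis by (rule ret[where W = W and g = g and A = B and B = A and r = r and k = a]) (use adj_sym[OF adj] W A B w le a in \<open>auto simp: max_def\<close>)
    qed
  qed
  from q show thesis
  proof
    assume x: "q = Xw i y j"
    have "i \<noteq> 0" using lq x out by (intro notI) auto
    then obtain i' where "i = Suc i'" using not0_implies_Suc by blast
    then show thesis by (intro gen[OF adj_x[of _ i' j]]) (use x in auto)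
  next
    assume z: "q = Zw i y j"
    have "j \<noteq> 0" using lq z out by (intro notI) auto
    then obtain j' where "j = Suc j'" using not0_implies_Suc by blast
    then show thesis by (intro gen[OF adj_z[of _ i j']]) (use z in auto)
  qed
qed

lemma adj_face_linked:
  assumes "adj y g A B W r a b" "\<exists>i j. B = Face i y j" "face r (y div 3) (y mod 3) b = Some (Plate v)"
  shows "linked B (root (3 * v + 1))"
proof -
  have "label B = Some (Plate v)" using assms(1,3) unfolding adj_def by simp
  then show ?thesis using assms(2) face_linked by blast
qed

lemma tube_range: "tube_at r (y div 3) (y mod 3) \<longleftrightarrow> has_tube r \<and> 3 * lo r + 2 \<le> y \<and> y < 3 * hi r"
proof -
  have "(y div 3 = a \<and> y mod 3 = 2 \<or> a < y div 3 \<and> y div 3 < b) \<longleftrightarrow> 3 * a + 2 \<le> y \<and> y < 3 * b" if "a < b" for a b :: nat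
    using that by presburger
  from this[OF lo_less_hi[of r]] show ?thesis unfolding tube_at_def by blast
qed

text \<open>The edge has to be chosen where the wall meets a single further square. An outer wall
  uses the front or the back face, never the middle one. A rim does likewise, except at the middle
  plate of a rule, where the upper rim is the only one and is linked to the middle face.\<close>

lemma plate_wall_linked:
  assumes adj: "\<And>y'. adj y' (g y') (A y') (B y') W r (k - 1) k" and k: "1 \<le> k" "k \<le> 4" "k \<noteq> 2"
    and w: "wall r (y div 3) (y mod 3) k = Some (Plate v)"
    and AB: "\<And>y'. \<exists>i j. A y' = Face i y' j" "\<And>y'. \<exists>i j. B y' = Face i y' j"
  shows "linked (W y) (root (3 * v + 1))"
proof -
  define l where "l = y mod 3"
  have v: "y div 3 = v" "v < 3 * N" using w k by (auto simp: wall_def split: if_splits)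
  have y: "y = 3 * v + l" "l < 3" using v(1) by (auto simp: l_def)
  have ne: "k - 1 \<noteq> k" "max (k - 1) k = k" using k by auto
  have w': "wall r v l k = Some (Plate v)" using w v l_def by simp
  have next_level: "Suc y div 3 = v" "Suc y mod 3 = 2" if "l = 1" using y(1) that by presburger+
  consider (1) "k = 1" | (3) "k = 3" | (4) "k = 4" using k by linarith
  then show ?thesis
  proof cases
    case 1
    have T: "below r v l 1 = None" "face r v l 0 = None" "face r v l 1 = Some (Plate v)"
      using edge_table_1(2)[OF y(2), of r v] w' 1 by auto
    have "linked (W y) (B y)"
      by (rule adj_private(2)[where v = v and l = l and k = k, OF adj]) (use v l_def ne T 1 in auto)
    moreover have "linked (B y) (root (3 * v + 1))"
      by (rule adj_face_linked[OF adj AB(2)]) (use v l_def T 1 in auto)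
    ultimately show ?thesis by (rule linked_trans)
  next
    case 3
    then have th: "thru r v" "l = 1 \<or> l = 0 \<and> \<not> md r v" using w' by (auto simp: wall_def split: if_splits)
    show ?thesis
    proof (cases "l = 0 \<or> md r v")
      case True
      have T: "face r v l 2 = None" "below r v l 3 = None" using th True by (auto simp: face_def yk_def below_def wall_def)
      have "linked (W y) (B y)"
        by (rule adj_private(2)[where v = v and l = l and k = k, OF adj]) (use v l_def ne T 3 in auto)
      moreover have "linked (B y) (root (3 * v + 1))"
        by (rule adj_face_linked[OF adj AB(2)]) (use v l_def face_outer 3 in auto)
      ultimately show ?thesis by (rule linked_trans)
    next
      case False
      then have l1: "l = 1" "\<not> md r v" using th by auto
      have T: "face r v 2 2 = None" "wall r v 2 3 = None" using th l1 by (auto simp: face_def yk_def wall_def)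
      have "linked (W y) (B (Suc y))"
        by (rule adj_private(3)[where v = v and l = 2 and k = k, OF adj]) (use next_level[OF l1(1)] ne T 3 in auto)
      moreover have "linked (B (Suc y)) (root (3 * v + 1))"
        by (rule adj_face_linked[OF adj AB(2)]) (use next_level[OF l1(1)] v face_outer 3 in auto)
      ultimately show ?thesis by (rule linked_trans)
    qed
  next
    case 4
    then have "l \<noteq> 2" using w' by (auto simp: wall_def split: if_splits)
    then have l: "l = 0 \<or> l = 1" using y by auto
    note adj' = adj_sym[OF adj]
    from l show ?thesis
    proof
      assume l0: "l = 0"
      have T: "below r v l 4 = None" using l0 by (auto simp: below_def wall_def)
      have "linked (W y) (A y)"
        by (rule adj_private(2)[where v = v and l = l and k = k, OF adj']) (use v l_def ne T 4 face_4 in auto)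
      moreover have "linked (A y) (root (3 * v + 1))"
        by (rule adj_face_linked[OF adj' AB(1)]) (use v l_def face_outer 4 in auto)
      ultimately show ?thesis by (rule linked_trans)
    next
      assume l1: "l = 1"
      have T: "wall r v 2 4 = None" by (auto simp: wall_def)
      have "linked (W y) (A (Suc y))"
        by (rule adj_private(3)[where v = v and l = 2 and k = k, OF adj']) (use next_level[OF l1] ne T 4 face_4 in auto)
      moreover have "linked (A (Suc y)) (root (3 * v + 1))"
        by (rule adj_face_linked[OF adj' AB(1)]) (use next_level[OF l1] v face_outer 4 in auto)
      ultimately show ?thesis by (rule linked_trans)
    qed
  qed
qed

lemma tube_step:
  assumes adj: "\<And>y'. adj y' (g y') (A y') (B y') W r 1 2" and t: "has_tube r" "3 * lo r + 2 \<le> y" "Suc y < 3 * hi r"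
    and m: "is_and r \<Longrightarrow> Suc y \<noteq> 3 * mid r"
  shows "linked (W (Suc y)) (W y)"
proof -
  have l: "Suc y mod 3 < 3" by simp
  have "lo r < Suc y div 3" "Suc y div 3 < hi r" using t(2,3) by auto
  then have th: "thru r (Suc y div 3)" using t(1) by (simp add: thru_def)
  have "\<not> (md r (Suc y div 3) \<and> Suc y mod 3 = 0)"
  proof
    assume a: "md r (Suc y div 3) \<and> Suc y mod 3 = 0"
    then have "Suc y = 3 * mid r" "is_and r" unfolding md_def by auto
    then show False using m by blast
  qed
  then have "face r (Suc y div 3) (Suc y mod 3) 1 = None" "face r (Suc y div 3) (Suc y mod 3) 2 = None"
    using th by (auto simp: face_def yk_def)
  then show ?thesis by (intro adj_private(4)[where k = 2, OF adj refl refl]) auto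
qed

text \<open>The induction starts at the end where the tube continues its own plate: the lower end
  for kind 3, the upper end for kind 4.\<close>

lemma copy_tube_linked:
  assumes adj: "\<And>y'. adj y' (g y') (A y') (B y') W r 1 2" and AB: "\<And>y'. \<exists>i j. B y' = Face i y' j"
    and t: "3 * lo r + 2 \<le> y" "y < 3 * hi r"
  shows "r mod 5 = 3 \<Longrightarrow> linked (W y) (root (3 * lo r + 1))" "r mod 5 = 4 \<Longrightarrow> linked (W y) (root (3 * hi r + 1))"
proof -
  note lh = lo_less_hi[of r] hi_less[of r]
  {
    assume k: "r mod 5 = 3"
    then have ht: "has_tube r" "\<not> is_and r" by (simp_all add: has_tube_def is_and_def)
    have "y < 3 * hi r \<longrightarrow> linked (W y) (root (3 * lo r + 1))" using t(1)
    proof (induction y rule: dec_induct)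
      case base
      have d: "(3 * lo r + 2) div 3 = lo r" "(3 * lo r + 2) mod 3 = 2" by presburger+
      have h: "hl r (lo r)" "\<not> xt r (lo r)" "\<not> yt r (lo r)" "\<not> thru r (lo r)"
        using k lh by (auto simp: hl_def xt_def yt_def thru_def)
      have T: "face r (lo r) 2 1 = None" "face r (lo r) 2 2 = Some (Plate (lo r))" "below r (lo r) 2 2 = None"
        using h lh by (auto simp: face_def yk_def below_2)
      have "linked (W (3 * lo r + 2)) (B (3 * lo r + 2))"
        by (rule adj_private(2)[where v = "lo r" and l = 2 and k = 2, OF adj]) (use d T in auto)
      moreover have "linked (B (3 * lo r + 2)) (root (3 * lo r + 1))"
        by (rule adj_face_linked[OF adj AB]) (use d T in auto)
      ultimately show ?case by (intro impI) (rule linked_trans)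
    next
      case (step n)
      show ?case
      proof
        assume u: "Suc n < 3 * hi r"
        have "linked (W (Suc n)) (W n)" by (rule tube_step[OF adj ht(1) step(1) u]) (use ht(2) in simp)
        moreover have "linked (W n) (root (3 * lo r + 1))" using step(3) u by simp
        ultimately show "linked (W (Suc n)) (root (3 * lo r + 1))" by (rule linked_trans)
      qed
    qed
    then show "linked (W y) (root (3 * lo r + 1))" using t(2) by blast
  }
  {
    assume k: "r mod 5 = 4"
    then have ht: "has_tube r" "\<not> is_and r" by (simp_all add: has_tube_def is_and_def)
    have le: "y \<le> 3 * hi r - 1" using t(2) by simp
    then have "3 * lo r + 2 \<le> y \<longrightarrow> linked (W y) (root (3 * hi r + 1))"
    proof (induction y rule: inc_induct)
      case base
      have s: "3 * hi r = Suc (3 * hi r - 1)" using lh by auto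
      have d: "(3 * hi r) div 3 = hi r" "(3 * hi r) mod 3 = 0" by auto
      have h: "hr r (hi r)" "\<not> xt r (hi r)" "\<not> yt r (hi r)" "\<not> thru r (hi r)" "\<not> hl r (hi r)"
        using k lh by (auto simp: hr_def xt_def yt_def thru_def hl_def)
      have T: "face r (hi r) 0 1 = None" "face r (hi r) 0 2 = Some (Plate (hi r))" "wall r (hi r) 0 2 = None"
        using h lh by (auto simp: face_def yk_def wall_2 tube_at_def)
      have "linked (W (3 * hi r - 1)) (B (3 * hi r))"
        by (rule adj_private(3)[where v = "hi r" and l = 0 and k = 2, OF adj]) (use d s T in auto)
      moreover have "linked (B (3 * hi r)) (root (3 * hi r + 1))"
        by (rule adj_face_linked[OF adj AB]) (use d T in auto)
      ultimately show ?case by (intro impI) (rule linked_trans)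
    next
      case (step n)
      show ?case
      proof
        assume u: "3 * lo r + 2 \<le> n"
        have "linked (W (Suc n)) (W n)" by (rule tube_step[OF adj ht(1) u]) (use step(2) ht(2) in simp_all)
        moreover have "linked (W (Suc n)) (root (3 * hi r + 1))" using step(3) u by simp
        ultimately show "linked (W n) (root (3 * hi r + 1))" by (rule linked_trans[OF linked_sym])
      qed
    qed
    then show "linked (W y) (root (3 * hi r + 1))" using t(1) by blast
  }
qed

text \<open>The two parts are treated separately, because the edge at the front face of the middle
  plate carries a third square and links nothing.\<close>

lemma and_tube_linked:
  assumes adj: "\<And>y'. adj y' (g y') (A y') (B y') W r 1 2" and a: "is_and r"
  shows "3 * lo r + 2 \<le> y \<Longrightarrow> y < 3 * mid r \<Longrightarrow> linked (W y) (W (3 * lo r + 2))"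
    "3 * mid r \<le> y \<Longrightarrow> y < 3 * hi r \<Longrightarrow> linked (W y) (W (3 * mid r))"
proof -
  have ht: "has_tube r" using a by (simp add: has_tube_def)
  note lh = lo_less_mid[OF a] mid_less_hi[OF a]
  show "linked (W y) (W (3 * lo r + 2))" if "3 * lo r + 2 \<le> y" "y < 3 * mid r"
    using that
  proof (induction y rule: dec_induct)
    case (step n)
    have "linked (W (Suc n)) (W n)" by (rule tube_step[OF adj ht step(1)]) (use step lh in auto)
    moreover have "linked (W n) (W (3 * lo r + 2))" using step by simp
    ultimately show ?case by (rule linked_trans)
  qed (simp add: linked_refl)
  show "linked (W y) (W (3 * mid r))" if "3 * mid r \<le> y" "y < 3 * hi r"
    using that
  proof (induction y rule: dec_induct)
    case (step n)
    have "linked (W (Suc n)) (W n)" by (rule tube_step[OF adj ht]) (use step lh in auto)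
    moreover have "linked (W n) (W (3 * mid r))" using step by simp
    ultimately show ?case by (rule linked_trans)
  qed (simp add: linked_refl)
qed

text \<open>Two adjacent walls along a vertical edge, going straight on in either direction or
  around one of three corners. The equal ring numbers exclude further walls at that edge.\<close>

lemma linkY:
  shows "rho i j = rho i (Suc j) \<Longrightarrow> rho (Suc i) j = rho (Suc i) (Suc j) \<Longrightarrow>
      linked (Xw (Suc i) y (Suc j)) (Xw (Suc i) y j)"
    "rho i j = rho (Suc i) j \<Longrightarrow> rho i (Suc j) = rho (Suc i) (Suc j) \<Longrightarrow>
      linked (Zw (Suc i) y (Suc j)) (Zw i y (Suc j))"
    "rho i j = rho (Suc i) j \<Longrightarrow> rho i j = rho i (Suc j) \<Longrightarrow>
      linked (Xw (Suc i) y (Suc j)) (Zw (Suc i) y (Suc j))"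
    "rho i j = rho i (Suc j) \<Longrightarrow> rho i j = rho (Suc i) (Suc j) \<Longrightarrow>
      linked (Xw (Suc i) y j) (Zw (Suc i) y (Suc j))"
    "rho i j = rho (Suc i) j \<Longrightarrow> rho i j = rho (Suc i) (Suc j) \<Longrightarrow>
      linked (Xw (Suc i) y (Suc j)) (Zw i y (Suc j))"
  by (rule private_linked[of "Ey (Suc i) y (Suc j)"]; auto simp: sides_simps)+

text \<open>At each height the tube consists of 12 squares around the 3 by 3 cells of rings 0 and 1.
  Three of its four corners already join all of them.\<close>

lemma ring_walls_linked:
  assumes c: "col r"
  shows "w \<in> {2, 3, 4} \<Longrightarrow> linked (Xw (7 * r + 2) y (7 + w)) (Xw (7 * r + 2) y 10)"
    "w \<in> {2, 3, 4} \<Longrightarrow> linked (Xw (7 * r + 5) y (7 + w)) (Xw (7 * r + 2) y 10)"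
    "u \<in> {2, 3, 4} \<Longrightarrow> linked (Zw (7 * r + u) y 9) (Xw (7 * r + 2) y 10)"
    "u \<in> {2, 3, 4} \<Longrightarrow> linked (Zw (7 * r + u) y 12) (Xw (7 * r + 2) y 10)"
proof -
  have rh: "rho (7 * r + u) j = max (ad u) (ad (j - 7))" if "u < 7" "7 \<le> j" "j < 14" for u j
    using rho_in[of r u "j - 7"] c that unfolding col_def by auto
  have rh12: "rho (Suc (7 * r)) j = max (ad 1) (ad (j - 7))" "rho (Suc (Suc (7 * r))) j = max (ad 2) (ad (j - 7))"
    if "7 \<le> j" "j < 14" for j
    using rh[of 1 j] rh[of 2 j] that by simp_all
  have cm: "3 + 7 * r = 7 * r + 3" "4 + 7 * r = 7 * r + 4" "5 + 7 * r = 7 * r + 5"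
    "Suc (Suc (Suc (7 * r))) = 7 * r + 3" "Suc (7 * r + 3) = 7 * r + 4" "Suc (7 * r + 4) = 7 * r + 5" by simp_all
  note rh = rh rh12 cm
  note l = linkY[where i = "7 * r + u" for u]
  have X23: "linked (Xw (7 * r + 2) y 10) (Xw (7 * r + 2) y 9)" using l(1)[of 1 9 y] by (simp add: rh ad_def)
  have X34: "linked (Xw (7 * r + 2) y 11) (Xw (7 * r + 2) y 10)" using l(1)[of 1 10 y] by (simp add: rh ad_def)
  have Y23: "linked (Xw (7 * r + 5) y 10) (Xw (7 * r + 5) y 9)" using l(1)[of 4 9 y] by (simp add: rh ad_def)
  have Y34: "linked (Xw (7 * r + 5) y 11) (Xw (7 * r + 5) y 10)" using l(1)[of 4 10 y] by (simp add: rh ad_def)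
  have Z23: "linked (Zw (7 * r + 3) y 9) (Zw (7 * r + 2) y 9)" using l(2)[of 2 8 y] by (simp add: rh ad_def)
  have Z34: "linked (Zw (7 * r + 4) y 9) (Zw (7 * r + 3) y 9)" using l(2)[of 3 8 y] by (simp add: rh ad_def)
  have V23: "linked (Zw (7 * r + 3) y 12) (Zw (7 * r + 2) y 12)" using l(2)[of 2 11 y] by (simp add: rh ad_def)
  have V34: "linked (Zw (7 * r + 4) y 12) (Zw (7 * r + 3) y 12)" using l(2)[of 3 11 y] by (simp add: rh ad_def)
  have XZ: "linked (Xw (7 * r + 2) y 9) (Zw (7 * r + 2) y 9)" using l(3)[of 1 8 y] by (simp add: rh ad_def)
  have XV: "linked (Xw (7 * r + 2) y 11) (Zw (7 * r + 2) y 12)" using l(4)[of 1 11 y] by (simp add: rh ad_def)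
  have YZ: "linked (Xw (7 * r + 5) y 9) (Zw (7 * r + 4) y 9)" using l(5)[of 4 8 y] by (simp add: rh ad_def)
  note s = linked_sym and t = linked_trans
  note x2 = s[OF X23] and z2 = t[OF s[OF XZ] s[OF X23]]
  note z3 = t[OF Z23 z2] note z4 = t[OF Z34 z3]
  note y2 = t[OF YZ z4] note y3 = t[OF Y23 y2] note y4 = t[OF Y34 y3]
  note v2 = t[OF s[OF XV] X34] note v3 = t[OF V23 v2] note v4 = t[OF V34 v3]
  show "w \<in> {2, 3, 4} \<Longrightarrow> linked (Xw (7 * r + 2) y (7 + w)) (Xw (7 * r + 2) y 10)"
    using x2 X34 linked_refl by auto
  show "w \<in> {2, 3, 4} \<Longrightarrow> linked (Xw (7 * r + 5) y (7 + w)) (Xw (7 * r + 2) y 10)"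
    using y2 y3 y4 by auto
  show "u \<in> {2, 3, 4} \<Longrightarrow> linked (Zw (7 * r + u) y 9) (Xw (7 * r + 2) y 10)"
    using z2 z3 z4 by auto
  show "u \<in> {2, 3, 4} \<Longrightarrow> linked (Zw (7 * r + u) y 12) (Xw (7 * r + 2) y 10)"
    using v2 v3 v4 by auto
qed

lemma rho_split:
  assumes "rho i j < 3"
  shows "\<exists>r u w. col r \<and> i = 7 * r + u \<and> j = 7 + w \<and> 1 \<le> u \<and> u \<le> 5 \<and> 1 \<le> w \<and> w \<le> 5 \<and> r = i div 7 \<and> rho i j = max (ad u) (ad w)"
proof -
  have ins: "inside i j" using assms rho_less_4[of i j] by auto
  have "\<not> (i mod 7 = 0 \<or> i mod 7 = 6 \<or> j mod 7 = 0 \<or> j mod 7 = 6)"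
  proof
    assume "i mod 7 = 0 \<or> i mod 7 = 6 \<or> j mod 7 = 0 \<or> j mod 7 = 6"
    then have "rho i j = 3 \<or> rho i j = 4" by (rule rho_border)
    then show False using assms by linarith
  qed
  then have "i mod 7 \<noteq> 0" "i mod 7 \<noteq> 6" "j mod 7 \<noteq> 0" "j mod 7 \<noteq> 6" by simp_all
  moreover have "i mod 7 < 7" "j mod 7 < 7" by auto
  ultimately have b: "1 \<le> i mod 7" "i mod 7 \<le> 5" "1 \<le> j mod 7" "j mod 7 \<le> 5" by linarith+
  have "j = 7 + j mod 7" using div_mult_mod_eq[of j 7] ins unfolding inside_def by simp
  moreover have "i = 7 * (i div 7) + i mod 7" by simp
  moreover have "col (i div 7)" using ins unfolding inside_def col_def by simp
  moreover have "rho i j = max (ad (i mod 7)) (ad (j mod 7))" using ins by (simp add: rho_def)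
  ultimately show ?thesis using b by blast
qed

lemma thr2_walls_linked:
  assumes q: "q = Xw i y j \<or> q = Zw i y j" and l: "label q \<noteq> None"
    and two: "q = Xw i y j \<Longrightarrow> max (rho (i - 1) j) (rho i j) = 2" "q = Zw i y j \<Longrightarrow> max (rho i (j - 1)) (rho i j) = 2"
  shows "col (i div 7) \<and> linked q (Xw (7 * (i div 7) + 2) y 10)"
  using q
proof
  assume x: "q = Xw i y j"
  have m: "rho (i - 1) j \<le> 2" "rho i j \<le> 2" "rho (i - 1) j \<noteq> rho i j" "rho (i - 1) j = 2 \<or> rho i j = 2"
    using two(1)[OF x] l x by (auto split: if_splits)
  obtain r u w where a: "col r" "i = 7 * r + u" "j = 7 + w" "1 \<le> u" "u \<le> 5" "1 \<le> w" "w \<le> 5" "r = i div 7" "rho i j = max (ad u) (ad w)"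
  proof -
    have "rho i j < 3" using m by simp
    from rho_split[OF this] show thesis by (elim exE conjE) (rule that)
  qed
  obtain u' where u': "u = Suc u'" using a(4) by (cases u) auto
  have b: "rho (i - 1) j = max (ad u') (ad w)"
  proof -
    have "i - 1 = 7 * r + u'" "u' < 7" "w < 7" "1 \<le> r" "r \<le> ncols" using a(1-7) u' unfolding col_def by simp_all
    then show ?thesis using rho_in[of r u' w] a(3) by simp
  qed
  have "(u = 2 \<or> u = 5) \<and> w \<in> {2, 3, 4}"
  proof -
    have "u \<in> {1,2,3,4,5}" "w \<in> {1,2,3,4,5}" using a(4-7) by auto
    then show ?thesis using m unfolding a(9) b u' by (auto simp: ad_def)
  qed
  then show ?thesis using ring_walls_linked(1,2)[OF a(1), of w y] a(1) unfolding a(8)[symmetric] unfolding x a(2) a(3) by auto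
next
  assume x: "q = Zw i y j"
  have m: "rho i (j - 1) \<le> 2" "rho i j \<le> 2" "rho i (j - 1) \<noteq> rho i j" "rho i (j - 1) = 2 \<or> rho i j = 2"
    using two(2)[OF x] l x by (auto split: if_splits)
  obtain r u w where a: "col r" "i = 7 * r + u" "j = 7 + w" "1 \<le> u" "u \<le> 5" "1 \<le> w" "w \<le> 5" "r = i div 7" "rho i j = max (ad u) (ad w)"
  proof -
    have "rho i j < 3" using m by simp
    from rho_split[OF this] show thesis by (elim exE conjE) (rule that)
  qed
  obtain w' where w': "w = Suc w'" using a(6) by (cases w) auto
  have b: "rho i (j - 1) = max (ad u) (ad w')"
  proof -
    have "j - 1 = 7 + w'" "u < 7" "w' < 7" "1 \<le> r" "r \<le> ncols" using a(1-7) w' unfolding col_def by simp_all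
    then show ?thesis using rho_in[of r u w'] a(2) by simp
  qed
  have "(w = 2 \<or> w = 5) \<and> u \<in> {2, 3, 4}"
  proof -
    have "u \<in> {1,2,3,4,5}" "w \<in> {1,2,3,4,5}" using a(4-7) by auto
    then show ?thesis using m unfolding a(9) b w' by (auto simp: ad_def)
  qed
  then show ?thesis using ring_walls_linked(3,4)[OF a(1), of u y] a(1) unfolding a(8)[symmetric] unfolding x a(2) a(3) by auto
qed

end

section \<open>Columns of the rules and representatives of the pieces\<close>

context layout
begin

definition column :: "nat \<Rightarrow> nat \<Rightarrow> nat \<Rightarrow> nat \<Rightarrow> nat" where
  "column k x y z = 5 * (x + N * (y + N * z)) + k"

lemma column:
  assumes "1 \<le> k" "k < 5" "x < N" "y < N" "z < N"
  shows "col (column k x y z)" "column k x y z mod 5 = k" "cx (column k x y z) = x"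
    "cy (column k x y z) = y" "cz (column k x y z) = z"
proof -
  have "(5 * s + k) div 5 = s" "(5 * s + k) mod 5 = k" for s using assms(2) by simp_all
  then have d: "column k x y z div 5 = x + N * (y + N * z)" and "column k x y z mod 5 = k" unfolding column_def by blast+
  then show "column k x y z mod 5 = k" by blast
  have e: "(x + N * (y + N * z)) div N = y + N * z" "(y + N * z) div N = z" using assms by auto
  show "cx (column k x y z) = x" unfolding cx_def d using assms by simp
  show "cy (column k x y z) = y" unfolding cy_def d e using assms by simp
  show "cz (column k x y z) = z" unfolding cz_def d e using assms by simp
  have "y + N * z < N * N"
  proof -
    have "y + N * z < N + N * z" using assms by simp
    also have "\<dots> = N * Suc z" by simp
    also have "\<dots> \<le> N * N" using assms(5) by (intro mult_le_mono) auto
    finally show ?thesis .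
  qed
  then have "N * Suc (y + N * z) \<le> N * (N * N)" by (intro mult_le_mono) auto
  then have "x + N * (y + N * z) < N * N * N" using assms(3) by (simp add: mult.assoc)
  moreover have "5 * s + k \<le> 5 * t" if "s < t" for s t :: nat using that assms(2) by linarith
  ultimately have "5 * (x + N * (y + N * z)) + k \<le> 5 * (N * N * N)" by blast
  then show "col (column k x y z)" unfolding col_def ncols_def column_def by (rule conjI[OF trans_le_add2[OF assms(1)]])
qed

text \<open>The tube pieces of a rule occur in one column only, otherwise two unconnected tubes
  would share a label. Copies recur in many columns, but their tubes are parts of plates and do no
  harm.\<close>

lemma column_unique:
  assumes "is_and r" "col r"
  shows "r = column 2 (cx r) (cy r) (cz r)"
proof -
  have k: "r mod 5 = 2" using assms by (simp add: is_and_def)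
  have "r div 5 < N * (N * N)"
  proof (rule ccontr)
    assume "\<not> ?thesis"
    then have "5 * (N * (N * N)) \<le> 5 * (r div 5)" by simp
    then have "5 * (N * (N * N)) + 2 \<le> r" using k div_mult_mod_eq[of r 5] by linarith
    then show False using assms(2) unfolding col_def ncols_def by (simp add: mult.assoc)
  qed
  then have "r div 5 < N * N * N" by (simp only: mult.assoc)
  then have "r div 5 div N < N * N" by (simp only: div_less_iff_less_mult[OF N_pos])
  then have "r div 5 div N div N < N" by (simp only: div_less_iff_less_mult[OF N_pos])
  then have "cz r = r div 5 div N div N" by (simp add: cz_def)
  then have "cy r + N * cz r = r div 5 div N" by (simp add: cy_def)
  then have "cx r + N * (cy r + N * cz r) = r div 5" by (simp add: cx_def)
  then show ?thesis using k unfolding column_def by presburger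
qed

fun home :: "piece \<Rightarrow> square" where
  "home (Plate v) = root (3 * v + 1)"
| "home (TubeA x y z) = Xw (7 * column 2 x y z + 2) (3 * x + 2) 10"
| "home (TubeB x y z) = Xw (7 * column 2 x y z + 2) (3 * (N + z)) 10"

lemma adj_tube:
  assumes "col r"
  shows "adj y (Ez (7 * r + 2) y 10) (F r 2 3 y) (F r 1 3 y) (\<lambda>y. Xw (7 * r + 2) y 10) r 1 2"
  using adj_sym[OF adj_u[OF assms, of 1 3 y]] by (simp add: ad_def numeral_2_eq_2)

lemma wall_plate: "wall r v l k = Some p \<Longrightarrow> k \<noteq> 2 \<Longrightarrow> p = Plate v"
  by (auto simp: wall_def split: if_splits)

text \<open>Linking all squares with label \<open>p\<close> to one representative makes every piece
  a unit: it is erased as a whole as soon as one of its squares is.\<close>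

lemma home_linked:
  assumes lq: "label q = Some p"
  shows "linked q (home p)"
proof -
  consider (f) i y j where "q = Face i y j" | (w) i y j where "q = Xw i y j \<or> q = Zw i y j"
    by (cases q) blast+
  then show ?thesis
  proof cases
    case f
    then obtain v where "p = Plate v" using lq by (auto simp: face_def split: if_splits)
    then show ?thesis using face_linked lq f by simp
  next
    case w
    show ?thesis
    proof (cases "\<exists>v. p = Plate v")
      case True
      then obtain v where p: "p = Plate v" by blast
      show ?thesis
      proof (rule wall_adj[OF lq w])
      fix W r k A B g
      assume a: "W y = q" "\<And>y'. adj y' (g y') (A y') (B y') W r (k - 1) k" "1 \<le> k" "k \<le> 4"
        "wall r (y div 3) (y mod 3) k = Some p" "\<And>y'. \<exists>i j. A y' = Face i y' j" "\<And>y'. \<exists>i j. B y' = Face i y' j"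
      show ?thesis
      proof (cases "k = 2")
        case False
        then have "linked (W y) (root (3 * v + 1))"
          by (intro plate_wall_linked[OF a(2-4) _ _ a(6,7)]) (use a(5) p in simp_all)
        then show ?thesis using a(1) p by simp
      next
        case k2: True
        have ad: "adj y' (g y') (A y') (B y') W r 1 2" for y' using a(2)[of y'] k2 by simp
        have t: "tube_at r (y div 3) (y mod 3)" "p = tube_label r (y div 3)"
          using a(5) k2 by (auto simp: wall_2 split: if_splits)
        have yr: "3 * lo r + 2 \<le> y" "y < 3 * hi r" using t(1) unfolding tube_range by auto
        have "r mod 5 = 3 \<and> v = lo r \<or> r mod 5 = 4 \<and> v = hi r"
          using t(2) p by (auto simp: tube_label_def split: if_splits)
        then show ?thesis
        proof (elim disjE conjE)
          assume h: "r mod 5 = 3" "v = lo r"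
          show ?thesis using copy_tube_linked(1)[OF ad a(7) yr h(1)] a(1) p h(2) by simp
        next
          assume h: "r mod 5 = 4" "v = hi r"
          show ?thesis using copy_tube_linked(2)[OF ad a(7) yr h(1)] a(1) p h(2) by simp
        qed
      qed
      qed
    next
      case False
      define r where "r = i div 7"
      have two: "q = Xw i y j \<Longrightarrow> max (rho (i - 1) j) (rho i j) = 2" "q = Zw i y j \<Longrightarrow> max (rho i (j - 1)) (rho i j) = 2"
        using False lq by (auto dest: wall_plate split: if_splits)
      have "col r" and L: "linked q (Xw (7 * r + 2) y 10)"
        using thr2_walls_linked[OF w _ two] lq unfolding r_def by simp_all
      have "wall r (y div 3) (y mod 3) 2 = Some p"
        using w lq two unfolding r_def by (auto split: if_splits)
      then have t: "tube_at r (y div 3) (y mod 3)" "p = tube_label r (y div 3)"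
        by (auto simp: wall_2 split: if_splits)
      then have yr: "3 * lo r + 2 \<le> y" "y < 3 * hi r" and ht: "has_tube r" unfolding tube_range by auto
      have "r mod 5 \<noteq> 3" "r mod 5 \<noteq> 4" using t(2) False by (auto simp: tube_label_def)
      then have ia: "is_and r" using ht by (auto simp: has_tube_def)
      have r: "column 2 (cx r) (cy r) (cz r) = r" using column_unique[OF ia \<open>col r\<close>] by simp
      have lm: "lo r = cx r" "mid r = N + cz r" using ia by (auto simp: lo_def mid_def is_and_def)
      show ?thesis
      proof (cases "y div 3 < mid r")
        case True
        then have "y < 3 * mid r" by (simp add: div_less_iff_less_mult mult.commute)
        then have "linked (Xw (7 * r + 2) y 10) (Xw (7 * r + 2) (3 * lo r + 2) 10)"
          by (rule and_tube_linked(1)[OF adj_tube[OF \<open>col r\<close>] ia yr(1)])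
        moreover have "home p = Xw (7 * r + 2) (3 * lo r + 2) 10"
          using t(2) True \<open>r mod 5 \<noteq> 3\<close> \<open>r mod 5 \<noteq> 4\<close> r lm by (simp add: tube_label_def)
        ultimately show ?thesis using linked_trans[OF L] by simp
      next
        case F: False
        then have "3 * mid r \<le> y" by (simp add: not_less less_eq_div_iff_mult_less_eq mult.commute)
        then have "linked (Xw (7 * r + 2) y 10) (Xw (7 * r + 2) (3 * mid r) 10)"
          by (rule and_tube_linked(2)[OF adj_tube[OF \<open>col r\<close>] ia _ yr(2)])
        moreover have "home p = Xw (7 * r + 2) (3 * mid r) 10"
          using t(2) F \<open>r mod 5 \<noteq> 3\<close> \<open>r mod 5 \<noteq> 4\<close> r lm by (simp add: tube_label_def)
        ultimately show ?thesis using linked_trans[OF L] by simp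
      qed
    qed
  qed
qed

subsection \<open>The edges realizing the rules\<close>

text \<open>The four squares at an edge of threshold 2, in the order inner face, outer face, wall
  above, wall below. All rules act at such edges.\<close>

definition edge_labels :: "piece option \<Rightarrow> piece option \<Rightarrow> piece option \<Rightarrow> piece option \<Rightarrow> bool" where
  "edge_labels f f' w b \<longleftrightarrow> (\<exists>r v l. col r \<and> l < 3 \<and> face r v l 1 = f \<and> face r v l 2 = f' \<and>
     wall r v l 2 = w \<and> below r v l 2 = b)"

lemma edge_start:
  assumes "col r" "has_tube r"
  shows "edge_labels (if r mod 5 = 3 then None else Some (Plate (lo r))) (Some (Plate (lo r))) (Some (tube_label r (lo r))) None"
proof -
  have w: "wall r (lo r) 2 2 \<noteq> None" "below r (lo r) 2 2 = None" using assms(2) by (simp_all add: wall_2 below_2 tube_at_def)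
  have "(2::nat) < 3" by simp
  then show ?thesis
  proof (cases rule: edge_table_2[where r = r and v = "lo r"])
    case start
    then show ?thesis unfolding edge_labels_def using assms(1) by (intro exI[of _ r] exI[of _ "lo r"] exI[of _ 2]) simp
  qed (use w in simp_all)
qed

lemma edge_stop:
  assumes "col r" "has_tube r"
  shows "edge_labels (if r mod 5 = 4 then None else Some (Plate (hi r))) (Some (Plate (hi r))) None (Some (tube_label r (hi r - 1)))"
proof -
  have w: "wall r (hi r) 0 2 = None" "below r (hi r) 0 2 \<noteq> None"
    using assms(2) lo_less_hi[of r] by (simp_all add: wall_2 below_2 tube_at_def)
  have "(0::nat) < 3" by simp
  then show ?thesis
  proof (cases rule: edge_table_2[where r = r and v = "hi r"])
    case stop
    then show ?thesis unfolding edge_labels_def using assms(1) by (intro exI[of _ r] exI[of _ "hi r"] exI[of _ 0]) simp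
  qed (use w in simp_all)
qed

lemma edge_mid:
  assumes "col r" "is_and r"
  shows "edge_labels None (Some (Plate (mid r))) (Some (TubeB (cx r) (cy r) (cz r))) (Some (TubeA (cx r) (cy r) (cz r)))"
proof -
  have m: "lo r < mid r" "mid r < hi r" using lo_less_mid mid_less_hi assms(2) by auto
  have t: "has_tube r" "md r (mid r)" using assms(2) by (simp_all add: has_tube_def md_def)
  have w: "wall r (mid r) 0 2 \<noteq> None" "below r (mid r) 0 2 \<noteq> None"
    using t m by (simp_all add: wall_2 below_2 tube_at_def)
  have "(0::nat) < 3" by simp
  then show ?thesis
  proof (cases rule: edge_table_2[where r = r and v = "mid r"])
    case mid
    then show ?thesis unfolding edge_labels_def using assms(1) by (intro exI[of _ r] exI[of _ "mid r"] exI[of _ 0]) simp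
  qed (use w t m in simp_all)
qed

lemma rule_edges:
  shows "a < N \<Longrightarrow> edge_labels (Some (Plate (N + a))) (Some (Plate (N + a))) None (Some (Plate a))"
    "a < N \<Longrightarrow> edge_labels (Some (Plate (N + a))) (Some (Plate (N + a))) (Some (Plate (2 * N + a))) None"
    "rl x y z \<Longrightarrow> edge_labels (Some (Plate x)) (Some (Plate x)) (Some (TubeA x y z)) None"
    "rl x y z \<Longrightarrow> edge_labels (Some (Plate (2 * N + y))) (Some (Plate (2 * N + y))) None (Some (TubeB x y z))"
    "rl x y z \<Longrightarrow> edge_labels None (Some (Plate (N + z))) (Some (TubeB x y z)) (Some (TubeA x y z))"
proof -
  show "edge_labels (Some (Plate (N + a))) (Some (Plate (N + a))) None (Some (Plate a))" if "a < N"
  proof -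
    note c = column[of 3 a 0 0, OF _ _ that N_pos N_pos]
    have h: "has_tube (column 3 a 0 0)" "lo (column 3 a 0 0) = a" "hi (column 3 a 0 0) = N + a"
      using c by (simp_all add: has_tube_def lo_def hi_def)
    show ?thesis using edge_stop[OF c(1) h(1)] c(2) h by (simp add: tube_label_def)
  qed
  show "edge_labels (Some (Plate (N + a))) (Some (Plate (N + a))) (Some (Plate (2 * N + a))) None" if "a < N"
  proof -
    note c = column[of 4 a 0 0, OF _ _ that N_pos N_pos]
    have h: "has_tube (column 4 a 0 0)" "lo (column 4 a 0 0) = N + a" "hi (column 4 a 0 0) = 2 * N + a"
      using c by (simp_all add: has_tube_def lo_def hi_def)
    show ?thesis using edge_start[OF c(1) h(1)] c(2) h by (simp add: tube_label_def)
  qed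
  assume rl: "rl x y z"
  let ?r = "column 2 x y z"
  have xyz: "x < N" "y < N" "z < N" using rl_less[OF rl] by auto
  note c = column[of 2 x y z, OF _ _ xyz]
  have ia: "is_and ?r" using rl c by (simp add: is_and_def)
  have h: "has_tube ?r" "lo ?r = x" "hi ?r = 2 * N + y" "mid ?r = N + z" "x < N + z" "\<not> 2 * N + y - 1 < N + z"
    using c ia xyz by (auto simp: has_tube_def lo_def hi_def mid_def)
  show "edge_labels (Some (Plate x)) (Some (Plate x)) (Some (TubeA x y z)) None"
    using edge_start[OF _ h(1)] c h by (simp add: tube_label_def)
  show "edge_labels (Some (Plate (2 * N + y))) (Some (Plate (2 * N + y))) None (Some (TubeB x y z))"
    using edge_stop[OF _ h(1)] c h by (simp add: tube_label_def)
  show "edge_labels None (Some (Plate (N + z))) (Some (TubeB x y z)) (Some (TubeA x y z))"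
    using edge_mid[OF _ ia] c h by simp
qed

lemma edge_labelsE:
  assumes "edge_labels f f' w b"
  obtains g q1 q2 q3 q4 where "label q1 = f" "label q2 = f'" "label q3 = w" "b \<noteq> None \<Longrightarrow> label q4 = b \<and> g \<in> sides q4"
    "g \<in> sides q1" "g \<in> sides q2" "g \<in> sides q3"
    "\<And>q. g \<in> sides q \<Longrightarrow> label q \<noteq> None \<Longrightarrow> q \<in> {q1, q2, q3} \<or> q = q4 \<and> b \<noteq> None"
proof -
  obtain r v l where a: "col r" "l < 3" "face r v l 1 = f" "face r v l 2 = f'" "wall r v l 2 = w" "below r v l 2 = b"
    using assms unfolding edge_labels_def by blast
  define y where "y = 3 * v + l"
  have y: "y div 3 = v" "y mod 3 = l" using a(2) by (auto simp: y_def)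
  note ad = adj_tube[OF a(1), of y]
  let ?W = "\<lambda>y. Xw (7 * r + 2) y 10"
  let ?g = "Ez (7 * r + 2) y 10"
  have lW: "label (?W y') = wall r (y' div 3) (y' mod 3) 2" for y'
  proof -
    have "\<forall>y'. label (?W y') = (if (1::nat) = 2 then None else wall r (y' div 3) (y' mod 3) (max 1 2))"
      using ad unfolding adj_def by (elim conjE)
    moreover have "max 1 2 = (2::nat)" by simp
    ultimately show ?thesis by (metis one_eq_numeral_iff semiring_norm(85))
  qed
  have lab: "label (F r 2 3 y) = f" "label (F r 1 3 y) = f'" "label (?W y) = w"
  proof -
    have "label (F r 2 3 y) = face r v l 1" using ad unfolding adj_def y by (elim conjE)
    then show "label (F r 2 3 y) = f" using a(3) by (rule trans)
    have "label (F r 1 3 y) = face r v l 2" using ad unfolding adj_def y by (elim conjE)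
    then show "label (F r 1 3 y) = f'" using a(4) by (rule trans)
    show "label (?W y) = w" using lW[of y] a(5) unfolding y by (rule trans)
  qed
  have sd: "?g \<in> sides q \<longleftrightarrow> q = F r 2 3 y \<or> q = F r 1 3 y \<or> q = ?W y \<or> (\<exists>y'. y = Suc y' \<and> q = ?W y')" for q
    by (rule adj_sides[OF ad])
  have W': "label (?W y') = b" if "y = Suc y'" for y'
  proof -
    show ?thesis unfolding lW[of y'] below_label[of r y' 2] that[symmetric] y by (rule a(6))
  qed
  have b0: "b = None" if "y = 0" using that a(6) y by (simp add: below_def y_def)
  show thesis
  proof (rule that[of "F r 2 3 y" "F r 1 3 y" "?W y" "?W (y - 1)" ?g])
    show "b \<noteq> None \<Longrightarrow> label (?W (y - 1)) = b \<and> ?g \<in> sides (?W (y - 1))"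
    proof -
      assume "b \<noteq> None"
      then obtain y' where y': "y = Suc y'" using b0 not0_implies_Suc by blast
      show "label (?W (y - 1)) = b \<and> ?g \<in> sides (?W (y - 1))" using W'[OF y'] sd y' by simp
    qed
    show "q \<in> {F r 2 3 y, F r 1 3 y, ?W y} \<or> q = ?W (y - 1) \<and> b \<noteq> None" if "?g \<in> sides q" "label q \<noteq> None" for q
    proof -
      from that(1) have "q = F r 2 3 y \<or> q = F r 1 3 y \<or> q = ?W y \<or> (\<exists>y'. y = Suc y' \<and> q = ?W y')" by (simp only: sd)
      then show ?thesis
      proof (elim disjE exE conjE)
        fix y' assume h: "y = Suc y'" "q = ?W y'"
        then show ?thesis using W'[OF h(1)] that(2) by simp
      qed simp_all
    qed
  qed (simp_all only: lab sd simp_thms)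
qed

text \<open>The piece has been erased completely, where \<open>A\<close> is the set of surviving
  squares.\<close>

definition dead :: "square set \<Rightarrow> piece \<Rightarrow> bool" where
  "dead A p \<longleftrightarrow> (\<forall>q\<in>A. label q \<noteq> Some p)"

lemma dead_if:
  assumes A: "A \<subseteq> squares" "stuck A" and q: "label q = Some p" "q \<notin> A"
  shows "dead A p"
  unfolding dead_def
proof (intro ballI notI)
  fix q' assume q': "q' \<in> A" "label q' = Some p"
  have "linked q' q" by (rule linked_trans[OF home_linked[OF q'(2)] linked_sym[OF home_linked[OF q(1)]]])
  then show False using A q' q unfolding linked_def by blast
qed

lemma dead_step:
  assumes A: "A \<subseteq> squares" "stuck A" and g: "g \<in> sides q" and p: "label q = Some p"
    and oth: "\<And>q' p'. g \<in> sides q' \<Longrightarrow> q' \<noteq> q \<Longrightarrow> label q' = Some p' \<Longrightarrow> dead A p'"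
  shows "dead A p"
proof (rule dead_if[OF A p])
  show "q \<notin> A"
  proof
    assume "q \<in> A"
    then obtain q' where q': "q' \<in> A" "g \<in> sides q'" "q' \<noteq> q" using A(2) g unfolding stuck_def by blast
    then obtain p' where p': "label q' = Some p'" using A(1) unfolding squares_def by blast
    then show False using oth[OF q'(2,3) p'] q'(1) unfolding dead_def by blast
  qed
qed

lemma edge_dead:
  assumes A: "A \<subseteq> squares" "stuck A" and e: "edge_labels f f' w b"
    and d: "\<And>p'. p' \<in> set_option f \<Longrightarrow> dead A p'"
  shows "w = Some p \<Longrightarrow> \<forall>p'\<in>set_option f' \<union> set_option b. dead A p' \<Longrightarrow> dead A p"
    "b = Some p \<Longrightarrow> \<forall>p'\<in>set_option f' \<union> set_option w. dead A p' \<Longrightarrow> dead A p"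
    "f' = Some p \<Longrightarrow> \<forall>p'\<in>set_option w \<union> set_option b. dead A p' \<Longrightarrow> dead A p"
proof (atomize(full), rule edge_labelsE[OF e], goal_cases)
  case (1 g q1 q2 q3 q4)
  note l = 1(1-4) and s = 1(5-7) and all = 1(8)
  have cs: "q' = q1 \<and> f = Some p' \<or> q' = q2 \<and> f' = Some p' \<or> q' = q3 \<and> w = Some p' \<or> q' = q4 \<and> b = Some p'"
    if "g \<in> sides q'" "label q' = Some p'" for q' p'
    using all[OF that(1)] that(2) l by auto
  have "dead A p" if h: "w = Some p" "\<forall>p'\<in>set_option f' \<union> set_option b. dead A p'"
  proof (rule dead_step[OF A s(3)])
    fix q' p' assume "g \<in> sides q'" "q' \<noteq> q3" "label q' = Some p'"
    then show "dead A p'" using cs[of q' p'] d[of p'] h(2) by auto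
  qed (use l h in simp)
  moreover have "dead A p" if h: "b = Some p" "\<forall>p'\<in>set_option f' \<union> set_option w. dead A p'"
  proof (rule dead_step[OF A, of g q4])
    fix q' p' assume "g \<in> sides q'" "q' \<noteq> q4" "label q' = Some p'"
    then show "dead A p'" using cs[of q' p'] d[of p'] h(2) by auto
  qed (use l h in simp_all)
  moreover have "dead A p" if h: "f' = Some p" "\<forall>p'\<in>set_option w \<union> set_option b. dead A p'"
  proof (rule dead_step[OF A s(2)])
    fix q' p' assume "g \<in> sides q'" "q' \<noteq> q2" "label q' = Some p'"
    then show "dead A p'" using cs[of q' p'] d[of p'] h(2) by auto
  qed (use l h in simp)
  ultimately show ?case by blast
qed

text \<open>Each clause of \<open>derived\<close> is realized by one of the edges in
  \<open>rule_edges\<close>: when all other squares there are gone, a stuck set cannot contain the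
  last one.\<close>

lemma derived_dead:
  assumes A: "A \<subseteq> squares" "stuck A" and P: "\<And>p. p \<in> P \<Longrightarrow> dead A p"
  shows "p \<in> derived N rl P \<Longrightarrow> dead A p"
proof (induction rule: derived.induct)
  case (seed p)
  then show ?case by (rule P)
next
  case (copyL a)
  show ?case by (rule edge_dead(2)[OF A rule_edges(1)[OF copyL(2)]]) (use copyL in simp_all)
next
  case (copyR a)
  show ?case by (rule edge_dead(1)[OF A rule_edges(2)[OF copyR(2)]]) (use copyR in simp_all)
next
  case (tubeA x y z)
  show ?case by (rule edge_dead(1)[OF A rule_edges(3)[OF tubeA(1)]]) (use tubeA in simp_all)
next
  case (tubeB x y z)
  show ?case by (rule edge_dead(2)[OF A rule_edges(4)[OF tubeB(1)]]) (use tubeB in simp_all)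
next
  case (head x y z)
  show ?case by (rule edge_dead(3)[OF A rule_edges(5)[OF head(1)]]) (use head in simp_all)
next
  case (backB x y z)
  show ?case by (rule edge_dead(1)[OF A rule_edges(5)[OF backB(1)]]) (use backB in simp_all)
next
  case (backA x y z)
  show ?case by (rule edge_dead(2)[OF A rule_edges(5)[OF backA(1)]]) (use backA in simp_all)
qed

lemma label_pieces:
  assumes "label q = Some p"
  shows "p \<in> pieces N rl"
proof -
  have w: "p \<in> pieces N rl" if "wall r v l k = Some p" for r v l k
  proof (cases "k = 2")
    case True
    then have t: "tube_at r v l" "p = tube_label r v" using that by (auto simp: wall_2 split: if_splits)
    have "lo r < 3 * N" "hi r < 3 * N" using lo_less_hi[of r] hi_less[of r] by auto
    then show ?thesis using t by (auto simp: tube_label_def pieces_def tube_at_def has_tube_def is_and_def)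
  next
    case False
    then show ?thesis using wall_plate[OF that] that by (auto simp: wall_def pieces_def split: if_splits)
  qed
  show ?thesis using assms w by (cases q) (auto simp: face_def pieces_def split: if_splits)
qed

lemma piece_label:
  assumes "p \<in> pieces N rl"
  shows "\<exists>q. label q = Some p"
proof -
  have t: "\<exists>q. label q = Some p" if "edge_labels f f' w b" "w = Some p \<or> b = Some p" for f f' w b p
  proof (rule edge_labelsE[OF that(1)])
    fix g q3 q4 assume "label q3 = w" "b \<noteq> None \<Longrightarrow> label q4 = b \<and> g \<in> sides q4"
    then show ?thesis using that(2) by auto
  qed
  have "label (root (3 * v + 1)) = Some (Plate v)" if "v < 3 * N" for v
  proof -
    have "1 \<le> ncols" using col_special(1) by (simp add: col_def)
    then have "rho 7 7 = 3" by (simp add: rho_def inside_def ad_def)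
    moreover have "Suc (3 * v) div 3 = v" "Suc (3 * v) mod 3 = 1" by presburger+
    ultimately show ?thesis using face_outer[OF that] by simp
  qed
  then show ?thesis using assms t[OF rule_edges(3)] t[OF rule_edges(4)] unfolding pieces_def by blast
qed

text \<open>The squares of underived pieces form a stuck set by soundness at the edges. Conversely,
  a stuck set that avoids \<open>C\<close> has no square of a derived piece.\<close>

theorem erasable_iff_derived:
  "erasable (tris squares) C \<longleftrightarrow>
     pieces N rl \<subseteq> derived N rl {p. \<exists>q b. tri q b \<in> C \<and> label q = Some p}" (is "_ \<longleftrightarrow> _ \<subseteq> derived N rl ?P")
proof
  assume e: "erasable (tris squares) C"
  let ?A = "{q \<in> squares. the (label q) \<notin> derived N rl ?P}"
  have "stuck ?A"
    unfolding stuck_def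
  proof (intro allI ballI impI, rule ccontr)
    fix g q assume q: "q \<in> ?A" "g \<in> sides q" and n: "\<not> (\<exists>q'\<in>?A. g \<in> sides q' \<and> q' \<noteq> q)"
    obtain p where p: "label q = Some p" using q unfolding squares_def by blast
    have "p \<in> derived N rl ?P"
    proof (rule edge_sound[OF _ q(2) _ p])
      fix q' p' assume h: "q' \<in> squares" "g \<in> sides q'" "q' \<noteq> q" "label q' = Some p'"
      then have "q' \<notin> ?A" using n by blast
      then show "p' \<in> derived N rl ?P" using h by simp
    qed (use q in simp)
    then show False using q(1) p by simp
  qed
  moreover have "tri q b \<notin> C" if qA: "q \<in> ?A" for q b
  proof
    assume t: "tri q b \<in> C"
    obtain p where p: "label q = Some p" using qA unfolding squares_def by blast
    then have "p \<in> ?P" using t by blast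
    then show False using qA p derived.seed[of p ?P] by simp
  qed
  ultimately have emp: "?A = {}" using e[unfolded erasable_iff_stuck, rule_format, of ?A] by blast
  show "pieces N rl \<subseteq> derived N rl ?P"
  proof
    fix p assume "p \<in> pieces N rl"
    then obtain q where q: "label q = Some p" using piece_label by blast
    then have "q \<in> squares" by (simp add: squares_def)
    then show "p \<in> derived N rl ?P" using emp q by force
  qed
next
  assume d: "pieces N rl \<subseteq> derived N rl ?P"
  show "erasable (tris squares) C"
    unfolding erasable_iff_stuck
  proof (intro allI impI)
    fix A assume A: "A \<subseteq> squares" "stuck A" "\<forall>q\<in>A. \<forall>b. tri q b \<notin> C"
    have dd: "dead A p" if "p \<in> ?P" for p
    proof -
      note hyp = that
      obtain q b where "tri q b \<in> C" "label q = Some p" using hyp by blast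
      then show ?thesis using dead_if[OF A(1,2)] A(3) by blast
    qed
    show "A = {}"
    proof (rule equals0I)
      fix q assume q: "q \<in> A"
      then obtain p where p: "label q = Some p" using A(1) unfolding squares_def by blast
      then have "p \<in> derived N rl ?P" using label_pieces d by blast
      then have "dead A p" using derived_dead[OF A(1,2), of ?P p] dd by blast
      then show False using q p unfolding dead_def by blast
    qed
  qed
qed

subsection \<open>The complex of a layout\<close>

lemma squares_bound:
  "Face i y j \<in> squares \<Longrightarrow> i < 7 * ncols + 8 \<and> y < 9 * N \<and> j < 15"
  "Xw i y j \<in> squares \<Longrightarrow> i < 7 * ncols + 8 \<and> y < 9 * N \<and> j < 15"
  "Zw i y j \<in> squares \<Longrightarrow> i < 7 * ncols + 8 \<and> y < 9 * N \<and> j < 15"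
proof -
  have ins: "i < 7 * ncols + 7 \<and> j < 14" if "rho i j \<noteq> 4" for i j
  proof -
    have "inside i j" using that by (auto simp: rho_def split: if_splits)
    then have h: "i div 7 \<le> ncols" "j div 7 = 1" by (auto simp: inside_def)
    have "i < 7 * ncols + 7" using h(1) by (metis add.commute div_less_iff_less_mult le_imp_less_Suc mult.commute mult_Suc_right zero_less_numeral)
    moreover have "j < 14" using h(2) div_mult_mod_eq[of j 7] mod_less_divisor[of 7 j] by linarith
    ultimately show ?thesis by simp
  qed
  have y9: "y < 9 * N" if "y div 3 < 3 * N" for y using that by (simp add: div_less_iff_less_mult)
  have w: "v < 3 * N" if "wall r v l k \<noteq> None" for r v l k using that by (auto simp: wall_def split: if_splits)
  show "i < 7 * ncols + 8 \<and> y < 9 * N \<and> j < 15" if "Face i y j \<in> squares"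
  proof -
    have "y div 3 < 3 * N" "rho i j \<noteq> 4" using that by (auto simp: squares_def face_def split: if_splits)
    then show ?thesis using ins[of i j] y9[of y] by simp
  qed
  show "i < 7 * ncols + 8 \<and> y < 9 * N \<and> j < 15" if "Xw i y j \<in> squares"
  proof -
    have "y div 3 < 3 * N" "rho (i - 1) j \<noteq> rho i j" using that by (auto simp: squares_def split: if_splits intro!: w)
    moreover from this(2) have "i - 1 < 7 * ncols + 7 \<and> j < 14 \<or> i < 7 * ncols + 7 \<and> j < 14"
      using ins[of i j] ins[of "i - 1" j] by (cases "rho i j = 4") simp_all
    ultimately show ?thesis using y9[of y] by linarith
  qed
  show "i < 7 * ncols + 8 \<and> y < 9 * N \<and> j < 15" if "Zw i y j \<in> squares"
  proof -
    have "y div 3 < 3 * N" "rho i (j - 1) \<noteq> rho i j" using that by (auto simp: squares_def split: if_splits intro!: w)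
    moreover from this(2) have "i < 7 * ncols + 7 \<and> j - 1 < 14 \<or> i < 7 * ncols + 7 \<and> j < 14"
      using ins[of i j] ins[of i "j - 1"] by (cases "rho i j = 4") simp_all
    ultimately show ?thesis using y9[of y] by linarith
  qed
qed

lemma finite_squares: "finite squares"
proof -
  let ?B = "{..<7 * ncols + 8} \<times> {..<9 * N} \<times> {..<15::nat}"
  have "squares \<subseteq> (\<lambda>(i, y, j). Face i y j) ` ?B \<union> (\<lambda>(i, y, j). Xw i y j) ` ?B \<union> (\<lambda>(i, y, j). Zw i y j) ` ?B"
  proof
    fix q assume "q \<in> squares"
    then show "q \<in> (\<lambda>(i, y, j). Face i y j) ` ?B \<union> (\<lambda>(i, y, j). Xw i y j) ` ?B \<union> (\<lambda>(i, y, j). Zw i y j) ` ?B"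
      using squares_bound by (cases q) (force simp: image_iff)+
  qed
  then show ?thesis by (rule finite_subset) simp
qed

lemma finite_tris: "finite (tris squares)"
proof -
  have "tris squares = (\<lambda>(q, b). tri q b) ` (squares \<times> UNIV)" unfolding tris_def by auto
  then show ?thesis using finite_squares by simp
qed

lemma root_square: "Face 7 1 7 \<in> squares"
proof -
  have "1 \<le> ncols" using col_special(1) by (simp add: col_def)
  then have "rho 7 7 = 3" by (simp add: rho_def inside_def ad_def)
  then show ?thesis using face_outer[of 0 1 1] N_pos by (simp add: squares_def)
qed

sublocale pure_2_complex "tris squares"
proof
  show "finite (tris squares)" by (rule finite_tris)
  show "card t = 3" if "t \<in> tris squares" for t using that card_tri by (auto simp: tris_def)
  show "tris squares \<noteq> {}" using root_square tri_in_tris by blast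
qed

lemma embeddable: "embeddable_in_R3 (complex_of (tris squares))"
proof -
  define X :: "nat \<Rightarrow> nat \<Rightarrow> int" where
    "X k v = (if k = 0 then int (fst (prod_decode v)) else if k = 1 then int (fst (prod_decode (snd (prod_decode v))))
      else int (snd (prod_decode (snd (prod_decode v)))))" for k v
  have Xv: "X 0 (vx i y j) = int i" "X 1 (vx i y j) = int y" "X 2 (vx i y j) = int j" "X (Suc 0) (vx i y j) = int y" for i y j
    by (simp_all add: X_def vx_def)
  show ?thesis
  proof (rule embeddable_if_kuhn[of X])
    fix u v assume h: "X 0 u = X 0 v" "X 1 u = X 1 v" "X 2 u = X 2 v"
    then have "snd (prod_decode u) = snd (prod_decode v)"
      by (intro injD[OF inj_prod_decode, of "snd (prod_decode u)"], intro prod_eqI) (simp_all add: X_def)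
    then have "prod_decode u = prod_decode v" using h(1) by (simp add: X_def prod_eq_iff)
    then show "u = v" using injD[OF inj_prod_decode] by blast
  next
    fix t assume "t \<in> tris squares"
    then obtain q b where t: "t = tri q b" by (auto simp: tris_def)
    let ?K = "\<lambda>i j k A B C. t = {A, B, C} \<and>
      (i, j, k) \<in> {(0, 1, 2), (0, 2, 1), (1, 0, 2), (1, 2, 0), (2, 0, 1), (2, 1, 0)} \<and>
      X i B = X i A + 1 \<and> X j B = X j A \<and> X k B = X k A \<and>
      X i C = X i A + 1 \<and> X j C = X j A + 1 \<and> X k C = X k A"
    show "\<exists>A B C i j k. ?K i j k A B C"
    proof (cases q)
      case (Face i y j)
      show ?thesis
      proof (cases b)
        case True
        have "?K 0 2 1 (vx i y j) (vx (Suc i) y j) (vx (Suc i) y (Suc j))" using t Face True by (simp add: Xv)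
        then show ?thesis by blast
      next
        case False
        have "?K 2 0 1 (vx i y j) (vx i y (Suc j)) (vx (Suc i) y (Suc j))" using t Face False by (simp add: Xv)
        then show ?thesis by blast
      qed
    next
      case (Xw i y j)
      show ?thesis
      proof (cases b)
        case True
        have "?K 1 2 0 (vx i y j) (vx i (Suc y) j) (vx i (Suc y) (Suc j))" using t Xw True by (simp add: Xv)
        then show ?thesis by blast
      next
        case False
        have "?K 2 1 0 (vx i y j) (vx i y (Suc j)) (vx i (Suc y) (Suc j))" using t Xw False by (simp add: Xv)
        then show ?thesis by blast
      qed
    next
      case (Zw i y j)
      show ?thesis
      proof (cases b)
        case True
        have "?K 0 1 2 (vx i y j) (vx (Suc i) y j) (vx (Suc i) (Suc y) j)" using t Zw True by (simp add: Xv)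
        then show ?thesis by blast
      next
        case False
        have "?K 1 0 2 (vx i y j) (vx i (Suc y) j) (vx (Suc i) (Suc y) j)" using t Zw False by (simp add: Xv)
        then show ?thesis by blast
      qed
    qed
  qed
qed

text \<open>Squares at a common edge are joined by paths, and no edge has just one square, so the
  squares reachable from a given one form a stuck set. It is thus a union of pieces, and the edges
  of the rules lead from the plate of \<open>acc\<close> to every piece.\<close>

lemma connected:
  assumes acc: "acc < N" "\<And>z. z < N \<Longrightarrow> \<exists>x. rl x acc z"
  shows "connected_complex (complex_of (tris squares))"
proof -
  define D where "D = complex_of (tris squares)"
  define R where "R = (complex_graph D)\<^sup>*"
  have edge: "(u, v) \<in> R" if "u \<in> tri q b" "v \<in> tri q b" "q \<in> squares" for u v q b
  proof (cases "u = v")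
    case False
    have "tri q b \<in> tris squares" using that(3) tri_in_tris by blast
    then have "{u, v} \<in> D" using that unfolding D_def complex_of_def by blast
    then have "(u, v) \<in> complex_graph D" using False unfolding complex_graph_def by simp
    then show ?thesis unfolding R_def by blast
  qed (simp add: R_def)
  have tr: "(u, w) \<in> R" if "(u, v) \<in> R" "(v, w) \<in> R" for u v w using that unfolding R_def by (rule rtrancl_trans)
  obtain q0 where q0: "label q0 = Some (Plate (N + acc))" using piece_label acc(1) unfolding pieces_def by fastforce
  have q0s: "q0 \<in> squares" using q0 by (simp add: squares_def)
  obtain u0 where u0: "u0 \<in> diag q0" by (cases q0) auto
  define A where "A = {q \<in> squares. \<exists>b. \<exists>u\<in>tri q b. (u0, u) \<in> R}"
  have all: "(u0, u) \<in> R" if "q \<in> A" "u \<in> tri q b" for q u b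
  proof -
    note hyp = that
    obtain b' u' where b': "u' \<in> tri q b'" "(u0, u') \<in> R" "q \<in> squares" using hyp unfolding A_def by blast
    obtain d where d: "d \<in> diag q" by (cases q) auto
    then have "d \<in> tri q b" "d \<in> tri q b'" using diag_subset by blast+
    then have "(u', d) \<in> R" "(d, u) \<in> R" using edge b'(1,3) hyp(2) by blast+
    then show ?thesis using tr[OF b'(2) tr] by blast
  qed
  have share: "q' \<in> A" if "q \<in> A" "q' \<in> squares" "g \<in> sides q" "g \<in> sides q'" for q q' g
  proof -
    note hyp = that
    obtain b where "g \<in> half_sides q b" using hyp(3) unfolding sides_def by blast
    moreover obtain b' where "g \<in> half_sides q' b'" using hyp(4) unfolding sides_def by blast
    moreover obtain d where "d \<in> eset g" by (cases g) auto
    ultimately have "d \<in> tri q b" "d \<in> tri q' b'" using eset_subset by blast+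
    then show ?thesis using all[OF hyp(1)] hyp(2) unfolding A_def by blast
  qed
  have A: "A \<subseteq> squares" unfolding A_def by blast
  have st: "stuck A" unfolding stuck_def
  proof (intro allI ballI impI)
    fix g q assume q: "q \<in> A" "g \<in> sides q"
    then obtain q' where "q' \<in> squares" "g \<in> sides q'" "q' \<noteq> q" using edge_partner[of q g] A by blast
    then show "\<exists>q'\<in>A. g \<in> sides q' \<and> q' \<noteq> q" using share[OF q(1) _ q(2)] by blast
  qed
  have live: "q \<in> A" if "\<not> dead A p" "label q = Some p" for p q
    using dead_if[OF A st that(2)] that(1) by blast
  have touch: "\<not> dead A p'" if "\<not> dead A p" "edge_labels f f' w b" "p \<in> set_option f' \<union> set_option w \<union> set_option b"
    "p' \<in> set_option f' \<union> set_option w \<union> set_option b" for p p' f f' w b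
  proof (rule edge_labelsE[OF that(2)])
    fix g q2 q3 q4 assume l: "label q2 = f'" "label q3 = w" "b \<noteq> None \<Longrightarrow> label q4 = b \<and> g \<in> sides q4"
      "g \<in> sides q2" "g \<in> sides q3"
    have ex: "\<exists>q. label q = Some p \<and> g \<in> sides q" if "p \<in> set_option f' \<union> set_option w \<union> set_option b" for p
      using that l by (cases f'; cases w; cases b) auto
    obtain q where q: "label q = Some p" "g \<in> sides q" using ex[OF \<open>p \<in> _\<close>] by blast
    obtain q' where q': "label q' = Some p'" "g \<in> sides q'" using ex[OF \<open>p' \<in> _\<close>] by blast
    have "q' \<in> squares" using q' by (simp add: squares_def)
    then have "q' \<in> A" using share[OF live[OF \<open>\<not> dead A p\<close> q(1)] _ q(2) q'(2)] by blast
    then show ?thesis using q'(1) unfolding dead_def by blast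
  qed
  have m0: "\<not> dead A (Plate (N + acc))"
  proof -
    have "u0 \<in> tri q0 True" using u0 diag_subset by blast
    then have "q0 \<in> A" using q0s unfolding A_def R_def by blast
    then show ?thesis using q0 unfolding dead_def by blast
  qed
  have L: "\<not> dead A (Plate a)" if "\<not> dead A (Plate (N + a))" "a < N" for a
    by (rule touch[OF that(1) rule_edges(1)[OF that(2)]]) simp_all
  have R2: "\<not> dead A (Plate (2 * N + a))" if "\<not> dead A (Plate (N + a))" "a < N" for a
    by (rule touch[OF that(1) rule_edges(2)[OF that(2)]]) simp_all
  have M: "\<not> dead A (Plate (N + z))" if z: "z < N" for z
  proof -
    obtain x where x: "rl x acc z" using acc(2)[OF z] by blast
    have "\<not> dead A (TubeB x acc z)" by (rule touch[OF R2[OF m0 acc(1)] rule_edges(4)[OF x]]) simp_all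
    then show ?thesis by (rule touch[OF _ rule_edges(5)[OF x]]) simp_all
  qed
  have P: "\<not> dead A (Plate v)" if "v < 3 * N" for v
  proof -
    consider "v < N" | "N \<le> v" "v < 2 * N" | "2 * N \<le> v" by linarith
    then show ?thesis
    proof cases
      case 1
      then show ?thesis using L M by blast
    next
      case 2
      then show ?thesis using M[of "v - N"] by simp
    next
      case 3
      then show ?thesis using R2[OF M, of "v - 2 * N"] that by simp
    qed
  qed
  have T: "\<not> dead A (TubeA x y z)" "\<not> dead A (TubeB x y z)" if "rl x y z" for x y z
  proof -
    have "\<not> dead A (Plate x)" "\<not> dead A (Plate (2 * N + y))" using rl_less[OF that] P by auto
    then show "\<not> dead A (TubeA x y z)" "\<not> dead A (TubeB x y z)"
      using touch[OF _ rule_edges(3)[OF that], of "Plate x" "TubeA x y z"]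
        touch[OF _ rule_edges(4)[OF that], of "Plate (2 * N + y)" "TubeB x y z"] by simp_all
  qed
  have sA: "q \<in> A" if "q \<in> squares" for q
  proof -
    note hyp = that
    obtain p where p: "label q = Some p" using hyp unfolding squares_def by blast
    then have "\<not> dead A p" using label_pieces[OF p] P T unfolding pieces_def by blast
    then show ?thesis using live p by blast
  qed
  have reach: "(u0, u) \<in> R" if "u \<in> \<Union>D" for u
  proof -
    note hyp = that
    obtain q b where "q \<in> squares" "u \<in> tri q b" using hyp unfolding D_def complex_of_def tris_def by blast
    then show ?thesis using all sA by blast
  qed
  have "sym R" unfolding R_def by (rule sym_rtrancl) (auto simp: complex_graph_def sym_def insert_commute)
  then have "(u, v) \<in> R" if "u \<in> \<Union>D" "v \<in> \<Union>D" for u v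
    by (rule tr[OF symD[OF _ reach[OF that(1)]] reach[OF that(2)]])
  then show ?thesis unfolding connected_complex_def D_def[symmetric] R_def by blast
qed

end

section \<open>The complex of a guess system\<close>

context guess_system
begin

interpretation layout N rl
  by standard (use acc_less rl_less in auto)

lemma erasable_iff_accepting:
  "(\<exists>C\<subseteq>tris squares. card C \<le> m \<and> erasable (tris squares) C) \<longleftrightarrow> (\<exists>c. acc \<in> der base ((\<lambda>i. U i (c i)) ` {..<m}))"
proof
  assume "\<exists>C\<subseteq>tris squares. card C \<le> m \<and> erasable (tris squares) C"
  then obtain C where C: "C \<subseteq> tris squares" "card C \<le> m" "erasable (tris squares) C" by blast
  let ?P = "{p. \<exists>q b. tri q b \<in> C \<and> label q = Some p}"
  \<comment> \<open>Recovers the piece from a triangle, so \<open>C\<close> meets at most as many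
    pieces as it has triangles.\<close>
  let ?f = "\<lambda>t. the (label (fst (SOME qb. t = tri (fst qb) (snd qb))))"
  have sub: "?P \<subseteq> ?f ` C"
  proof
    fix p assume "p \<in> ?P"
    then obtain q b where q: "tri q b \<in> C" "label q = Some p" by blast
    define s where "s = (SOME qb. tri q b = tri (fst qb) (snd qb))"
    have "tri q b = tri (fst s) (snd s)" unfolding s_def by (rule someI[of _ "(q, b)"]) simp
    then have "fst s = q" using tri_eq[of q b "fst s" "snd s"] by simp
    then have "?f (tri q b) = p" using q(2) unfolding s_def[symmetric] by simp
    then show "p \<in> ?f ` C" using q(1) by blast
  qed
  have fin: "finite C" using C(1) finite_tris by (rule finite_subset)
  have "finite ?P" using sub fin finite_surj by blast
  moreover have "card ?P \<le> m" using surj_card_le[OF fin sub] C(2) by simp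
  ultimately show "\<exists>c. acc \<in> der base ((\<lambda>i. U i (c i)) ` {..<m})"
    by (rule accepting_if_seeds[OF _ _ C(3)[unfolded erasable_iff_derived]])
next
  assume "\<exists>c. acc \<in> der base ((\<lambda>i. U i (c i)) ` {..<m})"
  then obtain c where c: "acc \<in> der base ((\<lambda>i. U i (c i)) ` {..<m})" by blast
  have "\<exists>q. label q = Some (Plate (N + U i (c i)))" if "i < m" for i
    using piece_label[of "Plate (N + U i (c i))"] U_less[OF that, of "c i"] by (auto simp: pieces_def)
  then obtain h where h: "\<And>i. i < m \<Longrightarrow> label (h i) = Some (Plate (N + U i (c i)))" by metis
  let ?C = "(\<lambda>i. tri (h i) True) ` {..<m}"
  have sub: "?C \<subseteq> tris squares" using h tri_in_tris by (auto simp: squares_def)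
  have "card ?C \<le> m" using card_image_le[of "{..<m}"] by simp
  moreover have "erasable (tris squares) ?C"
  proof -
    have "{p. \<exists>q b. tri q b \<in> ?C \<and> label q = Some p} = (\<lambda>i. Plate (N + U i (c i))) ` {..<m}"
    proof (intro equalityI subsetI)
      fix p assume "p \<in> {p. \<exists>q b. tri q b \<in> ?C \<and> label q = Some p}"
      then obtain q b i where "i < m" "tri q b = tri (h i) True" "label q = Some p" by blast
      then have "p = Plate (N + U i (c i))" using h[of i] by (simp add: tri_eq)
      then show "p \<in> (\<lambda>i. Plate (N + U i (c i))) ` {..<m}" using \<open>i < m\<close> by blast
    next
      fix p assume "p \<in> (\<lambda>i. Plate (N + U i (c i))) ` {..<m}"
      then obtain i where "i < m" "p = Plate (N + U i (c i))" by blast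
      then show "p \<in> {p. \<exists>q b. tri q b \<in> ?C \<and> label q = Some p}" using h[of i] by blast
    qed
    then show ?thesis unfolding erasable_iff_derived using seeds_if_accepting[OF c] by simp
  qed
  ultimately show "\<exists>C\<subseteq>tris squares. card C \<le> m \<and> erasable (tris squares) C" using sub by blast
qed

lemma reduction:
  "simplicial_complex (complex_of (tris squares))" "pure_complex (complex_of (tris squares))"
  "complex_has_dim (complex_of (tris squares)) 2" "connected_complex (complex_of (tris squares))"
  "embeddable_in_R3 (complex_of (tris squares))"
  "(\<exists>M. morse_matching (complex_of (tris squares)) M \<and> card (critical_faces (complex_of (tris squares)) M)
      \<le> card (skel 2 (tris squares)) + 2 * m + 2 - (card (skel 1 (tris squares)) + card (tris squares))) \<longleftrightarrow>
    (\<exists>c. acc \<in> der base ((\<lambda>i. U i (c i)) ` {..<m}))"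
proof -
  show "simplicial_complex (complex_of (tris squares))" by (rule simplicial)
  show "pure_complex (complex_of (tris squares))" by (rule pure)
  show "complex_has_dim (complex_of (tris squares)) 2" by (rule has_dim_2)
  show "embeddable_in_R3 (complex_of (tris squares))" by (rule embeddable)
  show con: "connected_complex (complex_of (tris squares))"
  proof (rule connected[OF acc_less])
    fix z assume z: "z < N"
    show "\<exists>x. rl x acc z"
    proof (cases "\<exists>i<m. \<exists>b. z = U i b")
      case True
      then obtain i b where "i < m" "z = U i b" by blast
      then show ?thesis using rl_group[of i "\<not> b"] by auto
    next
      case False
      then have "rl acc acc z" using z unfolding rl_def by blast
      then show ?thesis by blast
    qed
  qed
  show "(\<exists>M. morse_matching (complex_of (tris squares)) M \<and> card (critical_faces (complex_of (tris squares)) M)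
      \<le> card (skel 2 (tris squares)) + 2 * m + 2 - (card (skel 1 (tris squares)) + card (tris squares))) \<longleftrightarrow>
    (\<exists>c. acc \<in> der base ((\<lambda>i. U i (c i)) ` {..<m}))"
    using morse_bound_iff[OF con, of m] erasable_iff_accepting by simp
qed

end

section \<open>Turing machine computations as Horn systems\<close>

definition item :: "nat \<Rightarrow> nat \<Rightarrow> nat \<Rightarrow> nat \<Rightarrow> nat \<Rightarrow> nat" where
  "item k i t p s = prod_encode (k, prod_encode (i, prod_encode (t, prod_encode (p, s))))"

lemma item_eq [simp]: "item k i t p s = item k' i' t' p' s' \<longleftrightarrow> k = k' \<and> i = i' \<and> t = t' \<and> p = p' \<and> s = s'"
  by (simp add: item_def)

lemma prod_encode_mono: "a \<le> a' \<Longrightarrow> b \<le> b' \<Longrightarrow> prod_encode (a, b) \<le> prod_encode (a', b')"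
proof -
  assume h: "a \<le> a'" "b \<le> b'"
  have "triangle (a + b) \<le> triangle (a' + b')" unfolding triangle_def using h by (intro div_le_mono mult_le_mono) simp_all
  then show ?thesis using h by (simp add: prod_encode_def)
qed

lemma item_mono: "k \<le> b \<Longrightarrow> i \<le> b \<Longrightarrow> t \<le> b \<Longrightarrow> p \<le> b \<Longrightarrow> s \<le> b \<Longrightarrow> item k i t p s \<le> item b b b b b"
  unfolding item_def by (intro prod_encode_mono)

lemma definable_item [dintros]:
  "definable k \<Longrightarrow> definable i \<Longrightarrow> definable t \<Longrightarrow> definable p \<Longrightarrow> definable s \<Longrightarrow>
    definable (\<lambda>w \<sigma>. item (k w \<sigma>) (i w \<sigma>) (t w \<sigma>) (p w \<sigma>) (s w \<sigma>))"
  unfolding item_def by (intro dintros)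

fun dir_code :: "direction \<Rightarrow> nat" where
  "dir_code Go_Left = 0" | "dir_code Stay = 1" | "dir_code Go_Right = 2"

lemma word_tape_int: "word_tape w (int i) = (if i < length w then (if word_bit w i then 2 else 1) else 0)"
  by (simp add: word_tape_def word_bit_def)

lemma word_tape_neg: "i < 0 \<Longrightarrow> word_tape w i = 0"
  by (simp add: word_tape_def)

locale machine =
  fixes M :: tm assumes wf: "wf_tm M"
begin

abbreviation "K \<equiv> tm_tapes M"
abbreviation "G \<equiv> tm_symbols M"
abbreviation "S \<equiv> tm_states M"

lemma KG: "1 \<le> K" "3 \<le> G"
  using wf by (auto simp: wf_tm_def)

definition valid :: "nat \<Rightarrow> nat list \<Rightarrow> bool" where
  "valid q ss \<longleftrightarrow> q \<le> S \<and> length ss = K \<and> (\<forall>s\<in>set ss. s < G)"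

text \<open>In the halting state the machine is made to stand still by an explicit action, so that
  every run can be continued up to the same time.\<close>

definition nstate :: "nat \<Rightarrow> nat list \<Rightarrow> nat" where
  "nstate q ss = (if q < S then fst (tm_delta M q ss) else q)"

definition action :: "nat \<Rightarrow> nat list \<Rightarrow> nat \<Rightarrow> nat \<times> direction" where
  "action q ss i = (if q < S then snd (tm_delta M q ss) ! i else (ss ! i, Stay))"

lemma valid_step:
  assumes "valid q ss" "i < K"
  shows "nstate q ss \<le> S" "fst (action q ss i) < G"
proof -
  have *: "fst (tm_delta M q ss) \<le> S \<and> length (snd (tm_delta M q ss)) = K \<and> (\<forall>a\<in>set (snd (tm_delta M q ss)). fst a < G)" if qS: "q < S"
  proof -
    obtain q' as where d: "tm_delta M q ss = (q', as)" by (cases "tm_delta M q ss")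
    have C: "\<forall>q ss. q < S \<and> length ss = K \<and> (\<forall>s\<in>set ss. s < G) \<longrightarrow>
        (case tm_delta M q ss of (q', as) \<Rightarrow> q' \<le> S \<and> length as = K \<and> (\<forall>(s, d)\<in>set as. s < G))"
      using wf unfolding wf_tm_def by (elim conjE)
    have "q < S \<and> length ss = K \<and> (\<forall>s\<in>set ss. s < G)" using assms(1) qS unfolding valid_def by blast
    then have "case tm_delta M q ss of (q', as) \<Rightarrow> q' \<le> S \<and> length as = K \<and> (\<forall>(s, d)\<in>set as. s < G)"
      by (intro C[THEN spec, THEN spec, THEN mp])
    then have "q' \<le> S \<and> length as = K \<and> (\<forall>a\<in>set as. fst a < G)" unfolding d by (simp add: case_prod_beta)
    then show ?thesis unfolding d by simp
  qed
  show "nstate q ss \<le> S"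
  proof (cases "q < S")
    case True
    then show ?thesis using *[OF True] by (simp add: nstate_def)
  next
    case False
    then show ?thesis using assms(1) by (simp add: nstate_def valid_def)
  qed
  show "fst (action q ss i) < G"
  proof (cases "q < S")
    case True
    then have "snd (tm_delta M q ss) ! i \<in> set (snd (tm_delta M q ss))" using *[OF True] assms(2) by simp
    then show ?thesis using *[OF True] True unfolding action_def by simp
  next
    case False
    have "ss ! i \<in> set ss" using assms unfolding valid_def by simp
    then show ?thesis using False assms(1) unfolding action_def valid_def by simp
  qed
qed

text \<open>One pairing appends one symbol, so a rule with two premises can add the symbol of the
  next tape. Decoding is unique only for a fixed number of symbols.\<close>

definition enc :: "nat \<Rightarrow> nat list \<Rightarrow> nat" where
  "enc q ss = foldl (\<lambda>m s. prod_encode (m, s)) q ss"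

lemma enc_inj: "length ss = length ss' \<Longrightarrow> enc q ss = enc q' ss' \<Longrightarrow> q = q' \<and> ss = ss'"
proof (induction ss arbitrary: ss' rule: rev_induct)
  case Nil
  then show ?case by (simp add: enc_def)
next
  case (snoc s ss)
  then obtain ys y where ys: "ss' = ys @ [y]" by (cases ss' rule: rev_cases) auto
  have "length ss = length ys" "enc q ss = enc q' ys" "s = y" using snoc.prems unfolding ys by (simp_all add: enc_def)
  then show ?case using snoc.IH[of ys] ys by simp
qed

definition codes :: "nat set" where
  "codes = (\<lambda>(q, ss). enc q ss) ` ({..S} \<times> {ss. set ss \<subseteq> {..<G} \<and> length ss \<le> K})"

lemma finite_codes: "finite codes"
  unfolding codes_def by (intro finite_imageI finite_cartesian_product finite_lists_length_le) simp_all

lemma codes_Max: "q \<le> S \<Longrightarrow> set ss \<subseteq> {..<G} \<Longrightarrow> length ss \<le> K \<Longrightarrow> enc q ss \<le> Max codes"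
  by (rule Max_ge[OF finite_codes]) (force simp: codes_def)

text \<open>The second argument is a dummy that gives the function the binary form expected by
  \<open>definable_finite_support\<close>.\<close>

definition nst :: "nat \<Rightarrow> nat \<Rightarrow> nat" where
  "nst m z = (if z = 0 \<and> (\<exists>q ss. valid q ss \<and> m = enc q ss)
     then SOME r. \<exists>q ss. valid q ss \<and> m = enc q ss \<and> r = nstate q ss else 0)"

definition act :: "nat \<Rightarrow> nat \<Rightarrow> nat" where
  "act m i = (if i < K \<and> (\<exists>q ss. valid q ss \<and> m = enc q ss)
     then SOME r. \<exists>q ss. valid q ss \<and> m = enc q ss \<and> r = 3 * fst (action q ss i) + dir_code (snd (action q ss i)) else 0)"

lemma valid_enc: "valid q ss \<Longrightarrow> valid q' ss' \<Longrightarrow> enc q ss = enc q' ss' \<Longrightarrow> q = q' \<and> ss = ss'"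
  by (rule enc_inj) (simp_all add: valid_def)

lemma nst_enc: "valid q ss \<Longrightarrow> nst (enc q ss) 0 = nstate q ss"
proof -
  assume v: "valid q ss"
  have "(SOME r. \<exists>q' ss'. valid q' ss' \<and> enc q ss = enc q' ss' \<and> r = nstate q' ss') = nstate q ss"
  proof (rule some_equality)
    show "\<exists>q' ss'. valid q' ss' \<and> enc q ss = enc q' ss' \<and> nstate q ss = nstate q' ss'"
      by (intro exI[of _ q] exI[of _ ss] conjI refl v)
    fix r assume "\<exists>q' ss'. valid q' ss' \<and> enc q ss = enc q' ss' \<and> r = nstate q' ss'"
    then obtain q' ss' where h: "valid q' ss'" "enc q ss = enc q' ss'" "r = nstate q' ss'" by (elim exE conjE) (rule that)
    then show "r = nstate q ss" using valid_enc[OF v h(1,2)] by simp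
  qed
  moreover have "\<exists>q' ss'. valid q' ss' \<and> enc q ss = enc q' ss'" by (intro exI[of _ q] exI[of _ ss] conjI refl v)
  ultimately show ?thesis unfolding nst_def by simp
qed

lemma act_enc: "valid q ss \<Longrightarrow> i < K \<Longrightarrow> act (enc q ss) i = 3 * fst (action q ss i) + dir_code (snd (action q ss i))"
proof -
  assume v: "valid q ss" "i < K"
  have "(SOME r. \<exists>q' ss'. valid q' ss' \<and> enc q ss = enc q' ss' \<and> r = 3 * fst (action q' ss' i) + dir_code (snd (action q' ss' i))) =
      3 * fst (action q ss i) + dir_code (snd (action q ss i))"
  proof (rule some_equality)
    show "\<exists>q' ss'. valid q' ss' \<and> enc q ss = enc q' ss' \<and> 3 * fst (action q ss i) + dir_code (snd (action q ss i)) =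
        3 * fst (action q' ss' i) + dir_code (snd (action q' ss' i))" by (intro exI[of _ q] exI[of _ ss] conjI refl v(1))
    fix r assume "\<exists>q' ss'. valid q' ss' \<and> enc q ss = enc q' ss' \<and> r = 3 * fst (action q' ss' i) + dir_code (snd (action q' ss' i))"
    then obtain q' ss' where h: "valid q' ss'" "enc q ss = enc q' ss'" "r = 3 * fst (action q' ss' i) + dir_code (snd (action q' ss' i))"
      by (elim exE conjE) (rule that)
    then show "r = 3 * fst (action q ss i) + dir_code (snd (action q ss i))" using valid_enc[OF v(1) h(1,2)] by simp
  qed
  moreover have "\<exists>q' ss'. valid q' ss' \<and> enc q ss = enc q' ss'" by (intro exI[of _ q] exI[of _ ss] conjI refl v(1))
  ultimately show ?thesis using v(2) unfolding act_def by simp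
qed

lemma valid_codes: "valid q ss \<Longrightarrow> enc q ss \<in> codes"
  unfolding codes_def valid_def by force

lemma definable_nst: "definable f \<Longrightarrow> definable (\<lambda>w \<sigma>. nst (f w \<sigma>) 0)"
proof -
  assume f: "definable f"
  have "{(m, z). nst m z \<noteq> 0} \<subseteq> codes \<times> {0}" using valid_codes by (auto simp: nst_def split: if_splits)
  then have "finite {(m, z). nst m z \<noteq> 0}" by (rule finite_subset) (simp add: finite_codes)
  from definable_subst2[OF definable_finite_support[OF this] f definable_const[of 0]] show ?thesis .
qed

lemma definable_act: "definable f \<Longrightarrow> definable g \<Longrightarrow> definable (\<lambda>w \<sigma>. act (f w \<sigma>) (g w \<sigma>))"
proof -
  assume f: "definable f" "definable g"
  have "{(m, i). act m i \<noteq> 0} \<subseteq> codes \<times> {..<K}" using valid_codes by (auto simp: act_def split: if_splits)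
  then have "finite {(m, i). act m i \<noteq> 0}" by (rule finite_subset) (simp add: finite_codes)
  from definable_subst2[OF definable_finite_support[OF this] f] show ?thesis .
qed

subsection \<open>Runs\<close>

definition cfg :: "word \<Rightarrow> nat \<Rightarrow> config" where "cfg w t = (tm_step M ^^ t) (tm_init M w)"
definition st :: "word \<Rightarrow> nat \<Rightarrow> nat" where "st w t = fst (cfg w t)"
definition tp :: "word \<Rightarrow> nat \<Rightarrow> nat \<Rightarrow> tape" where "tp w i t = snd (cfg w t) ! i"
definition rd :: "word \<Rightarrow> nat \<Rightarrow> nat \<Rightarrow> nat" where "rd w i t = fst (tp w i t) (snd (tp w i t))"
definition rds :: "word \<Rightarrow> nat \<Rightarrow> nat list" where "rds w t = map (\<lambda>i. rd w i t) [0..<K]"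

definition inv :: "word \<Rightarrow> nat \<Rightarrow> bool" where
  "inv w t \<longleftrightarrow> length (snd (cfg w t)) = K \<and> st w t \<le> S \<and>
     (\<forall>i<K. (\<forall>j. fst (tp w i t) j < G) \<and> \<bar>snd (tp w i t)\<bar> \<le> int t)"

lemma inv_valid: "inv w t \<Longrightarrow> valid (st w t) (rds w t)"
  unfolding inv_def valid_def rds_def rd_def by auto

lemma step:
  assumes "inv w t"
  shows "st w (Suc t) = nstate (st w t) (rds w t)" "length (snd (cfg w (Suc t))) = K"
    "i < K \<Longrightarrow> tp w i (Suc t) = tape_act (action (st w t) (rds w t) i) (tp w i t)"
proof -
  obtain q ts where c: "cfg w t = (q, ts)" by (cases "cfg w t")
  have len: "length ts = K" using assms c by (simp add: inv_def)
  have q: "st w t = q" and tp: "\<And>i. tp w i t = ts ! i" using c by (simp_all add: st_def tp_def)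
  have r: "map (\<lambda>(t, h). t h) ts = rds w t"
    by (rule nth_equalityI) (auto simp: rds_def len rd_def tp split: prod.splits)
  have v: "valid q (rds w t)" using inv_valid[OF assms] q by simp
  have nx: "cfg w (Suc t) = tm_step M (q, ts)" using c by (simp add: cfg_def)
  have "st w (Suc t) = nstate (st w t) (rds w t) \<and> length (snd (cfg w (Suc t))) = K \<and>
    (\<forall>i<K. tp w i (Suc t) = tape_act (action (st w t) (rds w t) i) (tp w i t))"
  proof (cases "q < S")
    case True
    obtain q' as where d: "tm_delta M q (rds w t) = (q', as)" by (cases "tm_delta M q (rds w t)")
    have la: "length as = K" using wf v True d unfolding wf_tm_def valid_def by force
    have "cfg w (Suc t) = (q', map2 tape_act as ts)" using nx True r d by simp
    then show ?thesis unfolding q tp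
      using True d la len by (simp add: st_def tp_def nstate_def action_def)
  next
    case False
    then have "cfg w (Suc t) = (q, ts)" using nx by simp
    moreover have "tape_act (action q (rds w t) i) (ts ! i) = ts ! i" if "i < K" for i
      using False that by (cases "ts ! i") (simp add: action_def rds_def rd_def tp)
    ultimately show ?thesis unfolding q tp
      using False len by (simp add: st_def tp_def nstate_def)
  qed
  then show "st w (Suc t) = nstate (st w t) (rds w t)" "length (snd (cfg w (Suc t))) = K"
    "i < K \<Longrightarrow> tp w i (Suc t) = tape_act (action (st w t) (rds w t) i) (tp w i t)" by blast+
qed

lemma tape_act_simps: "fst (tape_act a x) = (fst x)(snd x := fst a)" "snd (tape_act a x) = snd x + offset (snd a)"
  by (cases a; cases x; simp)+

lemma tp_0: "i < K \<Longrightarrow> tp w i 0 = (if i = 0 then (word_tape w, 0) else (word_tape [], 0))"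
  by (simp add: tp_def cfg_def tm_init_def nth_Cons')

lemma inv: "inv w t"
proof (induction t)
  case 0
  have "word_tape v j < G" for v j using KG(2) by (simp add: word_tape_def)
  then have "\<forall>i<K. (\<forall>j. fst (tp w i 0) j < G) \<and> \<bar>snd (tp w i 0)\<bar> \<le> int 0" by (simp add: tp_0)
  then show ?case using KG(1) by (simp add: inv_def st_def cfg_def tm_init_def)
next
  case (Suc t)
  note v = inv_valid[OF Suc]
  have "(\<forall>j. fst (tp w i (Suc t)) j < G) \<and> \<bar>snd (tp w i (Suc t))\<bar> \<le> int (Suc t)" if i: "i < K" for i
  proof -
    have o: "\<forall>j. fst (tp w i t) j < G" "\<bar>snd (tp w i t)\<bar> \<le> int t" using Suc i unfolding inv_def by blast+
    have "\<bar>offset (snd (action (st w t) (rds w t) i))\<bar> \<le> 1" by (cases "snd (action (st w t) (rds w t) i)") auto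
    then have "\<bar>snd (tp w i t) + offset (snd (action (st w t) (rds w t) i))\<bar> \<le> int (Suc t)"
      using o(2) abs_triangle_ineq[of "snd (tp w i t)" "offset (snd (action (st w t) (rds w t) i))"] by (simp only: of_nat_Suc)
    then show ?thesis using o(1) valid_step(2)[OF v i] unfolding step(3)[OF Suc i] tape_act_simps by simp
  qed
  moreover have "st w (Suc t) \<le> S" using valid_step(1)[OF v] KG(1) unfolding step(1)[OF Suc] by force
  ultimately show ?case using step(2)[OF Suc] unfolding inv_def by blast
qed

text \<open>A halted machine no longer changes, so the answer can be inspected at time
  \<open>T\<close> instead of the unknown halting time. Symbol 2 stands for
  \<open>True\<close>.\<close>

lemma run_accepts:
  assumes "tm_computes_within M w [b] T"
  shows "fst (tp w (K - 1) T) 0 = 2 \<longleftrightarrow> b"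
proof -
  obtain t where t: "t \<le> T" "case (tm_step M ^^ t) (tm_init M w) of (q, ts) \<Rightarrow> q = S \<and> fst (last ts) = word_tape [b]"
    using assms unfolding tm_computes_within_def by (elim exE conjE) (rule that)
  obtain q ts where qts: "cfg w t = (q, ts)" by (cases "cfg w t")
  then have c: "cfg w t = (S, ts)" "fst (last ts) = word_tape [b]" using t(2) unfolding cfg_def[symmetric] qts by simp_all
  have "(tm_step M ^^ n) (S, ts) = (S, ts)" for n by (induction n) simp_all
  moreover have "cfg w T = (tm_step M ^^ (T - t)) (cfg w t)"
    using fun_cong[OF funpow_add[of "T - t" t "tm_step M"], of "tm_init M w"] t(1) by (simp add: cfg_def)
  ultimately have "cfg w T = (S, ts)" using c(1) by simp
  moreover have "length ts = K" using inv[of w t] c(1) by (simp add: inv_def)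
  then have "last ts = ts ! (K - 1)" using KG(1) last_conv_nth[of ts] by force
  ultimately have "fst (tp w (K - 1) T) = word_tape [b]" using c(2) by (simp add: tp_def)
  then show ?thesis by (simp add: word_tape_def)
qed

subsection \<open>The Horn system\<close>

text \<open>The initial tapes outside the cells of the certificate. Cell 0 has position
  \<open>T\<close>; it is followed by the doubled bits of \<open>x\<close> and the separator with
  symbols 1 and 2.\<close>

definition pre :: "word \<Rightarrow> nat \<Rightarrow> nat \<Rightarrow> nat \<Rightarrow> nat" where
  "pre x T i p = (if i = 0 \<and> T \<le> p \<and> p < T + 2 * length x
     then (if (p - T) div 2 < length x \<and> x ! ((p - T) div 2) then 2 else 1)
     else if i = 0 \<and> p = T + 2 * length x then 1
     else if i = 0 \<and> p = T + 2 * length x + 1 then 2 else 0)"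

text \<open>
  Item \<open>k i t p s\<close> says that quantity \<open>k\<close> of tape \<open>i\<close> at time \<open>t\<close> and position \<open>p\<close> (shifted by
  \<open>T\<close>) has value \<open>s\<close>: the cell content (0), the head position (1), the content, increased by \<open>G\<close> if
  the head is there (2), the symbol read if the head is left of \<open>p\<close> (3), the state together with the symbols read
  on the first \<open>i\<close> tapes (4), the action (5), the trivial quantity (6), whether the certificate is
  longer than \<open>p\<close> (7), the guessed bits (8), and acceptance (9). Each quantity is a function of at
  most two earlier ones.
\<close>

definition raw :: "word \<Rightarrow> nat \<Rightarrow> nat \<Rightarrow> nat \<Rightarrow> nat \<Rightarrow> nat \<Rightarrow> nat \<Rightarrow> bool" where
  "raw x T P B a b z \<longleftrightarrow>
    (\<exists>i<K. \<exists>t<T. \<exists>p<2 * T + 1. \<exists>h<B. \<exists>s<B. a = item 1 i t 0 h \<and> b = item 0 i t p s \<and> z = item 2 i t p (if h = p then G + s else s)) \<or>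
    (\<exists>i<K. \<exists>t<T. \<exists>p<2 * T + 1. \<exists>s<B. \<exists>r<B. a = item 2 i t p s \<and> b = item 3 i t p r \<and> z = item 3 i t (Suc p) (if G \<le> s then s - G else r)) \<or>
    (\<exists>i<K. \<exists>t<T. \<exists>m<B. \<exists>r<B. a = item 4 i t 0 m \<and> b = item 3 i t (2 * T + 1) r \<and> z = item 4 (Suc i) t 0 (prod_encode (m, r))) \<or>
    (\<exists>i<K. \<exists>t<T. \<exists>m<B. a = item 4 K t 0 m \<and> b = item 4 K t 0 m \<and> z = item 5 i t 0 (act m i)) \<or>
    (\<exists>t<T. \<exists>m<B. a = item 4 K t 0 m \<and> b = item 4 K t 0 m \<and> z = item 4 0 (Suc t) 0 (nst m 0)) \<or>
    (\<exists>i<K. \<exists>t<T. \<exists>e<B. \<exists>h<B. a = item 5 i t 0 e \<and> b = item 1 i t 0 h \<and> z = item 1 i (Suc t) 0 (h + e mod 3 - 1)) \<or>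
    (\<exists>i<K. \<exists>t<T. \<exists>p<2 * T + 1. \<exists>e<B. \<exists>s<B. a = item 5 i t 0 e \<and> b = item 2 i t p s \<and> z = item 0 i (Suc t) p (if G \<le> s then e div 3 else s)) \<or>
    (\<exists>i<K. a = item 6 0 0 0 0 \<and> b = item 6 0 0 0 0 \<and> z = item 1 i 0 0 T) \<or>
    (a = item 6 0 0 0 0 \<and> b = item 6 0 0 0 0 \<and> z = item 4 0 0 0 0) \<or>
    (\<exists>i<K. \<exists>t<T. a = item 6 0 0 0 0 \<and> b = item 6 0 0 0 0 \<and> z = item 3 i t 0 0) \<or>
    (\<exists>i<K. \<exists>p<2 * T + 1. \<not> (i = 0 \<and> T + 2 * length x + 2 \<le> p \<and> p < T + 2 * length x + 2 + P) \<and>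
       a = item 6 0 0 0 0 \<and> b = item 6 0 0 0 0 \<and> z = item 0 i 0 p (pre x T i p)) \<or>
    (a = item 6 0 0 0 0 \<and> b = item 6 0 0 0 0 \<and> z = item 7 0 0 0 1) \<or>
    (\<exists>j<P. \<exists>r<2. \<exists>v<2. a = item 7 0 0 j r \<and> b = item 8 0 0 (2 * j + 1) v \<and> z = item 7 0 0 (Suc j) (r * v)) \<or>
    (\<exists>j<P. \<exists>r<2. \<exists>v<2. a = item 7 0 0 (Suc j) r \<and> b = item 8 0 0 (2 * j + 2) v \<and>
       z = item 0 0 0 (T + 2 * length x + 2 + j) (if r = 0 then 0 else Suc v)) \<or>
    (\<exists>v<2. a = item 8 0 0 0 v \<and> b = item 8 0 0 0 v \<and> z = item 6 0 0 0 0) \<or>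
    (a = item 0 (K - 1) T T 2 \<and> b = item 0 (K - 1) T T 2 \<and> z = item 9 0 0 0 1)"

definition guess :: "nat \<Rightarrow> bool \<Rightarrow> nat" where "guess i b = item 8 0 0 i (of_bool b)"

text \<open>The summands take care of positions and times, guesses, codes of states, actions, tapes
  and kinds, so that every component of an item of the run fits.\<close>

definition bound :: "nat \<Rightarrow> nat \<Rightarrow> nat" where "bound T P = 2 * T + 2 * P + Max codes + 3 * G + K + 10"

definition horn :: "word \<Rightarrow> nat \<Rightarrow> nat \<Rightarrow> nat \<Rightarrow> nat \<Rightarrow> nat \<Rightarrow> bool" where
  "horn x T P a b z \<longleftrightarrow> (let B = bound T P; N = Suc (item B B B B B) in
     raw x T P (Suc B) a b z \<and> a < N \<and> b < N \<and> z < N)"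

definition size :: "nat \<Rightarrow> nat \<Rightarrow> nat" where "size T P = Suc (item (bound T P) (bound T P) (bound T P) (bound T P) (bound T P))"

lemma horn_def': "horn x T P a b z \<longleftrightarrow> raw x T P (Suc (bound T P)) a b z \<and> a < size T P \<and> b < size T P \<and> z < size T P"
  by (simp add: horn_def size_def Let_def)

lemma definable_horn:
  assumes T: "definable (\<lambda>w \<sigma>. T w)" and P: "definable (\<lambda>w \<sigma>. P w)"
  shows "definable (\<lambda>w \<sigma>. size (T w) (P w))" "definable_pred (\<lambda>w \<sigma>. horn w (T w) (P w) (\<sigma> 0) (\<sigma> 1) (\<sigma> 2))"
proof -
  have B: "definable (\<lambda>w \<sigma>. bound (T w) (P w))" unfolding bound_def by (intro dintros T P)
  show N: "definable (\<lambda>w \<sigma>. size (T w) (P w))" unfolding size_def by (intro dintros B)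
  show "definable_pred (\<lambda>w \<sigma>. horn w (T w) (P w) (\<sigma> 0) (\<sigma> 1) (\<sigma> 2))"
    unfolding horn_def' raw_def pre_def
    by (intro dintros T P B N definable_nst definable_act)
qed

lemma raw_kinds:
  assumes "raw x T P B a b z"
  shows "a \<noteq> item 9 0 0 0 1 \<and> b \<noteq> item 9 0 0 0 1 \<and> z \<noteq> guess i c"
  using assms unfolding raw_def guess_def by (elim disjE exE conjE) simp_all

lemma guess_less: "i < 2 * P + 1 \<Longrightarrow> guess i b < size T P"
  unfolding guess_def size_def less_Suc_eq_le by (rule item_mono) (auto simp: bound_def)

text \<open>Guess 0 carries no information: derivations need a given fact to start from, and either
  value of this guess yields the trivial quantity. The odd guesses tell whether the certificate
  continues, the even ones from 2 on are its bits.\<close>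

lemma horn_guess_system: "guess_system (size T P) (horn x T P) guess (item 9 0 0 0 1) (2 * P + 1)"
proof
  show "a < size T P \<and> b < size T P \<and> z < size T P \<and> a \<noteq> item 9 0 0 0 1 \<and> b \<noteq> item 9 0 0 0 1" if "horn x T P a b z" for a b z
    using that raw_kinds[of x T P _ a b z] unfolding horn_def' by blast
  show False if "horn x T P a b (guess i c)" for a b i c
    using that raw_kinds[of x T P _ a b "guess i c"] unfolding horn_def' by blast
  show "i = j \<and> b = c" if "guess i b = guess j c" for i j b c using that by (cases b; cases c) (auto simp: guess_def)
  show "guess i b < size T P" if "i < 2 * P + 1" for i b by (rule guess_less[OF that])
  show "item 9 0 0 0 1 < size T P" unfolding size_def less_Suc_eq_le by (rule item_mono) (simp_all add: bound_def)
  show "item 9 0 0 0 1 \<noteq> guess i b" for i b by (simp add: guess_def)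
qed

end

text \<open>The certificate ends at the first odd guess that is false, whatever the later ones say.
  In this way every choice \<open>c\<close> encodes some certificate of length at most
  \<open>P\<close>.\<close>

locale run = machine +
  fixes x u :: word and T P :: nat and c :: "nat \<Rightarrow> bool"
  assumes T: "2 * length x + 2 + P \<le> T" and u: "length u \<le> P"
    and cert: "\<And>j. j < P \<Longrightarrow> (j < length u \<longleftrightarrow> (\<forall>j'\<le>j. c (2 * j' + 1))) \<and> (j < length u \<longrightarrow> u ! j = c (2 * j + 2))"
begin

abbreviation "w \<equiv> pair_word x u"

definition hd :: "nat \<Rightarrow> nat \<Rightarrow> nat" where "hd i t = nat (snd (tp w i t) + int T)"
definition cl :: "nat \<Rightarrow> nat \<Rightarrow> nat \<Rightarrow> nat" where "cl i t p = fst (tp w i t) (int p - int T)"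

definition val :: "nat \<Rightarrow> nat \<Rightarrow> nat \<Rightarrow> nat \<Rightarrow> nat" where
  "val k i t p = (if k = 0 then cl i t p else if k = 1 then hd i t
     else if k = 2 then (if hd i t = p then G + cl i t p else cl i t p)
     else if k = 3 then (if hd i t < p then rd w i t else 0)
     else if k = 4 then enc (st w t) (take i (rds w t))
     else if k = 5 then act (enc (st w t) (rds w t)) i
     else if k = 7 then of_bool (\<forall>j<p. c (2 * j + 1))
     else if k = 8 then of_bool (c p)
     else if k = 9 then of_bool (cl (K - 1) T T = 2) else 0)"

lemma val_simps:
  "val 0 i t p = cl i t p" "val (Suc 0) i t p = hd i t" "val 2 i t p = (if hd i t = p then G + cl i t p else cl i t p)"
  "val 3 i t p = (if hd i t < p then rd w i t else 0)" "val 4 i t p = enc (st w t) (take i (rds w t))"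
  "val 5 i t p = act (enc (st w t) (rds w t)) i" "val 6 i t p = 0" "val 7 i t p = of_bool (\<forall>j<p. c (2 * j + 1))"
  "val 8 i t p = of_bool (c p)" "val 9 i t p = of_bool (cl (K - 1) T T = 2)"
  by (simp_all add: val_def)

lemma cl_less: "i < K \<Longrightarrow> cl i t p < G"
  using inv[of w t] unfolding inv_def cl_def by blast

lemma hd_bounds: "i < K \<Longrightarrow> t \<le> T \<Longrightarrow> snd (tp w i t) + int T = int (hd i t) \<and> hd i t \<le> T + t \<and> T \<le> hd i t + t"
proof -
  assume h: "i < K" "t \<le> T"
  have a: "\<bar>snd (tp w i t)\<bar> \<le> int t" using inv[of w t] h(1) unfolding inv_def by blast
  then have "0 \<le> snd (tp w i t) + int T" using h(2) by linarith
  then have e: "snd (tp w i t) + int T = int (hd i t)" unfolding hd_def by simp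
  have "int (hd i t) \<le> int T + int t" "int T \<le> int (hd i t) + int t" using e a by linarith+
  then show ?thesis using e by presburger
qed

lemma rd_cl: "i < K \<Longrightarrow> t \<le> T \<Longrightarrow> rd w i t = cl i t (hd i t)"
  using hd_bounds[of i t] unfolding rd_def cl_def by (metis add_diff_cancel_right')

lemma rds_take: "i < K \<Longrightarrow> take (Suc i) (rds w t) = take i (rds w t) @ [rd w i t]"
  by (simp add: rds_def take_Suc_conv_app_nth)

lemma len_rds: "length (rds w t) = K"
  by (simp add: rds_def)

lemma step_hd:
  assumes "i < K" "t < T"
  shows "hd i (Suc t) = hd i t + act (enc (st w t) (rds w t)) i mod 3 - 1"
proof -
  let ?a = "action (st w t) (rds w t) i"
  have h: "snd (tp w i t) + int T = int (hd i t)" "1 \<le> hd i t" using hd_bounds[of i t] assms by auto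
  have "snd (tp w i (Suc t)) = snd (tp w i t) + offset (snd ?a)"
    unfolding step(3)[OF inv assms(1)] tape_act_simps ..
  then have "hd i (Suc t) = nat (int (hd i t) + offset (snd ?a))" using h(1) unfolding hd_def[of i "Suc t"] by (simp add: algebra_simps)
  moreover have "act (enc (st w t) (rds w t)) i mod 3 = dir_code (snd ?a)"
    unfolding act_enc[OF inv_valid[OF inv] assms(1)] by (cases "snd ?a") (simp_all, presburger?)
  ultimately show ?thesis using h(2) by (cases "snd ?a") simp_all
qed

lemma step_cl:
  assumes "i < K" "t < T"
  shows "cl i (Suc t) p = (if hd i t = p then act (enc (st w t) (rds w t)) i div 3 else cl i t p)"
proof -
  let ?a = "action (st w t) (rds w t) i"
  have h: "snd (tp w i t) + int T = int (hd i t)" using hd_bounds[of i t] assms by auto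
  have "fst (tp w i (Suc t)) = (fst (tp w i t))(snd (tp w i t) := fst ?a)"
    unfolding step(3)[OF inv assms(1)] tape_act_simps ..
  moreover have "act (enc (st w t) (rds w t)) i div 3 = fst ?a"
    unfolding act_enc[OF inv_valid[OF inv] assms(1)] by (cases "snd ?a") (simp_all, presburger?)
  moreover have "int p - int T = snd (tp w i t) \<longleftrightarrow> hd i t = p" using h by linarith
  ultimately show ?thesis unfolding cl_def by simp
qed

lemma init_cl:
  assumes "i < K" "\<not> (i = 0 \<and> T + 2 * length x + 2 \<le> p \<and> p < T + 2 * length x + 2 + P)"
  shows "cl i 0 p = pre x T i p"
proof (cases "i = 0 \<and> T \<le> p")
  case False
  then have "cl i 0 p = 0" using tp_0[OF assms(1), of w] by (auto simp: cl_def word_tape_neg word_tape_def)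
  moreover have "pre x T i p = 0" using False by (auto simp: pre_def)
  ultimately show ?thesis by simp
next
  case True
  define n where "n = p - T"
  have p: "p = T + n" using True n_def by simp
  have c: "cl i 0 p = (if n < length w then (if word_bit w n then 2 else 1) else 0)"
    using tp_0[OF assms(1), of w] True word_tape_int[of w n] by (simp add: cl_def p)
  note b = pair_word_bits[where x = x and u = u]
  have len: "length w = 2 * length x + 2 + length u" by (rule b(6))
  consider "n < 2 * length x" | "n = 2 * length x" | "n = 2 * length x + 1" | "2 * length x + 2 + P \<le> n"
    using assms(2) True p by linarith
  then show ?thesis
  proof cases
    case 1
    have "n = 2 * (n div 2) \<or> n = 2 * (n div 2) + 1" by presburger
    moreover have "n div 2 < length x" using 1 by auto
    ultimately have "word_bit w n = x ! (n div 2)" using b(1)[of "n div 2"] b(2)[of "n div 2"] by metis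
    then show ?thesis using 1 c len True \<open>n div 2 < length x\<close> by (simp add: pre_def p)
  next
    case 2
    then show ?thesis using c len b(3) True by (simp add: pre_def p)
  next
    case 3
    then show ?thesis using c len b(4) True by (simp add: pre_def p)
  next
    case 4
    then show ?thesis using c len u True by (simp add: pre_def p)
  qed
qed

lemma cert_cl:
  assumes "j < P"
  shows "cl 0 0 (T + 2 * length x + 2 + j) = (if \<forall>j'<Suc j. c (2 * j' + 1) then Suc (of_bool (c (2 * j + 2))) else 0)"
proof -
  have c: "cl 0 0 (T + 2 * length x + 2 + j) = (if j < length u then (if word_bit u j then 2 else 1) else 0)"
    using tp_0[of 0 w] KG(1) word_tape_int[of w "2 * length x + 2 + j"] pair_word_bits(5,6)[of x u] by (simp add: cl_def)
  have "j < length u \<longleftrightarrow> (\<forall>j'<Suc j. c (2 * j' + 1))" "j < length u \<Longrightarrow> word_bit u j = c (2 * j + 2)"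
    using cert[OF assms] by (auto simp: less_Suc_eq_le word_bit_def)
  then show ?thesis using c by auto
qed

definition tr :: "nat \<Rightarrow> bool" where "tr a \<longleftrightarrow> (\<exists>k i t p. a = item k i t p (val k i t p))"

lemma tr_item: "tr (item k i t p s) \<longleftrightarrow> s = val k i t p"
  by (auto simp: tr_def)

text \<open>Every quantity has one true value, and each rule computes it from true values. Hence
  only true items are derived, although the rules are written for all values.\<close>

lemma raw_sound:
  assumes "raw x T P B a b z" "tr a" "tr b"
  shows "tr z"
  using assms(1)[unfolded raw_def]
proof (elim disjE exE conjE, goal_cases)
  case (1 i t p h s)
  then show ?case using assms(2,3) by (simp add: tr_item val_simps)
next
  case (2 i t p s r)
  then have s: "s = val 2 i t p" "r = val 3 i t p" using assms(2,3) by (simp_all add: tr_item)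
  have "rd w i t = cl i t (hd i t)" "cl i t p < G" using rd_cl[of i t] cl_less 2 by simp_all
  then show ?case unfolding 2(8) s by (auto simp: tr_item val_simps less_Suc_eq)
next
  case (3 i t m r)
  then have s: "m = val 4 i t 0" "r = val 3 i t (2 * T + 1)" using assms(2,3) by (simp_all add: tr_item)
  have "hd i t < 2 * T + 1" using hd_bounds[of i t] 3 by simp
  then show ?case unfolding 3(7) s using rds_take[of i t] 3 by (simp add: tr_item val_simps enc_def)
next
  case (4 i t m)
  then show ?case using assms(2) len_rds by (simp add: tr_item val_simps)
next
  case (5 t m)
  then show ?case using assms(2) len_rds nst_enc[OF inv_valid[OF inv]] step(1)[OF inv] by (simp add: tr_item val_simps enc_def)
next
  case (6 i t e h)
  then show ?case using assms(2,3) step_hd[of i t] by (simp add: tr_item val_simps)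
next
  case (7 i t p e s)
  then have s: "e = val 5 i t 0" "s = val 2 i t p" using assms(2,3) by (simp_all add: tr_item)
  have "cl i t p < G" using cl_less 7 by simp
  then show ?case unfolding 7(8) s using step_cl[of i t p] 7 by (auto simp: tr_item val_simps)
next
  case (8 i)
  then show ?case using tp_0[of i w] by (simp add: tr_item val_simps hd_def)
next
  case 9
  then show ?case by (simp add: tr_item val_simps enc_def st_def cfg_def tm_init_def)
next
  case (10 i t)
  then show ?case by (simp add: tr_item val_simps)
next
  case (11 i p)
  then show ?case using init_cl[of i p] by (simp add: tr_item val_simps)
next
  case 12
  then show ?case by (simp add: tr_item val_simps)
next
  case (13 j r v)
  then have s: "r = val 7 0 0 j" "v = val 8 0 0 (2 * j + 1)" using assms(2,3) by (simp_all add: tr_item)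
  then show ?case unfolding 13(6) s by (auto simp: tr_item val_simps less_Suc_eq)
next
  case (14 j r v)
  then have s: "r = val 7 0 0 (Suc j)" "v = val 8 0 0 (2 * j + 2)" using assms(2,3) by (simp_all add: tr_item)
  show ?case unfolding 14(6) s tr_item val_simps cert_cl[OF 14(1)] by simp
next
  case (15 v)
  then show ?case by (simp add: tr_item val_simps)
next
  case 16
  then show ?case using assms(2) by (simp add: tr_item val_simps)
qed

abbreviation "D \<equiv> der (horn x T P) ((\<lambda>i. guess i (c i)) ` {..<2 * P + 1})"
abbreviation "it k i t p \<equiv> item k i t p (val k i t p)"

lemma sound: "a \<in> D \<Longrightarrow> tr a"
proof (induction rule: der.induct)
  case (given a)
  then show ?case by (auto simp: guess_def tr_item val_simps)
next
  case (step a b z)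
  then show ?case using raw_sound unfolding horn_def' by blast
qed

definition ok :: "nat \<Rightarrow> nat \<Rightarrow> nat \<Rightarrow> nat \<Rightarrow> bool" where
  "ok k i t p \<longleftrightarrow> k \<le> 9 \<and> (i < K \<or> k = 4 \<and> i = K) \<and> t \<le> T \<and> p \<le> 2 * T + 1 + 2 * P"

lemma val_le: "ok k i t p \<Longrightarrow> val k i t p \<le> bound T P"
proof -
  assume o: "ok k i t p"
  have v: "valid (st w t) (rds w t)" by (rule inv_valid[OF inv])
  have r: "st w t \<le> S" "set (rds w t) \<subseteq> {..<G}" using v unfolding valid_def by auto
  have e: "enc (st w t) (take n (rds w t)) \<le> Max codes" for n
    by (rule codes_Max) (use r len_rds set_take_subset[of n "rds w t"] in auto)
  consider "k = 4" | "k = 5" "i < K" | "k = 0 \<or> k = 1 \<or> k = 2 \<or> k = 3" "i < K" | "5 < k" using o unfolding ok_def by linarith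
  then show ?thesis
  proof cases
    case 1
    then show ?thesis using e[of i] by (simp add: val_simps bound_def)
  next
    case 2
    have "fst (action (st w t) (rds w t) i) < G" by (rule valid_step(2)[OF v 2(2)])
    moreover have "dir_code d \<le> 2" for d by (cases d) simp_all
    then have "dir_code (snd (action (st w t) (rds w t) i)) \<le> 2" .
    ultimately have "act (enc (st w t) (rds w t)) i \<le> 3 * G" unfolding act_enc[OF v 2(2)] by linarith
    then show ?thesis using 2 by (simp add: val_simps bound_def)
  next
    case 3
    have "cl i t p < G" "rd w i t < G" "hd i t \<le> 2 * T"
      using cl_less[OF 3(2), of t] rd_cl[OF 3(2), of t] hd_bounds[OF 3(2), of t] o unfolding ok_def by auto
    then show ?thesis using 3 by (auto simp: val_simps bound_def)
  next
    case 4
    have "val k i t p \<le> 1" using 4 by (simp add: val_def)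
    then show ?thesis by (simp add: bound_def)
  qed
qed

lemma ok_less: "ok k i t p \<Longrightarrow> it k i t p < size T P"
  unfolding size_def less_Suc_eq_le by (rule item_mono) (use val_le KG in \<open>auto simp: ok_def bound_def\<close>)

text \<open>A rule produces its value in the form \<open>s\<close>; soundness identifies it with the
  true value, so completeness needs no second calculation.\<close>

lemma D_step:
  assumes "it k i t p \<in> D" "it k' i' t' p' \<in> D" "ok k i t p" "ok k' i' t' p'" "ok l i2 t2 p2"
    and "raw x T P (Suc (bound T P)) (it k i t p) (it k' i' t' p') (item l i2 t2 p2 s)"
  shows "it l i2 t2 p2 \<in> D"
proof -
  have "tr (item l i2 t2 p2 s)" by (rule raw_sound[OF assms(6)]) (simp_all add: tr_item)
  then have "item l i2 t2 p2 s = it l i2 t2 p2" by (simp add: tr_item)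
  then have "horn x T P (it k i t p) (it k' i' t' p') (it l i2 t2 p2)"
    using assms(3-6) ok_less unfolding horn_def' by metis
  then show ?thesis using assms(1,2) by (rule der.step)
qed

lemma val_less: "ok k i t p \<Longrightarrow> val k i t p < Suc (bound T P)"
  using val_le by (simp add: less_Suc_eq_le)

lemma complete_step:
  assumes t: "t < T" and q: "it 4 0 t 0 \<in> D" and hc: "\<And>i. i < K \<Longrightarrow> it 1 i t 0 \<in> D"
    and cc: "\<And>i p. i < K \<Longrightarrow> p < 2 * T + 1 \<Longrightarrow> it 0 i t p \<in> D" and tr6: "it 6 0 0 0 \<in> D"
  shows "it 4 0 (Suc t) 0 \<in> D \<and> (\<forall>i<K. it 1 i (Suc t) 0 \<in> D \<and> (\<forall>p<2 * T + 1. it 0 i (Suc t) p \<in> D))"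
proof -
  have ok: "ok k i t p" if "k \<le> 9" "i < K \<or> k = 4 \<and> i = K" "p \<le> 2 * T + 1" for k i p using that t by (simp add: ok_def)
  have okS: "ok k i (Suc t) p" if "k \<le> 9" "i < K" "p \<le> 2 * T + 1" for k i p using that t by (simp add: ok_def)
  have ok6: "ok 6 0 0 0" using KG by (simp add: ok_def)
  note vl = val_less[OF ok]
  have sel: "it 2 i t p \<in> D" if i: "i < K" "p < 2 * T + 1" for i p
  proof (rule D_step[OF hc[OF i(1)] cc[OF i] ok ok ok])
    show "raw x T P (Suc (bound T P)) (it 1 i t 0) (it 0 i t p) (item 2 i t p (if val 1 i t 0 = p then G + val 0 i t p else val 0 i t p))"
      unfolding raw_def
      by (rule disjI1, intro exI[of _ i] exI[of _ t] exI[of _ p] exI[of _ "val 1 i t 0"] exI[of _ "val 0 i t p"] conjI refl)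
        (use i t in \<open>auto intro!: vl\<close>)
  qed (use i in auto)
  \<comment> \<open>The scan for the symbol under the head starts at the left end and passes on what
    it has found.\<close>
  have rdd: "p \<le> 2 * T + 1 \<Longrightarrow> it 3 i t p \<in> D" if i: "i < K" for i p
  proof (induction p)
    case 0
    show ?case
    proof (rule D_step[OF tr6 tr6 ok6 ok6 ok])
      show "raw x T P (Suc (bound T P)) (it 6 0 0 0) (it 6 0 0 0) (item 3 i t 0 0)"
        unfolding raw_def val_simps using i t by blast
    qed (use i in auto)
  next
    case (Suc p)
    show ?case
    proof (rule D_step[OF sel[OF i] Suc.IH ok ok ok])
      show "raw x T P (Suc (bound T P)) (it 2 i t p) (it 3 i t p) (item 3 i t (Suc p) (if G \<le> val 2 i t p then val 2 i t p - G else val 3 i t p))"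
        unfolding raw_def
        by (rule disjI2, rule disjI1, intro exI[of _ i] exI[of _ t] exI[of _ p] exI[of _ "val 2 i t p"] exI[of _ "val 3 i t p"] conjI refl)
          (use i t Suc.prems in \<open>auto intro!: vl\<close>)
    qed (use i Suc.prems in auto)
  qed
  have cmb: "i \<le> K \<Longrightarrow> it 4 i t 0 \<in> D" for i
  proof (induction i)
    case 0
    show ?case by (rule q)
  next
    case (Suc i)
    then have i: "i < K" by simp
    show ?case
    proof (rule D_step[OF Suc.IH rdd[OF i order_refl] ok ok ok])
      show "raw x T P (Suc (bound T P)) (it 4 i t 0) (it 3 i t (2 * T + 1)) (item 4 (Suc i) t 0 (prod_encode (val 4 i t 0, val 3 i t (2 * T + 1))))"
        unfolding raw_def
        by (rule disjI2, rule disjI2, rule disjI1,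
            intro exI[of _ i] exI[of _ t] exI[of _ "val 4 i t 0"] exI[of _ "val 3 i t (2 * T + 1)"] conjI refl)
          (use i t in \<open>auto intro!: vl\<close>)
    qed (use i Suc.prems in auto)
  qed
  note cK = cmb[OF order_refl]
  have vK: "val 4 K t 0 < Suc (bound T P)" by (rule vl) auto
  have actD: "it 5 i t 0 \<in> D" if i: "i < K" for i
  proof (rule D_step[OF cK cK ok ok ok])
    show "raw x T P (Suc (bound T P)) (it 4 K t 0) (it 4 K t 0) (item 5 i t 0 (act (val 4 K t 0) i))"
      unfolding raw_def
      by (rule disjI2, rule disjI2, rule disjI2, rule disjI1, intro exI[of _ i] exI[of _ t] exI[of _ "val 4 K t 0"] conjI refl i t vK)
  qed (use i in auto)
  have "it 4 0 (Suc t) 0 \<in> D"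
  proof (rule D_step[OF cK cK ok ok okS])
    show "raw x T P (Suc (bound T P)) (it 4 K t 0) (it 4 K t 0) (item 4 0 (Suc t) 0 (nst (val 4 K t 0) 0))"
      unfolding raw_def
      by (rule disjI2, rule disjI2, rule disjI2, rule disjI2, rule disjI1, intro exI[of _ t] exI[of _ "val 4 K t 0"] conjI refl t vK)
  qed (use KG in auto)
  moreover have "it 1 i (Suc t) 0 \<in> D" if i: "i < K" for i
  proof (rule D_step[OF actD[OF i] hc[OF i] ok ok okS])
    show "raw x T P (Suc (bound T P)) (it 5 i t 0) (it 1 i t 0) (item 1 i (Suc t) 0 (val 1 i t 0 + val 5 i t 0 mod 3 - 1))"
      unfolding raw_def
      by (rule disjI2, rule disjI2, rule disjI2, rule disjI2, rule disjI2, rule disjI1,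
          intro exI[of _ i] exI[of _ t] exI[of _ "val 5 i t 0"] exI[of _ "val 1 i t 0"] conjI refl)
        (use i t in \<open>auto intro!: vl\<close>)
  qed (use i in auto)
  moreover have "it 0 i (Suc t) p \<in> D" if i: "i < K" "p < 2 * T + 1" for i p
  proof (rule D_step[OF actD[OF i(1)] sel[OF i] ok ok okS])
    show "raw x T P (Suc (bound T P)) (it 5 i t 0) (it 2 i t p) (item 0 i (Suc t) p (if G \<le> val 2 i t p then val 5 i t 0 div 3 else val 2 i t p))"
      unfolding raw_def
      by (rule disjI2, rule disjI2, rule disjI2, rule disjI2, rule disjI2, rule disjI2, rule disjI1,
          intro exI[of _ i] exI[of _ t] exI[of _ p] exI[of _ "val 5 i t 0"] exI[of _ "val 2 i t p"] conjI refl)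
        (use i t in \<open>auto intro!: vl\<close>)
  qed (use i in auto)
  ultimately show ?thesis by blast
qed

lemma guess_D: "p < 2 * P + 1 \<Longrightarrow> it 8 0 0 p \<in> D"
  by (rule der.given) (auto simp: guess_def val_simps)

lemma tr_D: "it 6 0 0 0 \<in> D"
proof (rule D_step[OF guess_D guess_D])
  show "raw x T P (Suc (bound T P)) (it 8 0 0 0) (it 8 0 0 0) (item 6 0 0 0 0)"
    unfolding raw_def val_simps by (cases "c 0") simp_all
qed (use KG in \<open>auto simp: ok_def\<close>)

lemma ok6: "ok 6 0 0 0"
  using KG by (simp add: ok_def)

lemma cert_D: "j \<le> P \<Longrightarrow> it 7 0 0 j \<in> D"
proof (induction j)
  case 0
  show ?case
  proof (rule D_step[OF tr_D tr_D ok6 ok6])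
    show "raw x T P (Suc (bound T P)) (it 6 0 0 0) (it 6 0 0 0) (item 7 0 0 0 1)"
      unfolding raw_def val_simps by blast
  qed (use KG in \<open>auto simp: ok_def\<close>)
next
  case (Suc j)
  have two: "val 7 0 0 j < 2" "val 8 0 0 (2 * j + 1) < 2" by (simp_all add: val_simps of_bool_def)
  show ?case
  proof (rule D_step[OF Suc.IH guess_D])
    show "raw x T P (Suc (bound T P)) (it 7 0 0 j) (it 8 0 0 (2 * j + 1)) (item 7 0 0 (Suc j) (val 7 0 0 j * val 8 0 0 (2 * j + 1)))"
      unfolding raw_def using two Suc.prems by simp
  qed (use KG Suc.prems in \<open>auto simp: ok_def\<close>)
qed

lemma init_D:
  assumes i: "i < K" and p: "p < 2 * T + 1"
  shows "it 0 i 0 p \<in> D"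
proof (cases "i = 0 \<and> T + 2 * length x + 2 \<le> p \<and> p < T + 2 * length x + 2 + P")
  case False
  show ?thesis
  proof (rule D_step[OF tr_D tr_D ok6 ok6])
    show "raw x T P (Suc (bound T P)) (it 6 0 0 0) (it 6 0 0 0) (item 0 i 0 p (pre x T i p))"
      unfolding raw_def val_simps using i p False by blast
  qed (use i p in \<open>auto simp: ok_def\<close>)
next
  case True
  define j where "j = p - (T + 2 * length x + 2)"
  have pj: "p = T + 2 * length x + 2 + j" "j < P" using True unfolding j_def by auto
  have two: "val 7 0 0 (Suc j) < 2" "val 8 0 0 (2 * j + 2) < 2" by (simp_all add: val_simps of_bool_def)
  have "it 0 0 0 (T + 2 * length x + 2 + j) \<in> D"
  proof (rule D_step[OF cert_D guess_D])
    show "raw x T P (Suc (bound T P)) (it 7 0 0 (Suc j)) (it 8 0 0 (2 * j + 2))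
        (item 0 0 0 (T + 2 * length x + 2 + j) (if val 7 0 0 (Suc j) = 0 then 0 else Suc (val 8 0 0 (2 * j + 2))))"
      unfolding raw_def using two pj(2) by simp
  qed (use KG pj p in \<open>auto simp: ok_def\<close>)
  then show ?thesis using pj True by simp
qed

lemma complete: "t \<le> T \<Longrightarrow> it 4 0 t 0 \<in> D \<and> (\<forall>i<K. it 1 i t 0 \<in> D \<and> (\<forall>p<2 * T + 1. it 0 i t p \<in> D))"
proof (induction t)
  case 0
  have "it 4 0 0 0 \<in> D"
  proof (rule D_step[OF tr_D tr_D ok6 ok6])
    show "raw x T P (Suc (bound T P)) (it 6 0 0 0) (it 6 0 0 0) (item 4 0 0 0 0)"
      unfolding raw_def val_simps by blast
  qed (use KG in \<open>auto simp: ok_def\<close>)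
  moreover have "it 1 i 0 0 \<in> D" if "i < K" for i
  proof (rule D_step[OF tr_D tr_D ok6 ok6])
    show "raw x T P (Suc (bound T P)) (it 6 0 0 0) (it 6 0 0 0) (item 1 i 0 0 T)"
      unfolding raw_def val_simps using that by blast
  qed (use that in \<open>auto simp: ok_def\<close>)
  ultimately show ?case using init_D by blast
next
  case (Suc t)
  then have ih: "it 4 0 t 0 \<in> D \<and> (\<forall>i<K. it 1 i t 0 \<in> D \<and> (\<forall>p<2 * T + 1. it 0 i t p \<in> D))" by simp
  show ?case by (rule complete_step) (use ih Suc.prems tr_D in auto)
qed

lemma accepting_iff:
  assumes "tm_computes_within M w [b] T"
  shows "item 9 0 0 0 1 \<in> D \<longleftrightarrow> b"
proof -
  have cl: "cl (K - 1) T T = 2 \<longleftrightarrow> b" using run_accepts[OF assms] by (simp add: cl_def)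
  show ?thesis
  proof
    assume "item 9 0 0 0 1 \<in> D"
    then have "tr (item 9 0 0 0 1)" by (rule sound)
    then have v: "1 = val 9 0 0 0" by (simp only: tr_item)
    have "cl (K - 1) T T = 2"
    proof (rule ccontr)
      assume "cl (K - 1) T T \<noteq> 2"
      then show False using v unfolding val_simps(10) by simp
    qed
    then show b by (rule cl[THEN iffD1])
  next
    assume b
    have h: "it 0 (K - 1) T T \<in> D" using complete[OF order_refl] KG(1) by simp
    have "it 9 0 0 0 \<in> D"
    proof (rule D_step[OF h h])
      show "raw x T P (Suc (bound T P)) (it 0 (K - 1) T T) (it 0 (K - 1) T T) (item 9 0 0 0 1)"
      proof -
        have "val 0 (K - 1) T T = 2" unfolding val_simps(1) by (rule cl[THEN iffD2, OF \<open>b\<close>])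
        then show ?thesis unfolding raw_def by simp
      qed
    qed (use KG in \<open>auto simp: ok_def\<close>)
    moreover have "val 9 0 0 0 = 1" unfolding val_simps(10) using cl[THEN iffD2, OF \<open>b\<close>] by simp
    ultimately show "item 9 0 0 0 1 \<in> D" by simp
  qed
qed

end

lemma NP_guess_system:
  assumes "A \<in> class_NP"
  obtains N m :: "word \<Rightarrow> nat" and base :: "word \<Rightarrow> nat \<Rightarrow> nat \<Rightarrow> nat \<Rightarrow> bool" and U acc
  where "\<And>x. guess_system (N x) (base x) U acc (m x)"
    "definable (\<lambda>w \<sigma>. N w)" "definable (\<lambda>w \<sigma>. m w)" "definable_pred (\<lambda>w \<sigma>. base w (\<sigma> 0) (\<sigma> 1) (\<sigma> 2))"
    "definable (\<lambda>w \<sigma>. U (\<sigma> 0) True)" "definable (\<lambda>w \<sigma>. U (\<sigma> 0) False)"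
    "\<And>x. x \<in> A \<longleftrightarrow> (\<exists>c. acc \<in> der (base x) ((\<lambda>i. U i (c i)) ` {..<m x}))"
proof -
  obtain R p where R: "R \<in> class_P" and A: "\<And>x. x \<in> A \<longleftrightarrow> (\<exists>u. length u \<le> poly p (length x) \<and> pair_word x u \<in> R)"
    using assms unfolding class_NP_def mem_Collect_eq by (elim bexE exE) (rule that, assumption, erule spec)
  obtain M r where M: "wf_tm M" "\<And>w. tm_computes_within M w [w \<in> R] (poly r (length w))"
    using R unfolding class_P_def poly_time_def mem_Collect_eq by (elim exE conjE) (rule that, assumption, erule spec)
  interpret machine M by unfold_locales (rule M(1))
  define P where "P x = poly p (length x)" for x :: word
  \<comment> \<open>The second summand makes room: the input starts at position \<open>T\<close> and
    must end within the positions up to \<open>2 * T\<close>.\<close>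
  define T where "T x = poly r (2 * length x + 2 + P x) + (2 * length x + 2 + P x)" for x
  have dP: "definable (\<lambda>w \<sigma>. P w)" unfolding P_def by (intro dintros)
  have dT: "definable (\<lambda>w \<sigma>. T w)" unfolding T_def by (intro dintros dP)
  have run: "pair_word x u \<in> R \<longleftrightarrow> item 9 0 0 0 1 \<in> der (horn x (T x) (P x)) ((\<lambda>i. guess i (c i)) ` {..<2 * P x + 1})"
    if "length u \<le> P x" "\<And>j. j < P x \<Longrightarrow> (j < length u \<longleftrightarrow> (\<forall>j'\<le>j. c (2 * j' + 1))) \<and> (j < length u \<longrightarrow> u ! j = c (2 * j + 2))" for x u c
  proof -
    interpret run M x u "T x" "P x" c by unfold_locales (use that in \<open>auto simp: T_def\<close>)
    have "poly r (length (pair_word x u)) \<le> T x"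
      unfolding pair_word_bits(6) T_def using poly_nat_mono[of "2 * length x + 2 + length u" "2 * length x + 2 + P x" r] that(1) by simp
    then have "tm_computes_within M (pair_word x u) [pair_word x u \<in> R] (T x)"
      using M(2)[of "pair_word x u"] unfolding tm_computes_within_def by (meson order_trans)
    then show ?thesis by (rule accepting_iff[symmetric])
  qed
  have iff: "x \<in> A \<longleftrightarrow> (\<exists>c. item 9 0 0 0 1 \<in> der (horn x (T x) (P x)) ((\<lambda>i. guess i (c i)) ` {..<2 * P x + 1}))" for x
  proof
    assume "x \<in> A"
    then obtain u where u: "length u \<le> P x" "pair_word x u \<in> R" unfolding A P_def by blast
    \<comment> \<open>Guess 0 falls into the even case by truncated subtraction; its value is
      arbitrary.\<close>
    define c where "c i = (if odd i then (i - 1) div 2 < length u else u ! ((i - 2) div 2))" for i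
    have c: "c (2 * j + 1) = (j < length u)" "c (2 * j + 2) = u ! j" for j by (simp_all add: c_def)
    have "item 9 0 0 0 1 \<in> der (horn x (T x) (P x)) ((\<lambda>i. guess i (c i)) ` {..<2 * P x + 1})"
      by (subst run[of u, symmetric]) (use u c in \<open>auto intro: le_less_trans\<close>)
    then show "\<exists>c. item 9 0 0 0 1 \<in> der (horn x (T x) (P x)) ((\<lambda>i. guess i (c i)) ` {..<2 * P x + 1})" by blast
  next
    assume "\<exists>c. item 9 0 0 0 1 \<in> der (horn x (T x) (P x)) ((\<lambda>i. guess i (c i)) ` {..<2 * P x + 1})"
    then obtain c where c: "item 9 0 0 0 1 \<in> der (horn x (T x) (P x)) ((\<lambda>i. guess i (c i)) ` {..<2 * P x + 1})" by blast
    \<comment> \<open>The initial run of true odd guesses determines the length of the certificate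
      to be read off.\<close>
    define n where "n = length (takeWhile (\<lambda>j. c (2 * j + 1)) [0..<P x])"
    have nP: "n \<le> P x" unfolding n_def using length_takeWhile_le[of "\<lambda>j. c (2 * j + 1)" "[0..<P x]"] by simp
    have n: "j < n \<longleftrightarrow> (\<forall>j'\<le>j. c (2 * j' + 1))" if "j < P x" for j
    proof
      assume j: "j < n"
      show "\<forall>j'\<le>j. c (2 * j' + 1)"
      proof (intro allI impI)
        fix j' assume "j' \<le> j"
        then have j': "j' < length (takeWhile (\<lambda>j. c (2 * j + 1)) [0..<P x])" using j n_def by simp
        then have "takeWhile (\<lambda>j. c (2 * j + 1)) [0..<P x] ! j' = j'" using nP n_def by (simp add: takeWhile_nth)
        then show "c (2 * j' + 1)" using nth_mem[OF j'] set_takeWhileD by metis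
      qed
    next
      assume a: "\<forall>j'\<le>j. c (2 * j' + 1)"
      show "j < n"
      proof (rule ccontr)
        assume "\<not> j < n"
        then have "n < length [0..<P x]" "c (2 * n + 1)" using that a by auto
        then show False using nth_length_takeWhile[of "\<lambda>j. c (2 * j + 1)" "[0..<P x]"] unfolding n_def[symmetric] by simp
      qed
    qed
    have "pair_word x (map (\<lambda>j. c (2 * j + 2)) [0..<n]) \<in> R"
      by (subst run[where c = c]) (use nP n c in auto)
    then show "x \<in> A" unfolding A using nP by (intro exI[of _ "map (\<lambda>j. c (2 * j + 2)) [0..<n]"]) (simp add: P_def)
  qed
  show thesis
  proof (rule that[of "\<lambda>x. size (T x) (P x)" "\<lambda>x. horn x (T x) (P x)" guess "item 9 0 0 0 1" "\<lambda>x. 2 * P x + 1"])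
    show "definable (\<lambda>w \<sigma>. guess (\<sigma> 0) True)" "definable (\<lambda>w \<sigma>. guess (\<sigma> 0) False)"
      unfolding guess_def by (intro dintros)+
    show "definable (\<lambda>w \<sigma>. 2 * P w + 1)" by (intro dintros dP)
  qed (rule horn_guess_system definable_horn[OF dT dP] iff)+
qed

section \<open>Enumerating the faces\<close>

lemma length_filter_count: "length (filter Q [0..<n]) = (\<Sum>k<n. of_bool (Q k))"
  by (induction n) simp_all

lemma filter_nth_count:
  assumes "n < V" "Q n"
  shows "(\<Sum>k<n. of_bool (Q k)) < length (filter Q [0..<V]) \<and> filter Q [0..<V] ! (\<Sum>k<n. of_bool (Q k)) = n"
proof -
  have "[0..<V] = [0..<n] @ [n..<V]" using upt_add_eq_append[of 0 n "V - n"] assms(1) by simp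
  also have "[n..<V] = n # [Suc n..<V]" using assms(1) by (rule upt_conv_Cons)
  finally have "filter Q [0..<V] = filter Q [0..<n] @ n # filter Q [Suc n..<V]" using assms(2) by simp
  then show ?thesis unfolding length_filter_count[symmetric] by simp
qed

definition code3 :: "nat \<Rightarrow> nat \<Rightarrow> nat \<Rightarrow> nat" where "code3 a b c = prod_encode (a, prod_encode (b, c))"

definition set3 :: "nat \<Rightarrow> nat set" where
  "set3 n = {fst (prod_decode n), fst (prod_decode (snd (prod_decode n))), snd (prod_decode (snd (prod_decode n)))}"

lemma set3_code [simp]: "set3 (code3 a b c) = {a, b, c}"
  by (simp add: set3_def code3_def)

lemma code3_eq [simp]: "code3 a b c = code3 a' b' c' \<longleftrightarrow> a = a' \<and> b = b' \<and> c = c'"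
  by (simp add: code3_def)

lemma code3_ge: "a < Suc (code3 a b c)" "b < Suc (code3 a b c)" "c < Suc (code3 a b c)"
  unfolding code3_def less_Suc_eq_le
  using le_prod_encode_1[of a "prod_encode (b, c)"] le_prod_encode_2[of "prod_encode (b, c)" a]
    le_prod_encode_1[of b c] le_prod_encode_2[of c b] by linarith+

text \<open>A face with fewer than three vertices repeats its smallest one, so that every face has
  exactly one sorted triple.\<close>

definition shape :: "nat \<Rightarrow> nat \<Rightarrow> nat \<Rightarrow> nat \<Rightarrow> bool" where
  "shape k a b c \<longleftrightarrow> k = 1 \<and> a = b \<and> b = c \<or> k = 2 \<and> a = b \<and> b < c \<or> k = 3 \<and> a < b \<and> b < c"

lemma shape_card: "shape k a b c \<Longrightarrow> card {a, b, c} = k"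
  by (auto simp: shape_def)

lemma shape_inj:
  assumes "shape k a b c" "shape k' a' b' c'" "{a, b, c} = {a', b', c'}"
  shows "a = a' \<and> b = b' \<and> c = c'"
proof -
  have k: "k = k'" using shape_card[OF assms(1)] shape_card[OF assms(2)] assms(3) by simp
  have o: "a \<le> b" "b \<le> c" "a' \<le> b'" "b' \<le> c'" using assms(1,2) by (auto simp: shape_def)
  have m: "a \<in> {a', b', c'}" "a' \<in> {a, b, c}" "c \<in> {a', b', c'}" "c' \<in> {a, b, c}" "b \<in> {a', b', c'}" using assms(3) by blast+
  have "a = a'" "c = c'" using m(1-4) o by auto
  moreover have "b = b'"
  proof (cases "k = 3")
    case True
    then have "a < b" "b < c" using assms(1) by (auto simp: shape_def)
    then show ?thesis using m(5) calculation by auto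
  next
    case False
    then have "a = b" "a' = b'" using assms(1,2) k by (auto simp: shape_def)
    then show ?thesis using calculation by simp
  qed
  ultimately show ?thesis by blast
qed

lemma shape_ex:
  fixes F :: "nat set"
  assumes "card F = k" "k = 1 \<or> k = 2 \<or> k = 3"
  shows "\<exists>a b c. shape k a b c \<and> F = {a, b, c}"
  using assms(2)
proof (elim disjE)
  assume k: "k = 1"
  then obtain a where "F = {a}" using assms(1) card_1_singletonE by metis
  then show ?thesis using k by (intro exI[of _ a]) (simp add: shape_def)
next
  assume k: "k = 2"
  then obtain a b where F: "F = {a, b}" "a \<noteq> b" using assms(1) by (auto simp: card_2_iff)
  then consider "a < b" | "b < a" by linarith
  then show ?thesis
  proof cases
    case 1
    then show ?thesis using k F by (intro exI[of _ a] exI[of _ a] exI[of _ b]) (simp add: shape_def)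
  next
    case 2
    then show ?thesis using k F by (intro exI[of _ b] exI[of _ b] exI[of _ a]) (auto simp: shape_def)
  qed
next
  assume k: "k = 3"
  then obtain a b c where F: "F = {a, b, c}" "a \<noteq> b" "b \<noteq> c" "a \<noteq> c" using assms(1) by (auto simp: card_3_iff)
  have "finite F" using F by simp
  define x z where "x = Min F" and "z = Max F"
  have xz: "x \<in> F" "z \<in> F" "\<And>e. e \<in> F \<Longrightarrow> x \<le> e \<and> e \<le> z" using \<open>finite F\<close> F(1) by (auto simp: x_def z_def)
  have "x < z" using xz(3)[of a] xz(3)[of b] F by auto
  then have "card (F - {x, z}) = 1" using assms(1) k xz \<open>finite F\<close> by (simp add: card_Diff_subset)
  then obtain y where y: "F - {x, z} = {y}" using card_1_singletonE by metis
  then have yF: "y \<in> F" "y \<noteq> x" "y \<noteq> z" by blast+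
  then have "x < y" "y < z" using xz(3)[of y] by auto
  moreover have "F = {x, y, z}" using y xz by blast
  ultimately show ?thesis using k by (intro exI[of _ x] exI[of _ y] exI[of _ z]) (simp add: shape_def)
qed

definition sub3 :: "nat \<Rightarrow> nat \<Rightarrow> nat \<Rightarrow> nat \<Rightarrow> nat \<Rightarrow> nat \<Rightarrow> bool" where
  "sub3 a b c p q r \<longleftrightarrow> (a = p \<or> a = q \<or> a = r) \<and> (b = p \<or> b = q \<or> b = r) \<and> (c = p \<or> c = q \<or> c = r)"

lemma sub3_iff: "sub3 a b c p q r \<longleftrightarrow> {a, b, c} \<subseteq> {p, q, r}"
  by (auto simp: sub3_def)

lemma vx_mono: "i \<le> i' \<Longrightarrow> y \<le> y' \<Longrightarrow> j \<le> j' \<Longrightarrow> vx i y j \<le> vx i' y' j'"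
  unfolding vx_def by (intro prod_encode_mono)

context layout
begin

text \<open>The walls again, without their labels: an arithmetical condition instead of an option of
  a datatype.\<close>

definition present :: "nat \<Rightarrow> nat \<Rightarrow> nat \<Rightarrow> nat \<Rightarrow> bool" where
  "present r v l k \<longleftrightarrow> v < 3 * N \<and> (if k = 1 then xt r v \<and> l = 1 \<or> yt r v \<and> l = 0
     else if k = 2 then tube_at r v l else if k = 3 then thru r v \<and> (l = 1 \<or> l = 0 \<and> \<not> md r v) else l \<noteq> 2)"

definition sqF :: "nat \<Rightarrow> nat \<Rightarrow> nat \<Rightarrow> bool" where
  "sqF i y j \<longleftrightarrow> y div 3 < 3 * N \<and> rho i j < 4 \<and> yk (i div 7) (y div 3) (y mod 3) \<le> rho i j"
definition sqX :: "nat \<Rightarrow> nat \<Rightarrow> nat \<Rightarrow> bool" where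
  "sqX i y j \<longleftrightarrow> rho (i - 1) j \<noteq> rho i j \<and>
     present (i div 7) (y div 3) (y mod 3) (if rho (i - 1) j \<le> rho i j then rho i j else rho (i - 1) j)"
definition sqZ :: "nat \<Rightarrow> nat \<Rightarrow> nat \<Rightarrow> bool" where
  "sqZ i y j \<longleftrightarrow> rho i (j - 1) \<noteq> rho i j \<and>
     present (i div 7) (y div 3) (y mod 3) (if rho i (j - 1) \<le> rho i j then rho i j else rho i (j - 1))"

lemma wall_present: "wall r v l k \<noteq> None \<longleftrightarrow> present r v l k"
  by (auto simp: wall_def present_def)

lemma in_squares:
  "Face i y j \<in> squares \<longleftrightarrow> sqF i y j" "Xw i y j \<in> squares \<longleftrightarrow> sqX i y j" "Zw i y j \<in> squares \<longleftrightarrow> sqZ i y j"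
proof -
  show "Face i y j \<in> squares \<longleftrightarrow> sqF i y j" by (simp add: squares_def sqF_def face_def)
  show "Xw i y j \<in> squares \<longleftrightarrow> sqX i y j"
    unfolding squares_def mem_Collect_eq sqX_def wall_present[symmetric] label.simps max_def by simp
  show "Zw i y j \<in> squares \<longleftrightarrow> sqZ i y j"
    unfolding squares_def mem_Collect_eq sqZ_def wall_present[symmetric] label.simps max_def by simp
qed

definition mem :: "nat \<Rightarrow> nat \<Rightarrow> nat \<Rightarrow> bool" where
  "mem a b c \<longleftrightarrow> (\<exists>i<7 * ncols + 8. \<exists>y<9 * N. \<exists>j<15.
     sqF i y j \<and> (sub3 a b c (vx i y j) (vx (Suc i) y j) (vx (Suc i) y (Suc j)) \<or> sub3 a b c (vx i y j) (vx i y (Suc j)) (vx (Suc i) y (Suc j))) \<or>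
     sqX i y j \<and> (sub3 a b c (vx i y j) (vx i (Suc y) j) (vx i (Suc y) (Suc j)) \<or> sub3 a b c (vx i y j) (vx i y (Suc j)) (vx i (Suc y) (Suc j))) \<or>
     sqZ i y j \<and> (sub3 a b c (vx i y j) (vx (Suc i) y j) (vx (Suc i) (Suc y) j) \<or> sub3 a b c (vx i y j) (vx i (Suc y) j) (vx (Suc i) (Suc y) j)))"

definition vmax :: nat where "vmax = vx (7 * ncols + 8) (9 * N) 15"

lemma tri_vmax: "q \<in> squares \<Longrightarrow> v \<in> tri q b \<Longrightarrow> v \<le> vmax"
proof (cases q)
  case (Face i y j)
  assume "q \<in> squares" "v \<in> tri q b"
  then have "i < 7 * ncols + 8 \<and> y < 9 * N \<and> j < 15" using squares_bound(1) Face by blast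
  then show ?thesis using \<open>v \<in> tri q b\<close> unfolding vmax_def Face by (auto intro!: vx_mono split: if_splits)
next
  case (Xw i y j)
  assume "q \<in> squares" "v \<in> tri q b"
  then have "i < 7 * ncols + 8 \<and> y < 9 * N \<and> j < 15" using squares_bound(2) Xw by blast
  then show ?thesis using \<open>v \<in> tri q b\<close> unfolding vmax_def Xw by (auto intro!: vx_mono split: if_splits)
next
  case (Zw i y j)
  assume "q \<in> squares" "v \<in> tri q b"
  then have "i < 7 * ncols + 8 \<and> y < 9 * N \<and> j < 15" using squares_bound(3) Zw by blast
  then show ?thesis using \<open>v \<in> tri q b\<close> unfolding vmax_def Zw by (auto intro!: vx_mono split: if_splits)
qed

lemma mem_iff: "mem a b c \<longleftrightarrow> {a, b, c} \<in> complex_of (tris squares)"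
proof
  assume "mem a b c"
  then obtain i y j where h: "sqF i y j \<and> ({a, b, c} \<subseteq> tri (Face i y j) True \<or> {a, b, c} \<subseteq> tri (Face i y j) False) \<or>
    sqX i y j \<and> ({a, b, c} \<subseteq> tri (Xw i y j) True \<or> {a, b, c} \<subseteq> tri (Xw i y j) False) \<or>
    sqZ i y j \<and> ({a, b, c} \<subseteq> tri (Zw i y j) True \<or> {a, b, c} \<subseteq> tri (Zw i y j) False)"
    unfolding mem_def sub3_iff tri.simps if_True if_False
    by (elim exE conjE) (rule that, unfold tri.simps if_True if_False, assumption)
  then obtain q bb where "q \<in> squares" "{a, b, c} \<subseteq> tri q bb" unfolding in_squares[symmetric] by (elim disjE conjE) (rule that, assumption, assumption)+
  then show "{a, b, c} \<in> complex_of (tris squares)" unfolding complex_of_def tris_def by blast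
next
  assume "{a, b, c} \<in> complex_of (tris squares)"
  then obtain q bb where q: "q \<in> squares" "{a, b, c} \<subseteq> tri q bb" unfolding complex_of_def tris_def by blast
  show "mem a b c"
  proof (cases q)
    case (Face i y j)
    have "i < 7 * ncols + 8" "y < 9 * N" "j < 15" using squares_bound(1) q(1) Face by blast+
    moreover have "sqF i y j" using q(1) Face in_squares(1) by simp
    moreover have "{a, b, c} \<subseteq> tri (Face i y j) True \<or> {a, b, c} \<subseteq> tri (Face i y j) False" using q(2) Face by (cases bb) simp_all
    ultimately show ?thesis unfolding mem_def sub3_iff tri.simps if_True if_False
      by - (rule exI[of _ i], rule conjI, assumption, rule exI[of _ y], rule conjI, assumption,
          rule exI[of _ j], rule conjI, assumption, rule disjI1, rule conjI)
  next
    case (Xw i y j)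
    have "i < 7 * ncols + 8" "y < 9 * N" "j < 15" using squares_bound(2) q(1) Xw by blast+
    moreover have "sqX i y j" using q(1) Xw in_squares(2) by simp
    moreover have "{a, b, c} \<subseteq> tri (Xw i y j) True \<or> {a, b, c} \<subseteq> tri (Xw i y j) False" using q(2) Xw by (cases bb) simp_all
    ultimately show ?thesis unfolding mem_def sub3_iff tri.simps if_True if_False
      by - (rule exI[of _ i], rule conjI, assumption, rule exI[of _ y], rule conjI, assumption,
          rule exI[of _ j], rule conjI, assumption, rule disjI2, rule disjI1, rule conjI)
  next
    case (Zw i y j)
    have "i < 7 * ncols + 8" "y < 9 * N" "j < 15" using squares_bound(3) q(1) Zw by blast+
    moreover have "sqZ i y j" using q(1) Zw in_squares(3) by simp
    moreover have "{a, b, c} \<subseteq> tri (Zw i y j) True \<or> {a, b, c} \<subseteq> tri (Zw i y j) False" using q(2) Zw by (cases bb) simp_all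
    ultimately show ?thesis unfolding mem_def sub3_iff tri.simps if_True if_False
      by - (rule exI[of _ i], rule conjI, assumption, rule exI[of _ y], rule conjI, assumption,
          rule exI[of _ j], rule conjI, assumption, rule disjI2, rule disjI2, rule conjI)
  qed
qed

definition isf :: "nat \<Rightarrow> nat \<Rightarrow> bool" where
  "isf k n \<longleftrightarrow> (\<exists>a<Suc n. \<exists>b<Suc n. \<exists>c<Suc n. n = code3 a b c \<and> shape k a b c \<and> mem a b c)"

definition nmax :: nat where "nmax = Suc (code3 vmax vmax vmax)"

lemma isfE:
  assumes "isf k n"
  obtains a b c where "n = code3 a b c" "shape k a b c" "{a, b, c} \<in> complex_of (tris squares)"
  using assms unfolding isf_def mem_iff by (elim exE conjE) (rule that)

lemma isf_code: "shape k a b c \<Longrightarrow> {a, b, c} \<in> complex_of (tris squares) \<Longrightarrow> isf k (code3 a b c)"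
  unfolding isf_def mem_iff by (intro exI[of _ a] exI[of _ b] exI[of _ c] conjI code3_ge refl)

lemma isf_less: "isf k n \<Longrightarrow> n < nmax"
proof (erule isfE)
  fix a b c assume n: "n = code3 a b c" and m: "{a, b, c} \<in> complex_of (tris squares)"
  obtain q bb where "q \<in> squares" "{a, b, c} \<subseteq> tri q bb" using m unfolding complex_of_def tris_def by blast
  then have "a \<le> vmax" "b \<le> vmax" "c \<le> vmax" using tri_vmax[of q _ bb] by blast+
  then show "n < nmax" unfolding n nmax_def less_Suc_eq_le code3_def by (intro prod_encode_mono)
qed

lemma isf_inj: "isf k n \<Longrightarrow> isf k' n' \<Longrightarrow> set3 n = set3 n' \<Longrightarrow> n = n'"
proof (erule isfE, erule isfE)
  fix a b c a' b' c'
  assume h: "set3 n = set3 n'" "n = code3 a b c" "shape k a b c" "n' = code3 a' b' c'" "shape k' a' b' c'"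
  then have "{a, b, c} = {a', b', c'}" by simp
  then show "n = n'" using shape_inj[OF h(3,5)] h(2,4) by simp
qed

lemma isf_bij: "k = 1 \<or> k = 2 \<or> k = 3 \<Longrightarrow> bij_betw set3 {n. isf k n} (skel k (tris squares))"
proof (rule bij_betwI')
  assume k: "k = 1 \<or> k = 2 \<or> k = 3"
  show "set3 n = set3 n' \<longleftrightarrow> n = n'" if "n \<in> {n. isf k n}" "n' \<in> {n. isf k n}" for n n'
    using that isf_inj by blast
  show "set3 n \<in> skel k (tris squares)" if "n \<in> {n. isf k n}" for n
  proof -
    have "isf k n" using that by simp
    then show ?thesis by (rule isfE) (simp add: skel_def shape_card)
  qed
  show "\<exists>n\<in>{n. isf k n}. F = set3 n" if F: "F \<in> skel k (tris squares)" for F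
  proof -
    have F: "F \<in> complex_of (tris squares)" "card F = k" using F unfolding skel_def by auto
    obtain a b c where s: "shape k a b c" "F = {a, b, c}" using shape_ex[OF F(2) k] by blast
    then have "isf k (code3 a b c)" using isf_code F(1) by blast
    then show ?thesis using s(2) by (intro bexI[of _ "code3 a b c"]) simp_all
  qed
qed

lemma card_skel: "k = 1 \<or> k = 2 \<or> k = 3 \<Longrightarrow> card (skel k (tris squares)) = (\<Sum>n<nmax. of_bool (isf k n))"
proof -
  assume k: "k = 1 \<or> k = 2 \<or> k = 3"
  have "(\<Sum>n<nmax. of_bool (isf k n)) = card ({..<nmax} \<inter> {n. isf k n})" by (simp add: of_bool_def sum.If_cases)
  also have "{..<nmax} \<inter> {n. isf k n} = {n. isf k n}" using isf_less by blast
  finally show ?thesis using bij_betw_same_card[OF isf_bij[OF k]] by simp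
qed

definition any :: "nat \<Rightarrow> bool" where "any n \<longleftrightarrow> isf 1 n \<or> isf 2 n \<or> isf 3 n"

definition faces :: "nat set list" where "faces = map set3 (filter any [0..<nmax])"

lemma any_isf: "any n \<Longrightarrow> \<exists>k. isf k n"
  unfolding any_def by blast

lemma set_faces: "set faces = complex_of (tris squares)"
proof -
  have "complex_of (tris squares) = skel 1 (tris squares) \<union> skel 2 (tris squares) \<union> skel 3 (tris squares)"
    using card_face unfolding skel_def by blast
  also have "\<dots> = set3 ` {n. isf 1 n} \<union> set3 ` {n. isf 2 n} \<union> set3 ` {n. isf 3 n}"
    using isf_bij[of 1] isf_bij[of 2] isf_bij[of 3] unfolding bij_betw_def by simp
  also have "\<dots> = set3 ` {n. any n}" unfolding any_def by blast
  also have "{n. any n} = {n. n < nmax \<and> any n}" using isf_less any_isf by blast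
  finally show ?thesis unfolding faces_def by auto
qed

lemma distinct_faces: "distinct faces"
  unfolding faces_def distinct_map
  using isf_inj any_isf by (auto intro!: inj_onI) blast

lemma length_faces: "length faces = (\<Sum>n<nmax. of_bool (any n))"
  unfolding faces_def length_map by (rule length_filter_count)

text \<open>Decoding a pair is replaced by a search: the components of a code are never larger than
  the code.\<close>

definition sub :: "nat \<Rightarrow> nat \<Rightarrow> bool" where
  "sub n n' \<longleftrightarrow> (\<exists>a<Suc n. \<exists>b<Suc n. \<exists>c<Suc n. \<exists>a'<Suc n'. \<exists>b'<Suc n'. \<exists>c'<Suc n'.
     n = code3 a b c \<and> n' = code3 a' b' c' \<and> sub3 a b c a' b' c')"

lemma sub_iff: "isf k n \<Longrightarrow> isf k' n' \<Longrightarrow> sub n n' \<longleftrightarrow> set3 n \<subseteq> set3 n'"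
proof (erule isfE, erule isfE)
  fix a b c a' b' c' assume h: "n = code3 a b c" "n' = code3 a' b' c'"
  show "sub n n' \<longleftrightarrow> set3 n \<subseteq> set3 n'"
  proof
    assume "sub n n'"
    then have "sub3 a b c a' b' c'" unfolding sub_def h code3_eq by (elim exE conjE) simp
    then show "set3 n \<subseteq> set3 n'" unfolding h set3_code sub3_iff .
  next
    assume "set3 n \<subseteq> set3 n'"
    then have "sub3 a b c a' b' c'" unfolding h set3_code sub3_iff .
    then show "sub n n'" unfolding sub_def h
      by (intro exI[of _ a] exI[of _ b] exI[of _ c] exI[of _ a'] exI[of _ b'] exI[of _ c'] conjI code3_ge refl)
  qed
qed

text \<open>The position of a face in the list is the number of smaller codes of faces; counting is
  available as a bounded sum, list operations are not.\<close>

definition incl :: "nat \<Rightarrow> nat \<Rightarrow> bool" where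
  "incl i j \<longleftrightarrow> (\<exists>n<nmax. \<exists>n'<nmax. any n \<and> any n' \<and> (\<Sum>k<n. of_bool (any k)) = i \<and> (\<Sum>k<n'. of_bool (any k)) = j \<and> sub n n')"

lemma incl_iff:
  assumes "i < length faces" "j < length faces"
  shows "incl i j \<longleftrightarrow> faces ! i \<subseteq> faces ! j"
proof -
  let ?L = "filter any [0..<nmax]"
  have nth: "?L ! i < nmax \<and> any (?L ! i) \<and> (\<Sum>k<?L ! i. of_bool (any k)) = i" if "i < length ?L" for i
  proof -
    have m: "?L ! i < nmax" "any (?L ! i)" using nth_mem[OF that] by auto
    have "?L ! (\<Sum>k<?L ! i. of_bool (any k)) = ?L ! i" "(\<Sum>k<?L ! i. of_bool (any k)) < length ?L"
      using filter_nth_count[where Q = any, OF m] by blast+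
    then show ?thesis using m that nth_eq_iff_index_eq[of ?L] by simp
  qed
  have F: "faces ! i = set3 (?L ! i)" "i < length ?L" if "i < length faces" for i using that unfolding faces_def by simp_all
  note I = nth[OF F(2)[OF assms(1)]] and J = nth[OF F(2)[OF assms(2)]]
  obtain k where k: "isf k (?L ! i)" using I any_isf by blast
  obtain k' where k': "isf k' (?L ! j)" using J any_isf by blast
  have "incl i j \<longleftrightarrow> sub (?L ! i) (?L ! j)"
  proof
    assume "incl i j"
    then obtain n n' where h: "n < nmax" "n' < nmax" "any n" "any n'" "(\<Sum>k<n. of_bool (any k)) = i"
      "(\<Sum>k<n'. of_bool (any k)) = j" "sub n n'" unfolding incl_def by (elim exE conjE) (rule that)
    have "?L ! i = n" "?L ! j = n'" using filter_nth_count[where Q = any, OF h(1,3)] filter_nth_count[where Q = any, OF h(2,4)] h(5,6) by auto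
    then show "sub (?L ! i) (?L ! j)" using h(7) by simp
  next
    assume "sub (?L ! i) (?L ! j)"
    then show "incl i j" unfolding incl_def using I J
      by (intro exI[of _ "?L ! i"] exI[of _ "?L ! j"] conjI) simp_all
  qed
  then show ?thesis using sub_iff[OF k k'] F(1)[OF assms(1)] F(1)[OF assms(2)] by simp
qed

definition crit :: "nat \<Rightarrow> nat" where
  "crit m = (\<Sum>n<nmax. of_bool (isf 2 n)) + 2 * m + 2 - ((\<Sum>n<nmax. of_bool (isf 1 n)) + (\<Sum>n<nmax. of_bool (isf 3 n)))"

lemma crit: "crit m = card (skel 2 (tris squares)) + 2 * m + 2 - (card (skel 1 (tris squares)) + card (tris squares))"
  unfolding crit_def using card_skel[of 1] card_skel[of 2] card_skel[of 3] skel_3 by simp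

definition out_bit :: "nat \<Rightarrow> nat \<Rightarrow> bool" where
  "out_bit m k \<longleftrightarrow> code_bit (\<Sum>n<nmax. of_bool (any n)) incl (binary_bit (crit m)) k"

definition out_len :: "nat \<Rightarrow> nat" where
  "out_len m = (\<Sum>n<nmax. of_bool (any n)) + 1 + (\<Sum>n<nmax. of_bool (any n)) * (\<Sum>n<nmax. of_bool (any n)) + binary_length (crit m)"

lemma out: "map (out_bit m) [0..<out_len m] = morse_code (faces, crit m)"
proof -
  have "morse_code (faces, crit m) = code_of (length faces) incl (binary_word (crit m))"
    unfolding morse_code_code_of by (rule code_of_cong) (use incl_iff in auto)
  also have "\<dots> = map (code_bit (length faces) incl (binary_bit (crit m))) [0..<length faces + 1 + length faces * length faces + binary_length (crit m)]"
    unfolding binary_word_conv by (rule code_of_conv)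
  finally show ?thesis unfolding out_bit_def[abs_def] out_len_def length_faces by simp
qed

end

section \<open>A bound on the number in the instance\<close>

context guess_system
begin

interpretation layout N rl
  by standard (use acc_less rl_less in auto)

text \<open>Plates for different guesses are different pieces and contribute different
  triangles.\<close>

lemma groups_le: "m \<le> card (tris squares)"
proof -
  have "\<exists>q. label q = Some (Plate (N + U i True))" if "i < m" for i
    using piece_label[of "Plate (N + U i True)"] U_less[OF that, of True] by (auto simp: pieces_def)
  then obtain h where h: "\<And>i. i < m \<Longrightarrow> label (h i) = Some (Plate (N + U i True))" by metis
  have "inj_on (\<lambda>i. tri (h i) True) {..<m}"
  proof (rule inj_onI)
    fix i j assume ij: "i \<in> {..<m}" "j \<in> {..<m}" "tri (h i) True = tri (h j) True"
    then have "label (h i) = label (h j)" by (simp add: tri_eq)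
    then have "U i True = U j True" using h[of i] h[of j] ij by simp
    then show "i = j" using U_inj ij by blast
  qed
  moreover have "(\<lambda>i. tri (h i) True) ` {..<m} \<subseteq> tris squares" using h by (auto simp: squares_def tri_in_tris)
  ultimately have "card {..<m} \<le> card (tris squares)" using finite_tris by (intro card_inj_on_le)
  then show ?thesis by simp
qed

text \<open>This is what makes hardness strong: the number in the instance is linear in the number
  of faces.\<close>

lemma crit_le: "crit m \<le> 3 * length faces + 2"
proof -
  have "card (skel 2 (tris squares)) \<le> length faces" "card (tris squares) \<le> length faces"
    using card_complex set_faces distinct_card[OF distinct_faces] by auto
  then show ?thesis using groups_le unfolding crit by linarith
qed

end

section \<open>The reduction is computable in polynomial time\<close>

locale definable_system =
  fixes N m :: "word \<Rightarrow> nat" and base :: "word \<Rightarrow> nat \<Rightarrow> nat \<Rightarrow> nat \<Rightarrow> bool" and U acc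
  assumes gs: "\<And>x. guess_system (N x) (base x) U acc (m x)"
    and dN [dintros]: "definable (\<lambda>w \<sigma>. N w)" and dm [dintros]: "definable (\<lambda>w \<sigma>. m w)"
    and dbase: "definable_pred (\<lambda>w \<sigma>. base w (\<sigma> 0) (\<sigma> 1) (\<sigma> 2))"
    and dU: "definable (\<lambda>w \<sigma>. U (\<sigma> 0) True)" "definable (\<lambda>w \<sigma>. U (\<sigma> 0) False)"
begin

abbreviation "RL w \<equiv> guess_system.rl (N w) (base w) U acc (m w)"

lemma lay: "layout (N w) (RL w)"
  using guess_system.acc_less[OF gs, of w] guess_system.rl_less[OF gs, of w] by unfold_locales auto

text \<open>The claim is first proved for variables, since the definition contains a bounded
  quantifier under which arbitrary arguments would have to be shifted.\<close>

lemma d_rl [dintros]: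
  assumes "definable f" "definable g" "definable h"
  shows "definable_pred (\<lambda>w \<sigma>. RL w (f w \<sigma>) (g w \<sigma>) (h w \<sigma>))"
proof (rule definable_pred_subst3[OF _ assms])
  show "definable_pred (\<lambda>w \<sigma>. RL w (\<sigma> 0) (\<sigma> 1) (\<sigma> 2))"
    unfolding guess_system.rl_def[OF gs] by (intro dintros dbase dU)
qed

lemma d_ncols [dintros]: "definable (\<lambda>w \<sigma>. layout.ncols (N w))"
  unfolding layout.ncols_def[OF lay] by (intro dintros)

lemma d_small [dintros]:
  assumes "definable f"
  shows "definable (\<lambda>w \<sigma>. layout.cx (N w) (f w \<sigma>))"
    "definable (\<lambda>w \<sigma>. layout.cy (N w) (f w \<sigma>))" "definable (\<lambda>w \<sigma>. layout.cz (N w) (f w \<sigma>))"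
    "definable (\<lambda>w \<sigma>. layout.ad (f w \<sigma>))"
  unfolding layout.cx_def[OF lay] layout.cy_def[OF lay] layout.cz_def[OF lay] layout.ad_def[OF lay]
  by (intro dintros assms)+

lemma d_inside [dintros]:
  assumes "definable f" "definable g"
  shows "definable_pred (\<lambda>w \<sigma>. layout.inside (N w) (f w \<sigma>) (g w \<sigma>))"
  unfolding layout.inside_def[OF lay] by (intro dintros assms)

lemma d_cols [dintros]:
  assumes "definable f"
  shows "definable_pred (\<lambda>w \<sigma>. layout.is_and (N w) (RL w) (f w \<sigma>))" "definable (\<lambda>w \<sigma>. layout.lo (N w) (f w \<sigma>))"
    "definable (\<lambda>w \<sigma>. layout.hi (N w) (f w \<sigma>))" "definable (\<lambda>w \<sigma>. layout.mid (N w) (f w \<sigma>))"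
  unfolding layout.is_and_def[OF lay] layout.lo_def[OF lay] layout.hi_def[OF lay] layout.mid_def[OF lay]
  by (intro dintros assms)+

lemma d_tube [dintros]: assumes "definable f" shows "definable_pred (\<lambda>w \<sigma>. layout.has_tube (N w) (RL w) (f w \<sigma>))"
  unfolding layout.has_tube_def[OF lay] by (intro dintros assms)

lemma d_marks [dintros]:
  assumes "definable f" "definable g"
  shows "definable_pred (\<lambda>w \<sigma>. layout.xt (N w) (RL w) (f w \<sigma>) (g w \<sigma>))"
    "definable_pred (\<lambda>w \<sigma>. layout.yt (N w) (RL w) (f w \<sigma>) (g w \<sigma>))"
    "definable_pred (\<lambda>w \<sigma>. layout.thru (N w) (RL w) (f w \<sigma>) (g w \<sigma>))"
    "definable_pred (\<lambda>w \<sigma>. layout.md (N w) (RL w) (f w \<sigma>) (g w \<sigma>))"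
    "definable_pred (\<lambda>w \<sigma>. layout.hl (N w) (f w \<sigma>) (g w \<sigma>))" "definable_pred (\<lambda>w \<sigma>. layout.hr (N w) (f w \<sigma>) (g w \<sigma>))"
  unfolding layout.xt_def[OF lay] layout.yt_def[OF lay] layout.thru_def[OF lay] layout.md_def[OF lay] layout.hl_def[OF lay] layout.hr_def[OF lay]
  by (intro dintros assms)+

lemma d_rho [dintros]:
  assumes "definable f" "definable g" shows "definable (\<lambda>w \<sigma>. layout.rho (N w) (f w \<sigma>) (g w \<sigma>))"
  unfolding layout.rho_def[OF lay] max_def by (intro dintros assms)

lemma d_yk [dintros]:
  assumes "definable f" "definable g" "definable h"
  shows "definable (\<lambda>w \<sigma>. layout.yk (N w) (RL w) (f w \<sigma>) (g w \<sigma>) (h w \<sigma>))"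
    "definable_pred (\<lambda>w \<sigma>. layout.tube_at (N w) (RL w) (f w \<sigma>) (g w \<sigma>) (h w \<sigma>))"
  unfolding layout.yk_def[OF lay] layout.tube_at_def[OF lay] by (intro dintros assms)+

lemma d_present [dintros]:
  assumes "definable f" "definable g" "definable h" "definable k"
  shows "definable_pred (\<lambda>w \<sigma>. layout.present (N w) (RL w) (f w \<sigma>) (g w \<sigma>) (h w \<sigma>) (k w \<sigma>))"
  unfolding layout.present_def[OF lay] by (intro dintros assms)

lemma d_squares [dintros]:
  assumes "definable f" "definable g" "definable h"
  shows "definable_pred (\<lambda>w \<sigma>. layout.sqF (N w) (RL w) (f w \<sigma>) (g w \<sigma>) (h w \<sigma>))"
    "definable_pred (\<lambda>w \<sigma>. layout.sqX (N w) (RL w) (f w \<sigma>) (g w \<sigma>) (h w \<sigma>))"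
    "definable_pred (\<lambda>w \<sigma>. layout.sqZ (N w) (RL w) (f w \<sigma>) (g w \<sigma>) (h w \<sigma>))"
  unfolding layout.sqF_def[OF lay] layout.sqX_def[OF lay] layout.sqZ_def[OF lay] by (intro dintros assms)+

lemma d_vx [dintros]:
  assumes "definable f" "definable g" "definable h"
  shows "definable (\<lambda>w \<sigma>. vx (f w \<sigma>) (g w \<sigma>) (h w \<sigma>))" "definable (\<lambda>w \<sigma>. code3 (f w \<sigma>) (g w \<sigma>) (h w \<sigma>))"
  unfolding vx_def code3_def by (intro dintros assms)+

lemma d_sub3 [dintros]:
  assumes "definable a" "definable b" "definable c" "definable p" "definable q" "definable r"
  shows "definable_pred (\<lambda>w \<sigma>. sub3 (a w \<sigma>) (b w \<sigma>) (c w \<sigma>) (p w \<sigma>) (q w \<sigma>) (r w \<sigma>))"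
  unfolding sub3_def by (intro dintros assms)

lemma d_mem [dintros]:
  assumes "definable f" "definable g" "definable h"
  shows "definable_pred (\<lambda>w \<sigma>. layout.mem (N w) (RL w) (f w \<sigma>) (g w \<sigma>) (h w \<sigma>))"
proof (rule definable_pred_subst3[OF _ assms])
  show "definable_pred (\<lambda>w \<sigma>. layout.mem (N w) (RL w) (\<sigma> 0) (\<sigma> 1) (\<sigma> 2))"
    unfolding layout.mem_def[OF lay] by (intro dintros)
qed

lemma d_shape [dintros]:
  assumes "definable f" "definable g" "definable h"
  shows "definable_pred (\<lambda>w \<sigma>. shape k (f w \<sigma>) (g w \<sigma>) (h w \<sigma>))"
  unfolding shape_def by (intro dintros assms)

lemma d_isf [dintros]:
  assumes "definable f" shows "definable_pred (\<lambda>w \<sigma>. layout.isf (N w) (RL w) k (f w \<sigma>))"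
proof (rule definable_pred_subst1[OF _ assms])
  show "definable_pred (\<lambda>w \<sigma>. layout.isf (N w) (RL w) k (\<sigma> 0))"
    unfolding layout.isf_def[OF lay] by (intro dintros)
qed

lemma d_any [dintros]:
  assumes "definable f" shows "definable_pred (\<lambda>w \<sigma>. layout.any (N w) (RL w) (f w \<sigma>))"
  unfolding layout.any_def[OF lay] by (intro dintros assms)

lemma d_nmax [dintros]: "definable (\<lambda>w \<sigma>. layout.nmax (N w))"
  unfolding layout.nmax_def[OF lay] layout.vmax_def[OF lay] by (intro dintros)

lemma d_crit [dintros]: "definable (\<lambda>w \<sigma>. layout.crit (N w) (RL w) (m w))"
  unfolding layout.crit_def[OF lay] by (intro dintros)

lemma d_sub [dintros]:
  assumes "definable f" "definable g" shows "definable_pred (\<lambda>w \<sigma>. layout.sub (f w \<sigma>) (g w \<sigma>))"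
proof (rule definable_pred_subst2[OF _ assms])
  show "definable_pred (\<lambda>w \<sigma>. layout.sub (\<sigma> 0) (\<sigma> 1))"
    unfolding layout.sub_def[OF lay] by (intro dintros)
qed

lemma d_incl [dintros]:
  assumes "definable f" "definable g" shows "definable_pred (\<lambda>w \<sigma>. layout.incl (N w) (RL w) (f w \<sigma>) (g w \<sigma>))"
proof (rule definable_pred_subst2[OF _ assms])
  show "definable_pred (\<lambda>w \<sigma>. layout.incl (N w) (RL w) (\<sigma> 0) (\<sigma> 1))"
    unfolding layout.incl_def[OF lay] by (intro dintros)
qed

lemma poly_time_out: "poly_time (\<lambda>w. morse_code (layout.faces (N w) (RL w), layout.crit (N w) (RL w) (m w)))"
proof -
  have "poly_time (\<lambda>w. map (layout.out_bit (N w) (RL w) (m w)) [0..<layout.out_len (N w) (RL w) (m w)])"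
  proof (rule definable_poly_time)
    show "definable (\<lambda>w \<sigma>. layout.out_len (N w) (RL w) (m w))"
      unfolding layout.out_len_def[OF lay] by (intro dintros)
    show "definable_pred (\<lambda>w \<sigma>. layout.out_bit (N w) (RL w) (m w) (\<sigma> 0))"
      unfolding layout.out_bit_def[OF lay] code_bit_def by (intro dintros)
  qed
  then show ?thesis unfolding layout.out[OF lay] .
qed

end

lemma NP_hard:
  "NP_hard_on ({(Fs, c). connected_complex (set Fs) \<and> pure_complex (set Fs) \<and> complex_has_dim (set Fs) 2 \<and>
      embeddable_in_R3 (set Fs)} \<inter>
    {i. max_number morse_matching_problem i \<le> poly [:2, 3:] (length (code_word morse_matching_problem i))})
    morse_matching_problem"
  unfolding NP_hard_on_def
proof
  fix A assume "A \<in> class_NP"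
  then obtain N m base U acc where g: "\<And>x. guess_system (N x) (base x) U acc (m x)"
    and d: "definable (\<lambda>w \<sigma>. N w)" "definable (\<lambda>w \<sigma>. m w)" "definable_pred (\<lambda>w \<sigma>. base w (\<sigma> 0) (\<sigma> 1) (\<sigma> 2))"
      "definable (\<lambda>w \<sigma>. U (\<sigma> 0) True)" "definable (\<lambda>w \<sigma>. U (\<sigma> 0) False)"
    and A: "\<And>x. x \<in> A \<longleftrightarrow> (\<exists>c. acc \<in> der (base x) ((\<lambda>i. U i (c i)) ` {..<m x}))"
    by (rule NP_guess_system) (rule that)
  interpret definable_system N m base U acc by (rule definable_system.intro) (rule g d)+
  let ?C = "{(Fs, c). connected_complex (set Fs) \<and> pure_complex (set Fs) \<and> complex_has_dim (set Fs) 2 \<and>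
      embeddable_in_R3 (set Fs)} \<inter>
    {i. max_number morse_matching_problem i \<le> poly [:2, 3:] (length (code_word morse_matching_problem i))}"
  let ?i = "\<lambda>x. (layout.faces (N x) (RL x), layout.crit (N x) (RL x) (m x))"
  have "?i x \<in> instances morse_matching_problem \<inter> ?C \<and> morse_code (?i x) = code_word morse_matching_problem (?i x) \<and>
      (x \<in> A \<longleftrightarrow> yes_instance morse_matching_problem (?i x))" for x
  proof -
    interpret layout "N x" "RL x" by (rule lay)
    note red = guess_system.reduction[OF g[of x], folded set_faces]
    have "crit (m x) \<le> 3 * length faces + 2" by (rule guess_system.crit_le[OF g[of x]])
    \<comment> \<open>The code starts with the number of faces in unary, so it is at least as
      long.\<close>
    also have "\<dots> \<le> 2 + 3 * length (morse_code (faces, crit (m x)))" by (simp add: morse_code_def)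
    finally have "crit (m x) \<le> poly [:2, 3:] (length (morse_code (faces, crit (m x))))" by (simp add: mult.commute)
    then show ?thesis
      using red distinct_faces A[of x] unfolding morse_matching_problem_def crit by (simp add: crit)
  qed
  then show "\<exists>f. poly_time f \<and> (\<forall>x. \<exists>i\<in>instances morse_matching_problem \<inter> ?C.
      f x = code_word morse_matching_problem i \<and> (x \<in> A \<longleftrightarrow> yes_instance morse_matching_problem i))"
    using poly_time_out by (intro exI[of _ "\<lambda>x. morse_code (?i x)"]) blast
qed

text \<open>The verifier decides the unrestricted problem, hence every promise version as
  well.\<close>

lemma in_NP_on: "in_NP_on C morse_matching_problem"
  unfolding in_NP_on_def using yes_words_in_NP by blast

lemma NP_hard_on_mono: "NP_hard_on C P \<Longrightarrow> C \<subseteq> C' \<Longrightarrow> NP_hard_on C' P"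
  unfolding NP_hard_on_def by (meson Int_mono order_refl subsetD)

theorem theorem4p4:
  "strongly_NP_complete morse_matching_problem \<and>
   strongly_NP_complete_on
     {(Fs, c). connected_complex (set Fs) \<and> pure_complex (set Fs) \<and>
               complex_has_dim (set Fs) 2 \<and> embeddable_in_R3 (set Fs)}
     morse_matching_problem"
  unfolding strongly_NP_complete_def strongly_NP_complete_on_def NP_complete_on_def
  by (intro conjI exI[of _ "[:2, 3:]"] in_NP_on NP_hard NP_hard_on_mono[OF NP_hard]) blast

end
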